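(* Let $M$ be a real analytic manifold and let $J=(J_1,\dots,J_\ell):M\to\mathbb{R}^\ell$ be an analytic map, with $Z:=J^{-1}(0)$. Assume that 1. $J_1,\dots,J_\ell$ generate the vanishing ideal of $Z$ in $\mathcal{C}^\infty(M)$; 2. the regular stratum $Z_r:=\{z\in Z \mid T_zJ \text{ is surjective}\}$ is dense in $Z$. Then the Koszul complex $K=K(\mathcal{C}^\infty(M),J)$ is acyclic (i.e. its homology vanishes in all degrees $\neq 0$) and $H_0(K)=\mathcal{C}^\infty(Z)$.
   Context: $\mathcal{C}^\infty(Z)$ denotes the algebra of restrictions to $Z$ of smooth functions on $M$, i.e. $\mathcal{C}^\infty(Z)=\mathcal{C}^\infty(M)/I_Z$, where $I_Z=\{f\in\mathcal{C}^\infty(M)\mid f|_Z=0\}$ is the vanishing ideal. The Koszul complex $K(\mathcal{C}^\infty(M),J)$ is $K_i=\mathcal{C}^\infty(M)\otimes\wedge^i V$, where $V$ is the dual space of $\mathbb{R}^\ell$ with its canonical basis $e_1,\dots,e_\ell$; the differential $\partial:K_i\to K_{i-1}$ is the $\mathcal{C}^\infty(M)$-linear (super-)derivation of the exterior algebra determined by $\partial e_a=J_a$. *)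

theory Defs
  imports "HOL-Analysis.Analysis" "HOL-Algebra.QuotRing" "HOL-Algebra.Module"
begin

section \<open>Analytic and smooth functions in coordinates\<close>

text \<open>
  \<open>\<real>\<^sup>n\<close> is the library's \<^const>\<open>Euclidean_space\<close> \<open>n\<close>, whose points are the
  functions \<open>nat \<Rightarrow> real\<close> vanishing from index \<open>n\<close> on; in this way \<open>n = 0\<close> is allowed.
  The following notions are meant for sets \<open>U\<close> that are open in this space.
\<close>

definition multi_indices :: "nat \<Rightarrow> (nat \<Rightarrow> nat) set" where
  "multi_indices n = {\<alpha>. \<forall>i\<ge>n. \<alpha> i = 0}"

definition real_analytic :: "nat \<Rightarrow> (nat \<Rightarrow> real) set \<Rightarrow> ((nat \<Rightarrow> real) \<Rightarrow> real) \<Rightarrow> bool" where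
  "real_analytic n U f \<longleftrightarrow>
     (\<forall>p\<in>U. \<exists>c r. r > 0 \<and>
        (\<forall>x\<in>U. (\<forall>i<n. \<bar>x i - p i\<bar> < r) \<longrightarrow>
           ((\<lambda>\<alpha>. c \<alpha> * (\<Prod>i<n. (x i - p i) ^ \<alpha> i)) has_sum f x) (multi_indices n)))"

definition partial_deriv :: "nat \<Rightarrow> ((nat \<Rightarrow> real) \<Rightarrow> real) \<Rightarrow> (nat \<Rightarrow> real) \<Rightarrow> real" where
  "partial_deriv i f = (\<lambda>x. deriv (\<lambda>t. f (x(i := t))) (x i))"

primrec ck_on :: "nat \<Rightarrow> nat \<Rightarrow> (nat \<Rightarrow> real) set \<Rightarrow> ((nat \<Rightarrow> real) \<Rightarrow> real) \<Rightarrow> bool" where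
  "ck_on 0 n U f \<longleftrightarrow> continuous_map (subtopology (Euclidean_space n) U) euclideanreal f"
| "ck_on (Suc k) n U f \<longleftrightarrow>
     continuous_map (subtopology (Euclidean_space n) U) euclideanreal f \<and>
     (\<forall>i<n. (\<forall>x\<in>U. (\<lambda>t. f (x(i := t))) differentiable at (x i)) \<and>
            ck_on k n U (partial_deriv i f))"

definition smooth_in :: "nat \<Rightarrow> (nat \<Rightarrow> real) set \<Rightarrow> ((nat \<Rightarrow> real) \<Rightarrow> real) \<Rightarrow> bool" where
  "smooth_in n U f \<longleftrightarrow> (\<forall>k. ck_on k n U f)"


section \<open>Real analytic manifolds\<close>

record 'm manifold =
  mtop :: "'m topology"
  mdim :: nat
  matlas :: "('m set \<times> ('m \<Rightarrow> nat \<Rightarrow> real)) set"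

abbreviation points :: "'m manifold \<Rightarrow> 'm set" where
  "points M \<equiv> topspace (mtop M)"

definition chart :: "'m topology \<Rightarrow> nat \<Rightarrow> 'm set \<Rightarrow> ('m \<Rightarrow> nat \<Rightarrow> real) \<Rightarrow> bool" where
  "chart X n U \<phi> \<longleftrightarrow>
     openin X U \<and> openin (Euclidean_space n) (\<phi> ` U) \<and>
     homeomorphic_map (subtopology X U) (subtopology (Euclidean_space n) (\<phi> ` U)) \<phi>"

definition real_analytic_manifold :: "'m manifold \<Rightarrow> bool" where
  "real_analytic_manifold M \<longleftrightarrow>
     Hausdorff_space (mtop M) \<and> second_countable (mtop M) \<and>
     (\<forall>(U, \<phi>) \<in> matlas M. chart (mtop M) (mdim M) U \<phi>) \<and>
     (\<Union>(U, \<phi>) \<in> matlas M. U) = points M \<and>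
     (\<forall>(U, \<phi>) \<in> matlas M. \<forall>(V, \<psi>) \<in> matlas M. \<forall>i < mdim M.
        real_analytic (mdim M) (\<phi> ` (U \<inter> V)) (\<lambda>y. \<psi> (inv_into U \<phi> y) i))"

definition euclidean_manifold :: "nat \<Rightarrow> (nat \<Rightarrow> real) manifold" where
  "euclidean_manifold n =
     \<lparr>mtop = Euclidean_space n, mdim = n, matlas = {(topspace (Euclidean_space n), \<lambda>x. x)}\<rparr>"

definition analytic_map :: "'m manifold \<Rightarrow> 'n manifold \<Rightarrow> ('m \<Rightarrow> 'n) \<Rightarrow> bool" where
  "analytic_map M N F \<longleftrightarrow>
     continuous_map (mtop M) (mtop N) F \<and>
     (\<forall>(U, \<phi>) \<in> matlas M. \<forall>(V, \<psi>) \<in> matlas N. \<forall>i < mdim N.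
        real_analytic (mdim M) (\<phi> ` (U \<inter> F -` V)) (\<lambda>y. \<psi> (F (inv_into U \<phi> y)) i))"


section \<open>Rings of smooth functions\<close>

text \<open>Functions on a set \<open>S\<close> are represented as elements of \<^term>\<open>extensional S\<close>.\<close>

definition function_ring :: "'m set \<Rightarrow> ('m \<Rightarrow> real) set \<Rightarrow> ('m \<Rightarrow> real) ring" where
  "function_ring S F =
     \<lparr>carrier = F,
      mult = (\<lambda>f g. \<lambda>x\<in>S. f x * g x), one = (\<lambda>x\<in>S. 1),
      zero = (\<lambda>x\<in>S. 0), add = (\<lambda>f g. \<lambda>x\<in>S. f x + g x)\<rparr>"

definition smooth_functions :: "'m manifold \<Rightarrow> ('m \<Rightarrow> real) set" where
  "smooth_functions M =
     {f \<in> extensional (points M).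
        \<forall>(U, \<phi>) \<in> matlas M. smooth_in (mdim M) (\<phi> ` U) (\<lambda>y. f (inv_into U \<phi> y))}"

definition C_inf :: "'m manifold \<Rightarrow> ('m \<Rightarrow> real) ring" where
  "C_inf M = function_ring (points M) (smooth_functions M)"

definition C_inf_restricted :: "'m manifold \<Rightarrow> 'm set \<Rightarrow> ('m \<Rightarrow> real) ring" where
  "C_inf_restricted M Z = function_ring Z ((\<lambda>f. restrict f Z) ` smooth_functions M)"

definition vanishing_ideal :: "'m manifold \<Rightarrow> 'm set \<Rightarrow> ('m \<Rightarrow> real) set" where
  "vanishing_ideal M Z = {f \<in> smooth_functions M. \<forall>z\<in>Z. f z = 0}"


section \<open>Tangent spaces and tangent maps\<close>

text \<open>Tangent vectors at \<open>z\<close> are the derivations of the algebra of smooth functions at \<open>z\<close>.\<close>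

definition tangent_space :: "'m manifold \<Rightarrow> 'm \<Rightarrow> (('m \<Rightarrow> real) \<Rightarrow> real) set" where
  "tangent_space M z =
     {D \<in> extensional (smooth_functions M).
        (\<forall>f\<in>smooth_functions M. \<forall>g\<in>smooth_functions M. D (f \<oplus>\<^bsub>C_inf M\<^esub> g) = D f + D g) \<and>
        (\<forall>c. \<forall>f\<in>smooth_functions M. D (\<lambda>x\<in>points M. c * f x) = c * D f) \<and>
        (\<forall>f\<in>smooth_functions M. \<forall>g\<in>smooth_functions M.
           D (f \<otimes>\<^bsub>C_inf M\<^esub> g) = f z * D g + g z * D f)}"

definition tangent_map ::
    "'m manifold \<Rightarrow> 'n manifold \<Rightarrow> ('m \<Rightarrow> 'n) \<Rightarrow> (('m \<Rightarrow> real) \<Rightarrow> real) \<Rightarrow> ('n \<Rightarrow> real) \<Rightarrow> real" where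
  "tangent_map M N F D = (\<lambda>g\<in>smooth_functions N. D (\<lambda>x\<in>points M. g (F x)))"

definition component :: "'m manifold \<Rightarrow> ('m \<Rightarrow> nat \<Rightarrow> real) \<Rightarrow> nat \<Rightarrow> 'm \<Rightarrow> real" where
  "component M J a = (\<lambda>x\<in>points M. J x a)"

definition zero_fibre :: "'m manifold \<Rightarrow> ('m \<Rightarrow> nat \<Rightarrow> real) \<Rightarrow> 'm set" where
  "zero_fibre M J = {z \<in> points M. J z = (\<lambda>_. 0)}"

definition regular_stratum :: "'m manifold \<Rightarrow> nat \<Rightarrow> ('m \<Rightarrow> nat \<Rightarrow> real) \<Rightarrow> 'm set" where
  "regular_stratum M l J =
     {z \<in> zero_fibre M J.
        tangent_map M (euclidean_manifold l) J ` tangent_space M z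
          = tangent_space (euclidean_manifold l) (J z)}"


section \<open>The Koszul complex\<close>

text \<open>
  The exterior algebra of the free module \<open>R\<^sup>l\<close>, that is \<open>R \<otimes> \<Lambda>V\<close> with \<open>V\<close> of dimension
  \<open>l\<close>. An element is given by its coefficients with respect to the basis
  \<open>e\<^sub>I = e\<^bsub>i1\<^esub> \<and> \<dots> \<and> e\<^bsub>ik\<^esub>\<close>, where \<open>I = {i1 < \<dots> < ik}\<close> runs over the subsets of \<open>{..<l}\<close>; the
  basis of \<open>V\<close> is thus indexed from \<open>0\<close>. For disjoint \<open>A\<close> and \<open>B\<close> one has
  \<open>e\<^sub>A \<and> e\<^sub>B = (-1)\<^bsup>inversions A B\<^esup> e\<^bsub>A \<union> B\<^esub>\<close>.
\<close>

definition inversions :: "nat set \<Rightarrow> nat set \<Rightarrow> nat" where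
  "inversions A B = card {(a, b). a \<in> A \<and> b \<in> B \<and> b < a}"

definition alt_sign :: "('a, 'r) ring_scheme \<Rightarrow> nat \<Rightarrow> 'a" where
  "alt_sign R k = (\<ominus>\<^bsub>R\<^esub> \<one>\<^bsub>R\<^esub>) [^]\<^bsub>R\<^esub> k"

definition ext_basis :: "('a, 'r) ring_scheme \<Rightarrow> nat \<Rightarrow> nat set \<Rightarrow> nat set \<Rightarrow> 'a" where
  "ext_basis R l I = (\<lambda>K\<in>Pow {..<l}. if K = I then \<one>\<^bsub>R\<^esub> else \<zero>\<^bsub>R\<^esub>)"

definition exterior_algebra :: "('a, 'r) ring_scheme \<Rightarrow> nat \<Rightarrow> ('a, nat set \<Rightarrow> 'a) module" where
  "exterior_algebra R l =
     \<lparr>carrier = Pow {..<l} \<rightarrow>\<^sub>E carrier R,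
      mult = (\<lambda>x y. \<lambda>I\<in>Pow {..<l}.
        \<Oplus>\<^bsub>R\<^esub>A\<in>Pow I. alt_sign R (inversions A (I - A)) \<otimes>\<^bsub>R\<^esub> (x A \<otimes>\<^bsub>R\<^esub> y (I - A))),
      one = ext_basis R l {},
      zero = (\<lambda>I\<in>Pow {..<l}. \<zero>\<^bsub>R\<^esub>),
      add = (\<lambda>x y. \<lambda>I\<in>Pow {..<l}. x I \<oplus>\<^bsub>R\<^esub> y I),
      smult = (\<lambda>r x. \<lambda>I\<in>Pow {..<l}. r \<otimes>\<^bsub>R\<^esub> x I)\<rparr>"

definition koszul_module :: "('a, 'r) ring_scheme \<Rightarrow> nat \<Rightarrow> nat \<Rightarrow> (nat set \<Rightarrow> 'a) set" where
  "koszul_module R l i =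
     {x \<in> carrier (exterior_algebra R l). \<forall>I\<in>Pow {..<l}. card I \<noteq> i \<longrightarrow> x I = \<zero>\<^bsub>R\<^esub>}"

definition koszul_derivation ::
    "('a, 'r) ring_scheme \<Rightarrow> nat \<Rightarrow> (nat \<Rightarrow> 'a) \<Rightarrow> ((nat set \<Rightarrow> 'a) \<Rightarrow> nat set \<Rightarrow> 'a) \<Rightarrow> bool" where
  "koszul_derivation R l J d \<longleftrightarrow>
     (let E = exterior_algebra R l in
      d \<in> carrier E \<rightarrow>\<^sub>E carrier E \<and>
      (\<forall>x\<in>carrier E. \<forall>y\<in>carrier E. d (x \<oplus>\<^bsub>E\<^esub> y) = d x \<oplus>\<^bsub>E\<^esub> d y) \<and>
      (\<forall>r\<in>carrier R. \<forall>x\<in>carrier E. d (r \<odot>\<^bsub>E\<^esub> x) = r \<odot>\<^bsub>E\<^esub> d x) \<and>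
      (\<forall>i. \<forall>x\<in>koszul_module R l i. \<forall>y\<in>carrier E.
         d (x \<otimes>\<^bsub>E\<^esub> y) = (d x \<otimes>\<^bsub>E\<^esub> y) \<oplus>\<^bsub>E\<^esub> alt_sign R i \<odot>\<^bsub>E\<^esub> (x \<otimes>\<^bsub>E\<^esub> d y)) \<and>
      (\<forall>a<l. d (ext_basis R l {a}) = J a \<odot>\<^bsub>E\<^esub> \<one>\<^bsub>E\<^esub>))"

definition koszul_diff ::
    "('a, 'r) ring_scheme \<Rightarrow> nat \<Rightarrow> (nat \<Rightarrow> 'a) \<Rightarrow> (nat set \<Rightarrow> 'a) \<Rightarrow> nat set \<Rightarrow> 'a" where
  "koszul_diff R l J = (THE d. koszul_derivation R l J d)"

definition koszul_cycles :: "('a, 'r) ring_scheme \<Rightarrow> nat \<Rightarrow> (nat \<Rightarrow> 'a) \<Rightarrow> nat \<Rightarrow> (nat set \<Rightarrow> 'a) set" where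
  "koszul_cycles R l J i =
     {x \<in> koszul_module R l i. koszul_diff R l J x = \<zero>\<^bsub>exterior_algebra R l\<^esub>}"

definition koszul_boundaries :: "('a, 'r) ring_scheme \<Rightarrow> nat \<Rightarrow> (nat \<Rightarrow> 'a) \<Rightarrow> nat \<Rightarrow> (nat set \<Rightarrow> 'a) set" where
  "koszul_boundaries R l J i = koszul_diff R l J ` koszul_module R l (Suc i)"

text \<open>
  In positive degrees only the additive structure of the quotient is meaningful; in degree
  \<open>0\<close> the product induced by the exterior product is that of \<open>R\<close> modulo the boundaries,
  where the degree-\<open>0\<close> part is identified with \<open>R\<close> by \<open>\<omega> \<mapsto> \<omega> {}\<close>.
\<close>

definition koszul_homology ::
    "('a, 'r) ring_scheme \<Rightarrow> nat \<Rightarrow> (nat \<Rightarrow> 'a) \<Rightarrow> nat \<Rightarrow> (nat set \<Rightarrow> 'a) set ring" where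
  "koszul_homology R l J i =
     (exterior_algebra R l)\<lparr>carrier := koszul_cycles R l J i\<rparr> Quot koszul_boundaries R l J i"

section \<open>Well-definedness of the Koszul differential\<close>

text \<open>
  Over a commutative ring there is exactly one \<^const>\<open>koszul_derivation\<close>, given by
  \<open>\<partial>e\<^sub>I = (\<Sum>a\<in>I. (-1)\<^bsup>inversions {a} I\<^esup> J\<^sub>a e\<^bsub>I - {a}\<^esub>)\<close>; so the definite description
  in \<^const>\<open>koszul_diff\<close> denotes it.
\<close>

lemma inversions_finite: "finite A \<Longrightarrow> finite B \<Longrightarrow> finite {(a, b). a \<in> A \<and> b \<in> B \<and> b < (a::nat)}"
  by (rule finite_subset[of _ "A \<times> B"]) auto

lemma inversions_Un_left:
  assumes "finite A" "finite A'" "finite B" "A \<inter> A' = {}"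
  shows "inversions (A \<union> A') B = inversions A B + inversions A' B"
proof -
  have "{(a, b). a \<in> A \<union> A' \<and> b \<in> B \<and> b < a}
      = {(a, b). a \<in> A \<and> b \<in> B \<and> b < a} \<union> {(a, b). a \<in> A' \<and> b \<in> B \<and> b < a}" by auto
  then show ?thesis unfolding inversions_def
    using assms by (simp add: card_Un_disjoint inversions_finite disjoint_iff)
qed

lemma inversions_Un_right:
  assumes "finite A" "finite B'" "finite B" "B \<inter> B' = {}"
  shows "inversions A (B \<union> B') = inversions A B + inversions A B'"
proof -
  have "{(a, b). a \<in> A \<and> b \<in> B \<union> B' \<and> b < a}
      = {(a, b). a \<in> A \<and> b \<in> B \<and> b < a} \<union> {(a, b). a \<in> A \<and> b \<in> B' \<and> b < a}" by auto
  then show ?thesis unfolding inversions_def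
    using assms by (simp add: card_Un_disjoint inversions_finite disjoint_iff)
qed

lemma inversions_swap:
  assumes "finite A" "a \<notin> A"
  shows "inversions {a} A + inversions A {a} = card A"
proof -
  have "{(a', b). a' \<in> {a} \<and> b \<in> A \<and> b < a'} = Pair a ` {b\<in>A. b < a}"
       "{(a', b). a' \<in> A \<and> b \<in> {a} \<and> b < a'} = (\<lambda>b. (b, a)) ` {b\<in>A. a < b}" by auto
  then have "inversions {a} A = card {b\<in>A. b < a}" "inversions A {a} = card {b\<in>A. a < b}"
    unfolding inversions_def by (simp_all add: card_image inj_on_def)
  moreover have "A = {b\<in>A. b < a} \<union> {b\<in>A. a < b}"
    using assms(2) by (auto, metis linorder_neqE_nat)
  then have "card A = card {b\<in>A. b < a} + card {b\<in>A. a < b}"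
    using assms(1) by (metis (no_types, lifting) card_Un_disjoint disjoint_iff finite_Un mem_Collect_eq order_less_asym)
  ultimately show ?thesis by simp
qed

lemma inversions_empty [simp]: "inversions {} B = 0" "inversions A {} = 0"
  by (simp_all add: inversions_def)

context cring
begin

lemma alt_sign_closed [simp, intro]: "alt_sign R k \<in> carrier R"
  by (simp add: alt_sign_def)

lemma alt_sign_0 [simp]: "alt_sign R 0 = \<one>"
  by (simp add: alt_sign_def)

lemma alt_sign_add: "alt_sign R (m + n) = alt_sign R m \<otimes> alt_sign R n"
  by (simp add: alt_sign_def nat_pow_mult)

lemma alt_sign_Suc: "alt_sign R (Suc n) = \<ominus> alt_sign R n"
  by (simp add: alt_sign_def r_minus)

lemma alt_sign_even: "alt_sign R n = (if even n then \<one> else \<ominus> \<one>)"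
  by (induction n) (auto simp: alt_sign_Suc)

lemma alt_sign_cong: "even m = even n \<Longrightarrow> alt_sign R m = alt_sign R n"
  by (simp add: alt_sign_even)

lemma finsum_Sigma:
  assumes "finite A" "\<And>a. a \<in> A \<Longrightarrow> finite (B a)"
    and "\<And>a b. a \<in> A \<Longrightarrow> b \<in> B a \<Longrightarrow> f a b \<in> carrier R"
  shows "(\<Oplus>a\<in>A. \<Oplus>b\<in>B a. f a b) = (\<Oplus>p\<in>Sigma A B. f (fst p) (snd p))"
  using assms
proof (induction A rule: finite_induct)
  case empty
  then show ?case by simp
next
  case (insert a A)
  have S: "Sigma (insert a A) B = Pair a ` B a \<union> Sigma A B" by auto
  have 1: "(\<Oplus>p\<in>Pair a ` B a. f (fst p) (snd p)) = (\<Oplus>b\<in>B a. f a b)"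
    by (subst finsum_reindex) (use insert.prems in \<open>auto simp: inj_on_def\<close>)
  have "(\<Oplus>p\<in>Sigma (insert a A) B. f (fst p) (snd p))
     = (\<Oplus>p\<in>Pair a ` B a. f (fst p) (snd p)) \<oplus> (\<Oplus>p\<in>Sigma A B. f (fst p) (snd p))"
    unfolding S by (rule finsum_Un_disjoint) (use insert in auto)
  also note 1
  also have "(\<Oplus>p\<in>Sigma A B. f (fst p) (snd p)) = (\<Oplus>a\<in>A. \<Oplus>b\<in>B a. f a b)"
    by (rule insert.IH[symmetric]) (use insert in auto)
  also have "(\<Oplus>b\<in>B a. f a b) \<oplus> (\<Oplus>a\<in>A. \<Oplus>b\<in>B a. f a b) = (\<Oplus>a\<in>insert a A. \<Oplus>b\<in>B a. f a b)"
    by (rule finsum_insert[symmetric]) (use insert in \<open>auto intro!: finsum_closed\<close>)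
  finally show ?case by simp
qed

lemma finsum_Sigma_bij:
  assumes "finite A" "\<And>a. a \<in> A \<Longrightarrow> finite (B a)"
    and "bij_betw h (Sigma A B) S"
    and "\<And>s. s \<in> S \<Longrightarrow> g s \<in> carrier R"
    and "\<And>a b. a \<in> A \<Longrightarrow> b \<in> B a \<Longrightarrow> f a b = g (h (a, b))"
  shows "(\<Oplus>a\<in>A. \<Oplus>b\<in>B a. f a b) = finsum R g S"
proof -
  have c: "g (h (a, b)) \<in> carrier R" if "a \<in> A" "b \<in> B a" for a b
    using assms(3,4) that by (auto simp: bij_betw_def)
  have "(\<Oplus>a\<in>A. \<Oplus>b\<in>B a. f a b) = (\<Oplus>p\<in>Sigma A B. f (fst p) (snd p))"
    using assms c by (intro finsum_Sigma) auto
  also have "\<dots> = (\<Oplus>p\<in>Sigma A B. g (h p))"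
    using assms c by (intro finsum_cong') auto
  also have "\<dots> = finsum R g (h ` Sigma A B)"
    using assms(3) c by (subst finsum_reindex) (auto simp: bij_betw_def)
  also have "h ` Sigma A B = S"
    using assms(3) by (auto simp: bij_betw_def)
  finally show ?thesis .
qed

end

definition koszul_formula ::
    "('a, 'r) ring_scheme \<Rightarrow> nat \<Rightarrow> (nat \<Rightarrow> 'a) \<Rightarrow> (nat set \<Rightarrow> 'a) \<Rightarrow> nat set \<Rightarrow> 'a" where
  "koszul_formula R l J =
     (\<lambda>x\<in>Pow {..<l} \<rightarrow>\<^sub>E carrier R. \<lambda>I\<in>Pow {..<l}.
        \<Oplus>\<^bsub>R\<^esub>a\<in>{..<l} - I. alt_sign R (inversions {a} I) \<otimes>\<^bsub>R\<^esub> (J a \<otimes>\<^bsub>R\<^esub> x (insert a I)))"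

locale koszul = cring R for R (structure) +
  fixes l :: nat and J :: "nat \<Rightarrow> 'a"
  assumes J_closed: "a < l \<Longrightarrow> J a \<in> carrier R"
begin

abbreviation "E \<equiv> exterior_algebra R l"
abbreviation "L \<equiv> {..<l}"

lemma E_simps:
  "carrier E = Pow L \<rightarrow>\<^sub>E carrier R"
  "x \<oplus>\<^bsub>E\<^esub> y = (\<lambda>I\<in>Pow L. x I \<oplus> y I)"
  "r \<odot>\<^bsub>E\<^esub> x = (\<lambda>I\<in>Pow L. r \<otimes> x I)"
  "x \<otimes>\<^bsub>E\<^esub> y = (\<lambda>I\<in>Pow L. \<Oplus>A\<in>Pow I. alt_sign R (inversions A (I - A)) \<otimes> (x A \<otimes> y (I - A)))"
  "\<one>\<^bsub>E\<^esub> = ext_basis R l {}"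
  "\<zero>\<^bsub>E\<^esub> = (\<lambda>I\<in>Pow L. \<zero>)"
  by (simp_all add: exterior_algebra_def)

lemma E_app [simp, intro]: "x \<in> carrier E \<Longrightarrow> I \<subseteq> L \<Longrightarrow> x I \<in> carrier R"
  by (auto simp: E_simps)

lemma E_mult_closed: "x \<in> carrier E \<Longrightarrow> y \<in> carrier E \<Longrightarrow> x \<otimes>\<^bsub>E\<^esub> y \<in> carrier E"
  by (auto simp: E_simps(1,4) intro!: finsum_closed m_closed)

lemma E_add_closed: "x \<in> carrier E \<Longrightarrow> y \<in> carrier E \<Longrightarrow> x \<oplus>\<^bsub>E\<^esub> y \<in> carrier E"
  by (auto simp: E_simps)

lemma E_smult_closed: "r \<in> carrier R \<Longrightarrow> x \<in> carrier E \<Longrightarrow> r \<odot>\<^bsub>E\<^esub> x \<in> carrier E"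
  by (auto simp: E_simps)

lemma ext_basis_closed: "ext_basis R l I \<in> carrier E"
  by (auto simp: E_simps ext_basis_def)

lemma E_ext:
  assumes "x \<in> carrier E" "y \<in> carrier E" "\<And>I. I \<subseteq> L \<Longrightarrow> x I = y I"
  shows "x = y"
  using assms by (intro PiE_ext[of _ "Pow L" "\<lambda>_. carrier R"]) (auto simp: E_simps)

abbreviation "dd \<equiv> koszul_formula R l J"

lemma dd_app: "x \<in> carrier E \<Longrightarrow> I \<subseteq> L \<Longrightarrow>
    dd x I = (\<Oplus>a\<in>L - I. alt_sign R (inversions {a} I) \<otimes> (J a \<otimes> x (insert a I)))"
  by (simp add: koszul_formula_def E_simps)

lemma dd_closed: "x \<in> carrier E \<Longrightarrow> dd x \<in> carrier E"
  by (auto simp: koszul_formula_def E_simps J_closed PiE_mem intro!: finsum_closed m_closed)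

lemma dd_add:
  assumes "x \<in> carrier E" "y \<in> carrier E"
  shows "dd (x \<oplus>\<^bsub>E\<^esub> y) = dd x \<oplus>\<^bsub>E\<^esub> dd y"
proof (rule E_ext)
  fix I assume I: "I \<subseteq> L"
  have "dd (x \<oplus>\<^bsub>E\<^esub> y) I = (\<Oplus>a\<in>L - I. alt_sign R (inversions {a} I) \<otimes> (J a \<otimes> x (insert a I))
       \<oplus> alt_sign R (inversions {a} I) \<otimes> (J a \<otimes> y (insert a I)))"
    unfolding dd_app[OF E_add_closed[OF assms] I]
    by (rule finsum_cong') (use assms I in \<open>auto simp: E_simps(2) J_closed r_distr\<close>)
  also have "\<dots> = dd x I \<oplus> dd y I"
    unfolding dd_app[OF assms(1) I] dd_app[OF assms(2) I]
    by (rule finsum_addf) (use assms I in \<open>auto simp: J_closed\<close>)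
  finally show "dd (x \<oplus>\<^bsub>E\<^esub> y) I = (dd x \<oplus>\<^bsub>E\<^esub> dd y) I" using I by (simp add: E_simps(2))
qed (auto simp: assms dd_closed E_add_closed)

lemma dd_smult:
  assumes "r \<in> carrier R" "x \<in> carrier E"
  shows "dd (r \<odot>\<^bsub>E\<^esub> x) = r \<odot>\<^bsub>E\<^esub> dd x"
proof (rule E_ext)
  fix I assume I: "I \<subseteq> L"
  have "dd (r \<odot>\<^bsub>E\<^esub> x) I = (\<Oplus>a\<in>L - I. r \<otimes> (alt_sign R (inversions {a} I) \<otimes> (J a \<otimes> x (insert a I))))"
    unfolding dd_app[OF E_smult_closed[OF assms] I]
    by (rule finsum_cong') (use assms I in \<open>auto simp: E_simps(3) J_closed m_ac\<close>)
  also have "\<dots> = r \<otimes> dd x I"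
    unfolding dd_app[OF assms(2) I]
    by (rule finsum_rdistr[symmetric]) (use assms I in \<open>auto simp: J_closed\<close>)
  finally show "dd (r \<odot>\<^bsub>E\<^esub> x) I = (r \<odot>\<^bsub>E\<^esub> dd x) I" using I by (simp add: E_simps(3))
qed (auto simp: assms dd_closed E_smult_closed)

lemma dd_basis:
  assumes "a < l"
  shows "dd (ext_basis R l {a}) = J a \<odot>\<^bsub>E\<^esub> \<one>\<^bsub>E\<^esub>"
proof (rule E_ext)
  fix I assume I: "I \<subseteq> L"
  have "dd (ext_basis R l {a}) I = (\<Oplus>b\<in>L - I. if b = a then (if I = {} then J a else \<zero>) else \<zero>)"
    unfolding dd_app[OF ext_basis_closed I]
    by (rule finsum_cong') (use assms I in \<open>auto simp: ext_basis_def J_closed\<close>)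
  also have "\<dots> = (if I = {} then J a else \<zero>)"
  proof (cases "a \<in> I")
    case True
    then have "(\<Oplus>b\<in>L - I. if b = a then (if I = {} then J a else \<zero>) else \<zero>) = (\<Oplus>b\<in>L - I. \<zero>)"
      by (intro finsum_cong') auto
    then show ?thesis using True by auto
  next
    case False
    then show ?thesis
      using finsum_singleton[of a "L - I" "\<lambda>_. if I = {} then J a else \<zero>"] assms J_closed
      by (simp add: eq_commute[of a])
  qed
  finally show "dd (ext_basis R l {a}) I = (J a \<odot>\<^bsub>E\<^esub> \<one>\<^bsub>E\<^esub>) I"
    using I assms by (auto simp: E_simps(3,5) ext_basis_def J_closed)
qed (auto simp: assms dd_closed E_smult_closed ext_basis_closed J_closed E_simps(5))

lemma dd_derivation:
  assumes x: "x \<in> koszul_module R l i" and y: "y \<in> carrier E"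
  shows "dd (x \<otimes>\<^bsub>E\<^esub> y) = (dd x \<otimes>\<^bsub>E\<^esub> y) \<oplus>\<^bsub>E\<^esub> alt_sign R i \<odot>\<^bsub>E\<^esub> (x \<otimes>\<^bsub>E\<^esub> dd y)"
proof -
  have xE: "x \<in> carrier E" and x0: "\<And>A. A \<subseteq> L \<Longrightarrow> card A \<noteq> i \<Longrightarrow> x A = \<zero>"
    using x by (auto simp: koszul_module_def)
  note cl = xE y dd_closed[OF xE] dd_closed[OF y]
  show ?thesis
  proof (rule E_ext)
    fix I assume I: "I \<subseteq> L"
    have fI: "finite I" using I finite_subset by blast
    define f where "f = (\<lambda>(a, A, B). J a \<otimes> (x A \<otimes> y B))"
    define S where "S = (\<lambda>(a, A, B). alt_sign R (inversions {a} I + inversions A B) \<otimes> f (a, A, B))"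
    define p where "p = (\<lambda>(a, A, B). alt_sign R (inversions (A - {a}) B + inversions {a} (A - {a})) \<otimes> f (a, A, B))"
    define q where "q = (\<lambda>(a, A, B). alt_sign R (i + inversions A (B - {a}) + inversions {a} (B - {a})) \<otimes> f (a, A, B))"
    define P where "P = {(a, A, B). a < l \<and> a \<in> A \<and> A - {a} \<subseteq> I \<and> B = I - (A - {a})}"
    define Q where "Q = {(a, A, B). a < l \<and> A \<subseteq> I \<and> a \<in> B \<and> B - {a} = I - A}"
    define T where "T = {(a, A, B). a < l \<and> a \<notin> I \<and> A \<subseteq> insert a I \<and> B = insert a I - A}"
    define U where "U = {(a, A, B). a < l \<and> A \<subseteq> L \<and> B \<subseteq> L}"
    have fc: "f u \<in> carrier R" if "u \<in> U" for u
      using that xE y by (auto simp: U_def f_def J_closed)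
    have finU: "finite U" 
      by (rule finite_subset[of _ "L \<times> Pow L \<times> Pow L"]) (auto simp: U_def)
    have PU: "P \<subseteq> U" and QU: "Q \<subseteq> U" and TU: "T \<subseteq> U"
      using I by (auto simp: P_def Q_def T_def U_def)
    have pc: "p u \<in> carrier R" and qc: "q u \<in> carrier R" and Sc: "S u \<in> carrier R" if "u \<in> U" for u
      using fc[OF that] by (auto simp: p_def q_def S_def split: prod.splits)

    have ScT: "\<And>u. u \<in> T \<Longrightarrow> S u \<in> carrier R" and pcP: "\<And>u. u \<in> P \<Longrightarrow> p u \<in> carrier R"
      and qcQ: "\<And>u. u \<in> Q \<Longrightarrow> q u \<in> carrier R"
      using PU QU TU pc qc Sc by blast+

    have l1: "dd (x \<otimes>\<^bsub>E\<^esub> y) I = finsum R S T"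
    proof -
      have "dd (x \<otimes>\<^bsub>E\<^esub> y) I = (\<Oplus>a\<in>L - I. \<Oplus>A\<in>Pow (insert a I). S (a, A, insert a I - A))"
        unfolding dd_app[OF E_mult_closed[OF xE y] I]
      proof (rule finsum_cong'[OF refl])
        fix a assume a: "a \<in> L - I"
        then have s: "insert a I \<subseteq> L" and al: "J a \<in> carrier R" using I J_closed by auto
        let ?s = "alt_sign R (inversions {a} I)"
        have *: "x A \<in> carrier R" "y (insert a I - A) \<in> carrier R" if "A \<in> Pow (insert a I)" for A
          using that s xE y by auto
        have "?s \<otimes> (J a \<otimes> (x \<otimes>\<^bsub>E\<^esub> y) (insert a I))
            = (?s \<otimes> J a) \<otimes> (\<Oplus>A\<in>Pow (insert a I). alt_sign R (inversions A (insert a I - A)) \<otimes> (x A \<otimes> y (insert a I - A)))"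
          using s al * by (subst m_assoc) (auto simp: E_simps(4) intro!: finsum_closed m_closed)
        also have "\<dots> = (\<Oplus>A\<in>Pow (insert a I). (?s \<otimes> J a) \<otimes> (alt_sign R (inversions A (insert a I - A)) \<otimes> (x A \<otimes> y (insert a I - A))))"
          by (rule finsum_rdistr) (use al * fI in auto)
        also have "\<dots> = (\<Oplus>A\<in>Pow (insert a I). S (a, A, insert a I - A))"
          by (rule finsum_cong') (use al * in \<open>auto simp: S_def f_def alt_sign_add m_ac\<close>)
        finally show "?s \<otimes> (J a \<otimes> (x \<otimes>\<^bsub>E\<^esub> y) (insert a I)) = (\<Oplus>A\<in>Pow (insert a I). S (a, A, insert a I - A))" .
      next
        show "(\<lambda>a. \<Oplus>A\<in>Pow (insert a I). S (a, A, insert a I - A)) \<in> L - I \<rightarrow> carrier R"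
          by (auto intro!: finsum_closed Sc subsetD[OF TU] simp: T_def)
      qed
      also have "\<dots> = finsum R S T"
        by (rule finsum_Sigma_bij[where h = "\<lambda>(a, A). (a, A, insert a I - A)"])
           (use fI ScT in \<open>auto simp: bij_betw_def inj_on_def T_def image_iff\<close>)
      finally show ?thesis .
    qed

    have l2: "(dd x \<otimes>\<^bsub>E\<^esub> y) I = finsum R p P"
    proof -
      have "(dd x \<otimes>\<^bsub>E\<^esub> y) I = (\<Oplus>A\<in>Pow I. \<Oplus>a\<in>L - A. p (a, insert a A, I - A))"
        unfolding E_simps(4) restrict_apply' [OF PowI[OF I]]
      proof (rule finsum_cong'[OF refl])
        fix A assume A: "A \<in> Pow I"
        then have s: "A \<subseteq> L" using I by auto
        let ?s = "alt_sign R (inversions A (I - A))"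
        have yc: "y (I - A) \<in> carrier R" using y I by auto
        have *: "J a \<in> carrier R" "x (insert a A) \<in> carrier R" if "a \<in> L - A" for a
          using that s xE J_closed by auto
        have "?s \<otimes> (dd x A \<otimes> y (I - A)) = (?s \<otimes> y (I - A)) \<otimes> dd x A"
          using dd_closed[OF xE] s yc by (auto simp: m_ac)
        also have "\<dots> = (\<Oplus>a\<in>L - A. (?s \<otimes> y (I - A)) \<otimes> (alt_sign R (inversions {a} A) \<otimes> (J a \<otimes> x (insert a A))))"
          unfolding dd_app[OF xE s] by (rule finsum_rdistr) (use * yc in auto)
        also have "\<dots> = (\<Oplus>a\<in>L - A. p (a, insert a A, I - A))"
          by (rule finsum_cong') (use * yc in \<open>auto simp: p_def f_def alt_sign_add m_ac\<close>)
        finally show "?s \<otimes> (dd x A \<otimes> y (I - A)) = (\<Oplus>a\<in>L - A. p (a, insert a A, I - A))" .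
      next
        show "(\<lambda>A. \<Oplus>a\<in>L - A. p (a, insert a A, I - A)) \<in> Pow I \<rightarrow> carrier R"
          by (auto intro!: finsum_closed pc subsetD[OF PU] simp: P_def)
      qed
      also have "\<dots> = finsum R p P"
      proof (rule finsum_Sigma_bij[where h = "\<lambda>(A, a). (a, insert a A, I - A)"])
        show "bij_betw (\<lambda>(A, a). (a, insert a A, I - A)) (SIGMA A:Pow I. L - A) P"
          by (rule bij_betw_byWitness[where f' = "\<lambda>(a, A, B). (A - {a}, a)"])
             (auto simp: P_def insert_absorb)
      qed (use fI pcP in auto)
      finally show ?thesis .
    qed

    have l3: "(alt_sign R i \<odot>\<^bsub>E\<^esub> (x \<otimes>\<^bsub>E\<^esub> dd y)) I = finsum R q Q"
    proof -
      have ip: "alt_sign R (inversions A (I - A)) \<otimes> (x A \<otimes> dd y (I - A)) \<in> carrier R" if "A \<in> Pow I" for A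
      proof -
        have "A \<subseteq> L" "I - A \<subseteq> L" using that I by auto
        then show ?thesis using xE dd_closed[OF y] by (intro m_closed) auto
      qed
      have "(alt_sign R i \<odot>\<^bsub>E\<^esub> (x \<otimes>\<^bsub>E\<^esub> dd y)) I
          = alt_sign R i \<otimes> (\<Oplus>A\<in>Pow I. alt_sign R (inversions A (I - A)) \<otimes> (x A \<otimes> dd y (I - A)))"
        using I by (simp add: E_simps(3,4))
      also have "\<dots> = (\<Oplus>A\<in>Pow I. alt_sign R i \<otimes> (alt_sign R (inversions A (I - A)) \<otimes> (x A \<otimes> dd y (I - A))))"
        by (rule finsum_rdistr) (use ip fI in auto)
      also have "\<dots> = (\<Oplus>A\<in>Pow I. \<Oplus>a\<in>L - (I - A). q (a, A, insert a (I - A)))"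
      proof (rule finsum_cong'[OF refl])
        fix A assume A: "A \<in> Pow I"
        then have s: "A \<subseteq> L" "I - A \<subseteq> L" using I by auto
        let ?s = "alt_sign R (inversions A (I - A))"
        have xc: "x A \<in> carrier R" using xE s by auto
        have *: "J a \<in> carrier R" "y (insert a (I - A)) \<in> carrier R" if "a \<in> L - (I - A)" for a
          using that s y J_closed by auto
        have "alt_sign R i \<otimes> (?s \<otimes> (x A \<otimes> dd y (I - A))) = (alt_sign R i \<otimes> (?s \<otimes> x A)) \<otimes> dd y (I - A)"
          using E_app[OF dd_closed[OF y] s(2)] xc by (simp add: m_ac)
        also have "\<dots> = (\<Oplus>a\<in>L - (I - A). (alt_sign R i \<otimes> (?s \<otimes> x A)) \<otimes> (alt_sign R (inversions {a} (I - A)) \<otimes> (J a \<otimes> y (insert a (I - A)))))"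
          unfolding dd_app[OF y s(2)] by (rule finsum_rdistr) (use * xc in auto)
        also have "\<dots> = (\<Oplus>a\<in>L - (I - A). q (a, A, insert a (I - A)))"
        proof (rule finsum_cong'[OF refl])
          show "(\<lambda>a. q (a, A, insert a (I - A))) \<in> L - (I - A) \<rightarrow> carrier R"
            using A by (auto intro!: qc subsetD[OF QU] simp: Q_def)
          fix a assume a: "a \<in> L - (I - A)"
          then have "insert a (I - A) - {a} = I - A" by auto
          then show "(alt_sign R i \<otimes> (?s \<otimes> x A)) \<otimes> (alt_sign R (inversions {a} (I - A)) \<otimes> (J a \<otimes> y (insert a (I - A)))) = q (a, A, insert a (I - A))"
            using *[OF a] xc by (simp add: q_def f_def alt_sign_add m_ac)
        qed
        finally show "alt_sign R i \<otimes> (?s \<otimes> (x A \<otimes> dd y (I - A))) = (\<Oplus>a\<in>L - (I - A). q (a, A, insert a (I - A)))" .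
      next
        show "(\<lambda>A. \<Oplus>a\<in>L - (I - A). q (a, A, insert a (I - A))) \<in> Pow I \<rightarrow> carrier R"
          by (auto intro!: finsum_closed qc subsetD[OF QU] simp: Q_def)
      qed
      also have "\<dots> = finsum R q Q"
      proof (rule finsum_Sigma_bij[where h = "\<lambda>(A, a). (a, A, insert a (I - A))"])
        show "bij_betw (\<lambda>(A, a). (a, A, insert a (I - A))) (SIGMA A:Pow I. L - (I - A)) Q"
          by (rule bij_betw_byWitness[where f' = "\<lambda>(a, A, B). (A, a)"])
             (auto simp: Q_def)
      qed (use fI qcQ in auto)
      finally show ?thesis .
    qed

    define P1 where "P1 = {u\<in>P. fst u \<notin> snd (snd u)}"
    define Q1 where "Q1 = {u\<in>Q. fst u \<notin> fst (snd u)}"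
    have P_Q: "(a, A, B) \<in> Q" if "(a, A, B) \<in> P" "a \<in> B" for a A B
      using that unfolding P_def Q_def by blast
    have Q_P: "(a, A, B) \<in> P" if "(a, A, B) \<in> Q" "a \<in> A" for a A B
    proof -
      have h: "a < l" "A \<subseteq> I" "a \<in> B" "B - {a} = I - A" using that by (auto simp: Q_def)
      then have "B = insert a (I - A)" by blast
      then show ?thesis using h that(2) unfolding P_def by blast
    qed
    have P_in: "a \<in> A" if "(a, A, B) \<in> P" for a A B using that by (simp add: P_def)
    have Q_in: "a \<in> B" if "(a, A, B) \<in> Q" for a A B using that by (simp add: Q_def)
    have T_P: "(a, A, B) \<in> P" if "(a, A, B) \<in> T" "a \<in> A" for a A B
      using that unfolding P_def T_def by blast
    have T_Q: "(a, A, B) \<in> Q" if "(a, A, B) \<in> T" "a \<notin> A" for a A B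
      using that unfolding Q_def T_def by blast
    have T_B: "a \<notin> B" if "(a, A, B) \<in> T" "a \<in> A" for a A B
      using that by (simp add: T_def)
    have P_T: "(a, A, B) \<in> T" if "(a, A, B) \<in> P" "a \<notin> B" for a A B
      using that unfolding P_def T_def by blast
    have Q_T: "(a, A, B) \<in> T" if "(a, A, B) \<in> Q" "a \<notin> A" for a A B
    proof -
      have h: "a < l" "A \<subseteq> I" "a \<in> B" "B - {a} = I - A" using that by (auto simp: Q_def)
      then have "B = insert a (I - A)" "a \<notin> I" using that(2) by blast+
      then show ?thesis using h that(2) unfolding T_def by blast
    qed
    have PQ: "P = P1 \<union> (P \<inter> Q)" "Q = Q1 \<union> (P \<inter> Q)" "P1 \<inter> (P \<inter> Q) = {}" "Q1 \<inter> (P \<inter> Q) = {}"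
    proof -
      have p: "u \<in> Q" if "u \<in> P" "fst u \<in> snd (snd u)" for u
        using that P_Q by (cases u) simp
      have q: "u \<in> P" if "u \<in> Q" "fst u \<in> fst (snd u)" for u
        using that Q_P by (cases u) simp
      have pi: "fst u \<in> fst (snd u)" if "u \<in> P" for u using that P_in by (cases u) simp
      have qi: "fst u \<in> snd (snd u)" if "u \<in> Q" for u using that Q_in by (cases u) simp
      show "P = P1 \<union> (P \<inter> Q)" unfolding P1_def using p by blast
      show "Q = Q1 \<union> (P \<inter> Q)" unfolding Q1_def using q by blast
      show "P1 \<inter> (P \<inter> Q) = {}" unfolding P1_def using qi by blast
      show "Q1 \<inter> (P \<inter> Q) = {}" unfolding Q1_def using pi by blast
    qed
    have TT: "T = P1 \<union> Q1" "P1 \<inter> Q1 = {}"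
    proof -
      show "T = P1 \<union> Q1"
      proof (rule Set.set_eqI)
        fix u :: "nat \<times> nat set \<times> nat set"
        obtain a A B where u: "u = (a, A, B)" by (rule prod_cases3[of u])
        have 1: "u \<in> P1 \<longleftrightarrow> (a, A, B) \<in> P \<and> a \<notin> B" unfolding P1_def u mem_Collect_eq fst_conv snd_conv ..
        have 2: "u \<in> Q1 \<longleftrightarrow> (a, A, B) \<in> Q \<and> a \<notin> A" unfolding Q1_def u mem_Collect_eq fst_conv snd_conv ..
        show "u \<in> T \<longleftrightarrow> u \<in> P1 \<union> Q1"
        proof
          assume "u \<in> T"
          then have t: "(a, A, B) \<in> T" unfolding u .
          show "u \<in> P1 \<union> Q1"
          proof (cases "a \<in> A")
            case True
            with T_P[OF t] T_B[OF t] have "u \<in> P1" unfolding 1 by blast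
            then show ?thesis ..
          next
            case False
            with T_Q[OF t] have "u \<in> Q1" unfolding 2 by blast
            then show ?thesis ..
          qed
        next
          assume "u \<in> P1 \<union> Q1"
          then have "(a, A, B) \<in> T"
          proof (rule UnE)
            assume "u \<in> P1"
            then show ?thesis unfolding 1 using P_T by blast
          next
            assume "u \<in> Q1"
            then show ?thesis unfolding 2 using Q_T by blast
          qed
          then show "u \<in> T" unfolding u .
        qed
      qed
      have "fst u \<in> fst (snd u)" if "u \<in> P" for u using that P_in by (cases u) simp
      then show "P1 \<inter> Q1 = {}" unfolding P1_def Q1_def by blast
    qed
    have fin: "finite P1" "finite Q1" "finite (P \<inter> Q)"
      using finite_subset[OF PU finU] finite_subset[OF QU finU] by (auto simp: P1_def Q1_def)
    have sub: "P1 \<subseteq> U" "Q1 \<subseteq> U" "P \<inter> Q \<subseteq> U"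
      using PU QU by (auto simp: P1_def Q1_def)

    have e1: "p u = S u" if u: "u \<in> P1" for u
    proof -
      obtain a A B where uu: "u = (a, A, B)" by (rule prod_cases3[of u])
      have h: "a \<in> A" "A - {a} \<subseteq> I" "B = I - (A - {a})" "a \<notin> B" using u uu by (auto simp: P1_def P_def)
      have "A \<subseteq> insert a I" "B \<subseteq> I" using h by blast+
      then have fA: "finite A" "finite B" using fI by (auto intro: finite_subset)
      have "inversions {a} I = inversions {a} (A - {a}) + inversions {a} B"
        using inversions_Un_right[of "{a}" B "A - {a}"] h fA by (simp add: Un_absorb1)
      moreover have "inversions A B = inversions (A - {a}) B + inversions {a} B"
        using inversions_Un_left[of "A - {a}" "{a}" B] h fA by (simp add: insert_absorb)
      ultimately show ?thesis unfolding uu p_def S_def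
        by (simp, intro arg_cong2[where f = "(\<otimes>)"] alt_sign_cong refl) auto
    qed
    have f0: "f u = \<zero>" if "u \<in> U" "card (fst (snd u)) \<noteq> i" for u
      using that y by (auto simp: U_def f_def x0 J_closed)
    have e2: "q u = S u" if u: "u \<in> Q1" for u
    proof -
      obtain a A B where uu: "u = (a, A, B)" by (rule prod_cases3[of u])
      have h: "A \<subseteq> I" "a \<in> B" "B - {a} = I - A" "a \<notin> A" using u uu by (auto simp: Q1_def Q_def)
      have fA: "finite A" "finite (B - {a})" using h fI by (auto intro: finite_subset)
      have 1: "inversions {a} I = inversions {a} A + inversions {a} (B - {a})"
        using inversions_Un_right[of "{a}" "B - {a}" A] h fA by (simp add: Un_absorb1)
      have 2: "inversions A B = inversions A (B - {a}) + inversions A {a}"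
      proof -
        have "B = (B - {a}) \<union> {a}" using h(2) by blast
        moreover have "inversions A ((B - {a}) \<union> {a}) = inversions A (B - {a}) + inversions A {a}"
          by (rule inversions_Un_right) (use fA in auto)
        ultimately show ?thesis by metis
      qed
      have uU: "(a, A, B) \<in> U" using sub u uu by auto
      show ?thesis
      proof (cases "card A = i")
        case False
        then show ?thesis using f0[OF uU] by (simp add: uu q_def S_def)
      next
        case True
        show ?thesis unfolding uu q_def S_def using True 1 2 inversions_swap[OF fA(1) h(4)]
          by (simp, intro arg_cong2[where f = "(\<otimes>)"] alt_sign_cong refl) presburger
      qed
    qed
    have e3: "p u \<oplus> q u = \<zero>" if u: "u \<in> P \<inter> Q" for u
    proof -
      obtain a A B where uu: "u = (a, A, B)" by (rule prod_cases3[of u])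
      have h: "A \<subseteq> I" "a \<in> B" "B - {a} = I - A" "a \<in> A" using u uu by (auto simp: P_def Q_def)
      have fA: "finite A" "finite (A - {a})" "finite (B - {a})" using h fI by (auto intro: finite_subset)
      have 1: "inversions (A - {a}) B = inversions (A - {a}) (B - {a}) + inversions (A - {a}) {a}"
      proof -
        have "B = (B - {a}) \<union> {a}" using h(2) by blast
        moreover have "inversions (A - {a}) ((B - {a}) \<union> {a})
            = inversions (A - {a}) (B - {a}) + inversions (A - {a}) {a}"
          by (rule inversions_Un_right) (use fA in auto)
        ultimately show ?thesis by metis
      qed
      have 2: "inversions A (B - {a}) = inversions (A - {a}) (B - {a}) + inversions {a} (B - {a})"
      proof -
        have "A = (A - {a}) \<union> {a}" using h(4) by blast
        moreover have "inversions ((A - {a}) \<union> {a}) (B - {a})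
            = inversions (A - {a}) (B - {a}) + inversions {a} (B - {a})"
          by (rule inversions_Un_left) (use fA in auto)
        ultimately show ?thesis by metis
      qed
      have 3: "inversions {a} (A - {a}) + inversions (A - {a}) {a} + 1 = card A"
        using inversions_swap[OF fA(2), of a] h fA card_Suc_Diff1[OF fA(1) h(4)] by simp
      have uU: "(a, A, B) \<in> U" using sub u uu by auto
      note fu = fc[OF uU]
      show ?thesis
      proof (cases "card A = i")
        case False
        then show ?thesis using f0[OF uU] by (simp add: uu p_def q_def)
      next
        case True
        have "alt_sign R (i + inversions A (B - {a}) + inversions {a} (B - {a}))
            = alt_sign R (Suc (inversions (A - {a}) B + inversions {a} (A - {a})))"
          by (rule alt_sign_cong) (use 1 2 3 True in presburger)
        then show ?thesis unfolding uu p_def q_def using fu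
          by (simp add: alt_sign_Suc l_minus r_neg)
      qed
    qed

    have "finsum R p P \<oplus> finsum R q Q
        = (finsum R p P1 \<oplus> finsum R p (P \<inter> Q)) \<oplus> (finsum R q Q1 \<oplus> finsum R q (P \<inter> Q))"
    proof -
      have "finsum R p P = finsum R p P1 \<oplus> finsum R p (P \<inter> Q)"
        by (subst PQ(1), rule finsum_Un_disjoint) (use fin PQ sub pc in auto)
      moreover have "finsum R q Q = finsum R q Q1 \<oplus> finsum R q (P \<inter> Q)"
        by (subst PQ(2), rule finsum_Un_disjoint) (use fin PQ sub qc in auto)
      ultimately show ?thesis by simp
    qed
    also have "\<dots> = (finsum R p P1 \<oplus> finsum R q Q1) \<oplus> (finsum R p (P \<inter> Q) \<oplus> finsum R q (P \<inter> Q))"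
    proof -
      have "finsum R p P1 \<in> carrier R" "finsum R q Q1 \<in> carrier R"
           "finsum R p (P \<inter> Q) \<in> carrier R" "finsum R q (P \<inter> Q) \<in> carrier R"
        using sub pc qc by (auto intro!: finsum_closed)
      then show ?thesis by (simp add: a_ac)
    qed
    also have "finsum R p (P \<inter> Q) \<oplus> finsum R q (P \<inter> Q) = (\<Oplus>u\<in>P \<inter> Q. p u \<oplus> q u)"
      by (rule finsum_addf[symmetric]) (use sub pc qc in auto)
    also have "\<dots> = (\<Oplus>u\<in>P \<inter> Q. \<zero>)"
      by (rule finsum_cong') (use e3 in auto)
    also have "finsum R p P1 = finsum R S P1"
      by (rule finsum_cong') (use e1 sub Sc in auto)
    also have "finsum R q Q1 = finsum R S Q1"
      by (rule finsum_cong') (use e2 sub Sc in auto)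
    also have "finsum R S P1 \<oplus> finsum R S Q1 = finsum R S T"
      unfolding TT(1) by (rule finsum_Un_disjoint[symmetric]) (use fin TT sub Sc in auto)
    finally have "finsum R p P \<oplus> finsum R q Q = finsum R S T"
      using TU Sc by (auto intro!: finsum_closed r_zero)
    then show "dd (x \<otimes>\<^bsub>E\<^esub> y) I = ((dd x \<otimes>\<^bsub>E\<^esub> y) \<oplus>\<^bsub>E\<^esub> alt_sign R i \<odot>\<^bsub>E\<^esub> (x \<otimes>\<^bsub>E\<^esub> dd y)) I"
      unfolding E_simps(2) restrict_apply'[OF PowI[OF I]] l1 l2 l3 by simp
  qed (use cl in \<open>auto intro!: dd_closed E_mult_closed E_add_closed E_smult_closed\<close>)
qed

lemma koszul_derivation_formula: "koszul_derivation R l J dd"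
  unfolding koszul_derivation_def Let_def
proof (intro conjI ballI allI impI)
  show "dd \<in> carrier E \<rightarrow>\<^sub>E carrier E"
    using dd_closed by (auto simp: koszul_formula_def E_simps(1))
qed (simp_all add: dd_add dd_smult dd_derivation dd_basis)

lemma mult_basis:
  assumes "finite A" "finite B" "A \<subseteq> L" "B \<subseteq> L" "A \<inter> B = {}"
  shows "ext_basis R l A \<otimes>\<^bsub>E\<^esub> ext_basis R l B
       = alt_sign R (inversions A B) \<odot>\<^bsub>E\<^esub> ext_basis R l (A \<union> B)"
proof (rule E_ext)
  fix I assume I: "I \<subseteq> L"
  then have fI: "finite I" using finite_subset by blast
  let ?v = "if I = A \<union> B then alt_sign R (inversions A B) else \<zero>"
  have "(ext_basis R l A \<otimes>\<^bsub>E\<^esub> ext_basis R l B) I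
      = (\<Oplus>C\<in>Pow I. if A = C then ?v else \<zero>)"
    unfolding E_simps(4) restrict_apply'[OF PowI[OF I]]
  proof (rule finsum_cong'[OF refl])
    fix C assume "C \<in> Pow I"
    then have C: "C \<subseteq> I" by auto
    have "C = A \<Longrightarrow> I - C = B \<longleftrightarrow> I = A \<union> B" using C assms(5) by auto
    moreover have "C \<subseteq> L" "I - C \<subseteq> L" using C I by auto
    ultimately show "alt_sign R (inversions C (I - C)) \<otimes> (ext_basis R l A C \<otimes> ext_basis R l B (I - C))
        = (if A = C then ?v else \<zero>)"
      by (auto simp: ext_basis_def)
  qed auto
  also have "\<dots> = ?v"
  proof (cases "A \<subseteq> I")
    case True
    then show ?thesis
      using finsum_singleton[of A "Pow I" "\<lambda>_. ?v"] fI by simp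
  next
    case False
    then have "(\<Oplus>C\<in>Pow I. if A = C then ?v else \<zero>) = (\<Oplus>C\<in>Pow I. \<zero>)"
      by (intro finsum_cong') auto
    then show ?thesis using False by auto
  qed
  finally show "(ext_basis R l A \<otimes>\<^bsub>E\<^esub> ext_basis R l B) I
      = (alt_sign R (inversions A B) \<odot>\<^bsub>E\<^esub> ext_basis R l (A \<union> B)) I"
    using I by (simp add: E_simps(3) ext_basis_def)
qed (auto intro!: E_mult_closed E_smult_closed ext_basis_closed)

lemma ext_basis_in_module: "A \<subseteq> L \<Longrightarrow> ext_basis R l A \<in> koszul_module R l (card A)"
  using ext_basis_closed by (auto simp: koszul_module_def ext_basis_def)

lemma smult_one_E: "x \<in> carrier E \<Longrightarrow> \<one> \<odot>\<^bsub>E\<^esub> x = x"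
proof (rule E_ext)
  assume x: "x \<in> carrier E"
  then show "\<one> \<odot>\<^bsub>E\<^esub> x \<in> carrier E" by (simp add: E_smult_closed)
  fix I assume "I \<subseteq> L"
  then show "(\<one> \<odot>\<^bsub>E\<^esub> x) I = x I" using x by (simp add: E_simps(3))
qed

lemma one_mult_E:
  assumes "x \<in> carrier E"
  shows "ext_basis R l {} \<otimes>\<^bsub>E\<^esub> x = x" "x \<otimes>\<^bsub>E\<^esub> ext_basis R l {} = x"
proof -
  show "ext_basis R l {} \<otimes>\<^bsub>E\<^esub> x = x"
  proof (rule E_ext)
    fix I assume I: "I \<subseteq> L"
    then have fI: "finite I" using finite_subset by blast
    have "(ext_basis R l {} \<otimes>\<^bsub>E\<^esub> x) I = (\<Oplus>C\<in>Pow I. if {} = C then x I else \<zero>)"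
      unfolding E_simps(4) restrict_apply'[OF PowI[OF I]]
    proof (rule finsum_cong'[OF refl])
      fix C assume "C \<in> Pow I"
      then have "C \<subseteq> L" "I - C \<subseteq> L" using I by auto
      then show "alt_sign R (inversions C (I - C)) \<otimes> (ext_basis R l {} C \<otimes> x (I - C))
          = (if {} = C then x I else \<zero>)"
        using assms by (auto simp: ext_basis_def)
    qed (use assms I in auto)
    also have "\<dots> = x I"
      using finsum_singleton[of "{}" "Pow I" "\<lambda>_. x I"] fI assms I by simp
    finally show "(ext_basis R l {} \<otimes>\<^bsub>E\<^esub> x) I = x I" .
  qed (auto intro!: E_mult_closed ext_basis_closed assms)
  show "x \<otimes>\<^bsub>E\<^esub> ext_basis R l {} = x"
  proof (rule E_ext)
    fix I assume I: "I \<subseteq> L"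
    then have fI: "finite I" using finite_subset by blast
    have "(x \<otimes>\<^bsub>E\<^esub> ext_basis R l {}) I = (\<Oplus>C\<in>Pow I. if I = C then x I else \<zero>)"
      unfolding E_simps(4) restrict_apply'[OF PowI[OF I]]
    proof (rule finsum_cong'[OF refl])
      fix C assume C: "C \<in> Pow I"
      then have "C \<subseteq> L" "I - C \<subseteq> L" "I - C = {} \<longleftrightarrow> I = C" using I by auto
      then show "alt_sign R (inversions C (I - C)) \<otimes> (x C \<otimes> ext_basis R l {} (I - C))
          = (if I = C then x I else \<zero>)"
        using assms by (auto simp: ext_basis_def)
    qed (use assms I in auto)
    also have "\<dots> = x I"
      using finsum_singleton[of "I" "Pow I" "\<lambda>_. x I"] fI assms I by simp
    finally show "(x \<otimes>\<^bsub>E\<^esub> ext_basis R l {}) I = x I" .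
  qed (auto intro!: E_mult_closed ext_basis_closed assms)
qed

lemma koszul_derivation_unique:
  assumes d: "koszul_derivation R l J d" and d': "koszul_derivation R l J d'"
  shows "d = d'"
proof -
  have D: "d \<in> carrier E \<rightarrow>\<^sub>E carrier E"
      "\<And>x y. x \<in> carrier E \<Longrightarrow> y \<in> carrier E \<Longrightarrow> d (x \<oplus>\<^bsub>E\<^esub> y) = d x \<oplus>\<^bsub>E\<^esub> d y"
      "\<And>r x. r \<in> carrier R \<Longrightarrow> x \<in> carrier E \<Longrightarrow> d (r \<odot>\<^bsub>E\<^esub> x) = r \<odot>\<^bsub>E\<^esub> d x"
      "\<And>i x y. x \<in> koszul_module R l i \<Longrightarrow> y \<in> carrier E \<Longrightarrow>
         d (x \<otimes>\<^bsub>E\<^esub> y) = (d x \<otimes>\<^bsub>E\<^esub> y) \<oplus>\<^bsub>E\<^esub> alt_sign R i \<odot>\<^bsub>E\<^esub> (x \<otimes>\<^bsub>E\<^esub> d y)"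
      "\<And>a. a < l \<Longrightarrow> d (ext_basis R l {a}) = J a \<odot>\<^bsub>E\<^esub> \<one>\<^bsub>E\<^esub>"
    if "koszul_derivation R l J d" for d
    using that unfolding koszul_derivation_def Let_def by blast+
  have one: "d (ext_basis R l {}) = \<zero>\<^bsub>E\<^esub>" if h: "koszul_derivation R l J d" for d
  proof -
    let ?e = "ext_basis R l {}"
    have c: "d ?e \<in> carrier E" using D(1)[OF h] ext_basis_closed by auto
    have "d ?e = d (?e \<otimes>\<^bsub>E\<^esub> ?e)" by (simp add: one_mult_E ext_basis_closed)
    also have "\<dots> = d ?e \<oplus>\<^bsub>E\<^esub> d ?e"
      using D(4)[OF h ext_basis_in_module[of "{}"] ext_basis_closed[of "{}"]] c
      by (simp add: one_mult_E smult_one_E)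
    finally have *: "d ?e = d ?e \<oplus>\<^bsub>E\<^esub> d ?e" .
    show ?thesis
    proof (rule E_ext)
      fix I assume I: "I \<subseteq> L"
      have v: "d ?e I \<in> carrier R" using c I by (rule E_app)
      have "d ?e I = (d ?e \<oplus>\<^bsub>E\<^esub> d ?e) I" by (rule fun_cong[OF *])
      then have "d ?e I = d ?e I \<oplus> d ?e I" using I by (simp add: E_simps(2))
      then have "d ?e I = \<zero>" using add.l_cancel_one[OF v v] by metis
      then show "d ?e I = \<zero>\<^bsub>E\<^esub> I" using I by (simp add: E_simps(6))
    qed (use c in \<open>simp_all only:\<close>, simp add: E_simps(1,6))
  qed
  have basis: "d (ext_basis R l A) = d' (ext_basis R l A)" if "A \<subseteq> L" for A
  proof -
    have "finite A" using that finite_subset by blast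
    then show ?thesis using that
    proof (induction A rule: finite_linorder_min_induct)
      case empty
      show ?case using one[OF d] one[OF d'] by simp
    next
      case (insert a A)
      have "inversions {a} A = 0"
      proof -
        have "{(a', b). a' \<in> {a} \<and> b \<in> A \<and> b < a'} = {}"
          using insert.hyps(2) by (auto dest: less_asym)
        then show ?thesis unfolding inversions_def by (simp only: card.empty)
      qed
      moreover have "a \<notin> A" using insert.hyps(2) by auto
      ultimately have e: "ext_basis R l (insert a A) = ext_basis R l {a} \<otimes>\<^bsub>E\<^esub> ext_basis R l A"
        using mult_basis[of "{a}" A] insert by (simp add: smult_one_E ext_basis_closed)
      have al: "a < l" and IH: "d (ext_basis R l A) = d' (ext_basis R l A)" using insert by auto
      have m: "ext_basis R l {a} \<in> koszul_module R l 1"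
        using ext_basis_in_module[of "{a}"] al by simp
      show ?case unfolding e D(4)[OF d m ext_basis_closed] D(4)[OF d' m ext_basis_closed]
        by (simp add: IH D(5)[OF d al] D(5)[OF d' al])
    qed
  qed
  have main: "\<forall>x\<in>carrier E. (\<forall>I\<in>Pow L - \<A>. x I = \<zero>) \<longrightarrow> d x = d' x"
    if "finite \<A>" "\<A> \<subseteq> Pow L" for \<A>
    using that
  proof (induction \<A> rule: finite_induct)
    case empty
    show ?case
    proof (intro ballI impI)
      fix x assume x: "x \<in> carrier E" "\<forall>I\<in>Pow L - {}. x I = \<zero>"
      have "x = \<zero> \<odot>\<^bsub>E\<^esub> ext_basis R l {}"
      proof (rule E_ext)
        show "\<zero> \<odot>\<^bsub>E\<^esub> ext_basis R l {} \<in> carrier E" by (intro E_smult_closed ext_basis_closed) simp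
        fix I assume I: "I \<subseteq> L"
        then show "x I = (\<zero> \<odot>\<^bsub>E\<^esub> ext_basis R l {}) I"
          using x by (simp add: E_simps(3) ext_basis_def)
      qed (use x in simp)
      then show "d x = d' x"
        using D(3)[OF d, of "\<zero>" "ext_basis R l {}"] D(3)[OF d', of "\<zero>" "ext_basis R l {}"]
          ext_basis_closed basis[of "{}"] by simp
    qed
  next
    case (insert A \<A>)
    show ?case
    proof (intro ballI impI)
      fix x assume x: "x \<in> carrier E" "\<forall>I\<in>Pow L - insert A \<A>. x I = \<zero>"
      have A: "A \<subseteq> L" using insert.prems by auto
      define z where "z = x(A := \<zero>)"
      have z: "z \<in> carrier E" using x A by (auto simp: z_def E_simps(1) PiE_def extensional_def)
      have "\<forall>I\<in>Pow L - \<A>. z I = \<zero>" using x by (auto simp: z_def)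
      then have dz: "d z = d' z" using insert z by auto
      have xA: "x A \<in> carrier R" using x A by auto
      have s: "x A \<odot>\<^bsub>E\<^esub> ext_basis R l A \<in> carrier E"
        using xA by (intro E_smult_closed ext_basis_closed)
      have xx: "x = z \<oplus>\<^bsub>E\<^esub> x A \<odot>\<^bsub>E\<^esub> ext_basis R l A"
      proof (rule E_ext)
        show "z \<oplus>\<^bsub>E\<^esub> x A \<odot>\<^bsub>E\<^esub> ext_basis R l A \<in> carrier E"
          using z s by (rule E_add_closed)
        fix I assume I: "I \<subseteq> L"
        have "x I \<in> carrier R" using x(1) I by (rule E_app)
        then show "x I = (z \<oplus>\<^bsub>E\<^esub> x A \<odot>\<^bsub>E\<^esub> ext_basis R l A) I"
          using I xA by (simp add: E_simps(2,3) ext_basis_def z_def)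
      qed (use x in simp)
      show "d x = d' x"
        by (subst (1 2) xx)
           (simp add: D(2)[OF d z s] D(2)[OF d' z s] dz basis[OF A]
              D(3)[OF d xA ext_basis_closed] D(3)[OF d' xA ext_basis_closed])
    qed
  qed
  show ?thesis
  proof (rule PiE_ext[OF D(1)[OF d] D(1)[OF d']])
    fix x assume "x \<in> carrier E"
    then show "d x = d' x" using main[of "Pow L"] by auto
  qed
qed

theorem koszul_derivation_ex1: "\<exists>!d. koszul_derivation R l J d"
  using koszul_derivation_formula koszul_derivation_unique by blast

theorem koszul_diff_derivation: "koszul_derivation R l J (koszul_diff R l J)"
  unfolding koszul_diff_def by (rule theI'[OF koszul_derivation_ex1])

theorem koszul_diff_formula: "koszul_diff R l J = koszul_formula R l J"
  by (rule koszul_derivation_unique[OF koszul_diff_derivation koszul_derivation_formula])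

theorem koszul_diff_degree:
  assumes "x \<in> koszul_module R l (Suc i)"
  shows "koszul_diff R l J x \<in> koszul_module R l i"
proof -
  have xE: "x \<in> carrier E" and x0: "\<And>A. A \<subseteq> L \<Longrightarrow> card A \<noteq> Suc i \<Longrightarrow> x A = \<zero>"
    using assms by (auto simp: koszul_module_def)
  have "dd x I = \<zero>" if I: "I \<in> Pow L" "card I \<noteq> i" for I
  proof -
    have sub: "I \<subseteq> L" and fI: "finite I" using I finite_subset by auto
    have "dd x I = (\<Oplus>a\<in>L - I. \<zero>)"
      unfolding dd_app[OF xE sub]
    proof (rule finsum_cong'[OF refl])
      fix a assume a: "a \<in> L - I"
      then have "x (insert a I) = \<zero>" using x0[of "insert a I"] sub fI I(2) by auto
      then show "alt_sign R (inversions {a} I) \<otimes> (J a \<otimes> x (insert a I)) = \<zero>"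
        using a J_closed by simp
    qed simp
    then show ?thesis by simp
  qed
  then show ?thesis
    using dd_closed[OF xE] by (simp add: koszul_diff_formula koszul_module_def)
qed

end

end

theory Submission
  imports Defs
begin

text \<open>
  Write \<open>A\<close> for the ring of smooth functions, \<open>I\<close> for its ideal \<open>(J\<^sub>1, \<dots>, J\<^sub>l)\<close> and \<open>\<partial>\<close> for the Koszul
  differential. That \<open>H\<^sub>0 = A/I\<close> is the ring of restrictions to \<open>Z\<close> just says that \<open>I\<close> is the
  vanishing ideal. Acyclicity has three ingredients.

  \<^bold>\<open>Quasi-regularity\<close> (\<open>quasi_regular_at\<close>). If a form \<open>\<Sum>c\<^sub>\<alpha> J\<^sup>\<alpha>\<close> of degree \<open>k\<close> with coefficients in \<open>A\<close>
  vanishes identically, then its coefficients vanish on \<open>Z\<close>, hence lie in \<open>I\<close>. At a regular point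
  \<open>z\<close> one moves \<open>z\<close> along a line on which \<open>J\<close> starts with a prescribed velocity \<open>w\<close>; dividing by
  \<open>t\<^sup>k\<close> and letting \<open>t \<rightarrow> 0\<close> gives \<open>\<Sum>c\<^sub>\<alpha>(z) w\<^sup>\<alpha> = 0\<close> for all \<open>w\<close>. Density of the regular points extends
  this to all of \<open>Z\<close>.

  \<^bold>\<open>A formal primitive\<close> (\<open>correction_step\<close>, \<open>formal_primitive\<close>). Let \<open>f\<^sub>k\<close> be a cycle of Koszul degree
  \<open>i \<ge> 1\<close> that is a form of degree \<open>k\<close> in \<open>J\<close>. On differential forms with polynomial coefficients
  the de Rham differential \<open>d\<close> satisfies Euler's relation \<open>\<partial>d + d\<partial> = k + i\<close>, and by quasi-regularity
  the coefficients of \<open>\<partial>\<close> of the form lie in \<open>I\<close>. Hence \<open>f\<^sub>k = \<partial>W\<^sub>k + f\<^bsub>k+1\<^esub>\<close> with \<open>W\<^sub>k\<close> of degree \<open>k - 1\<close>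
  and \<open>f\<^bsub>k+1\<^esub>\<close> of degree \<open>k + 1\<close> in \<open>J\<close>. Starting from a given cycle \<open>f = f\<^sub>0\<close>, the series \<open>\<Sum>W\<^sub>k\<close> is a
  primitive of \<open>f\<close> up to terms of arbitrarily high order along \<open>Z\<close>.

  \<^bold>\<open>Summation\<close> (\<open>local_primitive\<close>). Off \<open>Z\<close> the complex is contracted by
  \<open>s = \<bar>J\<bar>\<^sup>-\<^sup>2 (\<Sum>J\<^sub>a e\<^sub>a) \<and> _\<close>, so that \<open>E\<^sub>k = W\<^sub>k - s f\<^sub>k + s f\<^bsub>k+1\<^esub>\<close> are cycles there and
  \<open>\<eta> = s f\<^sub>0 + \<Sum>\<chi>(\<bar>J\<bar>\<^sup>2/\<epsilon>\<^sub>k) E\<^sub>k\<close> is a primitive of \<open>f\<close> off \<open>Z\<close>, where \<open>\<chi>\<close> is a cutoff function. Close to \<open>Z\<close>,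
  where the first \<open>m\<close> cutoffs are \<open>1\<close>, the sum telescopes to
  \<open>\<eta> = \<Sum>\<^bsub>k<m\<^esub> W\<^sub>k + s f\<^sub>m + \<Sum>\<^bsub>k\<ge>m\<^esub> \<chi>(\<bar>J\<bar>\<^sup>2/\<epsilon>\<^sub>k) E\<^sub>k\<close>. The last two terms have size \<open>\<bar>J\<bar>\<^sup>m\<^sup>-\<^sup>1\<close>, each derivative costs
  one power of \<open>\<bar>J\<bar>\<close>, and this survives summation if the \<open>\<epsilon>\<^sub>k\<close> decrease fast enough. So \<open>\<eta>\<close> extends across
  \<open>Z\<close> with any number of derivatives. The estimates are uniform only on relatively compact pieces of a
  chart; the resulting local primitives are glued with a partition of unity
  (\<open>koszul_primitive_glue\<close>), which is legitimate because \<open>\<partial>\<close> is \<open>A\<close>-linear.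
\<close>

section \<open>Functions of class \<open>C\<^sup>k\<close> on open subsets of coordinate space\<close>

abbreviation eopen :: "nat \<Rightarrow> (nat \<Rightarrow> real) set \<Rightarrow> bool" where
  "eopen n U \<equiv> openin (Euclidean_space n) U"

abbreviation coord_space :: "nat \<Rightarrow> (nat \<Rightarrow> real) set" where
  "coord_space n \<equiv> topspace (Euclidean_space n)"

definition open_box :: "nat \<Rightarrow> (nat \<Rightarrow> real) \<Rightarrow> real \<Rightarrow> (nat \<Rightarrow> real) set" where
  "open_box n p r = {x \<in> coord_space n. \<forall>i<n. \<bar>x i - p i\<bar> < r}"

text \<open>
  The partial derivative as a relation: \<^const>\<open>partial_deriv\<close> is a total function that says nothing
  about differentiability.
\<close>

definition has_pd :: "((nat \<Rightarrow> real) \<Rightarrow> real) \<Rightarrow> nat \<Rightarrow> real \<Rightarrow> (nat \<Rightarrow> real) \<Rightarrow> bool" where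
  "has_pd f i D x \<longleftrightarrow> ((\<lambda>t. f (x(i := t))) has_real_derivative D) (at (x i))"

lemma Euclidean_space_top_of_set: "Euclidean_space n = top_of_set (coord_space n)"
  unfolding topspace_Euclidean_space by (simp add: Euclidean_space_def euclidean_product_topology)

lemma eopen_subset: "eopen n U \<Longrightarrow> U \<subseteq> coord_space n"
  by (rule openin_subset)

lemma eopen_open_box: "eopen n (open_box n p r)"
proof -
  have "open {f. \<forall>i\<in>{..<n}. f i \<in> {y::real. \<bar>y - p i\<bar> < r}}"
    by (rule product_topology_basis') (auto intro!: open_Collect_less continuous_intros)
  moreover have "open_box n p r = coord_space n \<inter> {f. \<forall>i\<in>{..<n}. f i \<in> {y::real. \<bar>y - p i\<bar> < r}}"
    by (auto simp: open_box_def)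
  ultimately show ?thesis
    by (subst Euclidean_space_top_of_set) auto
qed

text \<open>
  Only finitely many coordinates of a point of coordinate space can be nonzero, so the product topology
  on infinite sequences induces the topology of the maximum norm.
\<close>

lemma eopen_contains_box:
  assumes "eopen n U" "x \<in> U"
  obtains r where "r > 0" "open_box n x r \<subseteq> U"
proof -
  obtain T where T: "open T" "U = coord_space n \<inter> T"
    using assms(1) by (subst (asm) Euclidean_space_top_of_set) (auto simp: openin_open)
  have "openin (product_topology (\<lambda>i. euclidean) UNIV) T"
    using T(1) by (simp add: euclidean_product_topology)
  then obtain X where X: "finite {i. X i \<noteq> UNIV}" "\<And>i. open (X i)" "x \<in> Pi\<^sub>E UNIV X" "Pi\<^sub>E UNIV X \<subseteq> T"
    using assms(2) T(2) unfolding openin_product_topology_alt by (auto dest!: bspec[of _ _ x])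
  have "\<forall>i. \<exists>r>0. \<forall>y. \<bar>y - x i\<bar> < r \<longrightarrow> y \<in> X i"
  proof
    fix i
    have "x i \<in> X i" using X(3) by auto
    then show "\<exists>r>0. \<forall>y. \<bar>y - x i\<bar> < r \<longrightarrow> y \<in> X i"
      using X(2)[of i] unfolding open_dist by (metis dist_real_def)
  qed
  then obtain r where r: "\<And>i. r i > 0" "\<And>i y. \<bar>y - x i\<bar> < r i \<Longrightarrow> y \<in> X i" by metis
  define F where "F = {i. X i \<noteq> UNIV}"
  define s where "s = Min (insert 1 (r ` F))"
  have "s > 0" using X(1) r(1) by (auto simp: s_def F_def)
  moreover have "open_box n x s \<subseteq> U"
  proof
    fix y assume y: "y \<in> open_box n x s"
    have "y i \<in> X i" for i
    proof (cases "i \<in> F")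
      case True
      then have "s \<le> r i" using X(1) by (auto simp: s_def F_def)
      moreover have "\<bar>y i - x i\<bar> < s"
      proof (cases "i < n")
        case True then show ?thesis using y by (auto simp: open_box_def)
      next
        case False
        then have "y i = 0" "x i = 0"
          using y assms(2) T(2) by (auto simp: open_box_def topspace_Euclidean_space)
        then show ?thesis using \<open>s > 0\<close> by simp
      qed
      ultimately show ?thesis using r(2) by force
    qed (auto simp: F_def)
    then have "y \<in> T" using X(4) by auto
    then show "y \<in> U" using y T(2) by (auto simp: open_box_def)
  qed
  ultimately show ?thesis using that by blast
qed

lemma coord_space_upd [simp]: "x \<in> coord_space n \<Longrightarrow> i < n \<Longrightarrow> x(i := t) \<in> coord_space n"
  by (auto simp: topspace_Euclidean_space)

lemma open_box_upd:
  "x \<in> coord_space n \<Longrightarrow> i < n \<Longrightarrow> \<bar>t - x i\<bar> < r \<Longrightarrow> r > 0 \<Longrightarrow> x(i := t) \<in> open_box n x r"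
  by (auto simp: open_box_def)

lemma eventually_upd_in_eopen:
  assumes "eopen n U" "x \<in> U" "i < n"
  shows "\<forall>\<^sub>F t in nhds (x i). x(i := t) \<in> U"
proof -
  obtain r where r: "r > 0" "open_box n x r \<subseteq> U" using eopen_contains_box[OF assms(1,2)] .
  have "\<forall>\<^sub>F t in nhds (x i). dist t (x i) < r" using r(1) by (auto simp: eventually_nhds_metric)
  then show ?thesis
    by eventually_elim
      (use r assms eopen_subset[OF assms(1)] in \<open>auto simp: dist_real_def intro!: subsetD[OF r(2)] open_box_upd\<close>)
qed

lemma continuous_on_upd: "continuous_on S (\<lambda>t. x(i := t))" for x :: "nat \<Rightarrow> real"
proof (rule continuous_on_coordinatewise_then_product)
  fix j show "continuous_on S (\<lambda>t. (x(i := t)) j)" by (cases "j = i") (auto intro: continuous_intros)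
qed

lemma continuous_map_eopen:
  assumes "eopen n U"
  shows "continuous_map (subtopology (Euclidean_space n) U) euclideanreal f \<longleftrightarrow> continuous_on U f"
proof -
  have "subtopology (Euclidean_space n) U = top_of_set U"
    by (subst Euclidean_space_top_of_set)
       (use eopen_subset[OF assms] in \<open>simp add: subtopology_subtopology Int_absorb1\<close>)
  then show ?thesis by simp
qed

lemma has_pd_cong:
  assumes "eopen n U" "x \<in> U" "i < n" "\<And>y. y \<in> U \<Longrightarrow> f y = g y"
  shows "has_pd f i D x \<longleftrightarrow> has_pd g i D x"
  unfolding has_pd_def
proof (rule DERIV_cong_ev[OF refl _ refl])
  show "\<forall>\<^sub>F t in nhds (x i). f (x(i := t)) = g (x(i := t))"
    using eventually_upd_in_eopen[OF assms(1-3)] by eventually_elim (use assms in auto)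
qed

lemma has_pd_partial_deriv: "has_pd f i D x \<Longrightarrow> partial_deriv i f x = D"
  unfolding has_pd_def partial_deriv_def by (rule DERIV_imp_deriv)

lemma has_pd_iff: "has_pd f i (partial_deriv i f x) x \<longleftrightarrow> (\<lambda>t. f (x(i := t))) differentiable at (x i)"
proof
  assume "(\<lambda>t. f (x(i := t))) differentiable at (x i)"
  then obtain D where "((\<lambda>t. f (x(i := t))) has_real_derivative D) (at (x i))"
    using real_differentiable_def by blast
  then show "has_pd f i (partial_deriv i f x) x"
    using has_pd_partial_deriv has_pd_def by metis
qed (auto simp: has_pd_def real_differentiable_def)

lemma ck_on_cong:
  assumes "eopen n U" "\<And>x. x \<in> U \<Longrightarrow> f x = g x"
  shows "ck_on k n U f \<longleftrightarrow> ck_on k n U g"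
  using assms(2)
proof (induction k arbitrary: f g)
  case 0
  then show ?case by (simp add: continuous_map_eopen[OF assms(1)] cong: continuous_on_cong)
next
  case (Suc k)
  have 1: "(\<lambda>t. f (x(i := t))) differentiable at (x i) \<longleftrightarrow> (\<lambda>t. g (x(i := t))) differentiable at (x i)"
    if "i < n" "x \<in> U" for i x
    using has_pd_cong[OF assms(1) that(2,1), of f g, OF Suc.prems]
    unfolding has_pd_def real_differentiable_def by blast
  have 2: "partial_deriv i f x = partial_deriv i g x" if "i < n" "x \<in> U" for i x
    unfolding partial_deriv_def
  proof (rule deriv_cong_ev[OF _ refl])
    show "\<forall>\<^sub>F t in nhds (x i). f (x(i := t)) = g (x(i := t))"
      using eventually_upd_in_eopen[OF assms(1) that(2,1)] by eventually_elim (use Suc.prems in auto)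
  qed
  have 3: "ck_on k n U (partial_deriv i f) \<longleftrightarrow> ck_on k n U (partial_deriv i g)" if "i < n" for i
    by (rule Suc.IH) (use 2 that in auto)
  show ?case
    using 1 3 Suc.prems by (simp add: continuous_map_eopen[OF assms(1)] cong: continuous_on_cong)
qed

lemma ck_on_0_iff: "eopen n U \<Longrightarrow> ck_on 0 n U f \<longleftrightarrow> continuous_on U f"
  by (simp add: continuous_map_eopen)

text \<open>
  Partial derivatives enter only through their values on the open set, so any function with these
  values may take the place of \<^const>\<open>partial_deriv\<close>. This is the form in which the closure
  properties below are proved by induction on \<open>k\<close>.
\<close>

lemma ck_on_Suc_iff:
  assumes "eopen n U"
  shows "ck_on (Suc k) n U f \<longleftrightarrow>
    continuous_on U f \<and> (\<forall>i<n. \<exists>g. ck_on k n U g \<and> (\<forall>x\<in>U. has_pd f i (g x) x))"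
proof
  assume "ck_on (Suc k) n U f"
  then show "continuous_on U f \<and> (\<forall>i<n. \<exists>g. ck_on k n U g \<and> (\<forall>x\<in>U. has_pd f i (g x) x))"
    by (auto simp: continuous_map_eopen[OF assms] has_pd_iff)
next
  assume *: "continuous_on U f \<and> (\<forall>i<n. \<exists>g. ck_on k n U g \<and> (\<forall>x\<in>U. has_pd f i (g x) x))"
  have "(\<forall>x\<in>U. (\<lambda>t. f (x(i := t))) differentiable at (x i)) \<and> ck_on k n U (partial_deriv i f)"
    if i: "i < n" for i
  proof -
    obtain g where g: "ck_on k n U g" "\<And>x. x \<in> U \<Longrightarrow> has_pd f i (g x) x" using * i by blast
    have "ck_on k n U (partial_deriv i f) \<longleftrightarrow> ck_on k n U g"
      by (rule ck_on_cong[OF assms]) (use g has_pd_partial_deriv in blast)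
    then show ?thesis using g has_pd_iff has_pd_partial_deriv by metis
  qed
  then show "ck_on (Suc k) n U f" using * by (simp add: continuous_map_eopen[OF assms])
qed

lemma ck_on_continuous: "eopen n U \<Longrightarrow> ck_on k n U f \<Longrightarrow> continuous_on U f"
  by (cases k) (auto simp: continuous_map_eopen)

lemma ck_on_Suc_lower:
  assumes "eopen n U" shows "ck_on (Suc k) n U f \<Longrightarrow> ck_on k n U f"
proof (induction k arbitrary: f)
  case 0
  then show ?case by (simp add: continuous_map_eopen[OF assms])
next
  case (Suc k)
  show ?case unfolding ck_on_Suc_iff[OF assms, of k]
    using Suc.prems Suc.IH unfolding ck_on_Suc_iff[OF assms, of "Suc k"] by blast
qed

lemma ck_on_le:
  assumes "eopen n U" "ck_on k n U f" "j \<le> k" shows "ck_on j n U f"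
  using assms(3,2) by (induction rule: dec_induct) (auto dest: ck_on_Suc_lower[OF assms(1)] simp del: ck_on.simps)

lemma ck_on_subset:
  assumes "eopen n U" "eopen n V" "V \<subseteq> U" shows "ck_on k n U f \<Longrightarrow> ck_on k n V f"
proof (induction k arbitrary: f)
  case 0
  then show ?case using assms(3) by (simp add: continuous_map_eopen assms(1,2) continuous_on_subset)
next
  case (Suc k)
  then show ?case unfolding ck_on_Suc_iff[OF assms(1)] ck_on_Suc_iff[OF assms(2)]
    using assms(3) by (meson continuous_on_subset subset_iff)
qed

lemma continuous_on_local:
  assumes "eopen n U"
    and "\<And>x. x \<in> U \<Longrightarrow> \<exists>V. eopen n V \<and> x \<in> V \<and> V \<subseteq> U \<and> continuous_on V f"
  shows "continuous_on U f"
  unfolding continuous_on_def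
proof
  fix x assume x: "x \<in> U"
  then obtain V where V: "eopen n V" "x \<in> V" "V \<subseteq> U" "continuous_on V f" using assms(2) by blast
  obtain T where T: "open T" "V = coord_space n \<inter> T"
    using V(1) by (subst (asm) Euclidean_space_top_of_set) (auto simp: openin_open)
  have "U \<inter> T - {x} = V \<inter> T - {x}" using T V(3) eopen_subset[OF assms(1)] by auto
  then have "at x within U = at x within V"
    by (rule at_within_nhd[OF _ T(1), rotated]) (use V T in auto)
  then show "(f \<longlongrightarrow> f x) (at x within U)" using V(2,4) by (simp add: continuous_on_def)
qed

lemma ck_on_local:
  assumes U: "eopen n U"
    and "\<And>x. x \<in> U \<Longrightarrow> \<exists>V. eopen n V \<and> x \<in> V \<and> V \<subseteq> U \<and> ck_on k n V f"
  shows "ck_on k n U f"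
  using assms(2)
proof (induction k arbitrary: f)
  case 0
  then show ?case unfolding ck_on_0_iff[OF U]
    by (intro continuous_on_local[OF U]) (meson ck_on_0_iff)
next
  case (Suc k)
  show ?case unfolding ck_on_Suc_iff[OF U]
  proof (intro conjI allI impI)
    show "continuous_on U f"
      by (intro continuous_on_local[OF U]) (meson Suc.prems ck_on_continuous)
    fix i assume i: "i < n"
    have *: "\<exists>V. eopen n V \<and> x \<in> V \<and> V \<subseteq> U \<and> ck_on k n V (partial_deriv i f)
             \<and> has_pd f i (partial_deriv i f x) x" if "x \<in> U" for x
      using Suc.prems[OF that] i by (auto simp: has_pd_iff)
    then have "ck_on k n U (partial_deriv i f)" by (intro Suc.IH) blast
    then show "\<exists>g. ck_on k n U g \<and> (\<forall>x\<in>U. has_pd f i (g x) x)" using * by blast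
  qed
qed

lemma has_pd_const: "has_pd (\<lambda>x. c) i 0 x"
  by (simp add: has_pd_def)

lemma has_pd_coord: "has_pd (\<lambda>x. x j) i (if i = j then 1 else 0) x"
  by (auto simp: has_pd_def)

lemma has_pd_add: "has_pd f i D x \<Longrightarrow> has_pd g i E x \<Longrightarrow> has_pd (\<lambda>x. f x + g x) i (D + E) x"
  unfolding has_pd_def by (rule DERIV_add)

lemma has_pd_mult: "has_pd f i D x \<Longrightarrow> has_pd g i E x \<Longrightarrow> has_pd (\<lambda>x. f x * g x) i (D * g x + f x * E) x"
  unfolding has_pd_def using DERIV_mult[of "\<lambda>t. f (x(i := t))" D "x i" UNIV "\<lambda>t. g (x(i := t))" E]
  by (simp add: mult.commute)

lemma has_pd_comp1:
  "(g has_real_derivative D) (at (f x)) \<Longrightarrow> has_pd f i E x \<Longrightarrow> has_pd (\<lambda>x. g (f x)) i (D * E) x"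
  unfolding has_pd_def using DERIV_chain2[of g D "\<lambda>t. f (x(i := t))" "x i" E] by simp

lemma ck_on_SucI:
  assumes "eopen n U" "continuous_on U f" "\<And>i. i < n \<Longrightarrow> ck_on k n U (g i)"
    and "\<And>i x. i < n \<Longrightarrow> x \<in> U \<Longrightarrow> has_pd f i (g i x) x"
  shows "ck_on (Suc k) n U f"
  unfolding ck_on_Suc_iff[OF assms(1)] using assms(2-4) by blast

lemma ck_on_SucD:
  assumes "ck_on (Suc k) n U f" "i < n"
  shows "ck_on k n U (partial_deriv i f)" "\<And>x. x \<in> U \<Longrightarrow> has_pd f i (partial_deriv i f x) x"
  using assms by (auto simp: has_pd_iff)

lemma ck_on_const: "eopen n U \<Longrightarrow> ck_on k n U (\<lambda>x. c)"
proof (induction k arbitrary: c)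
  case (Suc k)
  show ?case
    by (rule ck_on_SucI[where g = "\<lambda>i x. 0"]) (use Suc in \<open>auto intro: has_pd_const simp del: ck_on.simps\<close>)
qed (simp add: continuous_map_eopen)

lemma continuous_on_coord: "continuous_on U (\<lambda>x::nat \<Rightarrow> real. x j)"
  by (rule continuous_on_subset[OF continuous_on_product_coordinates]) simp

lemma ck_on_coord: "eopen n U \<Longrightarrow> ck_on k n U (\<lambda>x. x j)"
proof (cases k)
  case (Suc k')
  assume U: "eopen n U"
  show ?thesis unfolding Suc
    by (rule ck_on_SucI[where g = "\<lambda>i x. if i = j then 1 else 0"])
      (rule U continuous_on_coord has_pd_coord ck_on_const[OF U])+
qed (simp add: continuous_map_eopen continuous_on_coord)

lemma ck_on_add:
  assumes U: "eopen n U"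
  shows "ck_on k n U f \<Longrightarrow> ck_on k n U g \<Longrightarrow> ck_on k n U (\<lambda>x. f x + g x)"
proof (induction k arbitrary: f g)
  case 0
  then show ?case by (simp add: continuous_map_eopen[OF assms] continuous_on_add)
next
  case (Suc k)
  note * = ck_on_SucD[OF Suc.prems(1)] ck_on_SucD[OF Suc.prems(2)]
  show ?case
  proof (rule ck_on_SucI[where g = "\<lambda>i x. partial_deriv i f x + partial_deriv i g x"])
    show "continuous_on U (\<lambda>x. f x + g x)"
      using Suc.prems by (intro continuous_on_add ck_on_continuous[OF assms])
    fix i assume i: "i < n"
    show "ck_on k n U (\<lambda>x. partial_deriv i f x + partial_deriv i g x)"
      by (intro Suc.IH *(1,3) i)
    show "has_pd (\<lambda>x. f x + g x) i (partial_deriv i f x + partial_deriv i g x) x" if "x \<in> U" for x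
      by (intro has_pd_add *(2,4) i that)
  qed (rule U)
qed

lemma ck_on_mult:
  assumes U: "eopen n U"
  shows "ck_on k n U f \<Longrightarrow> ck_on k n U g \<Longrightarrow> ck_on k n U (\<lambda>x. f x * g x)"
proof (induction k arbitrary: f g)
  case 0
  then show ?case by (simp add: continuous_map_eopen[OF assms] continuous_on_mult)
next
  case (Suc k)
  note * = ck_on_SucD[OF Suc.prems(1)] ck_on_SucD[OF Suc.prems(2)]
  show ?case
  proof (rule ck_on_SucI[where g = "\<lambda>i x. partial_deriv i f x * g x + f x * partial_deriv i g x"])
    show "continuous_on U (\<lambda>x. f x * g x)"
      using Suc.prems by (intro continuous_on_mult ck_on_continuous[OF assms])
    fix i assume i: "i < n"
    show "ck_on k n U (\<lambda>x. partial_deriv i f x * g x + f x * partial_deriv i g x)"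
      by (intro ck_on_add U Suc.IH *(1,3) i Suc.prems[THEN ck_on_Suc_lower[OF U]])
    show "has_pd (\<lambda>x. f x * g x) i (partial_deriv i f x * g x + f x * partial_deriv i g x) x" if "x \<in> U" for x
      by (intro has_pd_mult *(2,4) i that)
  qed (rule U)
qed

lemma ck_on_cmult: "eopen n U \<Longrightarrow> ck_on k n U f \<Longrightarrow> ck_on k n U (\<lambda>x. c * f x)"
  by (intro ck_on_mult ck_on_const)

lemma ck_on_diff: "eopen n U \<Longrightarrow> ck_on k n U f \<Longrightarrow> ck_on k n U g \<Longrightarrow> ck_on k n U (\<lambda>x. f x - g x)"
  using ck_on_add[of n U k f "\<lambda>x. (-1) * g x"] ck_on_cmult[of n U k g "-1"] by (simp del: ck_on.simps)

lemma ck_on_sum: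
  "eopen n U \<Longrightarrow> (\<And>a. a \<in> A \<Longrightarrow> ck_on k n U (f a)) \<Longrightarrow> ck_on k n U (\<lambda>x. \<Sum>a\<in>A. f a x)"
  by (induction A rule: infinite_finite_induct) (simp_all add: ck_on_const ck_on_add del: ck_on.simps)

lemma ck_on_power: "eopen n U \<Longrightarrow> ck_on k n U f \<Longrightarrow> ck_on k n U (\<lambda>x. f x ^ m)"
  by (induction m) (simp_all add: ck_on_const ck_on_mult del: ck_on.simps)

text \<open>
  The one-variable case, kept apart because \<^const>\<open>ck_on\<close> lives on coordinate spaces; it supplies the outer
  functions of compositions such as \<open>\<chi>(\<bar>J\<bar>\<^sup>2/\<epsilon>)\<close>.
\<close>

primrec ck_real :: "nat \<Rightarrow> (real \<Rightarrow> real) \<Rightarrow> bool" where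
  "ck_real 0 g \<longleftrightarrow> continuous_on UNIV g"
| "ck_real (Suc k) g \<longleftrightarrow> (\<exists>g'. (\<forall>t. (g has_real_derivative g' t) (at t)) \<and> ck_real k g')"

lemma ck_real_SucI:
  "(\<And>t. (g has_real_derivative g' t) (at t)) \<Longrightarrow> ck_real k g' \<Longrightarrow> ck_real (Suc k) g"
  by auto

lemma ck_real_SucD:
  assumes "ck_real (Suc k) g"
  shows "\<And>t. (g has_real_derivative deriv g t) (at t)" "ck_real k (deriv g)"
proof -
  obtain g' where g': "\<And>t. (g has_real_derivative g' t) (at t)" "ck_real k g'"
    using assms unfolding ck_real.simps by blast
  then have "deriv g = g'" using DERIV_imp_deriv by blast
  then show "\<And>t. (g has_real_derivative deriv g t) (at t)" "ck_real k (deriv g)"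
    using g' by simp_all
qed

lemma ck_real_continuous: "ck_real k g \<Longrightarrow> continuous_on UNIV g"
  by (cases k) (auto simp: continuous_on_eq_continuous_at dest: DERIV_isCont)

lemma ck_real_Suc_lower: "ck_real (Suc k) g \<Longrightarrow> ck_real k g"
proof (induction k arbitrary: g)
  case 0
  then show ?case using ck_real_continuous by fastforce
next
  case (Suc k)
  show ?case by (rule ck_real_SucI[OF ck_real_SucD(1)[OF Suc.prems] Suc.IH[OF ck_real_SucD(2)[OF Suc.prems]]])
qed

lemma ck_real_const: "ck_real k (\<lambda>t. c)"
proof (induction k arbitrary: c)
  case (Suc k)
  show ?case by (rule ck_real_SucI[OF DERIV_const Suc])
qed (auto intro: continuous_intros)

lemma ck_real_id: "ck_real k (\<lambda>t. t)"
proof (cases k)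
  case (Suc k')
  show ?thesis unfolding Suc by (rule ck_real_SucI[OF DERIV_ident ck_real_const])
qed (auto intro: continuous_intros)

lemma ck_real_add: "ck_real k f \<Longrightarrow> ck_real k g \<Longrightarrow> ck_real k (\<lambda>t. f t + g t)"
proof (induction k arbitrary: f g)
  case (Suc k)
  note f = ck_real_SucD[OF Suc.prems(1)] and g = ck_real_SucD[OF Suc.prems(2)]
  show ?case by (rule ck_real_SucI[OF DERIV_add[OF f(1) g(1)] Suc.IH[OF f(2) g(2)]])
qed (auto intro: continuous_intros)

lemma ck_real_mult: "ck_real k f \<Longrightarrow> ck_real k g \<Longrightarrow> ck_real k (\<lambda>t. f t * g t)"
proof (induction k arbitrary: f g)
  case (Suc k)
  note f = ck_real_SucD[OF Suc.prems(1)] and g = ck_real_SucD[OF Suc.prems(2)]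
  note lo = Suc.prems[THEN ck_real_Suc_lower]
  show ?case by (rule ck_real_SucI[OF DERIV_mult[OF f(1) g(1)]
      ck_real_add[OF Suc.IH[OF f(2) lo(2)] Suc.IH[OF g(2) lo(1)]]])
qed (auto intro: continuous_intros)

lemma ck_real_comp: "ck_real k g \<Longrightarrow> ck_real k f \<Longrightarrow> ck_real k (\<lambda>t. g (f t))"
proof (induction k arbitrary: f g)
  case 0
  then show ?case using continuous_on_compose2[of UNIV g UNIV f] by simp
next
  case (Suc k)
  note g = ck_real_SucD[OF Suc.prems(1)] and f = ck_real_SucD[OF Suc.prems(2)]
  show ?case by (rule ck_real_SucI[OF DERIV_chain2[OF g(1) f(1)]
      ck_real_mult[OF Suc.IH[OF g(2) ck_real_Suc_lower[OF Suc.prems(2)]] f(2)]])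
qed

lemma ck_real_inverse: "(\<And>t. f t \<noteq> 0) \<Longrightarrow> ck_real k f \<Longrightarrow> ck_real k (\<lambda>t. inverse (f t))"
proof (induction k)
  case (Suc k)
  note f = ck_real_SucD[OF Suc.prems(2)]
  have IH: "ck_real k (\<lambda>t. inverse (f t))"
    by (rule Suc.IH[OF Suc.prems(1) ck_real_Suc_lower[OF Suc.prems(2)]])
  have d: "((\<lambda>t. inverse (f t)) has_real_derivative (-1) * (inverse (f t) * inverse (f t)) * deriv f t) (at t)" for t
    using DERIV_inverse_fun[OF f(1) Suc.prems(1)] by (simp add: power2_eq_square algebra_simps)
  show ?case by (rule ck_real_SucI[OF d ck_real_mult[OF ck_real_mult[OF ck_real_const ck_real_mult[OF IH IH]] f(2)]])
qed (auto intro: continuous_intros)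

lemma ck_on_comp1:
  assumes U: "eopen n U"
  shows "ck_real k g \<Longrightarrow> ck_on k n U f \<Longrightarrow> ck_on k n U (\<lambda>x. g (f x))"
proof (induction k arbitrary: g)
  case 0
  then show ?case
    using continuous_on_compose2[of UNIV g U f] by (simp add: continuous_map_eopen[OF U])
next
  case (Suc k)
  note g' = ck_real_SucD[OF Suc.prems(1)]
  note * = ck_on_SucD[OF Suc.prems(2)]
  show ?case
  proof (rule ck_on_SucI[where g = "\<lambda>i x. deriv g (f x) * partial_deriv i f x"])
    show "continuous_on U (\<lambda>x. g (f x))"
      using ck_on_continuous[OF U Suc.prems(2)] ck_real_continuous[OF Suc.prems(1)]
      using continuous_on_compose2[of UNIV g U f] by simp
    fix i assume i: "i < n"
    show "ck_on k n U (\<lambda>x. deriv g (f x) * partial_deriv i f x)"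
      by (rule ck_on_mult[OF U Suc.IH[OF g'(2) ck_on_Suc_lower[OF U Suc.prems(2)]] *(1)[OF i]])
    show "has_pd (\<lambda>x. g (f x)) i (deriv g (f x) * partial_deriv i f x) x" if "x \<in> U" for x
      by (rule has_pd_comp1[OF g'(1) *(2)[OF i that]])
  qed (rule U)
qed

lemma continuous_on_open_box:
  assumes U: "eopen n U" and g: "continuous_on U g" and x: "x \<in> U" and e: "e > 0"
  obtains r where "r > 0" "open_box n x r \<subseteq> U" "\<And>y. y \<in> open_box n x r \<Longrightarrow> \<bar>g y - g x\<bar> < (e::real)"
proof -
  have "openin (top_of_set U) (U \<inter> g -` {y. \<bar>y - g x\<bar> < e})"
    using g by (rule continuous_openin_preimage_gen) (auto intro!: open_Collect_less continuous_intros)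
  then have "eopen n (U \<inter> g -` {y. \<bar>y - g x\<bar> < e})"
    using U by (subst Euclidean_space_top_of_set, subst (asm) Euclidean_space_top_of_set) (rule openin_trans)
  moreover have "x \<in> U \<inter> g -` {y. \<bar>y - g x\<bar> < e}" using x e by auto
  ultimately obtain r where "r > 0" "open_box n x r \<subseteq> U \<inter> g -` {y. \<bar>y - g x\<bar> < e}"
    by (rule eopen_contains_box)
  then show ?thesis using that by (auto simp: subset_iff)
qed

lemma MVT_between:
  fixes a b :: real
  assumes "\<And>s. \<bar>s - a\<bar> \<le> \<bar>b - a\<bar> \<Longrightarrow> (g has_real_derivative g' s) (at s)"
  shows "\<exists>\<xi>. \<bar>\<xi> - a\<bar> \<le> \<bar>b - a\<bar> \<and> g b - g a = (b - a) * g' \<xi>"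
proof (cases a b rule: linorder_cases)
  case less
  then obtain z where "a < z" "z < b" "g b - g a = (b - a) * g' z"
    using MVT2[of a b g g'] assms by force
  then show ?thesis by (intro exI[of _ z]) auto
next
  case greater
  then obtain z where "b < z" "z < a" "g a - g b = (a - b) * g' z"
    using MVT2[of b a g g'] assms by force
  then show ?thesis by (intro exI[of _ z]) (auto simp: algebra_simps)
qed (auto)

text \<open>
  Continuous partial derivatives imply differentiability along curves: pass from \<open>c(t\<^sub>0)\<close> to \<open>c(t)\<close> one
  coordinate at a time and apply the mean value theorem in each coordinate; the intermediate points
  tend to \<open>c(t\<^sub>0)\<close>.
\<close>

lemma chain_rule:
  assumes U: "eopen n U" and h: "ck_on (Suc 0) n U h" and c: "\<And>t. c t \<in> coord_space n" and t0: "c t0 \<in> U"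
    and c': "\<And>j. j < n \<Longrightarrow> ((\<lambda>t. c t j) has_real_derivative c' j) (at t0)"
  shows "((\<lambda>t. h (c t)) has_real_derivative (\<Sum>j<n. partial_deriv j h (c t0) * c' j)) (at t0)"
proof -
  define z where "z m t = (\<lambda>j. if j < m then c t j else c t0 j)" for m :: nat and t
  have c0: "c t j = 0" if "j \<ge> n" for t j using c[of t] that by (auto simp: topspace_Euclidean_space)
  have zc: "z m t \<in> coord_space n" for m t using c0 by (auto simp: z_def topspace_Euclidean_space)
  have zn: "z n t = c t" for t using c0 by (auto simp: z_def)
  have ev: "\<forall>\<^sub>F t in at t0. \<forall>j<n. \<bar>c t j - c t0 j\<bar> < r" if "r > 0" for r
  proof -
    have "\<forall>\<^sub>F t in at t0. \<bar>c t j - c t0 j\<bar> < r" if "j < n" for j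
      using c'[OF that, THEN DERIV_isCont] \<open>r > 0\<close> unfolding isCont_def tendsto_iff dist_real_def by blast
    then have "\<forall>\<^sub>F t in at t0. \<forall>j\<in>{..<n}. \<bar>c t j - c t0 j\<bar> < r"
      by (intro eventually_ball_finite) auto
    then show ?thesis by eventually_elim auto
  qed
  have "((\<lambda>t. h (z m t)) has_real_derivative (\<Sum>j<m. partial_deriv j h (c t0) * c' j)) (at t0)" if "m \<le> n" for m
    using that
  proof (induction m)
    case 0
    then show ?case by (simp add: z_def)
  next
    case (Suc m)
    then have m: "m < n" by simp
    define h' where "h' = partial_deriv m h"
    have h': "continuous_on U h'" "\<And>x. x \<in> U \<Longrightarrow> has_pd h m (h' x) x"
      using h m by (auto simp: continuous_map_eopen[OF U] h'_def has_pd_iff)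
    obtain r where r: "r > 0" "open_box n (c t0) r \<subseteq> U" using eopen_contains_box[OF U t0] .
    have zs: "z (Suc m) t = (z m t)(m := c t m)" "z m t = (z m t)(m := c t0 m)" for t
      by (auto simp: z_def)
    have box: "(z m t)(m := s) \<in> open_box n (c t0) d"
      if "\<forall>j<n. \<bar>c t j - c t0 j\<bar> < d" "\<bar>s - c t0 m\<bar> \<le> \<bar>c t m - c t0 m\<bar>" "d > 0" for s t d
    proof -
      have "\<bar>((z m t)(m := s)) j - c t0 j\<bar> < d" if "j < n" for j
        using \<open>\<forall>j<n. \<bar>c t j - c t0 j\<bar> < d\<close> that \<open>d > 0\<close> \<open>\<bar>s - c t0 m\<bar> \<le> _\<close> m
        by (auto simp: z_def intro: le_less_trans)
      then show ?thesis using zc[of m t] m by (auto simp: open_box_def)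
    qed
    have "\<exists>\<xi>. \<bar>\<xi> - c t0 m\<bar> \<le> \<bar>c t m - c t0 m\<bar> \<and>
        h (z (Suc m) t) - h (z m t) = (c t m - c t0 m) * h' ((z m t)(m := \<xi>))"
      if t: "\<forall>j<n. \<bar>c t j - c t0 j\<bar> < r" for t
      unfolding zs(1)
      apply (subst (2) zs(2))
    proof (rule MVT_between)
      fix s assume "\<bar>s - c t0 m\<bar> \<le> \<bar>c t m - c t0 m\<bar>"
      then have "(z m t)(m := s) \<in> U" using box[OF t _ r(1)] r(2) by blast
      then have "has_pd h m (h' ((z m t)(m := s))) ((z m t)(m := s))" by (rule h'(2))
      then show "((\<lambda>s. h ((z m t)(m := s))) has_real_derivative h' ((z m t)(m := s))) (at s)"
        by (simp add: has_pd_def)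
    qed
    then obtain \<xi> where \<xi>: "\<And>t. \<forall>j<n. \<bar>c t j - c t0 j\<bar> < r \<Longrightarrow> \<bar>\<xi> t - c t0 m\<bar> \<le> \<bar>c t m - c t0 m\<bar> \<and>
        h (z (Suc m) t) - h (z m t) = (c t m - c t0 m) * h' ((z m t)(m := \<xi> t))" by metis
    have lim: "((\<lambda>t. h' ((z m t)(m := \<xi> t))) \<longlongrightarrow> h' (c t0)) (at t0)"
      unfolding tendsto_iff
    proof (intro allI impI)
      fix e :: real assume "e > 0"
      then obtain d where d: "d > 0" "\<And>y. y \<in> open_box n (c t0) d \<Longrightarrow> \<bar>h' y - h' (c t0)\<bar> < e"
        using continuous_on_open_box[OF U h'(1) t0] by metis
      have "\<forall>\<^sub>F t in at t0. \<forall>j<n. \<bar>c t j - c t0 j\<bar> < min r d" using r(1) d(1) by (intro ev) auto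
      then show "\<forall>\<^sub>F t in at t0. dist (h' ((z m t)(m := \<xi> t))) (h' (c t0)) < e"
      proof eventually_elim
        case (elim t)
        then have 1: "\<forall>j<n. \<bar>c t j - c t0 j\<bar> < r" "\<forall>j<n. \<bar>c t j - c t0 j\<bar> < d" by auto
        then show ?case using d(2)[OF box[OF 1(2) _ d(1)]] \<xi>[OF 1(1)] by (simp add: dist_real_def)
      qed
    qed
    have "((\<lambda>t. (c t m - c t0 m) / (t - t0)) \<longlongrightarrow> c' m) (at t0)"
      using c'[OF m] unfolding has_field_derivative_iff by simp
    then have "((\<lambda>t. h' ((z m t)(m := \<xi> t)) * ((c t m - c t0 m) / (t - t0))) \<longlongrightarrow> h' (c t0) * c' m) (at t0)"
      using lim by (intro tendsto_mult)
    moreover have "\<forall>\<^sub>F t in at t0. h' ((z m t)(m := \<xi> t)) * ((c t m - c t0 m) / (t - t0))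
        = ((h (z (Suc m) t) - h (z m t)) - (h (z (Suc m) t0) - h (z m t0))) / (t - t0)"
      using ev[OF r(1)]
    proof eventually_elim
      case (elim t)
      have "z (Suc m) t0 = z m t0" by (auto simp: z_def)
      then show ?case using \<xi>[OF elim] by simp
    qed
    ultimately have "((\<lambda>t. h (z (Suc m) t) - h (z m t)) has_real_derivative h' (c t0) * c' m) (at t0)"
      unfolding has_field_derivative_iff by (rule Lim_transform_eventually)
    then have "((\<lambda>t. h (z m t) + (h (z (Suc m) t) - h (z m t))) has_real_derivative
       (\<Sum>j<m. partial_deriv j h (c t0) * c' j) + h' (c t0) * c' m) (at t0)"
      using Suc by (intro DERIV_add) auto
    then show ?case by (simp add: h'_def)
  qed
  from this[of n] show ?thesis by (simp add: zn)
qed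

section \<open>Composition, and smoothness of analytic functions\<close>

text \<open>
  By the chain rule the derivatives of a composition are sums of products of derivatives of the inner
  map with compositions of one order less.
\<close>

lemma ck_on_comp:
  assumes U: "eopen n U" and V: "eopen m V" and FV: "\<And>x. x \<in> U \<Longrightarrow> F x \<in> V"
  shows "(\<And>j. j < m \<Longrightarrow> ck_on k n U (\<lambda>x. F x j)) \<Longrightarrow> ck_on k m V h \<Longrightarrow> ck_on k n U (\<lambda>x. h (F x))"
proof (induction k arbitrary: h)
  have zero: "F x j = 0" if "x \<in> U" "j \<ge> m" for x j
    using FV[OF that(1)] eopen_subset[OF V] that(2) by (auto simp: topspace_Euclidean_space)
  have cont: "continuous_on U (\<lambda>x. h (F x))"
    if F: "\<And>j. j < m \<Longrightarrow> ck_on k n U (\<lambda>x. F x j)" and h: "ck_on k m V h" for k h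
  proof -
    have "continuous_on U F"
    proof (rule continuous_on_coordinatewise_then_product)
      fix j show "continuous_on U (\<lambda>x. F x j)"
      proof (cases "j < m")
        case True then show ?thesis using ck_on_continuous[OF U F] by blast
      next
        case False
        then show ?thesis using zero continuous_on_cong[of U U "\<lambda>x. F x j" "\<lambda>x. 0"] by simp
      qed
    qed
    then show ?thesis
      using continuous_on_compose2[OF ck_on_continuous[OF V h], of U F] FV by blast
  qed
  {
    case 0
    show ?case unfolding ck_on_0_iff[OF U] by (rule cont[OF 0])
  next
    case (Suc k)
    note Fk = Suc.prems(1)[THEN ck_on_Suc_lower[OF U]]
    have C: "continuous_on U (\<lambda>x. h (F x))" by (rule cont[OF Suc.prems])
    show ?case
    proof (rule ck_on_SucI[where g = "\<lambda>i x. \<Sum>j<m. partial_deriv j h (F x) * partial_deriv i (\<lambda>x. F x j) x"])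
      fix i assume i: "i < n"
      show "ck_on k n U (\<lambda>x. \<Sum>j<m. partial_deriv j h (F x) * partial_deriv i (\<lambda>x. F x j) x)"
      proof (rule ck_on_sum[OF U])
        fix j assume "j \<in> {..<m}"
        then have j: "j < m" by simp
        show "ck_on k n U (\<lambda>x. partial_deriv j h (F x) * partial_deriv i (\<lambda>x. F x j) x)"
          by (rule ck_on_mult[OF U Suc.IH[OF Fk ck_on_SucD(1)[OF Suc.prems(2) j]]
                ck_on_SucD(1)[OF Suc.prems(1)[OF j] i]])
      qed
      fix x assume x: "x \<in> U"
      \<comment> \<open>The curve \<open>F(x(i := t))\<close> is modified to stay in coordinate space when \<open>x(i := t)\<close> leaves \<open>U\<close>.\<close>
      define c where "c t = (\<lambda>j. if j < m then F (x(i := t)) j else 0)" for t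
      have cc: "c t \<in> coord_space m" for t by (auto simp: c_def topspace_Euclidean_space)
      have cF: "c t = F (x(i := t))" if "x(i := t) \<in> U" for t
        using zero[OF that] by (auto simp: c_def)
      have c0: "c (x i) = F x" using cF[of "x i"] x by simp
      have "((\<lambda>t. h (c t)) has_real_derivative
          (\<Sum>j<m. partial_deriv j h (c (x i)) * partial_deriv i (\<lambda>x. F x j) x)) (at (x i))"
      proof (rule chain_rule[OF V ck_on_le[OF V Suc.prems(2)] cc])
        show "c (x i) \<in> V" using c0 FV[OF x] by simp
        fix j assume j: "j < m"
        show "((\<lambda>t. c t j) has_real_derivative partial_deriv i (\<lambda>x. F x j) x) (at (x i))"
          using ck_on_SucD(2)[OF Suc.prems(1)[OF j] i x] j by (simp add: has_pd_def c_def)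
      qed simp
      moreover have "\<forall>\<^sub>F t in nhds (x i). h (c t) = h (F (x(i := t)))"
        using eventually_upd_in_eopen[OF U x i] by eventually_elim (simp add: cF)
      ultimately show "has_pd (\<lambda>x. h (F x)) i
          (\<Sum>j<m. partial_deriv j h (F x) * partial_deriv i (\<lambda>x. F x j) x) x"
        unfolding has_pd_def using DERIV_cong_ev[OF refl _ refl] c0 by metis
    qed (rule U C)+
  }
qed

text \<open>
  The mean value estimate \<open>b\<^sup>e - a\<^sup>e \<ge> (b - a) e a\<^bsup>e-1\<^esup>\<close>: enlarging the radius of convergence slightly
  absorbs the factor \<open>e\<close> produced by differentiation.
\<close>

lemma power_derivative_bound:
  fixes a b :: real
  assumes "0 \<le> a" "a < b"
  shows "real e * a ^ (e - 1) \<le> b ^ e / (b - a)"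
proof -
  have "real e * a ^ (e - 1) * (b - a) \<le> b ^ e"
  proof (induction e)
    case (Suc e)
    have "real (Suc e) * a ^ e * (b - a) = a * (real e * a ^ (e - 1) * (b - a)) + a ^ e * (b - a)"
      by (cases e) (auto simp: algebra_simps)
    also have "\<dots> \<le> a * b ^ e + b ^ e * (b - a)"
      using Suc assms by (intro add_mono mult_left_mono mult_right_mono power_mono) auto
    finally show ?case by (simp add: algebra_simps)
  qed simp
  then show ?thesis using assms by (simp add: field_simps)
qed

text \<open>
  Termwise differentiation with respect to one variable. A multiple power series, enumerated in any
  way and with all other variables frozen, is a series of multiples of powers of that variable, and its
  formal derivative converges uniformly on smaller intervals.
\<close>

lemma has_sum_power_derivative:
  fixes C :: "'a \<Rightarrow> real" and e :: "'a \<Rightarrow> nat"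
  assumes cA: "countable A" and f: "\<And>s. \<bar>s\<bar> < r \<Longrightarrow> ((\<lambda>a. C a * s ^ e a) has_sum f s) A" and s0: "\<bar>s0\<bar> < r"
  obtains D where "((\<lambda>a. C a * (real (e a) * s0 ^ (e a - 1))) has_sum D) A" "(f has_real_derivative D) (at s0)"
proof -
  obtain s1 where s1: "\<bar>s0\<bar> < s1" "s1 < r" using dense[OF s0] by blast
  obtain s2 where s2: "s1 < s2" "s2 < r" using dense[OF s1(2)] by blast
  \<comment> \<open>A summable majorant of the formal derivative for \<open>\<bar>s\<bar> \<le> s1\<close>, from the series at \<open>s2\<close>.\<close>
  define M where "M a = \<bar>C a\<bar> * (s2 ^ e a / (s2 - s1))" for a
  have dom: "\<bar>C a * (real (e a) * s ^ (e a - 1))\<bar> \<le> M a" if "\<bar>s\<bar> \<le> s1" for a s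
  proof -
    have "\<bar>real (e a) * s ^ (e a - 1)\<bar> \<le> real (e a) * s1 ^ (e a - 1)"
      using that by (auto simp: abs_mult power_abs intro!: mult_left_mono power_mono)
    also have "\<dots> \<le> s2 ^ e a / (s2 - s1)" by (rule power_derivative_bound) (use s1 s2 in auto)
    finally show ?thesis unfolding M_def abs_mult[of "C a"] by (rule mult_left_mono) simp
  qed
  have "(\<lambda>a. C a * s2 ^ e a) summable_on A"
    using f[of s2] s1 s2 by (auto simp: summable_on_def)
  then have "(\<lambda>a. norm (C a * s2 ^ e a)) summable_on A"
    by (rule summable_on_iff_abs_summable_on_real[THEN iffD1])
  then have "(\<lambda>a. norm (C a * s2 ^ e a) * inverse (s2 - s1)) summable_on A" by (rule summable_on_cmult_left)
  moreover have "(\<lambda>a. norm (C a * s2 ^ e a) * inverse (s2 - s1)) = M"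
    using s1 s2 by (auto simp: M_def abs_mult power_abs field_simps)
  ultimately have M: "M summable_on A" by simp
  have dsum: "(\<lambda>a. norm (C a * (real (e a) * s ^ (e a - 1)))) summable_on A" if "\<bar>s\<bar> \<le> s1" for s
    by (rule summable_on_comparison_test[OF M]) (use dom[OF that] in simp_all)
  have dsum': "((\<lambda>a. C a * (real (e a) * s0 ^ (e a - 1))) has_sum
      (\<Sum>\<^sub>\<infinity>a\<in>A. C a * (real (e a) * s0 ^ (e a - 1)))) A"
    by (rule has_sum_infsum[OF iffD2[OF summable_on_iff_abs_summable_on_real dsum]]) (use s1 in simp)
  have "(f has_real_derivative (\<Sum>\<^sub>\<infinity>a\<in>A. C a * (real (e a) * s0 ^ (e a - 1)))) (at s0)"
  proof (cases "finite A")
    case True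
    have d: "((\<lambda>s. \<Sum>a\<in>A. C a * s ^ e a) has_real_derivative
        (\<Sum>a\<in>A. C a * (real (e a) * s0 ^ (e a - 1)))) (at s0)"
      by (auto intro!: derivative_eq_intros sum.cong)
    show ?thesis unfolding infsum_finite[OF True]
    proof (rule has_field_derivative_transform_within_open[OF d])
      show "open {-r<..<r}" "s0 \<in> {-r<..<r}" using s0 by auto
      fix s assume "s \<in> {-r<..<r}"
      then have "((\<lambda>a. C a * s ^ e a) has_sum f s) A" by (intro f) auto
      then show "(\<Sum>a\<in>A. C a * s ^ e a) = f s" using True by (simp add: has_sum_finite_iff)
    qed
  next
    case False
    define \<phi> where "\<phi> = from_nat_into A"
    have bij: "bij_betw \<phi> UNIV A" unfolding \<phi>_def by (rule bij_betw_from_nat_into[OF cA False])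
    have sums: "(\<lambda>k. C (\<phi> k) * s ^ e (\<phi> k)) sums f s" if "\<bar>s\<bar> < r" for s
      by (rule has_sum_imp_sums) (use f[OF that] has_sum_reindex_bij_betw[OF bij, of "\<lambda>a. C a * s ^ e a"] in simp)
    have "(\<lambda>k. M (\<phi> k)) summable_on UNIV"
      using M summable_on_reindex_bij_betw[OF bij, of M] by blast
    then have Ms: "summable (\<lambda>k. M (\<phi> k))" by (rule summable_on_imp_summable)
    let ?g = "\<lambda>k s. C (\<phi> k) * s ^ e (\<phi> k)"
    let ?g' = "\<lambda>k s. C (\<phi> k) * (real (e (\<phi> k)) * s ^ (e (\<phi> k) - 1))"
    have "((\<lambda>s. \<Sum>k. ?g k s) has_field_derivative (\<Sum>k. ?g' k s0)) (at s0)"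
    proof (rule has_field_derivative_series'(2)[of "{-s1<..<s1}" _ _ s0])
      show "uniformly_convergent_on {-s1<..<s1} (\<lambda>m x. \<Sum>k<m. ?g' k x)"
        by (rule Weierstrass_m_test'[OF _ Ms]) (use dom in \<open>auto simp: abs_less_iff\<close>)
      show "summable (\<lambda>k. ?g k s0)" using sums[OF s0] by (rule sums_summable)
      show "(?g k has_field_derivative ?g' k s) (at s within {-s1<..<s1})" for k s
        by (auto intro!: derivative_eq_intros)
    qed (use s1 in \<open>auto simp: interior_open\<close>)
    moreover have "(\<Sum>k. ?g' k s0) = (\<Sum>\<^sub>\<infinity>a\<in>A. C a * (real (e a) * s0 ^ (e a - 1)))"
    proof -
      have "(\<lambda>k. ?g' k s0) sums (\<Sum>\<^sub>\<infinity>a\<in>A. C a * (real (e a) * s0 ^ (e a - 1)))"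
        by (rule has_sum_imp_sums)
          (use dsum' has_sum_reindex_bij_betw[OF bij, of "\<lambda>a. C a * (real (e a) * s0 ^ (e a - 1))"] in simp)
      then show ?thesis by (rule sums_unique[symmetric])
    qed
    ultimately have d: "((\<lambda>s. \<Sum>k. ?g k s) has_field_derivative
        (\<Sum>\<^sub>\<infinity>a\<in>A. C a * (real (e a) * s0 ^ (e a - 1)))) (at s0)" by simp
    show ?thesis
    proof (rule has_field_derivative_transform_within_open[OF d])
      show "open {-r<..<r}" "s0 \<in> {-r<..<r}" using s0 by auto
      fix s assume "s \<in> {-r<..<r}"
      then show "(\<Sum>k. ?g k s) = f s" using sums_unique[OF sums[of s]] by auto
    qed
  qed
  then show ?thesis using that dsum' by blast
qed

lemma countable_multi_indices: "countable (multi_indices n)"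
proof (rule countable_subset)
  show "multi_indices n \<subseteq> range (\<lambda>xs i. if i < length xs then xs ! i else 0)"
  proof
    fix \<alpha> assume "\<alpha> \<in> multi_indices n"
    then have "\<alpha> = (\<lambda>i. if i < length (map \<alpha> [0..<n]) then map \<alpha> [0..<n] ! i else 0)"
      by (auto simp: multi_indices_def)
    then show "\<alpha> \<in> range (\<lambda>xs i. if i < length xs then xs ! i else 0)" by blast
  qed
qed auto

text \<open>
  Power series expansions on a whole box, so that their derivatives have expansions on the same box.
\<close>

definition has_expansion :: "nat \<Rightarrow> ((nat \<Rightarrow> real) \<Rightarrow> real) \<Rightarrow> (nat \<Rightarrow> real) \<Rightarrow> real \<Rightarrow> ((nat \<Rightarrow> nat) \<Rightarrow> real) \<Rightarrow> bool" where
  "has_expansion n f p r c \<longleftrightarrow> (\<forall>x\<in>open_box n p r.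
     ((\<lambda>\<alpha>. c \<alpha> * (\<Prod>i<n. (x i - p i) ^ \<alpha> i)) has_sum f x) (multi_indices n))"

lemma real_analytic_iff_expansion:
  assumes U: "eopen n U"
  shows "real_analytic n U f \<longleftrightarrow> (\<forall>p\<in>U. \<exists>c r. r > 0 \<and> open_box n p r \<subseteq> U \<and> has_expansion n f p r c)"
    (is "?L \<longleftrightarrow> ?R")
proof
  assume L: ?L
  show ?R
  proof
    fix p assume p: "p \<in> U"
    obtain c r where cr: "r > 0" "\<And>x. x \<in> U \<Longrightarrow> \<forall>i<n. \<bar>x i - p i\<bar> < r \<Longrightarrow>
           ((\<lambda>\<alpha>. c \<alpha> * (\<Prod>i<n. (x i - p i) ^ \<alpha> i)) has_sum f x) (multi_indices n)"
      using L p unfolding real_analytic_def by meson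
    obtain s where s: "s > 0" "open_box n p s \<subseteq> U" using eopen_contains_box[OF U p] .
    have "has_expansion n f p (min r s) c"
      unfolding has_expansion_def
    proof
      fix x assume x: "x \<in> open_box n p (min r s)"
      have "x \<in> U" by (rule subsetD[OF s(2)]) (use x in \<open>auto simp: open_box_def\<close>)
      then show "((\<lambda>\<alpha>. c \<alpha> * (\<Prod>i<n. (x i - p i) ^ \<alpha> i)) has_sum f x) (multi_indices n)"
        by (rule cr(2)) (use x in \<open>auto simp: open_box_def\<close>)
    qed
    moreover have "open_box n p (min r s) \<subseteq> U" using s(2) by (auto simp: open_box_def)
    ultimately show "\<exists>c r. r > 0 \<and> open_box n p r \<subseteq> U \<and> has_expansion n f p r c"
      using cr(1) s(1) by (intro exI[of _ c] exI[of _ "min r s"]) auto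
  qed
next
  assume R: ?R
  show ?L unfolding real_analytic_def
  proof
    fix p assume "p \<in> U"
    then obtain c r where cr: "r > 0" "has_expansion n f p r c" using R by blast
    then show "\<exists>c r. r > 0 \<and> (\<forall>x\<in>U. (\<forall>i<n. \<bar>x i - p i\<bar> < r) \<longrightarrow>
           ((\<lambda>\<alpha>. c \<alpha> * (\<Prod>i<n. (x i - p i) ^ \<alpha> i)) has_sum f x) (multi_indices n))"
      using eopen_subset[OF U] unfolding has_expansion_def open_box_def by blast
  qed
qed

lemma has_expansion_continuous:
  assumes e: "has_expansion n f p r c" and p: "p \<in> coord_space n" and s: "0 < s" "s < r"
  shows "continuous_on (open_box n p s) f"
proof -
  let ?t = "\<lambda>\<alpha> x. c \<alpha> * (\<Prod>i<n. (x i - p i) ^ \<alpha> i)"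
  \<comment> \<open>The corner of the smaller box, where every monomial is largest in absolute value.\<close>
  define q where "q = (\<lambda>i. if i < n then p i + s else 0)"
  have q: "q \<in> open_box n p r" using s by (auto simp: q_def open_box_def topspace_Euclidean_space)
  have "(\<lambda>\<alpha>. ?t \<alpha> q) summable_on multi_indices n"
    using e q unfolding has_expansion_def summable_on_def by blast
  then have M: "(\<lambda>\<alpha>. norm (?t \<alpha> q)) summable_on multi_indices n"
    by (rule summable_on_iff_abs_summable_on_real[THEN iffD1])
  have "uniform_limit (open_box n p s) (\<lambda>X x. \<Sum>\<alpha>\<in>X. ?t \<alpha> x) f (finite_subsets_at_top (multi_indices n))"
  proof (rule Weierstrass_m_test_general'[OF _ _ M])
    fix \<alpha> x assume x: "x \<in> open_box n p s"
    have "\<bar>\<Prod>i<n. (x i - p i) ^ \<alpha> i\<bar> \<le> (\<Prod>i<n. s ^ \<alpha> i)"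
      unfolding abs_prod power_abs
      by (rule prod_mono) (use x in \<open>simp add: open_box_def power_mono order_less_imp_le\<close>)
    also have "\<dots> = \<bar>\<Prod>i<n. (q i - p i) ^ \<alpha> i\<bar>"
      using s by (simp add: q_def abs_prod power_abs)
    finally show "norm (?t \<alpha> x) \<le> norm (?t \<alpha> q)"
      by (simp add: abs_mult mult_left_mono)
  next
    fix x assume "x \<in> open_box n p s"
    then have "x \<in> open_box n p r" using s by (auto simp: open_box_def intro: less_trans)
    then show "((\<lambda>\<alpha>. ?t \<alpha> x) has_sum f x) (multi_indices n)" using e by (auto simp: has_expansion_def)
  qed
  then show ?thesis
    by (rule uniform_limit_theorem[rotated])
      (auto intro!: always_eventually continuous_intros continuous_on_subset[OF continuous_on_product_coordinates])
qed

text \<open>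
  The derivative of \<open>\<Sum>c\<^sub>\<alpha> x\<^sup>\<alpha>\<close> is expanded with the coefficients \<open>(\<alpha>\<^sub>i + 1) c\<^bsub>\<alpha> + e\<^sub>i\<^esub>\<close>; the reindexing
  \<open>\<alpha> \<mapsto> \<alpha> + e\<^sub>i\<close> misses exactly the terms killed by differentiation.
\<close>

lemma has_expansion_partial_deriv:
  assumes e: "has_expansion n f p r c" and p: "p \<in> coord_space n" and i: "i < n"
  shows "\<exists>c' f'. has_expansion n f' p r c' \<and> (\<forall>x\<in>open_box n p r. has_pd f i (f' x) x)"
proof -
  define c' where "c' \<alpha> = real (Suc (\<alpha> i)) * c (\<alpha>(i := Suc (\<alpha> i)))" for \<alpha>
  let ?A = "multi_indices n"
  have "\<exists>D. ((\<lambda>\<alpha>. c' \<alpha> * (\<Prod>j<n. (x j - p j) ^ \<alpha> j)) has_sum D) ?A \<and> has_pd f i D x"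
    if x: "x \<in> open_box n p r" for x
  proof -
    define C where "C \<alpha> = c \<alpha> * (\<Prod>j\<in>{..<n} - {i}. (x j - p j) ^ \<alpha> j)" for \<alpha>
    have split: "(\<Prod>j<n. (y j - p j) ^ \<alpha> j) = (y i - p i) ^ \<alpha> i * (\<Prod>j\<in>{..<n} - {i}. (y j - p j) ^ \<alpha> j)" for y \<alpha>
      using i by (subst prod.remove[of _ i]) auto
    have "((\<lambda>\<alpha>. C \<alpha> * s ^ \<alpha> i) has_sum f (x(i := p i + s))) ?A" if "\<bar>s\<bar> < r" for s
    proof -
      have b: "x(i := p i + s) \<in> open_box n p r"
        using x that i by (auto simp: open_box_def)
      have eq: "c \<alpha> * (\<Prod>j<n. ((x(i := p i + s)) j - p j) ^ \<alpha> j) = C \<alpha> * s ^ \<alpha> i" for \<alpha>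
        unfolding split C_def by simp
      show ?thesis using bspec[OF e[unfolded has_expansion_def] b] unfolding eq .
    qed
    moreover have "\<bar>x i - p i\<bar> < r" using x i by (auto simp: open_box_def)
    ultimately obtain D where D: "((\<lambda>\<alpha>. C \<alpha> * (real (\<alpha> i) * (x i - p i) ^ (\<alpha> i - 1))) has_sum D) ?A"
        "((\<lambda>s. f (x(i := p i + s))) has_real_derivative D) (at (x i - p i))"
      by (rule has_sum_power_derivative[OF countable_multi_indices])
    have "((\<lambda>t. f (x(i := t))) has_real_derivative D) (at (x i))"
      using DERIV_shift[of "\<lambda>s. f (x(i := p i + s))" D "x i" "- p i"] D(2) by simp
    moreover have "((\<lambda>\<alpha>. c' \<alpha> * (\<Prod>j<n. (x j - p j) ^ \<alpha> j)) has_sum D) ?A"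
    proof -
      let ?h = "\<lambda>\<alpha>::nat \<Rightarrow> nat. \<alpha>(i := Suc (\<alpha> i))"
      let ?g = "\<lambda>\<alpha>. C \<alpha> * (real (\<alpha> i) * (x i - p i) ^ (\<alpha> i - 1))"
      have img: "?h ` ?A = {\<alpha>\<in>?A. \<alpha> i \<noteq> 0}"
      proof (intro equalityI subsetI)
        fix \<alpha> assume a: "\<alpha> \<in> {\<alpha>\<in>?A. \<alpha> i \<noteq> 0}"
        then have "\<alpha> = ?h (\<alpha>(i := \<alpha> i - 1))" "\<alpha>(i := \<alpha> i - 1) \<in> ?A" using i by (auto simp: multi_indices_def)
        then show "\<alpha> \<in> ?h ` ?A" by blast
      qed (use i in \<open>auto simp: multi_indices_def\<close>)
      have inj: "inj_on ?h ?A"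
      proof (rule inj_onI)
        fix \<alpha> \<beta> assume eq: "?h \<alpha> = ?h \<beta>"
        show "\<alpha> = \<beta>"
        proof
          fix j show "\<alpha> j = \<beta> j" using fun_cong[OF eq, of j] by (cases "j = i") auto
        qed
      qed
      have "(?g has_sum D) (?h ` ?A)"
        using D(1) has_sum_cong_neutral[of "?h ` ?A" ?A ?g ?g D] unfolding img by auto
      then have "(?g \<circ> ?h has_sum D) ?A" using has_sum_reindex[OF inj] by blast
      moreover have "(?g \<circ> ?h) \<alpha> = c' \<alpha> * (\<Prod>j<n. (x j - p j) ^ \<alpha> j)" for \<alpha>
        unfolding split C_def c'_def by simp
      ultimately show ?thesis by (simp add: o_def)
    qed
    ultimately show ?thesis unfolding has_pd_def by blast
  qed
  then obtain f' where "\<And>x. x \<in> open_box n p r \<Longrightarrow>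
      ((\<lambda>\<alpha>. c' \<alpha> * (\<Prod>j<n. (x j - p j) ^ \<alpha> j)) has_sum f' x) ?A \<and> has_pd f i (f' x) x" by metis
  then show ?thesis unfolding has_expansion_def by blast
qed

lemma open_box_mono: "r \<le> s \<Longrightarrow> open_box n p r \<subseteq> open_box n p s"
  by (force simp: open_box_def)

lemma open_box_center: "p \<in> coord_space n \<Longrightarrow> r > 0 \<Longrightarrow> p \<in> open_box n p r"
  by (simp add: open_box_def)

text \<open>
  Analytic functions are continuous, and their partial derivatives are again analytic.
\<close>

lemma real_analytic_imp_ck_on:
  assumes U: "eopen n U" shows "real_analytic n U f \<Longrightarrow> ck_on k n U f"
proof (induction k arbitrary: f)
  have cont: "continuous_on U f" if an: "real_analytic n U f" for f
  proof (rule continuous_on_local[OF U])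
    fix x assume x: "x \<in> U"
    then obtain c r where cr: "r > 0" "open_box n x r \<subseteq> U" "has_expansion n f x r c"
      using an unfolding real_analytic_iff_expansion[OF U] by blast
    have x': "x \<in> coord_space n" using x eopen_subset[OF U] by blast
    have "open_box n x (r/2) \<subseteq> U" using open_box_mono[of "r/2" r n x] cr by auto
    moreover have "x \<in> open_box n x (r/2)" using cr x' by (intro open_box_center) auto
    moreover have "continuous_on (open_box n x (r/2)) f"
      by (rule has_expansion_continuous[OF cr(3) x']) (use cr in auto)
    ultimately show "\<exists>V. eopen n V \<and> x \<in> V \<and> V \<subseteq> U \<and> continuous_on V f"
      using eopen_open_box by blast
  qed
  {
    case 0
    show ?case unfolding ck_on_0_iff[OF U] by (rule cont[OF 0])
  next
    case (Suc k)
    have d: "real_analytic n U (partial_deriv i f) \<and> (\<forall>x\<in>U. has_pd f i (partial_deriv i f x) x)" if i: "i < n" for i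
    proof -
      have "\<exists>c' r. r > 0 \<and> open_box n p r \<subseteq> U \<and> has_expansion n (partial_deriv i f) p r c' \<and>
         has_pd f i (partial_deriv i f p) p" if p: "p \<in> U" for p
      proof -
        obtain c r where cr: "r > 0" "open_box n p r \<subseteq> U" "has_expansion n f p r c"
          using p Suc.prems unfolding real_analytic_iff_expansion[OF U] by blast
        have p': "p \<in> coord_space n" using p eopen_subset[OF U] by blast
        obtain c' f' where c': "has_expansion n f' p r c'" "\<And>x. x \<in> open_box n p r \<Longrightarrow> has_pd f i (f' x) x"
          using has_expansion_partial_deriv[OF cr(3) p' i] by blast
        have eq: "partial_deriv i f x = f' x" if "x \<in> open_box n p r" for x
          using has_pd_partial_deriv[OF c'(2)[OF that]] .
        have "p \<in> open_box n p r" using p' cr by (auto simp: open_box_def)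
        then have "has_pd f i (partial_deriv i f p) p" using eq c'(2) by simp
        moreover have "has_expansion n (partial_deriv i f) p r c'"
          using c'(1) eq unfolding has_expansion_def by simp
        ultimately show ?thesis using cr by blast
      qed
      then show ?thesis unfolding real_analytic_iff_expansion[OF U] by meson
    qed
    show ?case
      by (rule ck_on_SucI[where g = "\<lambda>i. partial_deriv i f"]) (use U cont[OF Suc.prems] d Suc.IH in blast)+
  }
qed

section \<open>Cutoff functions and Hadamard's lemma\<close>

text \<open>
  The functions \<open>t\<^sup>-\<^sup>j exp (-1/t)\<close>, extended by zero to \<open>t \<le> 0\<close>. Their span is closed under
  differentiation: the derivative of one of them is a combination of two others.
\<close>

definition flat :: "nat \<Rightarrow> real \<Rightarrow> real" where
  "flat j t = (if t > 0 then inverse t ^ j / exp (inverse t) else 0)"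

lemma flat_tendsto_0: "(flat j \<longlongrightarrow> 0) (at 0)"
proof (rule filterlim_split_at)
  have "\<forall>\<^sub>F t in at_left (0::real). 0 = flat j t"
    by (auto simp: eventually_at_filter flat_def)
  then show "(flat j \<longlongrightarrow> 0) (at_left 0)" by (rule Lim_transform_eventually[OF tendsto_const])
  have "((\<lambda>t. inverse t ^ j / exp (inverse t)) \<longlongrightarrow> 0) (at_right (0::real))"
    by (rule filterlim_compose[OF tendsto_power_div_exp_0 filterlim_inverse_at_top_right])
  moreover have "\<forall>\<^sub>F t in at_right (0::real). inverse t ^ j / exp (inverse t) = flat j t"
    by (auto simp: eventually_at_filter flat_def)
  ultimately show "(flat j \<longlongrightarrow> 0) (at_right 0)" by (rule Lim_transform_eventually)
qed

lemma flat_derivative: "(flat j has_real_derivative flat (j + 2) t + (- real j) * flat (j + 1) t) (at t)"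
proof (cases t "0::real" rule: linorder_cases)
  case less
  have "((\<lambda>t. 0) has_real_derivative 0) (at t)" by simp
  then have "(flat j has_real_derivative 0) (at t)"
    by (rule has_field_derivative_transform_within_open[of _ _ _ "{..<0}"]) (use less in \<open>auto simp: flat_def\<close>)
  then show ?thesis using less by (simp add: flat_def)
next
  case equal
  have "((\<lambda>h. (flat j h - flat j 0) / (h - 0)) \<longlongrightarrow> 0) (at 0)"
  proof (rule Lim_transform_eventually[OF flat_tendsto_0[of "Suc j"]])
    show "\<forall>\<^sub>F h in at 0. flat (Suc j) h = (flat j h - flat j 0) / (h - 0)"
      by (auto simp: eventually_at_filter flat_def field_simps)
  qed
  then show ?thesis unfolding equal has_field_derivative_iff by (simp add: flat_def)
next
  case greater
  define a where "a = inverse t"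
  have "(inverse has_real_derivative - (a * a)) (at t)"
    using DERIV_inverse[of t] greater by (simp add: a_def)
  then have "((\<lambda>t. inverse t ^ j * exp (- inverse t)) has_real_derivative
      real j * (- (a * a) * a ^ (j - Suc 0)) * exp (- a) + exp (- a) * - (- (a * a)) * a ^ j) (at t)"
    using DERIV_mult[OF DERIV_power[of inverse "- (a * a)" t UNIV j]
        DERIV_chain2[OF DERIV_exp DERIV_minus[of inverse "- (a * a)" t UNIV]]] by (simp add: a_def)
  also have "real j * (- (a * a) * a ^ (j - Suc 0)) * exp (- a) + exp (- a) * - (- (a * a)) * a ^ j
      = flat (j + 2) t + (- real j) * flat (j + 1) t"
    using greater by (cases j) (simp_all add: flat_def a_def[symmetric] exp_minus divide_inverse algebra_simps)
  finally show ?thesis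
    by (rule has_field_derivative_transform_within_open[of _ _ _ "{0<..}"])
      (use greater in \<open>auto simp: flat_def exp_minus divide_inverse\<close>)
qed

lemma ck_real_flat: "ck_real k (flat j)"
proof (induction k arbitrary: j)
  case 0
  show ?case using DERIV_isCont[OF flat_derivative] by (simp add: continuous_on_eq_continuous_at)
next
  case (Suc k)
  show ?case
    by (rule ck_real_SucI[OF flat_derivative ck_real_add[OF Suc ck_real_mult[OF ck_real_const Suc]]])
qed

text \<open>
  Equal to \<open>1\<close> up to \<open>1/2\<close> and to \<open>0\<close> from \<open>1\<close> on.
\<close>

definition cutoff :: "real \<Rightarrow> real" where
  "cutoff t = flat 0 (1 + (-1) * t) * inverse (flat 0 (1 + (-1) * t) + flat 0 (t + (- 1/2)))"

lemma ck_real_cutoff: "ck_real k cutoff"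
proof -
  have 1: "ck_real k (\<lambda>t. flat 0 (1 + (-1) * t))"
    by (rule ck_real_comp[OF ck_real_flat ck_real_add[OF ck_real_const ck_real_mult[OF ck_real_const ck_real_id]]])
  have 2: "ck_real k (\<lambda>t. flat 0 (t + (- 1/2)))"
    by (rule ck_real_comp[OF ck_real_flat ck_real_add[OF ck_real_id ck_real_const]])
  have "flat 0 (1 + (-1) * t) + flat 0 (t + (- 1/2)) \<noteq> 0" for t
  proof -
    have "flat 0 s \<ge> 0" "s > 0 \<Longrightarrow> flat 0 s > 0" for s by (auto simp: flat_def)
    moreover have "1 + (-1) * t > 0 \<or> t + (- 1/2) > 0" by auto
    ultimately show ?thesis by (metis add_nonneg_pos add_pos_nonneg less_irrefl)
  qed
  then show ?thesis
    unfolding cutoff_def[abs_def] by (rule ck_real_mult[OF 1 ck_real_inverse[OF _ ck_real_add[OF 1 2]]])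
qed

lemma cutoff_eq_1: "t \<le> 1/2 \<Longrightarrow> cutoff t = 1"
  by (auto simp: cutoff_def flat_def)

lemma cutoff_eq_0: "t \<ge> 1 \<Longrightarrow> cutoff t = 0"
  by (auto simp: cutoff_def flat_def)

definition closed_box :: "nat \<Rightarrow> (nat \<Rightarrow> real) \<Rightarrow> real \<Rightarrow> (nat \<Rightarrow> real) set" where
  "closed_box n p r = {x \<in> coord_space n. \<forall>i<n. \<bar>x i - p i\<bar> \<le> r}"

lemma compact_closed_box: "compact (closed_box n p r)"
proof -
  let ?S = "\<lambda>i. if i < n then {p i - r..p i + r} else {0}"
  have "compactin (product_topology (\<lambda>i. euclidean) UNIV) (Pi\<^sub>E UNIV ?S)"
    unfolding compactin_PiE by simp
  moreover have "closed_box n p r = Pi\<^sub>E UNIV ?S"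
    by (auto simp: closed_box_def topspace_Euclidean_space PiE_iff abs_diff_le_iff split: if_splits)
  ultimately show ?thesis by (simp add: euclidean_product_topology)
qed

text \<open>
  The integral remainder of the first-order Taylor formula. The exponent \<open>m\<close> makes this family closed
  under partial derivatives: by \<open>\<partial>\<^sub>i\<close> the function \<open>v\<close> becomes \<open>\<partial>\<^sub>i v\<close> and \<open>m\<close> grows by one.
\<close>

definition segment_mean :: "(nat \<Rightarrow> real) \<Rightarrow> nat \<Rightarrow> ((nat \<Rightarrow> real) \<Rightarrow> real) \<Rightarrow> (nat \<Rightarrow> real) \<Rightarrow> real" where
  "segment_mean p m v x = integral (cbox 0 1) (\<lambda>s. s ^ m * v (\<lambda>j. p j + s * (x j - p j)))"

lemma segment_in_box:
  assumes "p \<in> coord_space n" "x \<in> open_box n p r" "s \<in> cbox 0 1"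
  shows "(\<lambda>j. p j + s * (x j - p j)) \<in> open_box n p r"
proof -
  have "\<bar>s * (x i - p i)\<bar> < r" if "i < n" for i
  proof -
    have "\<bar>s * (x i - p i)\<bar> \<le> 1 * \<bar>x i - p i\<bar>"
      unfolding abs_mult using assms(3) by (intro mult_right_mono) auto
    also have "\<dots> < r" using assms(2) that by (auto simp: open_box_def)
    finally show ?thesis .
  qed
  then show ?thesis using assms(1,2) by (auto simp: open_box_def topspace_Euclidean_space)
qed

lemma continuous_on_segment:
  assumes p: "p \<in> coord_space n" and v: "continuous_on (open_box n p r) v"
  shows "continuous_on (open_box n p r \<times> cbox 0 1) (\<lambda>(x, s). s ^ m * v (\<lambda>j. p j + s * (x j - p j)))"
proof -
  have "continuous_on S (\<lambda>z. \<lambda>j. p j + snd z * (fst z j - p j))" for S :: "((nat \<Rightarrow> real) \<times> real) set"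
  proof (rule continuous_on_coordinatewise_then_product)
    fix j
    have "continuous_on S (\<lambda>z. fst z j)"
      by (rule continuous_on_compose2[OF continuous_on_product_coordinates continuous_on_fst])
        (auto intro: continuous_intros)
    then show "continuous_on S (\<lambda>z. p j + snd z * (fst z j - p j))"
      by (intro continuous_intros)
  qed
  then have "continuous_on (open_box n p r \<times> cbox 0 1) (\<lambda>z. v (\<lambda>j. p j + snd z * (fst z j - p j)))"
    by (rule continuous_on_compose2[OF v]) (use segment_in_box[OF p] in auto)
  then show ?thesis unfolding case_prod_beta by (intro continuous_intros)
qed

lemma ck_on_segment_mean:
  assumes p: "p \<in> coord_space n"
  shows "ck_on k n (open_box n p r) v \<Longrightarrow> ck_on k n (open_box n p r) (segment_mean p m v)"
proof (induction k arbitrary: v m)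
  let ?B = "open_box n p r"
  note B = eopen_open_box[of n p r]
  have cont: "continuous_on ?B (segment_mean p m v)" if "continuous_on ?B v" for v m
    unfolding segment_mean_def[abs_def]
    by (rule integral_continuous_on_param[OF continuous_on_segment[OF p that]])
  {
    case 0
    then show ?case using cont unfolding ck_on_0_iff[OF B] by blast
  next
    case (Suc k)
    have vc: "continuous_on ?B v" by (rule ck_on_continuous[OF B Suc.prems])
    show ?case
    proof (rule ck_on_SucI[where g = "\<lambda>i. segment_mean p (Suc m) (partial_deriv i v)"])
      show "continuous_on ?B (segment_mean p m v)" by (rule cont[OF vc])
      fix i assume i: "i < n"
      note d = ck_on_SucD[OF Suc.prems i]
      show "ck_on k n ?B (segment_mean p (Suc m) (partial_deriv i v))" by (rule Suc.IH[OF d(1)])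
      fix x assume x: "x \<in> ?B"
      define T where "T = ball (p i) r"
      have T: "x i \<in> T" "open T" "convex T" using x i by (auto simp: T_def open_box_def dist_real_def abs_minus_commute)
      have xT: "x(i := t) \<in> ?B" if "t \<in> T" for t
        using x i that by (auto simp: T_def open_box_def dist_real_def abs_minus_commute)
      have upd: "(\<lambda>j. p j + s * ((x(i := t)) j - p j)) = (\<lambda>j. p j + s * (x j - p j))(i := p i + s * (t - p i))" for s t
        by auto
      have "((\<lambda>t. integral (cbox 0 1) (\<lambda>s. s ^ m * v (\<lambda>j. p j + s * ((x(i := t)) j - p j))))
          has_field_derivative integral (cbox 0 1)
            (\<lambda>s. s ^ Suc m * partial_deriv i v (\<lambda>j. p j + s * ((x(i := x i)) j - p j)))) (at (x i) within T)"
      proof (rule leibniz_rule_field_derivative[OF _ _ _ T(1,3)])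
        fix t s assume t: "t \<in> T" and s: "s \<in> cbox 0 (1::real)"
        let ?y = "\<lambda>j. p j + s * ((x(i := t)) j - p j)"
        have "((\<lambda>u. v (?y(i := u))) has_real_derivative partial_deriv i v ?y) (at (p i + s * (t - p i)))"
          using d(2)[OF segment_in_box[OF p xT[OF t] s]] by (simp only: has_pd_def fun_upd_same)
        moreover have "((\<lambda>t. p i + s * (t - p i)) has_real_derivative s) (at t)"
          by (auto intro!: derivative_eq_intros)
        ultimately have "((\<lambda>t. v (?y(i := p i + s * (t - p i)))) has_real_derivative partial_deriv i v ?y * s) (at t)"
          by (rule DERIV_chain2)
        moreover have "?y(i := p i + s * (t' - p i)) = (\<lambda>j. p j + s * ((x(i := t')) j - p j))" for t' by auto
        ultimately have "((\<lambda>t. v (\<lambda>j. p j + s * ((x(i := t)) j - p j))) has_real_derivative partial_deriv i v ?y * s) (at t)"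
          by simp
        then have "((\<lambda>t. s ^ m * v (\<lambda>j. p j + s * ((x(i := t)) j - p j))) has_real_derivative
            s ^ m * (partial_deriv i v ?y * s)) (at t)" by (rule DERIV_cmult)
        moreover have "s ^ m * (partial_deriv i v ?y * s) = s ^ Suc m * partial_deriv i v ?y" by simp
        ultimately show "((\<lambda>t. s ^ m * v (\<lambda>j. p j + s * ((x(i := t)) j - p j))) has_field_derivative
            s ^ Suc m * partial_deriv i v ?y) (at t within T)"
          by (simp only: has_field_derivative_at_within)
      next
        fix t assume t: "t \<in> T"
        have "continuous_on (cbox 0 1) (\<lambda>s. (\<lambda>(x, s). s ^ m * v (\<lambda>j. p j + s * (x j - p j))) (x(i := t), s))"
          by (rule continuous_on_compose2[OF continuous_on_segment[OF p vc]])
            (use xT[OF t] in \<open>auto intro: continuous_intros\<close>)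
        then have "continuous_on (cbox 0 1) (\<lambda>s. s ^ m * v (\<lambda>j. p j + s * ((x(i := t)) j - p j)))"
          by (simp only: prod.case)
        then show "(\<lambda>s. s ^ m * v (\<lambda>j. p j + s * ((x(i := t)) j - p j))) integrable_on cbox 0 1"
          by (rule integrable_continuous)
      next
        have "continuous_on (T \<times> cbox 0 1) (\<lambda>z. x(i := fst z))"
          by (rule continuous_on_compose2[OF continuous_on_upd[of UNIV] continuous_on_fst[OF continuous_on_id]]) auto
        then have "continuous_on (T \<times> cbox 0 1) (\<lambda>z::real \<times> real. (x(i := fst z), snd z))"
          by (intro continuous_on_Pair continuous_on_snd continuous_on_id)
        then have "continuous_on (T \<times> cbox 0 1) (\<lambda>z. (\<lambda>(x, s). s ^ Suc m * partial_deriv i v (\<lambda>j. p j + s * (x j - p j)))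
            (x(i := fst z), snd z))"
          by (rule continuous_on_compose2[OF continuous_on_segment[OF p ck_on_continuous[OF B d(1)]]])
            (use xT in auto)
        then show "continuous_on (T \<times> cbox 0 1)
            (\<lambda>(t, s). s ^ Suc m * partial_deriv i v (\<lambda>j. p j + s * ((x(i := t)) j - p j)))"
          by (simp only: case_prod_beta' fst_conv snd_conv)
      qed
      then show "has_pd (segment_mean p m v) i (segment_mean p (Suc m) (partial_deriv i v) x) x"
        unfolding has_pd_def segment_mean_def at_within_open[OF T(1,2)] by (simp only: fun_upd_triv)
    qed (rule B)
  }
qed

text \<open>
  Integrate the derivative of \<open>u\<close> along the segment from \<open>p\<close> to \<open>x\<close>.
\<close>

lemma hadamard:
  assumes p: "p \<in> coord_space n" and r: "r > 0" and u: "smooth_in n (open_box n p r) u"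
  obtains g where "\<And>i. i < n \<Longrightarrow> smooth_in n (open_box n p r) (g i)"
    "\<And>i. i < n \<Longrightarrow> g i p = partial_deriv i u p"
    "\<And>x. x \<in> open_box n p r \<Longrightarrow> u x = u p + (\<Sum>i<n. (x i - p i) * g i x)"
proof
  let ?B = "open_box n p r" and ?g = "\<lambda>i. segment_mean p 0 (partial_deriv i u)"
  note B = eopen_open_box[of n p r]
  have du: "smooth_in n ?B (partial_deriv i u)" if "i < n" for i
    using u ck_on_SucD(1)[OF _ that] unfolding smooth_in_def by blast
  show "smooth_in n ?B (?g i)" if "i < n" for i
    using du[OF that] ck_on_segment_mean[OF p] unfolding smooth_in_def by blast
  show "?g i p = partial_deriv i u p" for i by (simp add: segment_mean_def)
  fix x assume x: "x \<in> ?B"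
  let ?c = "\<lambda>s j. p j + s * (x j - p j)"
  have cc: "?c s \<in> coord_space n" for s
    using p x by (auto simp: open_box_def topspace_Euclidean_space)
  have int: "(\<lambda>s. partial_deriv i u (?c s)) integrable_on cbox 0 1" if "i < n" for i
  proof -
    have "continuous_on (cbox 0 1) (\<lambda>s. (\<lambda>(x, s). s ^ 0 * partial_deriv i u (\<lambda>j. p j + s * (x j - p j))) (x, s))"
      by (rule continuous_on_compose2[OF continuous_on_segment[OF p ck_on_continuous[OF B]]])
        (use x du[OF that] in \<open>auto intro: continuous_intros simp: smooth_in_def\<close>)
    then show ?thesis by (intro integrable_continuous) simp
  qed
  have "((\<lambda>s. \<Sum>i<n. partial_deriv i u (?c s) * (x i - p i)) has_integral u (?c 1) - u (?c 0)) {0..1}"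
  proof (rule fundamental_theorem_of_calculus)
    fix s :: real assume s: "s \<in> {0..1}"
    have "((\<lambda>s. u (?c s)) has_real_derivative (\<Sum>i<n. partial_deriv i u (?c s) * (x i - p i))) (at s)"
      by (rule chain_rule[OF B _ cc segment_in_box[OF p x]])
        (use u s in \<open>auto simp: smooth_in_def simp del: ck_on.simps intro!: derivative_eq_intros\<close>)
    then show "((\<lambda>s. u (?c s)) has_vector_derivative (\<Sum>i<n. partial_deriv i u (?c s) * (x i - p i))) (at s within {0..1})"
      by (simp add: has_real_derivative_iff_has_vector_derivative has_vector_derivative_at_within)
  qed simp
  moreover have "((\<lambda>s. \<Sum>i<n. partial_deriv i u (?c s) * (x i - p i)) has_integral (\<Sum>i<n. ?g i x * (x i - p i))) {0..1}"
    using int by (intro has_integral_sum has_integral_mult_left) (auto simp: segment_mean_def cbox_interval)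
  ultimately have "u (?c 1) - u (?c 0) = (\<Sum>i<n. ?g i x * (x i - p i))" by (rule has_integral_unique)
  then show "u x = u p + (\<Sum>i<n. (x i - p i) * ?g i x)" by (simp add: mult.commute)
qed

section \<open>Derivative bounds relative to a weight\<close>

text \<open>
  Think of \<open>q\<close> as the squared distance to a singular set at the boundary of \<open>X\<close>. The weight that is constantly
  \<open>1\<close> describes functions all of whose derivatives are bounded.
\<close>

locale weighted_domain =
  fixes n :: nat and X :: "(nat \<Rightarrow> real) set" and q :: "(nat \<Rightarrow> real) \<Rightarrow> real"
  assumes X: "eopen n X" and q_pos: "\<And>x. x \<in> X \<Longrightarrow> q x > 0"
begin

text \<open>
  A function is of order \<open>N\<close> if it is bounded by a multiple of \<open>q\<^sup>N\<close> and every derivative costs a factor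
  \<open>q\<^bsup>-1/2\<^esup>\<close>. One constant serves all derivatives up to order \<open>k\<close>, which keeps track of uniformity in
  infinite sums.
\<close>

primrec symb :: "nat \<Rightarrow> real \<Rightarrow> real \<Rightarrow> ((nat \<Rightarrow> real) \<Rightarrow> real) \<Rightarrow> bool" where
  "symb 0 N C h \<longleftrightarrow> continuous_on X h \<and> (\<forall>x\<in>X. \<bar>h x\<bar> \<le> C * q x powr N)"
| "symb (Suc k) N C h \<longleftrightarrow> continuous_on X h \<and> (\<forall>x\<in>X. \<bar>h x\<bar> \<le> C * q x powr N) \<and>
     (\<forall>i<n. \<exists>h'. symb k (N - 1/2) C h' \<and> (\<forall>x\<in>X. has_pd h i (h' x) x))"

lemma symb_continuous: "symb k N C h \<Longrightarrow> continuous_on X h"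
  by (cases k) auto

lemma symb_bound: "symb k N C h \<Longrightarrow> x \<in> X \<Longrightarrow> \<bar>h x\<bar> \<le> C * q x powr N"
  by (cases k) auto

lemma symb_SucI:
  assumes "continuous_on X h" "\<And>x. x \<in> X \<Longrightarrow> \<bar>h x\<bar> \<le> C * q x powr N"
    and "\<And>i. i < n \<Longrightarrow> symb k (N - 1/2) C (h' i)"
    and "\<And>i x. i < n \<Longrightarrow> x \<in> X \<Longrightarrow> has_pd h i (h' i x) x"
  shows "symb (Suc k) N C h"
  unfolding symb.simps using assms by blast

lemma symb_cong:
  assumes "\<And>x. x \<in> X \<Longrightarrow> f x = g x" shows "symb k N C f \<longleftrightarrow> symb k N C g"
proof (cases k)
  case 0
  then show ?thesis using assms continuous_on_cong[of X X f g] by simp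
next
  case (Suc k')
  have "(\<forall>x\<in>X. has_pd f i (h' x) x) \<longleftrightarrow> (\<forall>x\<in>X. has_pd g i (h' x) x)" if "i < n" for i h'
    using has_pd_cong[OF X _ that, of _ f g] assms by blast
  then show ?thesis using assms continuous_on_cong[of X X f g] unfolding Suc symb.simps by auto
qed

lemma symb_SucD:
  assumes "symb (Suc k) N C h" "i < n"
  shows "symb k (N - 1/2) C (partial_deriv i h)" "\<And>x. x \<in> X \<Longrightarrow> has_pd h i (partial_deriv i h x) x"
proof -
  obtain h' where h': "symb k (N - 1/2) C h'" "\<And>x. x \<in> X \<Longrightarrow> has_pd h i (h' x) x"
    using assms unfolding symb.simps by blast
  have eq: "partial_deriv i h x = h' x" if "x \<in> X" for x using has_pd_partial_deriv[OF h'(2)[OF that]] .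
  then show "symb k (N - 1/2) C (partial_deriv i h)" using h'(1) symb_cong[of "partial_deriv i h" h'] eq by blast
  show "has_pd h i (partial_deriv i h x) x" if "x \<in> X" for x using h'(2)[OF that] eq[OF that] by simp
qed

lemma symb_ck_on: "symb k N C h \<Longrightarrow> ck_on k n X h"
proof (induction k arbitrary: N h)
  case 0
  then show ?case by (simp add: ck_on_0_iff[OF X] del: ck_on.simps)
next
  case (Suc k)
  show ?case
    by (rule ck_on_SucI[OF X symb_continuous[OF Suc.prems] Suc.IH[OF symb_SucD(1)[OF Suc.prems]]
          symb_SucD(2)[OF Suc.prems]])
qed

lemma symb_Suc_lower: "symb (Suc k) N C h \<Longrightarrow> symb k N C h"
proof (induction k arbitrary: N h)
  case 0
  then show ?case using symb_continuous[OF 0] symb_bound[OF 0] by simp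
next
  case (Suc k)
  show ?case
    by (rule symb_SucI[OF symb_continuous[OF Suc.prems] symb_bound[OF Suc.prems]
          Suc.IH[OF symb_SucD(1)[OF Suc.prems]] symb_SucD(2)[OF Suc.prems]])
qed

lemma symb_le: "j \<le> k \<Longrightarrow> symb k N C h \<Longrightarrow> symb j N C h"
  by (induction rule: dec_induct) (auto dest: symb_Suc_lower simp del: symb.simps)

lemma symb_mono: "symb k N C h \<Longrightarrow> C \<le> C' \<Longrightarrow> symb k N C' h"
proof (induction k arbitrary: N h)
  have b: "\<bar>h x\<bar> \<le> C' * q x powr N" if "symb k N C h" "C \<le> C'" "x \<in> X" for k N h x
    using symb_bound[OF that(1,3)] mult_right_mono[OF that(2), of "q x powr N"] by simp
  {
    case 0
    then show ?case using symb_continuous[OF 0(1)] b[OF 0] by simp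
  next
    case (Suc k)
    show ?case
      by (rule symb_SucI[OF symb_continuous[OF Suc.prems(1)] b[OF Suc.prems]
            Suc.IH[OF symb_SucD(1)[OF Suc.prems(1)] Suc.prems(2)] symb_SucD(2)[OF Suc.prems(1)]])
  }
qed

lemma symb_zero: "C \<ge> 0 \<Longrightarrow> symb k N C (\<lambda>x. 0)"
proof (induction k arbitrary: N)
  case (Suc k)
  show ?case by (rule symb_SucI[OF _ _ Suc.IH has_pd_const]) (use Suc.prems in auto)
qed auto

lemma symb_const: "symb k 0 \<bar>c\<bar> (\<lambda>x. c)"
proof (cases k)
  case (Suc k')
  have "\<bar>c\<bar> \<le> \<bar>c\<bar> * q x powr 0" if "x \<in> X" for x using q_pos[OF that] by simp
  then show ?thesis unfolding Suc by (intro symb_SucI[OF _ _ symb_zero has_pd_const]) auto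
next
  case 0
  have "\<bar>c\<bar> \<le> \<bar>c\<bar> * q x powr 0" if "x \<in> X" for x using q_pos[OF that] by simp
  then show ?thesis unfolding 0 by auto
qed

lemma symb_add: "symb k N C f \<Longrightarrow> symb k N D g \<Longrightarrow> symb k N (C + D) (\<lambda>x. f x + g x)"
proof (induction k arbitrary: N f g)
  have b: "\<bar>f x + g x\<bar> \<le> (C + D) * q x powr N"
    if "symb k N C f" "symb k N D g" "x \<in> X" for k N f g x
    using symb_bound[OF that(1,3)] symb_bound[OF that(2,3)] abs_triangle_ineq[of "f x" "g x"]
    by (simp add: algebra_simps)
  {
    case 0
    then show ?case using symb_continuous[OF 0(1)] symb_continuous[OF 0(2)] b[OF 0]
      by (simp add: continuous_on_add)
  next
    case (Suc k)
    note f = symb_SucD[OF Suc.prems(1)] and g = symb_SucD[OF Suc.prems(2)]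
    show ?case
      by (rule symb_SucI[OF continuous_on_add[OF symb_continuous[OF Suc.prems(1)] symb_continuous[OF Suc.prems(2)]]
            b[OF Suc.prems] Suc.IH[OF f(1) g(1)] has_pd_add[OF f(2) g(2)]])
  }
qed

text \<open>
  The factor \<open>2\<^sup>k\<close> counts the terms of the Leibniz rule.
\<close>

lemma symb_mult:
  "symb k N C f \<Longrightarrow> symb k M D g \<Longrightarrow> C \<ge> 0 \<Longrightarrow> D \<ge> 0 \<Longrightarrow> symb k (N + M) (2 ^ k * C * D) (\<lambda>x. f x * g x)"
proof (induction k arbitrary: N M f g)
  have b: "\<bar>f x * g x\<bar> \<le> (2 ^ k * C * D) * q x powr (N + M)"
    if f: "symb k N C f" and g: "symb k M D g" and CD: "C \<ge> 0" "D \<ge> 0" and x: "x \<in> X" for k N M f g x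
  proof -
    have "\<bar>f x * g x\<bar> \<le> (C * q x powr N) * (D * q x powr M)"
      unfolding abs_mult by (rule mult_mono[OF symb_bound[OF f x] symb_bound[OF g x]]) (use CD in auto)
    also have "\<dots> = 1 * (C * D) * q x powr (N + M)" by (simp add: powr_add)
    also have "\<dots> \<le> 2 ^ k * (C * D) * q x powr (N + M)"
      by (intro mult_right_mono) (use CD in auto)
    finally show ?thesis by (simp add: mult_ac)
  qed
  {
    case 0
    then show ?case using symb_continuous[OF 0(1)] symb_continuous[OF 0(2)] b[OF 0]
      by (simp add: continuous_on_mult)
  next
    case (Suc k)
    note f = symb_SucD[OF Suc.prems(1)] and g = symb_SucD[OF Suc.prems(2)]
    note lo = symb_Suc_lower[OF Suc.prems(1)] symb_Suc_lower[OF Suc.prems(2)]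
    have eq: "N - 1/2 + M = N + M - 1/2" "N + (M - 1/2) = N + M - 1/2"
      "2 ^ k * C * D + 2 ^ k * C * D = 2 ^ Suc k * C * D" by auto
    have d: "symb k (N + M - 1/2) (2 ^ Suc k * C * D) (\<lambda>x. partial_deriv i f x * g x + f x * partial_deriv i g x)"
      if i: "i < n" for i
      using symb_add[OF Suc.IH[OF f(1)[OF i] lo(2) Suc.prems(3,4), unfolded eq(1)]
          Suc.IH[OF lo(1) g(1)[OF i] Suc.prems(3,4), unfolded eq(2)]] unfolding eq(3) .
    show ?case
      by (rule symb_SucI[OF continuous_on_mult[OF symb_continuous[OF Suc.prems(1)] symb_continuous[OF Suc.prems(2)]]
            b[OF Suc.prems] d has_pd_mult[OF f(2) g(2)]])
  }
qed

text \<open>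
  The bounds hold for derivatives of every order, with constants that may grow.
\<close>

definition sym_order :: "real \<Rightarrow> ((nat \<Rightarrow> real) \<Rightarrow> real) \<Rightarrow> bool" where
  "sym_order N h \<longleftrightarrow> (\<forall>k. \<exists>C\<ge>0. symb k N C h)"

lemma sym_order_const: "sym_order 0 (\<lambda>x. c)"
  unfolding sym_order_def using symb_const[of _ c] abs_ge_zero by blast

lemma sym_order_zero: "sym_order N (\<lambda>x. 0)"
  unfolding sym_order_def using symb_zero by blast

lemma sym_order_add: "sym_order N f \<Longrightarrow> sym_order N g \<Longrightarrow> sym_order N (\<lambda>x. f x + g x)"
  unfolding sym_order_def
proof
  fix k assume "\<forall>k. \<exists>C\<ge>0. symb k N C f" "\<forall>k. \<exists>C\<ge>0. symb k N C g"
  then obtain C D where "C \<ge> 0" "symb k N C f" "D \<ge> 0" "symb k N D g" by blast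
  then show "\<exists>C\<ge>0. symb k N C (\<lambda>x. f x + g x)"
    by (intro exI[of _ "C + D"] conjI symb_add) auto
qed

lemma sym_order_mult:
  assumes "sym_order N f" "sym_order M g" shows "sym_order (N + M) (\<lambda>x. f x * g x)"
  unfolding sym_order_def
proof
  fix k
  obtain C D where "C \<ge> 0" "symb k N C f" "D \<ge> 0" "symb k M D g"
    using assms unfolding sym_order_def by blast
  then show "\<exists>C\<ge>0. symb k (N + M) C (\<lambda>x. f x * g x)"
    by (intro exI[of _ "2 ^ k * C * D"] conjI symb_mult) auto
qed

lemma sym_order_cmult: "sym_order N f \<Longrightarrow> sym_order N (\<lambda>x. c * f x)"
  using sym_order_mult[OF sym_order_const[of c], of N f] by simp

lemma sym_order_diff: "sym_order N f \<Longrightarrow> sym_order N g \<Longrightarrow> sym_order N (\<lambda>x. f x - g x)"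
  using sym_order_add[of N f "\<lambda>x. (-1) * g x"] sym_order_cmult[of N g "-1"] by simp

lemma sym_order_sum: "(\<And>a. a \<in> A \<Longrightarrow> sym_order N (f a)) \<Longrightarrow> sym_order N (\<lambda>x. \<Sum>a\<in>A. f a x)"
  by (induction A rule: infinite_finite_induct) (simp_all add: sym_order_zero sym_order_add)

lemma sym_order_smooth: "sym_order N f \<Longrightarrow> ck_on k n X f"
  unfolding sym_order_def using symb_ck_on by blast

lemma sym_order_bound: "sym_order N f \<Longrightarrow> \<exists>C\<ge>0. \<forall>x\<in>X. \<bar>f x\<bar> \<le> C * q x powr N"
  unfolding sym_order_def using symb_bound by blast

lemma sym_order_partial_deriv:
  assumes "sym_order N f" "i < n"
  shows "sym_order (N - 1/2) (partial_deriv i f)" "x \<in> X \<Longrightarrow> has_pd f i (partial_deriv i f x) x"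
proof -
  show "sym_order (N - 1/2) (partial_deriv i f)"
    using assms symb_SucD(1) unfolding sym_order_def by blast
  show "has_pd f i (partial_deriv i f x) x" if "x \<in> X"
    using assms that symb_SucD(2)[of 0] unfolding sym_order_def by blast
qed

text \<open>
  The finitely many constants for the first partial derivatives are replaced by their sum.
\<close>

lemma symb_Suc_ex:
  assumes "continuous_on X h" "D \<ge> 0" "\<And>x. x \<in> X \<Longrightarrow> \<bar>h x\<bar> \<le> D * q x powr N"
    and "\<And>i. i < n \<Longrightarrow> \<exists>C\<ge>0. symb k (N - 1/2) C (h' i)"
    and "\<And>i x. i < n \<Longrightarrow> x \<in> X \<Longrightarrow> has_pd h i (h' i x) x"
  shows "\<exists>C\<ge>0. symb (Suc k) N C h"
proof -
  obtain C where C: "\<And>i. i < n \<Longrightarrow> C i \<ge> 0" "\<And>i. i < n \<Longrightarrow> symb k (N - 1/2) (C i) (h' i)"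
    using assms(4) by metis
  define E where "E = D + (\<Sum>i<n. C i)"
  have CE: "C i \<le> E" if "i < n" for i
    using member_le_sum[of i "{..<n}" C] C(1) that assms(2) by (auto simp: E_def)
  have DE: "D \<le> E" using C(1) by (auto simp: E_def intro!: sum_nonneg)
  have "symb (Suc k) N E h"
  proof (rule symb_SucI[OF assms(1) _ _ assms(5)])
    show "\<bar>h x\<bar> \<le> E * q x powr N" if "x \<in> X" for x
      using assms(3)[OF that] mult_right_mono[OF DE, of "q x powr N"] by simp
    show "symb k (N - 1/2) E (h' i)" if "i < n" for i
      by (rule symb_mono[OF C(2)[OF that] CE[OF that]])
  qed
  moreover have "E \<ge> 0" using DE assms(2) by linarith
  ultimately show ?thesis by blast
qed

lemma sym_orderI:
  assumes "continuous_on X h" "D \<ge> 0" "\<And>x. x \<in> X \<Longrightarrow> \<bar>h x\<bar> \<le> D * q x powr N"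
    and "\<And>i. i < n \<Longrightarrow> sym_order (N - 1/2) (h' i)"
    and "\<And>i x. i < n \<Longrightarrow> x \<in> X \<Longrightarrow> has_pd h i (h' i x) x"
  shows "sym_order N h"
  unfolding sym_order_def
proof
  fix k
  have "\<exists>C\<ge>0. symb k (N - 1/2) C (h' i)" if "i < n" for i
    using assms(4)[OF that] unfolding sym_order_def by blast
  from symb_Suc_ex[OF assms(1-3) this assms(5)]
  show "\<exists>C\<ge>0. symb k N C h" using symb_Suc_lower by blast
qed

text \<open>
  Induction on the number of derivatives, as \<open>\<partial>(1/q) = -(1/q)\<^sup>2 \<partial>q\<close> has order \<open>-2 + 1/2\<close>.
\<close>

lemma sym_order_inverse_weight:
  assumes qo: "sym_order 1 q" shows "sym_order (- 1) (\<lambda>x. inverse (q x))"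
proof -
  have cont: "continuous_on X (\<lambda>x. inverse (q x))"
    using ck_on_continuous[OF X sym_order_smooth[OF qo]] q_pos by (intro continuous_on_inverse) force+
  have b: "\<bar>inverse (q x)\<bar> \<le> 1 * q x powr (-1)" if "x \<in> X" for x
    using q_pos[OF that] by (simp add: powr_minus)
  have "\<exists>C\<ge>0. symb k (-1) C (\<lambda>x. inverse (q x))" for k
  proof (induction k)
    case 0
    then show ?case using cont b by (intro exI[of _ 1]) auto
  next
    case (Suc k)
    then obtain C where C: "C \<ge> 0" "symb k (-1) C (\<lambda>x. inverse (q x))" by blast
    show ?case
    proof (rule symb_Suc_ex[OF cont zero_le_one b])
      fix i assume i: "i < n"
      from sym_order_partial_deriv(1)[OF qo i] obtain D where D: "D \<ge> 0" "symb k (1 - 1/2) D (partial_deriv i q)"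
        unfolding sym_order_def by blast
      have 1: "symb k (-1 + -1) (2 ^ k * C * C) (\<lambda>x. inverse (q x) * inverse (q x))"
        by (rule symb_mult[OF C(2) C(2)]) (use C in auto)
      have 2: "symb k (0 + (-1 + -1)) (2 ^ k * \<bar>-1\<bar> * (2 ^ k * C * C)) (\<lambda>x. (-1) * (inverse (q x) * inverse (q x)))"
        by (rule symb_mult[OF symb_const 1]) (use C in auto)
      have S: "symb k (0 + (-1 + -1) + (1 - 1/2)) (2 ^ k * (2 ^ k * \<bar>-1\<bar> * (2 ^ k * C * C)) * D)
          (\<lambda>x. (-1) * (inverse (q x) * inverse (q x)) * partial_deriv i q x)"
        by (rule symb_mult[OF 2 D(2)]) (use C D in auto)
      have E: "0 + (-1 + -1) + (1 - 1/2) = (-1 - 1/2 :: real)" by simp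
      have "2 ^ k * (2 ^ k * \<bar>-1\<bar> * (2 ^ k * C * C)) * D \<ge> 0" using C D by simp
      then show "\<exists>D\<ge>0. symb k (-1 - 1/2) D (\<lambda>x. (-1) * (inverse (q x) * inverse (q x)) * partial_deriv i q x)"
        using S unfolding E by blast
      show "has_pd (\<lambda>x. inverse (q x)) i ((-1) * (inverse (q x) * inverse (q x)) * partial_deriv i q x) x"
        if x: "x \<in> X" for x
      proof (rule has_pd_comp1[OF _ sym_order_partial_deriv(2)[OF qo i x]])
        show "(inverse has_real_derivative (-1) * (inverse (q x) * inverse (q x))) (at (q x))"
          using DERIV_inverse[of "q x"] q_pos[OF x] by simp
      qed
    qed
  qed
  then show ?thesis unfolding sym_order_def by blast
qed

lemma sym_order_weaken:
  assumes "sym_order N h" "M \<le> N" "Q > 0" "\<And>x. x \<in> X \<Longrightarrow> q x \<le> Q"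
  shows "sym_order M h"
proof -
  define e where "e = N - M"
  have e: "e \<ge> 0" using assms(2) by (simp add: e_def)
  have "symb k (N - e) (C * Q powr e) h" if "symb k N C h" "C \<ge> 0" for k N C h
    using that
  proof (induction k arbitrary: N h)
    have b: "\<bar>h x\<bar> \<le> C * Q powr e * q x powr (N - e)" if "symb k N C h" "C \<ge> 0" "x \<in> X" for k N h x
    proof -
      have "q x powr N = q x powr e * q x powr (N - e)" by (simp add: powr_add[symmetric])
      also have "\<dots> \<le> Q powr e * q x powr (N - e)"
        using assms(4)[OF that(3)] q_pos[OF that(3)] e by (intro mult_right_mono powr_mono2) auto
      finally have "C * q x powr N \<le> C * (Q powr e * q x powr (N - e))" using that(2) by (rule mult_left_mono)
      then show ?thesis using symb_bound[OF that(1,3)] by (simp add: mult.assoc)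
    qed
    {
      case 0
      then show ?case using symb_continuous[OF 0(1)] b[OF 0] by simp
    next
      case (Suc k)
      have eq: "N - 1/2 - e = N - e - 1/2" by simp
      show ?case
        by (rule symb_SucI[OF symb_continuous[OF Suc.prems(1)] b[OF Suc.prems]
              Suc.IH[OF symb_SucD(1)[OF Suc.prems(1)] Suc.prems(2), unfolded eq] symb_SucD(2)[OF Suc.prems(1)]])
    }
  qed
  then have *: "symb k (N - e) (C * Q powr e) h" if "symb k N C h" "C \<ge> 0" for k C using that by blast
  show ?thesis unfolding sym_order_def
  proof
    fix k
    obtain C where C: "C \<ge> 0" "symb k N C h" using assms(1) unfolding sym_order_def by blast
    have "symb k M (C * Q powr e) h" using *[OF C(2,1)] by (simp add: e_def)
    then show "\<exists>C\<ge>0. symb k M C h" using C(1) by (intro exI[of _ "C * Q powr e"]) auto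
  qed
qed

text \<open>
  A function living where \<open>q \<le> \<epsilon>\<close> gains a factor \<open>\<epsilon>\<^sup>e\<close> when its order is lowered by \<open>e\<close>. This makes the
  terms of the series for the primitive as small as desired.
\<close>

lemma symb_shrink:
  assumes qc: "continuous_on X q" and "\<epsilon> > 0" and "e \<ge> 0" and "C \<ge> 0"
  shows "symb k N C h \<Longrightarrow> (\<And>x. x \<in> X \<Longrightarrow> q x > \<epsilon> \<Longrightarrow> h x = 0) \<Longrightarrow> symb k (N - e) (C * \<epsilon> powr e) h"
proof (induction k arbitrary: N h)
  have b: "\<bar>h x\<bar> \<le> C * \<epsilon> powr e * q x powr (N - e)"
    if "symb k N C h" "\<And>x. x \<in> X \<Longrightarrow> q x > \<epsilon> \<Longrightarrow> h x = 0" "x \<in> X" for k N h x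
  proof (cases "q x > \<epsilon>")
    case True
    then show ?thesis using that(2)[OF that(3)] assms(4) by simp
  next
    case False
    have "q x powr N = q x powr e * q x powr (N - e)" by (simp add: powr_add[symmetric])
    also have "\<dots> \<le> \<epsilon> powr e * q x powr (N - e)"
      using False q_pos[OF that(3)] assms(3) by (intro mult_right_mono powr_mono2) auto
    finally have "C * q x powr N \<le> C * (\<epsilon> powr e * q x powr (N - e))" using assms(4) by (rule mult_left_mono)
    then show ?thesis using symb_bound[OF that(1,3)] by (simp add: mult.assoc)
  qed
  {
    case 0
    then show ?case using symb_continuous[OF 0(1)] b[OF 0] by simp
  next
    case (Suc k)
    have eq: "N - 1/2 - e = N - e - 1/2" by simp
    have z: "partial_deriv i h x = 0" if i: "i < n" and x: "x \<in> X" "q x > \<epsilon>" for i x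
    proof -
      have "openin (top_of_set X) (X \<inter> q -` {\<epsilon><..})"
        using qc by (rule continuous_openin_preimage_gen) auto
      then have V: "eopen n (X \<inter> q -` {\<epsilon><..})"
        using X by (subst Euclidean_space_top_of_set, subst (asm) Euclidean_space_top_of_set) (rule openin_trans)
      have "has_pd h i 0 x \<longleftrightarrow> has_pd (\<lambda>x. 0) i 0 x"
        by (rule has_pd_cong[OF V _ i]) (use x Suc.prems(2) in auto)
      then show ?thesis using has_pd_const has_pd_partial_deriv by blast
    qed
    show ?case
      by (rule symb_SucI[OF symb_continuous[OF Suc.prems(1)] b[OF Suc.prems]
            Suc.IH[OF symb_SucD(1)[OF Suc.prems(1)] z, unfolded eq] symb_SucD(2)[OF Suc.prems(1)]])
  }
qed

lemma symb_sum:
  assumes "finite A" "\<And>a. a \<in> A \<Longrightarrow> symb k N (C a) (f a)"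
  shows "symb k N (\<Sum>a\<in>A. C a) (\<lambda>x. \<Sum>a\<in>A. f a x)"
  using assms
proof (induction A rule: finite_induct)
  case empty
  then show ?case by (simp add: symb_zero del: symb.simps)
next
  case (insert a A)
  then show ?case by (simp add: symb_add del: symb.simps)
qed

text \<open>
  The chain rule yields a factor \<open>1/\<epsilon>\<close>, but \<open>\<partial> \<theta>(q/\<epsilon>) = \<theta>'(q/\<epsilon>) \<partial>q/\<epsilon> = \<theta>\<^sub>1(q/\<epsilon>) \<partial>q/q\<close> with \<open>\<theta>\<^sub>1(t) = t \<theta>'(t)\<close>,
  which belongs to the same class of functions as \<open>\<theta>\<close>. So the constant does not depend on \<open>\<epsilon>\<close>.
\<close>

lemma cutoff_symb_uniform:
  assumes qo: "sym_order 1 q"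
  shows "(\<And>j. ck_real j \<theta>) \<Longrightarrow> (\<And>t. t > 1 \<Longrightarrow> \<theta> t = 0) \<Longrightarrow>
    \<exists>C\<ge>0. \<forall>\<epsilon>>0. symb k 0 C (\<lambda>x. \<theta> (q x / \<epsilon>))"
proof (induction k arbitrary: \<theta>)
  have qc: "continuous_on X q" using ck_on_continuous[OF X sym_order_smooth[OF qo]] .
  have base: "\<exists>C\<ge>0. \<forall>\<epsilon>>0. continuous_on X (\<lambda>x. \<theta> (q x / \<epsilon>)) \<and> (\<forall>x\<in>X. \<bar>\<theta> (q x / \<epsilon>)\<bar> \<le> C * q x powr 0)"
    if \<theta>: "\<And>j. ck_real j \<theta>" "\<And>t. t > 1 \<Longrightarrow> \<theta> t = 0" for \<theta>
  proof -
    have c: "continuous_on UNIV \<theta>" using \<theta>(1) ck_real_continuous by blast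
    have "bounded (\<theta> ` {0..1})"
      by (intro compact_imp_bounded compact_continuous_image continuous_on_subset[OF c]) auto
    then obtain C where C: "\<And>t. t \<in> {0..1} \<Longrightarrow> \<bar>\<theta> t\<bar> \<le> C"
      unfolding bounded_iff real_norm_def by blast
    have C0: "C \<ge> 0" using C[of 0] by simp
    have "\<bar>\<theta> t\<bar> \<le> C" if "t \<ge> 0" for t
      using C[of t] \<theta>(2)[of t] C0 that by (cases "t \<le> 1") auto
    moreover have "continuous_on X (\<lambda>x. \<theta> (q x / \<epsilon>))" if "\<epsilon> > 0" for \<epsilon>
      by (rule continuous_on_compose2[OF c]) (use qc that in \<open>auto intro!: continuous_intros\<close>)
    ultimately show ?thesis using C0 q_pos
      by (intro exI[of _ C]) (auto simp: less_imp_le dest: q_pos)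
  qed
  {
    case (0 \<theta>)
    then show ?case using base[of \<theta>] by simp
  next
    case (Suc k \<theta>)
    note d = ck_real_SucD[OF Suc.prems(1)]
    define \<theta>' where "\<theta>' t = t * deriv \<theta> t" for t
    have "ck_real j \<theta>'" for j unfolding \<theta>'_def[abs_def] by (rule ck_real_mult[OF ck_real_id d(2)])
    moreover have "\<theta>' t = 0" if "t > 1" for t
    proof -
      have "((\<lambda>t. 0) has_real_derivative deriv \<theta> t) (at t)"
        by (rule has_field_derivative_transform_within_open[of \<theta> "deriv \<theta> t" t "{1<..}"])
          (use d(1) that Suc.prems(2) in auto)
      then have "deriv \<theta> t = 0" using DERIV_unique DERIV_const by blast
      then show ?thesis by (simp add: \<theta>'_def)
    qed
    ultimately obtain C1 where C1: "C1 \<ge> 0" "\<And>\<epsilon>. \<epsilon> > 0 \<Longrightarrow> symb k 0 C1 (\<lambda>x. \<theta>' (q x / \<epsilon>))"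
      using Suc.IH[of \<theta>'] by blast
    obtain C0 where C0: "C0 \<ge> 0" "\<And>\<epsilon>. \<epsilon> > 0 \<Longrightarrow> continuous_on X (\<lambda>x. \<theta> (q x / \<epsilon>))"
        "\<And>\<epsilon> x. \<epsilon> > 0 \<Longrightarrow> x \<in> X \<Longrightarrow> \<bar>\<theta> (q x / \<epsilon>)\<bar> \<le> C0 * q x powr 0"
      using base[OF Suc.prems] by blast
    have "\<exists>D\<ge>0. symb k (0 - 1/2) D (\<lambda>x. inverse (q x) * partial_deriv i q x)" if i: "i < n" for i
      using sym_order_mult[OF sym_order_inverse_weight[OF qo] sym_order_partial_deriv(1)[OF qo i]]
      unfolding sym_order_def by simp
    then obtain D where D: "\<And>i. i < n \<Longrightarrow> D i \<ge> 0"
        "\<And>i. i < n \<Longrightarrow> symb k (0 - 1/2) (D i) (\<lambda>x. inverse (q x) * partial_deriv i q x)" by metis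
    define E where "E = C0 + (\<Sum>i<n. 2 ^ k * C1 * D i)"
    have DE: "2 ^ k * C1 * D i \<le> E" if "i < n" for i
      using member_le_sum[of i "{..<n}" "\<lambda>i. 2 ^ k * C1 * D i"] C1 C0 D(1) that by (auto simp: E_def)
    have CE: "C0 \<le> E" using C1 D(1) by (auto simp: E_def intro!: sum_nonneg)
    have "symb (Suc k) 0 E (\<lambda>x. \<theta> (q x / \<epsilon>))" if e: "\<epsilon> > 0" for \<epsilon>
    proof (rule symb_SucI[OF C0(2)[OF e]])
      show "\<bar>\<theta> (q x / \<epsilon>)\<bar> \<le> E * q x powr 0" if "x \<in> X" for x
        by (rule order_trans[OF C0(3)[OF e that] mult_right_mono[OF CE powr_ge_zero]])
      fix i assume i: "i < n"
      have "symb k (0 + (0 - 1/2)) (2 ^ k * C1 * D i) (\<lambda>x. \<theta>' (q x / \<epsilon>) * (inverse (q x) * partial_deriv i q x))"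
        by (rule symb_mult[OF C1(2)[OF e] D(2)[OF i] C1(1) D(1)[OF i]])
      then show "symb k (0 - 1/2) E (\<lambda>x. \<theta>' (q x / \<epsilon>) * (inverse (q x) * partial_deriv i q x))"
        using symb_mono[OF _ DE[OF i]] by (simp only: add_0)
      fix x assume x: "x \<in> X"
      have "((\<lambda>t. t / \<epsilon>) has_real_derivative 1 / \<epsilon>) (at (q x))" using e by (auto intro!: derivative_eq_intros)
      from DERIV_chain2[OF d(1) this]
      have "((\<lambda>t. \<theta> (t / \<epsilon>)) has_real_derivative deriv \<theta> (q x / \<epsilon>) * (1 / \<epsilon>)) (at (q x))" .
      from has_pd_comp1[OF this sym_order_partial_deriv(2)[OF qo i x]]
      have "has_pd (\<lambda>x. \<theta> (q x / \<epsilon>)) i (deriv \<theta> (q x / \<epsilon>) * (1 / \<epsilon>) * partial_deriv i q x) x" .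
      moreover have "deriv \<theta> (q x / \<epsilon>) * (1 / \<epsilon>) * partial_deriv i q x
          = \<theta>' (q x / \<epsilon>) * (inverse (q x) * partial_deriv i q x)"
        using e q_pos[OF x] by (simp add: \<theta>'_def field_simps)
      ultimately show "has_pd (\<lambda>x. \<theta> (q x / \<epsilon>)) i (\<theta>' (q x / \<epsilon>) * (inverse (q x) * partial_deriv i q x)) x" by simp
    qed
    moreover have "E \<ge> 0" using CE C0(1) by linarith
    ultimately show ?case by blast
  }
qed

end

lemma symb_subset:
  assumes "weighted_domain n X q" "eopen n Y" "Y \<subseteq> X"
  shows "weighted_domain.symb n X q k N C h \<Longrightarrow> weighted_domain.symb n Y q k N C h"
proof -
  interpret X: weighted_domain n X q by fact
  interpret Y: weighted_domain n Y q using assms X.q_pos by unfold_locales auto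
  show "X.symb k N C h \<Longrightarrow> Y.symb k N C h"
  proof (induction k arbitrary: N h)
    case 0
    then show ?case using continuous_on_subset[OF _ assms(3)] assms(3) by auto
  next
    case (Suc k)
    note d = X.symb_SucD[OF Suc.prems]
    show ?case
      by (rule Y.symb_SucI[OF continuous_on_subset[OF X.symb_continuous[OF Suc.prems] assms(3)]
            X.symb_bound[OF Suc.prems subsetD[OF assms(3)]] Suc.IH[OF d(1)] d(2)[OF _ subsetD[OF assms(3)]]])
  qed
qed

lemma symb_local:
  assumes "weighted_domain n X q"
    and "\<And>x. x \<in> X \<Longrightarrow> \<exists>V. eopen n V \<and> x \<in> V \<and> V \<subseteq> X \<and> weighted_domain.symb n V q k N C h"
  shows "weighted_domain.symb n X q k N C h"
proof -
  interpret X: weighted_domain n X q by fact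
  have wd: "weighted_domain n V q" if "eopen n V" "V \<subseteq> X" for V
    using that X.q_pos by unfold_locales auto
  have cont: "continuous_on X h"
    if "\<And>x. x \<in> X \<Longrightarrow> \<exists>V. eopen n V \<and> x \<in> V \<and> V \<subseteq> X \<and> weighted_domain.symb n V q k N C h" for k N h
    by (rule continuous_on_local[OF X.X]) (meson that wd weighted_domain.symb_continuous)
  have bound: "\<bar>h x\<bar> \<le> C * q x powr N"
    if loc: "\<And>x. x \<in> X \<Longrightarrow> \<exists>V. eopen n V \<and> x \<in> V \<and> V \<subseteq> X \<and> weighted_domain.symb n V q k N C h"
      and x: "x \<in> X" for k N h x
  proof -
    obtain V where V: "eopen n V" "x \<in> V" "V \<subseteq> X" "weighted_domain.symb n V q k N C h"
      using loc[OF x] by meson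
    show ?thesis by (rule weighted_domain.symb_bound[OF wd[OF V(1,3)] V(4,2)])
  qed
  show ?thesis using assms(2)
  proof (induction k arbitrary: N h)
    case (0 N h)
    show ?case using cont[of 0 N h] bound[of 0 N h] 0 by simp
  next
    case (Suc k N h)
    have d: "\<exists>V. eopen n V \<and> x \<in> V \<and> V \<subseteq> X \<and> weighted_domain.symb n V q k (N - 1/2) C (partial_deriv i h)
        \<and> has_pd h i (partial_deriv i h x) x" if x: "x \<in> X" and i: "i < n" for x i
    proof -
      obtain V where V: "eopen n V" "x \<in> V" "V \<subseteq> X" "weighted_domain.symb n V q (Suc k) N C h"
        using Suc.prems[OF x] by blast
      from weighted_domain.symb_SucD[OF wd[OF V(1,3)] V(4) i] V show ?thesis by blast
    qed
    show ?case
    proof (rule X.symb_SucI[where h' = "\<lambda>i. partial_deriv i h"])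
      show "continuous_on X h" by (rule cont[OF Suc.prems])
      show "\<bar>h x\<bar> \<le> C * q x powr N" if "x \<in> X" for x by (rule bound[OF Suc.prems that])
      fix i assume i: "i < n"
      show "X.symb k (N - 1/2) C (partial_deriv i h)"
        by (rule Suc.IH) (use d[OF _ i] in blast)
      show "has_pd h i (partial_deriv i h x) x" if "x \<in> X" for x using d[OF that i] by blast
    qed
  qed
qed

lemma smooth_bounded_on_box:
  assumes U: "eopen n U" and K: "closed_box n p r \<subseteq> U" and f: "smooth_in n U f"
  shows "weighted_domain.sym_order n (open_box n p r) (\<lambda>_. 1) N f"
proof -
  let ?B = "open_box n p r"
  interpret B: weighted_domain n ?B "\<lambda>_. 1" by unfold_locales (auto intro: eopen_open_box)
  have BU: "?B \<subseteq> U" using K by (force simp: open_box_def closed_box_def)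
  have "\<exists>C\<ge>0. B.symb k N C f" if "smooth_in n U f" for k N f
    using that
  proof (induction k arbitrary: N f)
    have base: "continuous_on ?B f \<and> (\<exists>C\<ge>0. \<forall>x\<in>?B. \<bar>f x\<bar> \<le> C * 1 powr N)" if "smooth_in n U f" for f N
    proof -
      have c: "continuous_on U f" using that ck_on_continuous[OF U] unfolding smooth_in_def by blast
      have "bounded (f ` closed_box n p r)"
        by (intro compact_imp_bounded compact_continuous_image continuous_on_subset[OF c K] compact_closed_box)
      then obtain C where C: "\<And>x. x \<in> closed_box n p r \<Longrightarrow> \<bar>f x\<bar> \<le> C"
        unfolding bounded_iff real_norm_def by blast
      have "\<bar>f x\<bar> \<le> max 0 C * 1 powr N" if "x \<in> ?B" for x
      proof -
        have "x \<in> closed_box n p r" using that by (force simp: open_box_def closed_box_def)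
        from C[OF this] show ?thesis by simp
      qed
      then show ?thesis using continuous_on_subset[OF c BU] by (intro conjI exI[of _ "max 0 C"]) auto
    qed
    {
      case (0 N f)
      then show ?case using base[OF 0] by simp
    next
      case (Suc k N f)
      obtain C where C: "C \<ge> 0" "\<And>x. x \<in> ?B \<Longrightarrow> \<bar>f x\<bar> \<le> C * 1 powr N" using base[OF Suc.prems] by blast
      show ?case
      proof (rule B.symb_Suc_ex[OF conjunct1[OF base[OF Suc.prems]] C])
        fix i assume i: "i < n"
        have d: "ck_on j n U (partial_deriv i f)" "\<And>x. x \<in> U \<Longrightarrow> has_pd f i (partial_deriv i f x) x" for j
          using ck_on_SucD[OF _ i] Suc.prems unfolding smooth_in_def by blast+
        show "\<exists>C\<ge>0. B.symb k (N - 1/2) C (partial_deriv i f)"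
          by (rule Suc.IH) (use d(1) in \<open>auto simp: smooth_in_def\<close>)
        show "has_pd f i (partial_deriv i f x) x" if "x \<in> ?B" for x using d(2) that BU by blast
      qed
    }
  qed
  then show ?thesis unfolding B.sym_order_def using f by blast
qed

text \<open>
  For bounded \<open>q\<close> and \<open>N \<le> 0\<close> the weight \<open>q\<^sup>N\<close> and the weights of all the derivatives are bounded below,
  so that bounded derivatives are good enough.
\<close>

lemma (in weighted_domain) bounded_smooth_order:
  assumes B: "eopen n B" "X \<subseteq> B" and Q: "Q > 0" "\<And>x. x \<in> X \<Longrightarrow> q x \<le> Q"
    and f: "weighted_domain.sym_order n B (\<lambda>_. 1) M f" and N: "N \<le> 0"
  shows "sym_order N f"
proof -
  interpret B: weighted_domain n B "\<lambda>_. 1" using B by unfold_locales auto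
  have "\<exists>C\<ge>0. symb k N C f" for k using f N
  proof (induction k arbitrary: M N f)
    have base: "continuous_on X f \<and> (\<exists>C\<ge>0. \<forall>x\<in>X. \<bar>f x\<bar> \<le> C * q x powr N)"
      if f: "B.sym_order M f" and N: "N \<le> 0" for f M N
    proof -
      obtain C where C: "C \<ge> 0" "\<And>x. x \<in> B \<Longrightarrow> \<bar>f x\<bar> \<le> C * 1 powr M" using B.sym_order_bound[OF f] by blast
      have "\<bar>f x\<bar> \<le> (C * Q powr (- N)) * q x powr N" if x: "x \<in> X" for x
      proof -
        have "\<bar>f x\<bar> \<le> C * (Q powr (- N) * Q powr N)"
          using C(2)[of x] x B(2) Q(1) by (auto simp: powr_add[symmetric])
        also have "\<dots> \<le> C * (Q powr (- N) * q x powr N)"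
          using C(1) Q q_pos x N by (intro mult_left_mono powr_mono2') auto
        finally show ?thesis by (simp add: mult.assoc)
      qed
      then show ?thesis
        using continuous_on_subset[OF ck_on_continuous[OF B(1) B.sym_order_smooth[OF f]] B(2)] C(1)
        by (intro conjI exI[of _ "C * Q powr (- N)"]) auto
    qed
    {
      case (0 M N f)
      then show ?case using base[OF 0] by simp
    next
      case (Suc k M N f)
      obtain C where C: "C \<ge> 0" "\<And>x. x \<in> X \<Longrightarrow> \<bar>f x\<bar> \<le> C * q x powr N" using base[OF Suc.prems] by blast
      show ?case
      proof (rule symb_Suc_ex[OF conjunct1[OF base[OF Suc.prems]] C])
        fix i assume i: "i < n"
        show "\<exists>C\<ge>0. symb k (N - 1/2) C (partial_deriv i f)"
          by (rule Suc.IH[OF B.sym_order_partial_deriv(1)[OF Suc.prems(1) i]]) (use Suc.prems(2) in simp)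
        show "has_pd f i (partial_deriv i f x) x" if "x \<in> X" for x
          using B.sym_order_partial_deriv(2)[OF Suc.prems(1) i] that B(2) by blast
      qed
    }
  qed
  then show ?thesis unfolding sym_order_def by blast
qed

text \<open>
  Along the zero set of \<open>q\<close> a function of order at least \<open>1\<close> is \<open>O(q)\<close>, and \<open>q\<close>, being minimal there, has vanishing
  derivative; so the extension is differentiable with derivative \<open>0\<close>. Every further derivative
  lowers the order by \<open>1/2\<close>.
\<close>

lemma ck_on_extend_by_zero:
  assumes B: "eopen n B" and qB: "ck_on (Suc 0) n B q" and q0: "\<And>x. x \<in> B \<Longrightarrow> q x \<ge> 0"
    and wd: "weighted_domain n {x \<in> B. q x > 0} q" and C: "C \<ge> 0"
  shows "weighted_domain.symb n {x \<in> B. q x > 0} q k N C h \<Longrightarrow> N \<ge> 1 + real k / 2 \<Longrightarrow>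
    ck_on k n B (\<lambda>x. if q x > 0 then h x else 0)"
proof -
  let ?X = "{x \<in> B. q x > 0}"
  interpret X: weighted_domain n ?X q by (rule wd)
  have qc: "continuous_on B q" using ck_on_continuous[OF B qB] .
  define ext where "ext h = (\<lambda>x. if q x > 0 then h x else (0::real))" for h :: "(nat \<Rightarrow> real) \<Rightarrow> real"
  have ext_eq: "ext h x = h x" if "x \<in> ?X" for h x using that by (simp add: ext_def)
  have bound: "\<bar>ext h x\<bar> \<le> C * q x powr N" if "X.symb k N C h" "x \<in> B" for k N h x
    using X.symb_bound[OF that(1), of x] that(2) C by (auto simp: ext_def)
  have cont: "continuous_on B (ext h)" if h: "X.symb k N C h" and N: "N > 0" for k N h
    unfolding continuous_on_def
  proof
    fix z assume z: "z \<in> B"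
    show "(ext h \<longlongrightarrow> ext h z) (at z within B)"
    proof (cases "q z > 0")
      case True
      have "continuous_on ?X (ext h)"
        using X.symb_continuous[OF h] continuous_on_cong[of ?X ?X "ext h" h] ext_eq by blast
      then have 1: "(ext h \<longlongrightarrow> ext h z) (at z within ?X)" using z True by (auto simp: continuous_on_def)
      obtain T where T: "open T" "?X = coord_space n \<inter> T"
        using X.X by (subst (asm) Euclidean_space_top_of_set) (auto simp: openin_open)
      have "z \<in> T" using z True T(2) by auto
      moreover have "B \<inter> T - {z} = ?X \<inter> T - {z}" using T(2) eopen_subset[OF B] by auto
      ultimately have "at z within B = at z within ?X" by (intro at_within_nhd[OF _ T(1)])
      then show ?thesis using 1 by simp
    next
      case False
      then have qz: "q z = 0" using q0[OF z] by simp
      have "continuous_on B (\<lambda>x. C * q x powr N)"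
        by (intro continuous_on_mult continuous_on_const continuous_on_powr' qc) (use q0 N in auto)
      then have "((\<lambda>x. C * q x powr N) \<longlongrightarrow> 0) (at z within B)"
        using z qz by (auto simp: continuous_on_def)
      then have "(ext h \<longlongrightarrow> 0) (at z within B)"
      proof (rule Lim_null_comparison[rotated])
        show "\<forall>\<^sub>F x in at z within B. norm (ext h x) \<le> C * q x powr N"
          using bound[OF h] by (auto simp: eventually_at_filter)
      qed
      then show ?thesis using qz by (simp add: ext_def)
    qed
  qed
  have flat: "has_pd (ext h) i 0 z" if h: "X.symb k N C h" and N: "N \<ge> 1" and z: "z \<in> B" "q z = 0" and i: "i < n" for k N h z i
  proof -
    note qd = ck_on_SucD(2)[OF qB i z(1)]
    have inB: "\<forall>\<^sub>F t in nhds (z i). z(i := t) \<in> B" by (rule eventually_upd_in_eopen[OF B z(1) i])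
    have der: "((\<lambda>t. q (z(i := t))) has_real_derivative partial_deriv i q z) (at (z i))"
      using qd by (simp add: has_pd_def)
    obtain d where d: "d > 0" "\<And>t. dist t (z i) < d \<Longrightarrow> z(i := t) \<in> B"
      using inB unfolding eventually_nhds_metric by blast
    have "partial_deriv i q z = 0"
      by (rule DERIV_local_min[OF der d(1)]) (use d(2) q0 z in \<open>auto simp: dist_real_def abs_minus_commute\<close>)
    then have lim: "((\<lambda>t. q (z(i := t)) / (t - z i)) \<longlongrightarrow> 0) (at (z i))"
      using der z(2) by (simp add: has_field_derivative_iff)
    then have lim': "((\<lambda>t. C * \<bar>q (z(i := t)) / (t - z i)\<bar>) \<longlongrightarrow> 0) (at (z i))"
      by (intro tendsto_mult_right_zero tendsto_rabs_zero)
    have "((\<lambda>t. q (z(i := t))) \<longlongrightarrow> 0) (at (z i))"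
      using DERIV_isCont[OF der] z(2) by (simp add: isCont_def)
    then have small: "\<forall>\<^sub>F t in at (z i). q (z(i := t)) < 1" by (rule order_tendstoD) simp
    have inB': "\<forall>\<^sub>F t in at (z i). z(i := t) \<in> B"
      using inB unfolding eventually_at_filter by eventually_elim simp
    have "((\<lambda>t. ext h (z(i := t)) / (t - z i)) \<longlongrightarrow> 0) (at (z i))"
    proof (rule Lim_null_comparison[OF _ lim'])
      show "\<forall>\<^sub>F t in at (z i). norm (ext h (z(i := t)) / (t - z i)) \<le> C * \<bar>q (z(i := t)) / (t - z i)\<bar>"
        using small inB'
      proof eventually_elim
        case (elim t)
        have "q (z(i := t)) powr N \<le> q (z(i := t))"
        proof (cases "q (z(i := t)) = 0")
          case False
          then have "q (z(i := t)) > 0" using q0[OF elim(2)] by simp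
          then show ?thesis using powr_mono'[of 1 N "q (z(i := t))"] N elim(1) by simp
        qed simp
        then have "\<bar>ext h (z(i := t))\<bar> \<le> C * q (z(i := t))"
          using bound[OF h elim(2)] C mult_left_mono order_trans by blast
        then have "\<bar>ext h (z(i := t))\<bar> / \<bar>t - z i\<bar> \<le> C * q (z(i := t)) / \<bar>t - z i\<bar>"
          by (rule divide_right_mono) simp
        then show ?case using q0[OF elim(2)] by (simp add: abs_divide)
      qed
    qed
    moreover have "ext h z = 0" using z by (simp add: ext_def)
    ultimately show ?thesis unfolding has_pd_def has_field_derivative_iff by simp
  qed
  have "ck_on k n B (ext h)" if "X.symb k N C h" "N \<ge> 1 + real k / 2" for k N h
    using that
  proof (induction k arbitrary: N h)
    case (0 N h)
    show ?case unfolding ck_on_0_iff[OF B] by (rule cont[OF 0(1)]) (use 0 in simp)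
  next
    case (Suc k N h)
    show ?case
    proof (rule ck_on_SucI[where g = "\<lambda>i. ext (partial_deriv i h)", OF B])
      show "continuous_on B (ext h)" by (rule cont[OF Suc.prems(1)]) (use Suc.prems(2) of_nat_0_le_iff[of "Suc k"] in linarith)
      fix i assume i: "i < n"
      note d = X.symb_SucD[OF Suc.prems(1) i]
      show "ck_on k n B (ext (partial_deriv i h))"
        by (rule Suc.IH[OF d(1)]) (use Suc.prems(2) in \<open>simp add: field_simps\<close>)
      fix x assume x: "x \<in> B"
      show "has_pd (ext h) i (ext (partial_deriv i h) x) x"
      proof (cases "q x > 0")
        case True
        then have "has_pd h i (partial_deriv i h x) x" using d(2) x by blast
        then have "has_pd (ext h) i (partial_deriv i h x) x"
          using has_pd_cong[OF X.X _ i, of x "ext h" h] ext_eq x True by blast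
        then show ?thesis using True by (simp add: ext_def)
      next
        case False
        then have "q x = 0" using q0[OF x] by simp
        moreover have "N \<ge> 1" using Suc.prems(2) by (simp add: field_simps)
        ultimately show ?thesis using flat[OF Suc.prems(1) _ x _ i] False by (simp add: ext_def)
      qed
    qed
  qed
  then show "X.symb k N C h \<Longrightarrow> N \<ge> 1 + real k / 2 \<Longrightarrow> ck_on k n B (\<lambda>x. if q x > 0 then h x else 0)"
    unfolding ext_def by blast
qed

section \<open>The Koszul differential at a point\<close>

text \<open>
  The formula for \<open>\<partial>\<close> in coefficients, for a single value \<open>y\<close> of the map \<open>J\<close>.
\<close>

definition koszul_d :: "nat \<Rightarrow> (nat \<Rightarrow> real) \<Rightarrow> (nat set \<Rightarrow> real) \<Rightarrow> nat set \<Rightarrow> real" where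
  "koszul_d l y v I = (\<Sum>a\<in>{..<l} - I. (-1) ^ inversions {a} I * (y a * v (insert a I)))"

text \<open>
  Exterior multiplication by \<open>\<Sum>y\<^sub>a e\<^sub>a\<close>.
\<close>

definition koszul_wedge :: "(nat \<Rightarrow> real) \<Rightarrow> (nat set \<Rightarrow> real) \<Rightarrow> nat set \<Rightarrow> real" where
  "koszul_wedge y v I = (\<Sum>a\<in>I. (-1) ^ inversions {a} (I - {a}) * (y a * v (I - {a})))"

lemma inversions_singletons: "inversions {a} {b} = (if b < a then 1 else 0)"
proof -
  have "{(a', b'). a' \<in> {a} \<and> b' \<in> {b} \<and> b' < a'} = (if b < a then {(a, b)} else {})" by auto
  then show ?thesis unfolding inversions_def by simp
qed

lemma inversions_insert:
  assumes "finite T" "b \<notin> T" shows "inversions {a} (insert b T) = inversions {a} T + (if b < a then 1 else 0)"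
  using inversions_Un_right[of "{a}" "{b}" T] assms by (simp add: inversions_singletons)

text \<open>
  The signs express that contractions and exterior multiplications by basis vectors anticommute.
\<close>

lemma inversion_signs_swap:
  assumes "finite T" "a \<notin> T" "b \<notin> T" "a \<noteq> b"
  shows "(-1::real) ^ inversions {a} (insert b T) * (-1) ^ inversions {b} (insert a T)
       = - ((-1) ^ inversions {a} T * (-1) ^ inversions {b} T)"
    and "(-1::real) ^ inversions {a} T * (-1) ^ inversions {b} (insert a T)
       = - ((-1) ^ inversions {b} T * (-1) ^ inversions {a} (insert b T))"
  using assms by (auto simp: inversions_insert not_less dest!: le_neq_implies_less)

text \<open>
  The common core of all homotopy formulas. With commuting families of operators
  \<open>Y\<^sub>a\<close> and \<open>D\<^sub>b\<close> on the coefficients, apart from \<open>a = b\<close>, the anticommutator of \<open>\<Sum>Y\<^sub>a \<iota>\<^sub>a\<close> and \<open>\<Sum>D\<^sub>b e\<^sub>b \<and> _\<close> has only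
  diagonal terms. Here \<open>P a b\<close> is \<open>Y\<^sub>a D\<^sub>b\<close> and \<open>Q a b\<close> is \<open>D\<^sub>b Y\<^sub>a\<close>. It is used with \<open>D\<^sub>b\<close> the
  multiplication by \<open>y\<^sub>b\<close>, and with \<open>D\<^sub>b = \<partial>/\<partial>y\<^sub>b\<close>.
\<close>

lemma koszul_homotopy_sum:
  fixes P Q :: "nat \<Rightarrow> nat \<Rightarrow> nat set \<Rightarrow> real"
  assumes S: "S \<subseteq> {..<l}" and PQ: "\<And>a b T. a \<noteq> b \<Longrightarrow> P a b T = Q a b T"
  shows "(\<Sum>a\<in>{..<l} - S. (-1) ^ inversions {a} S *
            (\<Sum>b\<in>insert a S. (-1) ^ inversions {b} (insert a S - {b}) * P a b (insert a S - {b})))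
       + (\<Sum>b\<in>S. (-1) ^ inversions {b} (S - {b}) *
            (\<Sum>a\<in>{..<l} - (S - {b}). (-1) ^ inversions {a} (S - {b}) * Q a b (insert a (S - {b}))))
       = (\<Sum>a\<in>{..<l} - S. P a a S) + (\<Sum>b\<in>S. Q b b S)"
proof -
  have fS: "finite S" using S finite_subset by blast
  let ?s = "\<lambda>a T. (-1::real) ^ inversions {a} T"
  have sq: "?s a T * (?s a T * c) = c" for a T and c :: real
    by (simp add: mult.assoc[symmetric] power_mult_distrib[symmetric])
  have 1: "?s a S * (\<Sum>b\<in>insert a S. ?s b (insert a S - {b}) * P a b (insert a S - {b}))
      = P a a S + (\<Sum>b\<in>S. ?s a S * (?s b (insert a S - {b}) * P a b (insert a S - {b})))"
    if a: "a \<in> {..<l} - S" for a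
  proof -
    have "insert a S - {a} = S" using a by auto
    then show ?thesis using a fS by (simp add: distrib_left sq sum_distrib_left del: insert_Diff_single)
  qed
  have 2: "?s b (S - {b}) * (\<Sum>a\<in>{..<l} - (S - {b}). ?s a (S - {b}) * Q a b (insert a (S - {b})))
      = Q b b S + (\<Sum>a\<in>{..<l} - S. ?s b (S - {b}) * (?s a (S - {b}) * Q a b (insert a (S - {b}))))"
    if b: "b \<in> S" for b
  proof -
    have "{..<l} - (S - {b}) = insert b ({..<l} - S)" "insert b (S - {b}) = S" using b S by auto
    then show ?thesis using b by (simp add: distrib_left sq sum_distrib_left)
  qed
  have 3: "?s a S * (?s b (insert a S - {b}) * P a b (insert a S - {b}))
      = - (?s b (S - {b}) * (?s a (S - {b}) * Q a b (insert a (S - {b}))))"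
    if a: "a \<in> {..<l} - S" and b: "b \<in> S" for a b
  proof -
    define T where "T = S - {b}"
    have T: "finite T" "a \<notin> T" "b \<notin> T" "a \<noteq> b" "S = insert b T" "insert a S - {b} = insert a T"
      using a b fS by (auto simp: T_def)
    have "?s a (insert b T) * (?s b (insert a T) * P a b (insert a T))
        = - (?s a T * ?s b T) * Q a b (insert a T)"
      using inversion_signs_swap(1)[OF T(1-4)] PQ[OF T(4)] by (simp add: mult.assoc[symmetric])
    then show ?thesis unfolding T(6) T_def[symmetric] by (subst T(5)) (simp add: mult_ac)
  qed
  have "(\<Sum>a\<in>{..<l} - S. \<Sum>b\<in>S. ?s a S * (?s b (insert a S - {b}) * P a b (insert a S - {b})))
      = - (\<Sum>b\<in>S. \<Sum>a\<in>{..<l} - S. ?s b (S - {b}) * (?s a (S - {b}) * Q a b (insert a (S - {b}))))"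
    by (subst sum.swap) (simp add: 3 sum_negf)
  then show ?thesis by (simp add: 1 2 sum.distrib)
qed

text \<open>
  Thus where \<open>y \<noteq> 0\<close> the complex is contracted by \<open>\<bar>y\<bar>\<^sup>-\<^sup>2 (\<Sum>y\<^sub>a e\<^sub>a) \<and> _\<close>.
\<close>

lemma koszul_d_wedge:
  assumes S: "S \<subseteq> {..<l}"
  shows "koszul_d l y (koszul_wedge y v) S + koszul_wedge y (koszul_d l y v) S = (\<Sum>a<l. (y a)\<^sup>2) * v S"
proof -
  have fS: "finite S" using S finite_subset by blast
  have "koszul_d l y (koszul_wedge y v) S + koszul_wedge y (koszul_d l y v) S
     = (\<Sum>a\<in>{..<l} - S. y a * y a * v S) + (\<Sum>b\<in>S. y b * y b * v S)"
    unfolding koszul_d_def koszul_wedge_def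
    using koszul_homotopy_sum[OF S, of "\<lambda>a b T. y a * y b * v T" "\<lambda>a b T. y a * y b * v T"]
    by (simp add: sum_distrib_left mult_ac)
  also have "\<dots> = (\<Sum>a\<in>({..<l} - S) \<union> S. y a * y a * v S)"
    by (rule sum.union_disjoint[symmetric]) (use fS in auto)
  also have "({..<l} - S) \<union> S = {..<l}" using S by auto
  finally show ?thesis by (simp add: sum_distrib_right power2_eq_square)
qed

lemma koszul_d_d:
  assumes S: "S \<subseteq> {..<l}" shows "koszul_d l y (koszul_d l y v) S = 0"
proof -
  have fS: "finite S" using S finite_subset by blast
  let ?A = "{..<l} - S" and ?s = "\<lambda>a T. (-1::real) ^ inversions {a} T"
  define g where "g a b = (if a = b then 0 else ?s a S * ?s b (insert a S) * (y a * y b * v (insert a (insert b S))))" for a b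
  have anti: "g a b = - g b a" if "a \<in> ?A" "b \<in> ?A" for a b
  proof (cases "a = b")
    case False
    then show ?thesis using inversion_signs_swap(2)[OF fS, of a b] that
      by (simp add: g_def insert_commute mult_ac)
  qed (simp add: g_def)
  have "koszul_d l y (koszul_d l y v) S = (\<Sum>a\<in>?A. \<Sum>b\<in>?A. g a b)"
    unfolding koszul_d_def
  proof (rule sum.cong[OF refl])
    fix a assume a: "a \<in> ?A"
    have "?A = insert a ({..<l} - insert a S)" using a by auto
    then have "(\<Sum>b\<in>?A. g a b) = g a a + (\<Sum>b\<in>{..<l} - insert a S. g a b)"
      by (metis (no_types, lifting) finite_Diff finite_lessThan sum.insert Diff_iff insertI1)
    also have "\<dots> = (\<Sum>b\<in>{..<l} - insert a S. ?s a S * (y a * (?s b (insert a S) * (y b * v (insert b (insert a S))))))"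
      by (auto simp: g_def insert_commute mult_ac intro!: sum.cong)
    finally show "?s a S * (y a * (\<Sum>b\<in>{..<l} - insert a S. ?s b (insert a S) * (y b * v (insert b (insert a S)))))
        = (\<Sum>b\<in>?A. g a b)" by (simp add: sum_distrib_left)
  qed
  moreover have "(\<Sum>a\<in>?A. \<Sum>b\<in>?A. g a b) = - (\<Sum>a\<in>?A. \<Sum>b\<in>?A. g a b)"
  proof -
    have "(\<Sum>a\<in>?A. \<Sum>b\<in>?A. g a b) = (\<Sum>b\<in>?A. \<Sum>a\<in>?A. g a b)" by (rule sum.swap)
    also have "\<dots> = (\<Sum>b\<in>?A. \<Sum>a\<in>?A. - g b a)" by (intro sum.cong refl anti)
    finally show ?thesis by (simp add: sum_negf)
  qed
  ultimately show ?thesis by simp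
qed

lemma koszul_d_add: "koszul_d l y (\<lambda>S. u S + v S) S = koszul_d l y u S + koszul_d l y v S"
  by (simp add: koszul_d_def algebra_simps sum.distrib)

lemma koszul_d_diff: "koszul_d l y (\<lambda>S. u S - v S) S = koszul_d l y u S - koszul_d l y v S"
  by (simp add: koszul_d_def algebra_simps sum_subtractf)

lemma koszul_d_cmult: "koszul_d l y (\<lambda>S. c * v S) S = c * koszul_d l y v S"
  by (simp add: koszul_d_def sum_distrib_left mult_ac)

lemma koszul_d_sum: "koszul_d l y (\<lambda>S. \<Sum>k\<in>K. v k S) S = (\<Sum>k\<in>K. koszul_d l y (v k) S)"
  unfolding koszul_d_def by (subst sum.swap) (simp add: sum_distrib_left)

lemma koszul_d_cong: 
  "S \<subseteq> {..<l} \<Longrightarrow> (\<And>T. T \<subseteq> {..<l} \<Longrightarrow> u T = v T) \<Longrightarrow> koszul_d l y u S = koszul_d l y v S"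
  unfolding koszul_d_def by (intro sum.cong refl) auto

section \<open>Summing the formal primitive in a chart\<close>

text \<open>
  A piece \<open>B\<close> of a chart on which the functions \<open>J\<^sub>a\<close> have bounded derivatives. The weight is \<open>q = \<bar>J\<bar>\<^sup>2\<close>, which is
  singular along the zero fibre, and \<open>X\<close> is the complement of the zero fibre.
\<close>

locale local_equations =
  fixes n :: nat and B :: "(nat \<Rightarrow> real) set" and l :: nat and J :: "nat \<Rightarrow> (nat \<Rightarrow> real) \<Rightarrow> real"
  assumes B: "eopen n B" and J: "\<And>a. a < l \<Longrightarrow> weighted_domain.sym_order n B (\<lambda>_. 1) 0 (J a)"
begin

definition q :: "(nat \<Rightarrow> real) \<Rightarrow> real" where "q x = (\<Sum>a<l. (J a x)\<^sup>2)"
definition X :: "(nat \<Rightarrow> real) set" where "X = {x \<in> B. q x > 0}"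

lemma q_nonneg: "q x \<ge> 0" by (auto simp: q_def intro: sum_nonneg)

lemma q_zero_iff: "q x = 0 \<longleftrightarrow> (\<forall>a<l. J a x = 0)"
  by (auto simp: q_def sum_nonneg_eq_0_iff)

sublocale B: weighted_domain n B "\<lambda>_. 1" by unfold_locales (auto simp: B)

lemma J_smooth: "a < l \<Longrightarrow> ck_on k n B (J a)"
  by (rule B.sym_order_smooth[OF J])

lemma q_smooth: "ck_on k n B q"
  unfolding q_def[abs_def] by (intro ck_on_sum ck_on_power B J_smooth) auto

lemma q_continuous: "continuous_on B q" by (rule ck_on_continuous[OF B q_smooth])

lemma eopen_superlevel: "eopen n {x \<in> B. q x > c}"
proof -
  have "openin (top_of_set B) (B \<inter> q -` {c<..})"
    using q_continuous by (rule continuous_openin_preimage_gen) auto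
  moreover have "{x \<in> B. q x > c} = B \<inter> q -` {c<..}" by auto
  ultimately show ?thesis
    using B by (subst Euclidean_space_top_of_set, subst (asm) (2) Euclidean_space_top_of_set) (auto intro: openin_trans)
qed

lemma eopen_sublevel: "eopen n {x \<in> B. q x < c}"
proof -
  have "openin (top_of_set B) (B \<inter> q -` {..<c})"
    using q_continuous by (rule continuous_openin_preimage_gen) auto
  moreover have "{x \<in> B. q x < c} = B \<inter> q -` {..<c}" by auto
  ultimately show ?thesis
    using B by (subst Euclidean_space_top_of_set, subst (asm) (2) Euclidean_space_top_of_set) (auto intro: openin_trans)
qed

sublocale X: weighted_domain n X q
  using eopen_superlevel[of 0] by unfold_locales (auto simp: X_def)

lemma X_subset: "X \<subseteq> B" by (auto simp: X_def)

lemma q_bounded: obtains Q where "Q > 0" "\<And>x. x \<in> X \<Longrightarrow> q x \<le> Q"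
proof -
  have "\<exists>C\<ge>0. \<forall>x\<in>B. \<bar>J a x\<bar> \<le> C" if "a < l" for a
    using B.sym_order_bound[OF J[OF that]] by simp
  then obtain C where C: "\<And>a. a < l \<Longrightarrow> C a \<ge> 0" "\<And>a x. a < l \<Longrightarrow> x \<in> B \<Longrightarrow> \<bar>J a x\<bar> \<le> C a" by metis
  show ?thesis
  proof
    show "0 < 1 + (\<Sum>a<l. (C a)\<^sup>2)" by (intro add_pos_nonneg sum_nonneg) auto
    fix x assume "x \<in> X"
    then have "x \<in> B" by (simp add: X_def)
    then have "q x \<le> (\<Sum>a<l. (C a)\<^sup>2)"
      unfolding q_def using C by (intro sum_mono) (metis abs_le_square_iff abs_of_nonneg lessThan_iff)
    then show "q x \<le> 1 + (\<Sum>a<l. (C a)\<^sup>2)" by simp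
  qed
qed

lemma order_bounded_smooth: "B.sym_order M f \<Longrightarrow> N \<le> 0 \<Longrightarrow> X.sym_order N f"
  using q_bounded X.bounded_smooth_order[OF B X_subset] by metis

lemma order_lower: "X.sym_order N h \<Longrightarrow> M \<le> N \<Longrightarrow> X.sym_order M h"
  using q_bounded X.sym_order_weaken by metis

text \<open>
  Only the function itself is small, its derivatives are merely bounded; for order \<open>1/2\<close> this suffices.
\<close>

lemma order_J: assumes a: "a < l" shows "X.sym_order (1/2) (J a)"
proof (rule X.sym_orderI[where D = 1])
  show "continuous_on X (J a)"
    using continuous_on_subset[OF ck_on_continuous[OF B J_smooth[OF a]] X_subset] .
  fix x
  have "(J a x)\<^sup>2 \<le> q x" unfolding q_def by (rule member_le_sum) (use a in auto)
  then have "sqrt ((J a x)\<^sup>2) \<le> sqrt (q x)" by (rule real_sqrt_le_mono)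
  then show "\<bar>J a x\<bar> \<le> 1 * q x powr (1/2)" using q_nonneg[of x] by (simp add: powr_half_sqrt)
next
  fix i assume i: "i < n"
  show "X.sym_order (1/2 - 1/2) (partial_deriv i (J a))"
    by (rule order_bounded_smooth[OF B.sym_order_partial_deriv(1)[OF J[OF a] i]]) simp
  show "has_pd (J a) i (partial_deriv i (J a) x) x" if "x \<in> X" for x
    using B.sym_order_partial_deriv(2)[OF J[OF a] i] that X_subset by blast
qed simp

lemma order_q: "X.sym_order 1 q"
proof -
  have "X.sym_order (1/2 + 1/2) (\<lambda>x. J a x * J a x)" if "a < l" for a
    by (rule X.sym_order_mult[OF order_J[OF that] order_J[OF that]])
  then have "X.sym_order 1 (\<lambda>x. \<Sum>a<l. J a x * J a x)" by (intro X.sym_order_sum) simp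
  moreover have "(\<Sum>a<l. J a x * J a x) = q x" for x by (simp add: q_def power2_eq_square)
  ultimately show ?thesis by simp
qed

lemma order_monomial: "m \<le> l \<Longrightarrow> X.sym_order (real (\<Sum>a<m. \<alpha> a) / 2) (\<lambda>x. \<Prod>a<m. J a x ^ \<alpha> a)"
proof (induction m)
  case 0
  then show ?case using X.sym_order_const[of 1] by simp
next
  case (Suc m)
  have p: "X.sym_order (real j / 2) (\<lambda>x. J m x ^ j)" for j
  proof (induction j)
    case 0
    then show ?case using X.sym_order_const[of 1] by simp
  next
    case (Suc j)
    have "X.sym_order (1/2 + real j / 2) (\<lambda>x. J m x * J m x ^ j)"
      by (rule X.sym_order_mult[OF order_J Suc]) (use Suc.prems \<open>Suc m \<le> l\<close> in simp)
    then show ?case by (simp add: add_divide_distrib)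
  qed
  have "X.sym_order (real (\<Sum>a<m. \<alpha> a) / 2 + real (\<alpha> m) / 2) (\<lambda>x. (\<Prod>a<m. J a x ^ \<alpha> a) * J m x ^ \<alpha> m)"
    by (rule X.sym_order_mult[OF Suc.IH p]) (use Suc.prems in simp)
  then show ?case by (simp add: add_divide_distrib)
qed

lemma order_form:
  assumes "\<And>\<alpha>. \<alpha> \<in> A \<Longrightarrow> (\<Sum>a<l. \<alpha> a) = k" "\<And>\<alpha>. \<alpha> \<in> A \<Longrightarrow> B.sym_order 0 (c \<alpha>)"
  shows "X.sym_order (real k / 2) (\<lambda>x. \<Sum>\<alpha>\<in>A. c \<alpha> x * (\<Prod>a<l. J a x ^ \<alpha> a))"
proof (rule X.sym_order_sum)
  fix \<alpha> assume a: "\<alpha> \<in> A"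
  have "X.sym_order (0 + real (\<Sum>a<l. \<alpha> a) / 2) (\<lambda>x. c \<alpha> x * (\<Prod>a<l. J a x ^ \<alpha> a))"
    by (rule X.sym_order_mult[OF order_bounded_smooth[OF assms(2)[OF a]] order_monomial]) auto
  then show "X.sym_order (real k / 2) (\<lambda>x. c \<alpha> x * (\<Prod>a<l. J a x ^ \<alpha> a))" using assms(1)[OF a] by simp
qed

lemma order_wedge:
  assumes S: "S \<subseteq> {..<l}" and v: "\<And>T. T \<subseteq> {..<l} \<Longrightarrow> X.sym_order N (v T)"
  shows "X.sym_order (N + 1/2) (\<lambda>x. koszul_wedge (\<lambda>a. J a x) (\<lambda>T. v T x) S)"
  unfolding koszul_wedge_def
proof (rule X.sym_order_sum)
  fix a assume a: "a \<in> S"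
  have "X.sym_order (1/2 + N) (\<lambda>x. J a x * v (S - {a}) x)"
    by (rule X.sym_order_mult[OF order_J v]) (use a S in auto)
  then show "X.sym_order (N + 1/2) (\<lambda>x. (-1) ^ inversions {a} (S - {a}) * (J a x * v (S - {a}) x))"
    unfolding add.commute[of N] by (rule X.sym_order_cmult)
qed

end

text \<open>
  The data of a formal primitive of \<open>f 0\<close>: each \<open>f k\<close> is a cycle of order \<open>k\<close> in \<open>J\<close> that differs from
  \<open>f (k + 1)\<close> by the boundary of \<open>W k\<close>. As \<open>W k\<close> comes from a form of degree \<open>k - 1\<close> in \<open>J\<close>, only \<open>W 1\<close> can be
  nonzero on the zero fibre.
\<close>

locale local_resolution = local_equations +
  fixes f W :: "nat \<Rightarrow> nat set \<Rightarrow> (nat \<Rightarrow> real) \<Rightarrow> real"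
  assumes f_order: "\<And>k S. S \<subseteq> {..<l} \<Longrightarrow> X.sym_order (real k / 2) (f k S)"
    and W_order: "\<And>k S. S \<subseteq> {..<l} \<Longrightarrow> X.sym_order ((real k - 1) / 2) (W k S)"
    and W_smooth: "\<And>k S. S \<subseteq> {..<l} \<Longrightarrow> smooth_in n B (W k S)"
    and W_zero: "\<And>k S x. S \<subseteq> {..<l} \<Longrightarrow> x \<in> B \<Longrightarrow> q x = 0 \<Longrightarrow> k \<noteq> 1 \<Longrightarrow> W k S x = 0"
    and f_zero: "\<And>S x. S \<subseteq> {..<l} \<Longrightarrow> x \<in> B \<Longrightarrow> q x = 0 \<Longrightarrow> f 0 S x = 0"
    and cycle: "\<And>k S x. S \<subseteq> {..<l} \<Longrightarrow> x \<in> B \<Longrightarrow> koszul_d l (\<lambda>a. J a x) (\<lambda>T. f k T x) S = 0"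
    and step: "\<And>k S x. S \<subseteq> {..<l} \<Longrightarrow> x \<in> B \<Longrightarrow>
      f k S x = koszul_d l (\<lambda>a. J a x) (\<lambda>T. W k T x) S + f (Suc k) S x"
begin

text \<open>
  The contraction \<open>s\<close> applied to \<open>f k\<close>.
\<close>

definition h :: "nat \<Rightarrow> nat set \<Rightarrow> (nat \<Rightarrow> real) \<Rightarrow> real" where
  "h k S x = inverse (q x) * koszul_wedge (\<lambda>a. J a x) (\<lambda>T. f k T x) S"

definition E :: "nat \<Rightarrow> nat set \<Rightarrow> (nat \<Rightarrow> real) \<Rightarrow> real" where
  "E k S x = W k S x - h k S x + h (Suc k) S x"

lemma h_order: assumes S: "S \<subseteq> {..<l}" shows "X.sym_order ((real k - 1) / 2) (h k S)"
proof -
  have *: "X.sym_order (-1 + (real k / 2 + 1/2)) (\<lambda>x. inverse (q x) * koszul_wedge (\<lambda>a. J a x) (\<lambda>T. f k T x) S)"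
    by (rule X.sym_order_mult[OF X.sym_order_inverse_weight[OF order_q] order_wedge[OF S f_order]])
  have eq: "-1 + (real k / 2 + 1/2) = (real k - 1) / 2" by (simp add: field_simps)
  show ?thesis using * unfolding h_def[abs_def] eq .
qed

lemma E_order: assumes S: "S \<subseteq> {..<l}" shows "X.sym_order ((real k - 1) / 2) (E k S)"
  unfolding E_def[abs_def]
proof (rule X.sym_order_add[OF X.sym_order_diff[OF W_order[OF S] h_order[OF S]]])
  show "X.sym_order ((real k - 1) / 2) (h (Suc k) S)" by (rule order_lower[OF h_order[OF S]]) simp
qed

lemma d_h:
  assumes S: "S \<subseteq> {..<l}" and x: "x \<in> X"
  shows "koszul_d l (\<lambda>a. J a x) (\<lambda>T. h k T x) S = f k S x"
proof -
  have xB: "x \<in> B" and qx: "q x > 0" using x by (auto simp: X_def)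
  let ?y = "\<lambda>a. J a x" and ?v = "\<lambda>T. f k T x"
  have "koszul_wedge ?y (koszul_d l ?y ?v) S = 0"
    unfolding koszul_wedge_def
  proof (intro sum.neutral ballI)
    fix a assume "a \<in> S"
    then have "S - {a} \<subseteq> {..<l}" using S by blast
    then show "(-1) ^ inversions {a} (S - {a}) * (?y a * koszul_d l ?y ?v (S - {a})) = 0"
      using cycle[OF _ xB] by simp
  qed
  then have "koszul_d l ?y (koszul_wedge ?y ?v) S = q x * f k S x"
    using koszul_d_wedge[OF S, of ?y ?v] by (simp add: q_def)
  then show ?thesis unfolding h_def koszul_d_cmult using qx by (simp add: field_simps)
qed

lemma d_E: "S \<subseteq> {..<l} \<Longrightarrow> x \<in> X \<Longrightarrow> koszul_d l (\<lambda>a. J a x) (\<lambda>T. E k T x) S = 0"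
  unfolding E_def koszul_d_add koszul_d_diff using d_h step[of S x k] by (simp add: X_def)

text \<open>
  The function \<open>E k\<close> has order \<open>(k - 1)/2\<close>. When \<open>j + 4 \<le> k\<close> this exceeds \<open>1 + j/2\<close>, the order that makes
  \<open>j\<close> derivatives extend across the zero fibre, by at least \<open>1/2\<close>; so cutting off at scale \<open>\<epsilon>\<close>
  produces a factor \<open>\<epsilon>\<^bsup>1/2\<^esup>\<close>, which can be made to beat any constant. The bound \<open>1/(k + 1)\<close> forces \<open>\<epsilon>\<^sub>k \<rightarrow> 0\<close>
  and hence local finiteness off the zero fibre.
\<close>

lemma exists_scales:
  obtains \<epsilon> where "\<And>k. \<epsilon> k > 0" "\<And>k. \<epsilon> k \<le> 1 / (real k + 1)"
    "\<And>k j S. S \<subseteq> {..<l} \<Longrightarrow> k \<ge> j + 4 \<Longrightarrow>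
       X.symb j (1 + real j / 2) ((1/2) ^ k) (\<lambda>x. cutoff (q x / \<epsilon> k) * E k S x)"
proof -
  have "\<exists>e>0. e \<le> 1 / (real k + 1) \<and> (\<forall>j S. S \<subseteq> {..<l} \<longrightarrow> k \<ge> j + 4 \<longrightarrow>
       X.symb j (1 + real j / 2) ((1/2) ^ k) (\<lambda>x. cutoff (q x / e) * E k S x))" for k
  proof -
    obtain C1 where C1: "C1 \<ge> 0" "\<And>e. e > 0 \<Longrightarrow> X.symb k 0 C1 (\<lambda>x. cutoff (q x / e))"
      using X.cutoff_symb_uniform[OF order_q, of cutoff k] ck_real_cutoff cutoff_eq_0 by (auto simp: less_imp_le)
    have "\<exists>D\<ge>0. X.symb k ((real k - 1) / 2) D (E k S)" if "S \<in> Pow {..<l}" for S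
      using E_order that unfolding X.sym_order_def by blast
    then obtain D where D: "\<And>S. S \<in> Pow {..<l} \<Longrightarrow> D S \<ge> 0"
        "\<And>S. S \<in> Pow {..<l} \<Longrightarrow> X.symb k ((real k - 1) / 2) (D S) (E k S)" by metis
    define C2 where "C2 = (\<Sum>S\<in>Pow {..<l}. D S)"
    have DC: "D S \<le> C2" if "S \<in> Pow {..<l}" for S
      unfolding C2_def by (rule member_le_sum) (use that D(1) in auto)
    have C2: "C2 \<ge> 0" unfolding C2_def by (rule sum_nonneg) (rule D(1))
    define C where "C = 2 ^ k * C1 * C2"
    have C: "C \<ge> 0" using C1 C2 by (simp add: C_def)
    \<comment> \<open>Chosen so that \<open>C e\<^bsup>1/2\<^esup> \<le> 2\<^sup>-\<^sup>k\<close>.\<close>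
    define e where "e = min (1 / (real k + 1)) (((1/2) ^ k / (C + 1))\<^sup>2)"
    have e: "e > 0" "e \<le> 1 / (real k + 1)" using C by (auto simp: e_def)
    have "1 / (real k + 1) \<le> 1" by simp
    then have e1: "e \<le> 1" using e(2) by linarith
    have "sqrt e \<le> (1/2) ^ k / (C + 1)"
      using C by (intro real_le_lsqrt) (auto simp: e_def)
    then have Ce: "C * e powr (1/2) \<le> (1/2) ^ k"
    proof -
      have "C * sqrt e \<le> C * ((1/2) ^ k / (C + 1))" using \<open>sqrt e \<le> _\<close> C by (rule mult_left_mono)
      also have "\<dots> = (1/2) ^ k * (C / (C + 1))" by simp
      also have "\<dots> \<le> (1/2) ^ k * 1" using C by (intro mult_left_mono) auto
      finally show ?thesis using e(1) by (simp add: powr_half_sqrt)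
    qed
    have "X.symb j (1 + real j / 2) ((1/2) ^ k) (\<lambda>x. cutoff (q x / e) * E k S x)"
      if S: "S \<subseteq> {..<l}" and jk: "k \<ge> j + 4" for j S
    proof -
      let ?g = "\<lambda>x. cutoff (q x / e) * E k S x"
      have "X.symb k ((real k - 1) / 2) C2 (E k S)" using X.symb_mono[OF D(2) DC] S by blast
      from X.symb_mult[OF C1(2)[OF e(1)] this C1(1) C2] have "X.symb k ((real k - 1) / 2) C ?g"
        by (simp add: C_def)
      then have 1: "X.symb j ((real k - 1) / 2) C ?g" using X.symb_le[of j k] jk by simp
      define d where "d = (real k - 1) / 2 - (1 + real j / 2)"
      have d: "d \<ge> 1/2" using jk by (simp add: d_def field_simps)
      have "X.symb j ((real k - 1) / 2 - d) (C * e powr d) ?g"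
      proof (rule X.symb_shrink[OF _ e(1) _ C 1])
        show "continuous_on X q" using continuous_on_subset[OF q_continuous X_subset] .
        show "d \<ge> 0" using d by simp
        show "?g x = 0" if "q x > e" for x using that e(1) cutoff_eq_0[of "q x / e"] by simp
      qed
      moreover have "C * e powr d \<le> (1/2) ^ k"
      proof -
        have "e powr d \<le> e powr (1/2)" using powr_mono'[of "1/2" d e] d e(1) e1 by simp
        then show ?thesis using mult_left_mono[OF _ C] Ce by fastforce
      qed
      ultimately show ?thesis using X.symb_mono by (simp add: d_def)
    qed
    then show ?thesis using e by blast
  qed
  then have "\<forall>k. \<exists>e>0. e \<le> 1 / (real k + 1) \<and> (\<forall>j S. S \<subseteq> {..<l} \<longrightarrow> k \<ge> j + 4 \<longrightarrow>
       X.symb j (1 + real j / 2) ((1/2) ^ k) (\<lambda>x. cutoff (q x / e) * E k S x))" by blast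
  from choice[OF this] obtain \<epsilon> where "\<forall>k. \<epsilon> k > 0 \<and> \<epsilon> k \<le> 1 / (real k + 1) \<and>
     (\<forall>j S. S \<subseteq> {..<l} \<longrightarrow> k \<ge> j + 4 \<longrightarrow>
       X.symb j (1 + real j / 2) ((1/2) ^ k) (\<lambda>x. cutoff (q x / \<epsilon> k) * E k S x))" by blast
  then show ?thesis by (intro that[of \<epsilon>]) auto
qed

text \<open>
  Off the zero fibre the series is locally finite, and it is a primitive since the \<open>E k\<close> are cycles. To see
  \<open>j\<close> derivatives on the zero fibre, stay so close to it that the first \<open>m = j + 4\<close> cutoffs are \<open>1\<close>; there the
  partial sum telescopes, and what remains has order \<open>1 + j/2\<close>. On the zero fibre all that survives of
  the telescoped sum is \<open>W 1\<close>.
\<close>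

theorem local_primitive:
  "\<exists>\<eta>. \<forall>S\<subseteq>{..<l}. smooth_in n B (\<eta> S) \<and>
     (\<forall>x\<in>B. koszul_d l (\<lambda>a. J a x) (\<lambda>T. \<eta> T x) S = f 0 S x)"
proof -
  obtain \<epsilon> where e: "\<And>k. \<epsilon> k > 0" "\<And>k. \<epsilon> k \<le> 1 / (real k + 1)"
    "\<And>k j S. S \<subseteq> {..<l} \<Longrightarrow> k \<ge> j + 4 \<Longrightarrow>
       X.symb j (1 + real j / 2) ((1/2) ^ k) (\<lambda>x. cutoff (q x / \<epsilon> k) * E k S x)" by (rule exists_scales) blast
  define G where "G k S x = cutoff (q x / \<epsilon> k) * E k S x" for k S x
  note eG = e(3)[folded G_def]
  have G0: "G k S x = 0" if "q x > 1 / (real k + 1)" for k S x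
    using that e(1,2)[of k] cutoff_eq_0[of "q x / \<epsilon> k"] by (simp add: G_def)
  have G0': "G k S x = 0" if "q x > d" "d > 0" "k \<ge> nat \<lceil>1 / d\<rceil>" for k S x d
  proof (rule G0)
    have "1 / d \<le> real k" using that(3) by linarith
    then have "1 / (real k + 1) \<le> d" using that(2) by (simp add: field_simps)
    then show "q x > 1 / (real k + 1)" using that(1) by linarith
  qed
  define \<eta> where "\<eta> S x = (if q x > 0 then h 0 S x + (\<Sum>k. G k S x) else W 1 S x)" for S x
  have fin: "(\<Sum>k. G k S x) = (\<Sum>k<K. G k S x)" if "q x > d" "d > 0" "K \<ge> nat \<lceil>1 / d\<rceil>" for S x d K
    by (rule suminf_finite) (use G0'[OF that(1,2)] that(3) in auto)
  have tail: "(\<Sum>k. G (k + m) S x) = (\<Sum>k\<in>{m..<K}. G k S x)" if "q x > d" "d > 0" "K \<ge> nat \<lceil>1 / d\<rceil>" "K \<ge> m" for S x d K m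
  proof -
    have "(\<Sum>k. G (k + m) S x) = (\<Sum>k\<in>{..<K - m}. G (k + m) S x)"
      by (rule suminf_finite) (use G0'[OF that(1,2)] that(3) in auto)
    also have "\<dots> = (\<Sum>k\<in>{m..<K}. G k S x)"
      by (rule sum.reindex_bij_witness[of _ "\<lambda>k. k - m" "\<lambda>k. k + m"]) (use that(4) in auto)
    finally show ?thesis .
  qed
  have hsm: "ck_on j n X (h k S)" and Gsm: "ck_on j n X (G k S)" if S: "S \<subseteq> {..<l}" for j k S
  proof -
    show "ck_on j n X (h k S)" by (rule X.sym_order_smooth[OF h_order[OF S]])
    have "ck_on j n X (\<lambda>x. cutoff (inverse (\<epsilon> k) * q x) * E k S x)"
      by (rule ck_on_mult[OF X.X ck_on_comp1[OF X.X ck_real_cutoff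
            ck_on_cmult[OF X.X ck_on_subset[OF B X.X X_subset q_smooth]]] X.sym_order_smooth[OF E_order[OF S]]])
    then show "ck_on j n X (G k S)" unfolding G_def[abs_def] by (simp add: divide_inverse mult.commute)
  qed
  have "koszul_d l (\<lambda>a. J a x) (\<lambda>T. \<eta> T x) S = f 0 S x" if S: "S \<subseteq> {..<l}" and x: "x \<in> B" for S x
  proof (cases "q x > 0")
    case True
    then have xX: "x \<in> X" using x by (simp add: X_def)
    define K where "K = nat \<lceil>1 / (q x / 2)\<rceil>"
    have sumK: "(\<Sum>k. G k T x) = (\<Sum>k<K. G k T x)" for T
      by (rule fin[of "q x / 2"]) (use True in \<open>auto simp: K_def\<close>)
    have "koszul_d l (\<lambda>a. J a x) (\<lambda>T. \<eta> T x) S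
        = koszul_d l (\<lambda>a. J a x) (\<lambda>T. h 0 T x + (\<Sum>k<K. cutoff (q x / \<epsilon> k) * E k T x)) S"
      using True sumK by (simp add: \<eta>_def G_def)
    also have "\<dots> = f 0 S x"
      unfolding koszul_d_add koszul_d_sum koszul_d_cmult using d_h[OF S xX] d_E[OF S xX] by simp
    finally show ?thesis .
  next
    case False
    then have z: "q x = 0" using q_nonneg[of x] by simp
    then show ?thesis using f_zero[OF S x z] q_zero_iff[of x] by (simp add: koszul_d_def)
  qed
  moreover have "ck_on j n B (\<eta> S)" if S: "S \<subseteq> {..<l}" for j S
  proof -
    define m where "m = j + 4"
    \<comment> \<open>Where \<open>q < \<delta>\<close>, the first \<open>m\<close> cutoffs are equal to \<open>1\<close>.\<close>
    define \<delta> where "\<delta> = Min (\<epsilon> ` {..<m}) / 2"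
    have \<delta>: "\<delta> > 0" "\<And>k. k < m \<Longrightarrow> \<delta> \<le> \<epsilon> k / 2"
    proof -
      have ne: "\<epsilon> ` {..<m} \<noteq> {}" by (auto simp: m_def lessThan_empty_iff)
      show "\<delta> > 0" unfolding \<delta>_def using ne e(1) by (subst zero_less_divide_iff) auto
      show "\<delta> \<le> \<epsilon> k / 2" if "k < m" for k unfolding \<delta>_def using that by (intro divide_right_mono Min_le) auto
    qed
    define T where "T x = h m S x + (\<Sum>k. G (k + m) S x)" for x
    obtain C where C: "C \<ge> 0" "X.symb j (1 + real j / 2) C (h m S)"
    proof -
      have "X.sym_order (1 + real j / 2) (h m S)"
        by (rule order_lower[OF h_order[OF S]]) (simp add: m_def field_simps)
      then show ?thesis using that unfolding X.sym_order_def by blast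
    qed
    \<comment> \<open>The constant \<open>2\<close> is \<open>\<Sum>2\<^sup>-\<^sup>k\<close>; it does not depend on the number of terms present near a point.\<close>
    have Tsymb: "X.symb j (1 + real j / 2) (C + 2) T"
    proof (rule symb_local[OF X.weighted_domain_axioms])
      fix x assume x: "x \<in> X"
      define d where "d = q x / 2"
      define V where "V = {x \<in> B. q x > d}"
      have d: "d > 0" using x by (simp add: d_def X_def)
      have V: "eopen n V" "x \<in> V" "V \<subseteq> X"
        using x d eopen_superlevel[of d] by (auto simp: V_def X_def d_def)
      interpret V: weighted_domain n V q using V X.q_pos by unfold_locales auto
      define K where "K = max m (nat \<lceil>1 / d\<rceil>)"
      have eq: "T y = h m S y + (\<Sum>k\<in>{m..<K}. G k S y)" if "y \<in> V" for y
        unfolding T_def using tail[of d y K m S] that d by (simp add: V_def K_def)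
      note sub = symb_subset[OF X.weighted_domain_axioms V(1,3)]
      have "V.symb j (1 + real j / 2) (C + (\<Sum>k\<in>{m..<K}. (1/2) ^ k)) (\<lambda>y. h m S y + (\<Sum>k\<in>{m..<K}. G k S y))"
        by (intro V.symb_add V.symb_sum sub C(2) eG[OF S]) (auto simp: m_def)
      then have 1: "V.symb j (1 + real j / 2) (C + (\<Sum>k\<in>{m..<K}. (1/2) ^ k)) T"
        using V.symb_cong[of T "\<lambda>y. h m S y + (\<Sum>k\<in>{m..<K}. G k S y)"] eq by blast
      have "(\<Sum>k\<in>{m..<K}. (1/2::real) ^ k) \<le> (\<Sum>k<K. (1/2) ^ k)" by (rule sum_mono2) auto
      also have "\<dots> \<le> (\<Sum>k. (1/2) ^ k)" by (rule sum_le_suminf) auto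
      also have "\<dots> = 2" by (subst suminf_geometric) auto
      finally have "V.symb j (1 + real j / 2) (C + 2) T" by (intro V.symb_mono[OF 1]) simp
      then show "\<exists>V. eopen n V \<and> x \<in> V \<and> V \<subseteq> X \<and> weighted_domain.symb n V q j (1 + real j / 2) (C + 2) T"
        using V by blast
    qed
    have ext: "ck_on j n B (\<lambda>x. if q x > 0 then T x else 0)"
      by (rule ck_on_extend_by_zero[OF B q_smooth, folded X_def, OF _ X.weighted_domain_axioms _ Tsymb])
        (use C q_nonneg in auto)
    define U where "U = {x \<in> B. q x < \<delta>}"
    have U: "eopen n U" "U \<subseteq> B" using eopen_sublevel[of \<delta>] by (auto simp: U_def)
    have near: "\<eta> S x = (\<Sum>k<m. W k S x) + (if q x > 0 then T x else 0)" if x: "x \<in> U" for x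
    proof (cases "q x > 0")
      case True
      have "G k S x = W k S x - h k S x + h (Suc k) S x" if "k < m" for k
      proof -
        have "q x < \<epsilon> k / 2" using \<delta>(2)[OF that] x by (simp add: U_def)
        then have "q x / \<epsilon> k \<le> 1/2" using e(1)[of k] by (simp add: field_simps)
        then show ?thesis using cutoff_eq_1 by (simp add: G_def E_def)
      qed
      then have "(\<Sum>k<m. G k S x) = (\<Sum>k<m. W k S x) + (\<Sum>k<m. h (Suc k) S x - h k S x)"
        unfolding sum.distrib[symmetric] by (intro sum.cong) auto
      also have "(\<Sum>k<m. h (Suc k) S x - h k S x) = h m S x - h 0 S x" by (rule sum_lessThan_telescope)
      finally have 1: "(\<Sum>k<m. G k S x) = (\<Sum>k<m. W k S x) + h m S x - h 0 S x" by simp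
      define K where "K = max m (nat \<lceil>1 / (q x / 2)\<rceil>)"
      have "(\<Sum>k. G k S x) = (\<Sum>k<K. G k S x)" by (rule fin[of "q x / 2"]) (use True in \<open>auto simp: K_def\<close>)
      also have "\<dots> = (\<Sum>k<m. G k S x) + (\<Sum>k\<in>{m..<K}. G k S x)"
        by (metis K_def atLeast0LessThan le0 max.cobounded1 sum.atLeastLessThan_concat)
      also have "(\<Sum>k\<in>{m..<K}. G k S x) = (\<Sum>k. G (k + m) S x)"
        by (rule tail[of "q x / 2", symmetric]) (use True in \<open>auto simp: K_def\<close>)
      finally show ?thesis using True 1 by (simp add: \<eta>_def T_def)
    next
      case False
      then have z: "q x = 0" using q_nonneg[of x] by simp
      have "(\<Sum>k<m. W k S x) = (\<Sum>k\<in>{1}. W k S x)"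
        by (rule sum.mono_neutral_right) (use W_zero[OF S _ z] x in \<open>auto simp: m_def U_def\<close>)
      then show ?thesis using False by (simp add: \<eta>_def)
    qed
    show ?thesis
    proof (rule ck_on_local[OF B])
      fix x assume x: "x \<in> B"
      show "\<exists>V. eopen n V \<and> x \<in> V \<and> V \<subseteq> B \<and> ck_on j n V (\<eta> S)"
      proof (cases "q x > 0")
        case True
        define d where "d = q x / 2"
        define V where "V = {x \<in> B. q x > d}"
        have d: "d > 0" using True by (simp add: d_def)
        have V: "eopen n V" "x \<in> V" "V \<subseteq> B" "V \<subseteq> X"
          using x d eopen_superlevel[of d] by (auto simp: V_def X_def d_def)
        define K where "K = nat \<lceil>1 / d\<rceil>"
        have eq: "\<eta> S y = h 0 S y + (\<Sum>k<K. G k S y)" if "y \<in> V" for y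
          unfolding \<eta>_def using fin[of d y K S] that d by (simp add: V_def K_def)
        have "ck_on j n V (\<lambda>y. h 0 S y + (\<Sum>k<K. G k S y))"
          by (intro ck_on_add ck_on_sum V(1) ck_on_subset[OF X.X V(1,4)] hsm Gsm S)
        then have "ck_on j n V (\<eta> S)"
          using ck_on_cong[OF V(1), of "\<eta> S" "\<lambda>y. h 0 S y + (\<Sum>k<K. G k S y)"] eq by blast
        then show ?thesis using V by blast
      next
        case False
        then have xU: "x \<in> U" using x \<delta>(1) q_nonneg[of x] by (simp add: U_def)
        have "ck_on j n U (\<lambda>y. (\<Sum>k<m. W k S y) + (if q y > 0 then T y else 0))"
          by (intro ck_on_add ck_on_sum U(1) ck_on_subset[OF B U] ext)
            (use W_smooth[OF S] in \<open>auto simp: smooth_in_def simp del: ck_on.simps\<close>)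
        then have "ck_on j n U (\<eta> S)"
          using ck_on_cong[OF U(1), of "\<eta> S" "\<lambda>y. (\<Sum>k<m. W k S y) + (if q y > 0 then T y else 0)"] near by blast
        then show ?thesis using U xU by blast
      qed
    qed
  qed
  ultimately show ?thesis unfolding smooth_in_def by blast
qed

end

section \<open>Smooth functions on an analytic manifold\<close>

text \<open>
  Smoothness of a function regardless of its values off the manifold, so that functions can be written without
  restricting them.
\<close>

definition smooth_fun :: "'m manifold \<Rightarrow> ('m \<Rightarrow> real) \<Rightarrow> bool" where
  "smooth_fun M h \<longleftrightarrow> (\<forall>(U, \<phi>)\<in>matlas M. smooth_in (mdim M) (\<phi> ` U) (\<lambda>y. h (inv_into U \<phi> y)))"

lemma smooth_functions_iff: "f \<in> smooth_functions M \<longleftrightarrow> f \<in> extensional (points M) \<and> smooth_fun M f"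
  by (auto simp: smooth_functions_def smooth_fun_def)

locale analytic_manifold =
  fixes M :: "'m manifold" assumes manifold: "real_analytic_manifold M"
begin

abbreviation "dm \<equiv> mdim M"

lemma chart_facts:
  assumes "(U, \<phi>) \<in> matlas M"
  shows "openin (mtop M) U" "eopen dm (\<phi> ` U)" "inj_on \<phi> U" "U \<subseteq> points M"
    "homeomorphic_map (subtopology (mtop M) U) (subtopology (Euclidean_space dm) (\<phi> ` U)) \<phi>"
proof -
  have c: "chart (mtop M) dm U \<phi>" using manifold assms by (auto simp: real_analytic_manifold_def)
  then show 1: "openin (mtop M) U" "eopen dm (\<phi> ` U)"
    and 5: "homeomorphic_map (subtopology (mtop M) U) (subtopology (Euclidean_space dm) (\<phi> ` U)) \<phi>"
    by (auto simp: chart_def)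
  show "U \<subseteq> points M" using 1 openin_subset by blast
  then have "topspace (subtopology (mtop M) U) = U" by auto
  then show "inj_on \<phi> U" using 5 homeomorphic_imp_injective_map by metis
qed

lemma chart_at:
  assumes "m \<in> points M" obtains U \<phi> where "(U, \<phi>) \<in> matlas M" "m \<in> U"
proof -
  have "(\<Union>(U, \<phi>)\<in>matlas M. U) = points M" using manifold unfolding real_analytic_manifold_def by blast
  then have "m \<in> (\<Union>(U, \<phi>)\<in>matlas M. U)" using assms by simp
  then show ?thesis using that by auto
qed

lemma openin_chart_preimage:
  assumes c: "(U, \<phi>) \<in> matlas M" and V: "eopen dm V"
  shows "openin (mtop M) {m \<in> U. \<phi> m \<in> V}"
proof -
  have "continuous_map (subtopology (mtop M) U) (Euclidean_space dm) \<phi>"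
    using chart_facts(5)[OF c] homeomorphic_imp_continuous_map continuous_map_in_subtopology by blast
  from openin_continuous_map_preimage[OF this V]
  have "openin (subtopology (mtop M) U) {m \<in> U. \<phi> m \<in> V}"
    using chart_facts(4)[OF c] by (simp add: Int_absorb1 topspace_subtopology)
  then show ?thesis using chart_facts(1)[OF c] openin_trans_full by blast
qed

lemma eopen_chart_image:
  assumes c: "(U, \<phi>) \<in> matlas M" and "openin (mtop M) Q" "Q \<subseteq> U"
  shows "eopen dm (\<phi> ` Q)"
proof -
  have "openin (subtopology (mtop M) U) Q" using assms by (simp add: openin_open_subtopology chart_facts(1)[OF c])
  then have "openin (subtopology (Euclidean_space dm) (\<phi> ` U)) (\<phi> ` Q)"
    using chart_facts(5)[OF c] homeomorphic_imp_open_map open_map_def by blast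
  then show ?thesis using chart_facts(2)[OF c] openin_trans_full by blast
qed

lemma transition_smooth:
  assumes "(U, \<phi>) \<in> matlas M" "(V, \<psi>) \<in> matlas M" "i < dm"
  shows "ck_on k dm (\<phi> ` (U \<inter> V)) (\<lambda>y. \<psi> (inv_into U \<phi> y) i)"
proof (rule real_analytic_imp_ck_on)
  show "real_analytic dm (\<phi> ` (U \<inter> V)) (\<lambda>y. \<psi> (inv_into U \<phi> y) i)"
  proof -
    have "\<forall>(U, \<phi>)\<in>matlas M. \<forall>(V, \<psi>)\<in>matlas M. \<forall>i<dm. real_analytic dm (\<phi> ` (U \<inter> V)) (\<lambda>y. \<psi> (inv_into U \<phi> y) i)"
      using manifold unfolding real_analytic_manifold_def by (elim conjE)
    from bspec[OF this assms(1)] have "\<forall>(V, \<psi>)\<in>matlas M. \<forall>i<dm. real_analytic dm (\<phi> ` (U \<inter> V)) (\<lambda>y. \<psi> (inv_into U \<phi> y) i)"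
      by simp
    from bspec[OF this assms(2)] show ?thesis using assms(3) by simp
  qed
  show "eopen dm (\<phi> ` (U \<inter> V))"
    by (rule eopen_chart_image[OF assms(1)]) (use chart_facts(1) assms in auto)
qed

text \<open>
  It is enough to test smoothness at each point in one chart, because the transition maps are analytic and
  therefore smooth.
\<close>

lemma smooth_fun_by_charts:
  assumes "\<And>m. m \<in> points M \<Longrightarrow> \<exists>U \<phi> V. (U, \<phi>) \<in> matlas M \<and> m \<in> U \<and> eopen dm V \<and> V \<subseteq> \<phi> ` U \<and>
      \<phi> m \<in> V \<and> smooth_in dm V (\<lambda>y. h (inv_into U \<phi> y))"
  shows "smooth_fun M h"
proof -
  have "ck_on k dm (\<psi> ` U') (\<lambda>y. h (inv_into U' \<psi> y))" if c': "(U', \<psi>) \<in> matlas M" for U' \<psi> k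
  proof (rule ck_on_local[OF chart_facts(2)[OF c']])
    fix y assume "y \<in> \<psi> ` U'"
    then obtain m where m: "m \<in> U'" "y = \<psi> m" by blast
    then have "m \<in> points M" using chart_facts(4)[OF c'] by blast
    then obtain U \<phi> V where c: "(U, \<phi>) \<in> matlas M" "m \<in> U" "eopen dm V" "V \<subseteq> \<phi> ` U"
        "\<phi> m \<in> V" "smooth_in dm V (\<lambda>y. h (inv_into U \<phi> y))" using assms by meson
    define Q where "Q = U' \<inter> {x \<in> U. \<phi> x \<in> V}"
    have Q: "openin (mtop M) Q" "Q \<subseteq> U'" "m \<in> Q"
      using openin_chart_preimage[OF c(1,3)] chart_facts(1)[OF c'] c m by (auto simp: Q_def)
    note V' = eopen_chart_image[OF c' Q(1,2)]
    have inv: "inv_into U' \<psi> (\<psi> x) = x" if "x \<in> U'" for x using chart_facts(3)[OF c'] that by simp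
    have inv2: "inv_into U \<phi> (\<phi> x) = x" if "x \<in> U" for x using chart_facts(3)[OF c(1)] that by simp
    have tr: "ck_on k dm (\<psi> ` Q) (\<lambda>y. \<phi> (inv_into U' \<psi> y) j)" if "j < dm" for j
      by (rule ck_on_subset[OF _ V' _ transition_smooth[OF c' c(1) that]])
        (use eopen_chart_image[OF c', of "U' \<inter> U"] chart_facts(1) c' c(1) in \<open>auto simp: Q_def\<close>)
    have "ck_on k dm (\<psi> ` Q) (\<lambda>y. h (inv_into U \<phi> (\<phi> (inv_into U' \<psi> y))))"
      by (rule ck_on_comp[where F = "\<lambda>y. \<phi> (inv_into U' \<psi> y)" and h = "\<lambda>y. h (inv_into U \<phi> y)", OF V' c(3) _ tr])
        (use c(6) inv in \<open>auto simp: Q_def smooth_in_def\<close>)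
    then have "ck_on k dm (\<psi> ` Q) (\<lambda>y. h (inv_into U' \<psi> y))"
      by (subst ck_on_cong[OF V', where g = "\<lambda>y. h (inv_into U \<phi> (\<phi> (inv_into U' \<psi> y)))"])
        (auto simp: inv inv2 Q_def)
    then show "\<exists>V. eopen dm V \<and> y \<in> V \<and> V \<subseteq> \<psi> ` U' \<and> ck_on k dm V (\<lambda>y. h (inv_into U' \<psi> y))"
      using V' Q m by blast
  qed
  then show ?thesis unfolding smooth_fun_def smooth_in_def by blast
qed

lemma smooth_fun_chart: "smooth_fun M h \<Longrightarrow> (U, \<phi>) \<in> matlas M \<Longrightarrow> smooth_in dm (\<phi> ` U) (\<lambda>y. h (inv_into U \<phi> y))"
  unfolding smooth_fun_def by blast

lemma smooth_fun_local:
  assumes "\<And>m. m \<in> points M \<Longrightarrow> \<exists>Q g. openin (mtop M) Q \<and> m \<in> Q \<and> smooth_fun M g \<and> (\<forall>x\<in>Q. h x = g x)"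
  shows "smooth_fun M h"
proof (rule smooth_fun_by_charts)
  fix m assume m: "m \<in> points M"
  obtain Q g where Q: "openin (mtop M) Q" "m \<in> Q" "smooth_fun M g" "\<And>x. x \<in> Q \<Longrightarrow> h x = g x"
    using assms[OF m] by blast
  obtain U \<phi> where c: "(U, \<phi>) \<in> matlas M" "m \<in> U" using chart_at[OF m] .
  have V: "eopen dm (\<phi> ` (Q \<inter> U))"
    by (rule eopen_chart_image[OF c(1)]) (use Q chart_facts(1)[OF c(1)] in auto)
  have eq: "h (inv_into U \<phi> y) = g (inv_into U \<phi> y)" if "y \<in> \<phi> ` (Q \<inter> U)" for y
    using that chart_facts(3)[OF c(1)] Q(4) by auto
  have "ck_on k dm (\<phi> ` (Q \<inter> U)) (\<lambda>y. g (inv_into U \<phi> y))" for k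
    by (rule ck_on_subset[OF chart_facts(2)[OF c(1)] V])
      (use smooth_fun_chart[OF Q(3) c(1)] in \<open>auto simp: smooth_in_def\<close>)
  then have "smooth_in dm (\<phi> ` (Q \<inter> U)) (\<lambda>y. h (inv_into U \<phi> y))"
    unfolding smooth_in_def using ck_on_cong[OF V, of "\<lambda>y. h (inv_into U \<phi> y)" "\<lambda>y. g (inv_into U \<phi> y)"] eq by blast
  then show "\<exists>U \<phi> V. (U, \<phi>) \<in> matlas M \<and> m \<in> U \<and> eopen dm V \<and> V \<subseteq> \<phi> ` U \<and>
      \<phi> m \<in> V \<and> smooth_in dm V (\<lambda>y. h (inv_into U \<phi> y))"
    using c V Q(2) by (intro exI[of _ U] exI[of _ \<phi>] exI[of _ "\<phi> ` (Q \<inter> U)"]) auto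
qed

lemma smooth_fun_cong:
  assumes "smooth_fun M g" "\<And>x. x \<in> points M \<Longrightarrow> h x = g x" shows "smooth_fun M h"
proof (rule smooth_fun_local)
  fix m assume "m \<in> points M"
  then show "\<exists>Q g. openin (mtop M) Q \<and> m \<in> Q \<and> smooth_fun M g \<and> (\<forall>x\<in>Q. h x = g x)"
    using assms by (intro exI[of _ "points M"] exI[of _ g]) auto
qed

lemma smooth_funI:
  "(\<And>U \<phi> k. (U, \<phi>) \<in> matlas M \<Longrightarrow> ck_on k dm (\<phi> ` U) (\<lambda>y. h (inv_into U \<phi> y))) \<Longrightarrow> smooth_fun M h"
  unfolding smooth_fun_def smooth_in_def by blast

lemma smooth_fun_ck_on:
  "smooth_fun M h \<Longrightarrow> (U, \<phi>) \<in> matlas M \<Longrightarrow> ck_on k dm (\<phi> ` U) (\<lambda>y. h (inv_into U \<phi> y))"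
  unfolding smooth_fun_def smooth_in_def by blast

lemma smooth_fun_const: "smooth_fun M (\<lambda>x. c)"
  by (rule smooth_funI) (rule ck_on_const[OF chart_facts(2)])

lemma smooth_fun_add:
  assumes "smooth_fun M f" "smooth_fun M g" shows "smooth_fun M (\<lambda>x. f x + g x)"
  by (rule smooth_funI) (rule ck_on_add[OF chart_facts(2) smooth_fun_ck_on[OF assms(1)] smooth_fun_ck_on[OF assms(2)]])

lemma smooth_fun_mult:
  assumes "smooth_fun M f" "smooth_fun M g" shows "smooth_fun M (\<lambda>x. f x * g x)"
  by (rule smooth_funI) (rule ck_on_mult[OF chart_facts(2) smooth_fun_ck_on[OF assms(1)] smooth_fun_ck_on[OF assms(2)]])

lemma smooth_fun_cmult: "smooth_fun M f \<Longrightarrow> smooth_fun M (\<lambda>x. c * f x)"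
  by (rule smooth_fun_mult[OF smooth_fun_const])

lemma smooth_fun_diff: "smooth_fun M f \<Longrightarrow> smooth_fun M g \<Longrightarrow> smooth_fun M (\<lambda>x. f x - g x)"
  using smooth_fun_add[of f "\<lambda>x. (-1) * g x"] smooth_fun_cmult[of g "-1"] by simp

lemma smooth_fun_sum: "(\<And>a. a \<in> A \<Longrightarrow> smooth_fun M (f a)) \<Longrightarrow> smooth_fun M (\<lambda>x. \<Sum>a\<in>A. f a x)"
  by (induction A rule: infinite_finite_induct) (simp_all add: smooth_fun_const smooth_fun_add)

lemma smooth_fun_prod: "(\<And>a. a \<in> A \<Longrightarrow> smooth_fun M (f a)) \<Longrightarrow> smooth_fun M (\<lambda>x. \<Prod>a\<in>A. f a x)"
  by (induction A rule: infinite_finite_induct) (simp_all add: smooth_fun_const smooth_fun_mult)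

lemma smooth_fun_power: "smooth_fun M f \<Longrightarrow> smooth_fun M (\<lambda>x. f x ^ k)"
  by (induction k) (simp_all add: smooth_fun_const smooth_fun_mult)

lemma smooth_fun_restrict: "smooth_fun M f \<Longrightarrow> restrict f (points M) \<in> smooth_functions M"
  unfolding smooth_functions_iff by (auto intro: smooth_fun_cong)

text \<open>
  A closed box inside the chart is compact, so in a Hausdorff manifold its preimage is closed; off it the extended
  function is locally zero.
\<close>

lemma smooth_fun_extend_by_zero:
  assumes c: "(U, \<phi>) \<in> matlas M" and Q: "eopen dm Q" "Q \<subseteq> \<phi> ` U" and g: "smooth_in dm Q g"
    and K: "closed_box dm p s \<subseteq> Q" "\<And>y. y \<in> Q \<Longrightarrow> y \<notin> closed_box dm p s \<Longrightarrow> g y = 0"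
  shows "smooth_fun M (\<lambda>m. if m \<in> U \<and> \<phi> m \<in> Q then g (\<phi> m) else 0)" (is "smooth_fun M ?h")
proof (rule smooth_fun_by_charts)
  fix m assume m: "m \<in> points M"
  have inv: "inv_into U \<phi> (\<phi> x) = x" if "x \<in> U" for x using chart_facts(3)[OF c] that by simp
  show "\<exists>U \<phi> V. (U, \<phi>) \<in> matlas M \<and> m \<in> U \<and> eopen dm V \<and> V \<subseteq> \<phi> ` U \<and>
      \<phi> m \<in> V \<and> smooth_in dm V (\<lambda>y. ?h (inv_into U \<phi> y))"
  proof (cases "m \<in> U \<and> \<phi> m \<in> Q")
    case True
    have eq: "?h (inv_into U \<phi> y) = g y" if "y \<in> Q" for y
      using that Q(2) inv by (auto simp: f_inv_into_f inv_into_into)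
    have "smooth_in dm Q (\<lambda>y. ?h (inv_into U \<phi> y))"
      using g unfolding smooth_in_def using ck_on_cong[OF Q(1), of "\<lambda>y. ?h (inv_into U \<phi> y)" g] eq by blast
    then show ?thesis using True c Q by blast
  next
    case False
    obtain \<phi>' where \<phi>': "homeomorphic_maps (subtopology (mtop M) U) (subtopology (Euclidean_space dm) (\<phi> ` U)) \<phi> \<phi>'"
      using chart_facts(5)[OF c] homeomorphic_map_maps by blast
    define K where "K = \<phi>' ` closed_box dm p s"
    have "closed_box dm p s \<subseteq> coord_space dm" by (auto simp: closed_box_def)
    then have "compactin (Euclidean_space dm) (closed_box dm p s)"
      by (subst Euclidean_space_top_of_set) (simp add: compactin_subtopology compact_closed_box)
    then have "compactin (subtopology (Euclidean_space dm) (\<phi> ` U)) (closed_box dm p s)"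
      using K(1) Q(2) by (simp add: compactin_subtopology)
    moreover have "continuous_map (subtopology (Euclidean_space dm) (\<phi> ` U)) (subtopology (mtop M) U) \<phi>'"
      using \<phi>' by (simp add: homeomorphic_maps_def)
    ultimately have "compactin (subtopology (mtop M) U) K"
      unfolding K_def by (rule image_compactin)
    then have "compactin (mtop M) K" by (simp add: compactin_subtopology)
    moreover have "Hausdorff_space (mtop M)" using manifold by (simp add: real_analytic_manifold_def)
    ultimately have cl: "closedin (mtop M) K" by (rule compactin_imp_closedin[rotated])
    have inK: "x \<in> K" if "x \<in> U" "\<phi> x \<in> closed_box dm p s" for x
    proof -
      have "\<phi>' (\<phi> x) = x"
        using \<phi>' that(1) chart_facts(4)[OF c] by (auto simp: homeomorphic_maps_def)
      then show ?thesis unfolding K_def using that(2) by (metis imageI)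
    qed
    have Kin: "x \<in> U \<and> \<phi> x \<in> Q" if "x \<in> K" for x
    proof -
      obtain y where y: "y \<in> closed_box dm p s" "x = \<phi>' y" using \<open>x \<in> K\<close> by (auto simp: K_def)
      have yU: "y \<in> \<phi> ` U" using y K(1) Q(2) by blast
      then have yt: "y \<in> topspace (subtopology (Euclidean_space dm) (\<phi> ` U))"
        using eopen_subset[OF chart_facts(2)[OF c]] by auto
      have "\<phi> (\<phi>' y) = y" using \<phi>' yt by (auto simp: homeomorphic_maps_def)
      moreover have "\<phi>' y \<in> U"
        using \<phi>' yt continuous_map_image_subset_topspace[of _ "subtopology (mtop M) U" \<phi>'] chart_facts(4)[OF c]
        by (fastforce simp: homeomorphic_maps_def)
      ultimately show ?thesis using y K(1) by auto
    qed
    obtain U' \<psi> where c': "(U', \<psi>) \<in> matlas M" "m \<in> U'" using chart_at[OF m] .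
    define V where "V = \<psi> ` (U' - K)"
    have V: "eopen dm V" unfolding V_def
      by (rule eopen_chart_image[OF c'(1)]) (use cl chart_facts(1)[OF c'(1)] in \<open>auto intro: openin_diff\<close>)
    have mV: "\<psi> m \<in> V" using Kin[of m] False c' by (auto simp: V_def)
    have z: "?h (inv_into U' \<psi> y) = 0" if y: "y \<in> V" for y
    proof -
      obtain x where x: "x \<in> U'" "x \<notin> K" "y = \<psi> x" using y by (auto simp: V_def)
      then have "inv_into U' \<psi> y = x" using chart_facts(3)[OF c'(1)] by simp
      moreover have "?h x = 0" using inK[of x] x K(2)[of "\<phi> x"] by auto
      ultimately show ?thesis by (simp only:)
    qed
    have "smooth_in dm V (\<lambda>y. ?h (inv_into U' \<psi> y))"
      unfolding smooth_in_def
      using ck_on_cong[OF V, of "\<lambda>y. ?h (inv_into U' \<psi> y)" "\<lambda>y. 0"] z ck_on_const[OF V] by blast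
    then show ?thesis using c' V mV by (auto simp: V_def)
  qed
qed

text \<open>
  A cutoff of the squared Euclidean distance to the point, in a chart.
\<close>

lemma bump_chart:
  assumes m: "m \<in> points M"
  obtains U \<phi> r \<rho> where "(U, \<phi>) \<in> matlas M" "m \<in> U" "r > 0" "closed_box dm (\<phi> m) r \<subseteq> \<phi> ` U"
    "\<And>Q k. eopen dm Q \<Longrightarrow> ck_on k dm Q \<rho>"
    "\<And>y. y \<in> open_box dm (\<phi> m) r \<Longrightarrow> y \<notin> closed_box dm (\<phi> m) (r/2) \<Longrightarrow> \<rho> y = 0"
    "\<exists>s>0. s < r \<and> (\<forall>y\<in>open_box dm (\<phi> m) s. \<rho> y = 1)"
proof -
  obtain U \<phi> where c: "(U, \<phi>) \<in> matlas M" "m \<in> U" using chart_at[OF m] .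
  define p where "p = \<phi> m"
  have p: "p \<in> \<phi> ` U" using c by (simp add: p_def)
  obtain r0 where r0: "r0 > 0" "open_box dm p r0 \<subseteq> \<phi> ` U" using eopen_contains_box[OF chart_facts(2)[OF c(1)] p] .
  define r where "r = r0 / 2"
  have r: "r > 0" "closed_box dm p r \<subseteq> \<phi> ` U"
  proof -
    show "r > 0" using r0 by (simp add: r_def)
    have "closed_box dm p r \<subseteq> open_box dm p r0" using r0(1) by (force simp: closed_box_def open_box_def r_def)
    then show "closed_box dm p r \<subseteq> \<phi> ` U" using r0(2) by blast
  qed
  define N where "N y = (\<Sum>i<dm. ((y i - p i) * inverse (r/2))\<^sup>2)" for y :: "nat \<Rightarrow> real"
  define \<rho> where "\<rho> y = cutoff (N y)" for y
  have Ns: "ck_on k dm Q N" if Q: "eopen dm Q" for k Q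
    unfolding N_def[abs_def] by (intro ck_on_sum ck_on_power ck_on_mult ck_on_diff ck_on_coord ck_on_const Q)
  have 1: "ck_on k dm Q \<rho>" if Q: "eopen dm Q" for k Q
    unfolding \<rho>_def[abs_def] by (rule ck_on_comp1[OF Q ck_real_cutoff Ns[OF Q]])
  have 2: "\<rho> y = 0" if "y \<in> open_box dm p r" "y \<notin> closed_box dm p (r/2)" for y
  proof -
    have "\<not> (\<forall>i<dm. \<bar>y i - p i\<bar> \<le> r/2)" using that by (auto simp: open_box_def closed_box_def)
    then obtain i where i: "i < dm" "\<bar>y i - p i\<bar> > r/2" unfolding not_all not_imp not_le by blast
    have "1 = (r/2) * inverse (r/2)" using r(1) by simp
    also have "\<dots> \<le> \<bar>y i - p i\<bar> * \<bar>inverse (r/2)\<bar>"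
      using i(2) r(1) by (intro mult_mono) auto
    finally have "\<bar>(y i - p i) * inverse (r/2)\<bar> \<ge> 1" by (simp only: abs_mult)
    then have "((y i - p i) * inverse (r/2))\<^sup>2 \<ge> 1"
      using abs_le_square_iff[of 1 "(y i - p i) * inverse (r/2)"] by simp
    also have "((y i - p i) * inverse (r/2))\<^sup>2 \<le> N y" unfolding N_def by (rule member_le_sum) (use i in auto)
    finally show ?thesis using cutoff_eq_0 by (simp add: \<rho>_def)
  qed
  have pc: "p \<in> coord_space dm" using p eopen_subset[OF chart_facts(2)[OF c(1)]] by blast
  have "continuous_on (coord_space dm) N"
    using ck_on_continuous[OF openin_topspace Ns[OF openin_topspace]] .
  then obtain s where s: "s > 0" "\<And>y. y \<in> open_box dm p s \<Longrightarrow> \<bar>N y - N p\<bar> < 1/2"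
    by (rule continuous_on_open_box[OF openin_topspace _ pc, where e = "1/2"]) auto
  have "\<rho> y = 1" if "y \<in> open_box dm p (min s (r/2))" for y
  proof -
    have "y \<in> open_box dm p s" using open_box_mono[of "min s (r/2)" s] that by auto
    then have "N y \<le> 1/2" using s(2)[of y] by (simp add: N_def)
    then show ?thesis using cutoff_eq_1 by (simp add: \<rho>_def)
  qed
  then have 3: "\<exists>s>0. s < r \<and> (\<forall>y\<in>open_box dm p s. \<rho> y = 1)"
    using s(1) r(1) by (intro exI[of _ "min s (r/2)"]) auto
  show ?thesis using that[OF c r[unfolded p_def], of \<rho>] 1 2 3 unfolding p_def by blast
qed

end

section \<open>Gluing of primitives, and point derivations\<close>

lemma sum_prod_one_minus:
  fixes g :: "nat \<Rightarrow> real"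
  shows "(\<Sum>k<N. (\<Prod>j<k. 1 - g j) * g k) = 1 - (\<Prod>j<N. 1 - g j)"
  by (induction N) (simp_all add: algebra_simps)

context analytic_manifold
begin

text \<open>
  By the Lindelof property countably many of the sets \<open>V\<close> suffice. With \<open>\<rho>\<^sub>k = 1\<close> on \<open>V\<^sub>k\<close> and \<open>\<partial>e\<^sub>k = \<rho>\<^sub>k f\<close>, the
  functions \<open>\<rho>\<^sub>k \<Prod>\<^bsub>j<k\<^esub> (1 - \<rho>\<^sub>j)\<close> form a partition of unity: their sum telescopes to \<open>1\<close>, and those with
  \<open>k > N\<close> vanish on \<open>V\<^sub>N\<close>. Hence \<open>\<Sum>\<^sub>k \<Prod>\<^bsub>j<k\<^esub> (1 - \<rho>\<^sub>j) e\<^sub>k\<close> is a primitive of \<open>f\<close>.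
\<close>

lemma koszul_primitive_glue:
  assumes loc: "\<And>p. p \<in> points M \<Longrightarrow> \<exists>\<rho> V e. smooth_fun M \<rho> \<and> openin (mtop M) V \<and> p \<in> V \<and> (\<forall>x\<in>V. \<rho> x = 1) \<and>
      (\<forall>S\<subseteq>{..<l}. smooth_fun M (e S) \<and>
         (\<forall>x\<in>points M. koszul_d l (\<lambda>a. J a x) (\<lambda>T. e T x) S = \<rho> x * f S x))"
  shows "\<exists>\<eta>. \<forall>S\<subseteq>{..<l}. smooth_fun M (\<eta> S) \<and>
         (\<forall>x\<in>points M. koszul_d l (\<lambda>a. J a x) (\<lambda>T. \<eta> T x) S = f S x)"
proof (cases "points M = {}")
  case True
  have "smooth_fun M h" for h by (rule smooth_fun_local) (simp add: True)
  then show ?thesis using True by auto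
next
  case False
  have "\<forall>p\<in>points M. \<exists>z. smooth_fun M (fst z) \<and> openin (mtop M) (fst (snd z)) \<and> p \<in> fst (snd z) \<and>
      (\<forall>x\<in>fst (snd z). fst z x = 1) \<and> (\<forall>S\<subseteq>{..<l}. smooth_fun M (snd (snd z) S) \<and>
         (\<forall>x\<in>points M. koszul_d l (\<lambda>a. J a x) (\<lambda>T. snd (snd z) T x) S = fst z x * f S x))"
  proof
    fix p assume "p \<in> points M"
    from loc[OF this] obtain \<rho> V e where "smooth_fun M \<rho> \<and> openin (mtop M) V \<and> p \<in> V \<and> (\<forall>x\<in>V. \<rho> x = 1) \<and>
      (\<forall>S\<subseteq>{..<l}. smooth_fun M (e S) \<and>
         (\<forall>x\<in>points M. koszul_d l (\<lambda>a. J a x) (\<lambda>T. e T x) S = \<rho> x * f S x))" by blast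
    then show "\<exists>z. smooth_fun M (fst z) \<and> openin (mtop M) (fst (snd z)) \<and> p \<in> fst (snd z) \<and>
      (\<forall>x\<in>fst (snd z). fst z x = 1) \<and> (\<forall>S\<subseteq>{..<l}. smooth_fun M (snd (snd z) S) \<and>
         (\<forall>x\<in>points M. koszul_d l (\<lambda>a. J a x) (\<lambda>T. snd (snd z) T x) S = fst z x * f S x))"
      by (intro exI[of _ "(\<rho>, V, e)"]) simp
  qed
  from bchoice[OF this] obtain z where z: "\<forall>p\<in>points M. smooth_fun M (fst (z p)) \<and> openin (mtop M) (fst (snd (z p))) \<and>
      p \<in> fst (snd (z p)) \<and> (\<forall>x\<in>fst (snd (z p)). fst (z p) x = 1) \<and>
      (\<forall>S\<subseteq>{..<l}. smooth_fun M (snd (snd (z p)) S) \<and>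
         (\<forall>x\<in>points M. koszul_d l (\<lambda>a. J a x) (\<lambda>T. snd (snd (z p)) T x) S = fst (z p) x * f S x))" by blast
  let ?V = "\<lambda>p. fst (snd (z p))"
  have "Lindelof_space (mtop M)"
    using manifold second_countable_imp_Lindelof_space by (auto simp: real_analytic_manifold_def)
  moreover have "\<forall>U\<in>?V ` points M. openin (mtop M) U" "\<Union>(?V ` points M) = points M"
  proof -
    show 1: "\<forall>U\<in>?V ` points M. openin (mtop M) U" using z by blast
    have "U \<subseteq> points M" if "U \<in> ?V ` points M" for U using 1 that openin_subset by blast
    then show "\<Union>(?V ` points M) = points M" using z by blast
  qed
  ultimately obtain \<V> where \<V>: "countable \<V>" "\<V> \<subseteq> ?V ` points M" "\<Union>\<V> = points M"
    unfolding Lindelof_space_def by meson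
  from countable_subset_image[THEN iffD1, OF conjI[OF \<V>(1,2)]]
  obtain C where C: "countable C" "C \<subseteq> points M" "\<V> = ?V ` C" by blast
  have "C \<noteq> {}" using C(3) \<V>(3) False by (metis Union_empty image_empty)
  define c where "c = from_nat_into C"
  have cC: "c k \<in> points M" for k using from_nat_into[OF \<open>C \<noteq> {}\<close>] C(2) by (auto simp: c_def)
  have cover: "\<exists>k. x \<in> ?V (c k)" if x: "x \<in> points M" for x
  proof -
    have "x \<in> \<Union>(?V ` C)" using x unfolding \<V>(3)[symmetric] C(3) .
    then obtain p where p: "p \<in> C" "x \<in> ?V p" by (elim UN_E)
    obtain k where "from_nat_into C k = p" using from_nat_into_surj[OF C(1) p(1)] by blast
    then show ?thesis using p(2) unfolding c_def by (intro exI[of _ k]) simp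
  qed
  define \<rho> where "\<rho> k = fst (z (c k))" for k
  define e where "e k = snd (snd (z (c k)))" for k
  define V where "V k = ?V (c k)" for k
  note zc = bspec[OF z cC]
  have \<rho>: "smooth_fun M (\<rho> k)" and V: "openin (mtop M) (V k)" and \<rho>1: "x \<in> V k \<Longrightarrow> \<rho> k x = 1" for k x
    using zc[of k] by (auto simp: \<rho>_def V_def)
  have e: "smooth_fun M (e k S)" "x \<in> points M \<Longrightarrow> koszul_d l (\<lambda>a. J a x) (\<lambda>T. e k T x) S = \<rho> k x * f S x"
    if "S \<subseteq> {..<l}" for k S x
    using zc[of k] that by (auto simp: \<rho>_def e_def)
  define P where "P k x = (\<Prod>j<k. 1 - \<rho> j x)" for k x
  have P0: "P k x = 0" if "x \<in> V N" "k > N" for k N x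
    unfolding P_def using that \<rho>1 by (auto intro!: prod_zero)
  have Psm: "smooth_fun M (P k)" for k
    unfolding P_def[abs_def] by (intro smooth_fun_prod smooth_fun_diff smooth_fun_const \<rho>)
  define \<eta> where "\<eta> S x = (\<Sum>k. P k x * e k S x)" for S x
  have fin: "\<eta> S x = (\<Sum>k<Suc N. P k x * e k S x)" if "x \<in> V N" for N S x
    unfolding \<eta>_def by (rule suminf_finite) (use P0[OF that] in auto)
  have "smooth_fun M (\<eta> S)" if S: "S \<subseteq> {..<l}" for S
  proof (rule smooth_fun_local)
    fix m assume "m \<in> points M"
    then obtain N where N: "m \<in> V N" using cover by (auto simp: V_def)
    have "smooth_fun M (\<lambda>x. \<Sum>k<Suc N. P k x * e k S x)"
      by (rule smooth_fun_sum) (rule smooth_fun_mult[OF Psm e(1)[OF S]])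
    then show "\<exists>Q g. openin (mtop M) Q \<and> m \<in> Q \<and> smooth_fun M g \<and> (\<forall>x\<in>Q. \<eta> S x = g x)"
      using V N fin by blast
  qed
  moreover have "koszul_d l (\<lambda>a. J a x) (\<lambda>T. \<eta> T x) S = f S x" if S: "S \<subseteq> {..<l}" and x: "x \<in> points M" for S x
  proof -
    obtain N where N: "x \<in> V N" using cover[OF x] by (auto simp: V_def)
    have "koszul_d l (\<lambda>a. J a x) (\<lambda>T. \<eta> T x) S = (\<Sum>k<Suc N. P k x * (\<rho> k x * f S x))"
      unfolding fin[OF N] koszul_d_sum koszul_d_cmult by (simp only: e(2)[OF S x])
    also have "\<dots> = (\<Sum>k<Suc N. P k x * \<rho> k x) * f S x" by (simp only: sum_distrib_right mult.assoc)
    also have "(\<Sum>k<Suc N. P k x * \<rho> k x) = 1 - P (Suc N) x"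
      unfolding P_def by (rule sum_prod_one_minus)
    finally show ?thesis using P0[OF N, of "Suc N"] by simp
  qed
  ultimately show ?thesis by blast
qed

text \<open>
  By Hadamard's lemma \<open>b\<^sup>2 (u - u(z)) = \<Sum>X\<^sub>i G\<^sub>i\<close> for a bump function \<open>b\<close> at \<open>z\<close>, where \<open>X\<^sub>i\<close> is a cut off coordinate
  centred at \<open>z\<close> and \<open>G\<^sub>i(z) = \<partial>\<^sub>i u(z)\<close>. Applying the derivation, with \<open>b(z) = 1\<close> and \<open>X\<^sub>i(z) = 0\<close>, gives
  \<open>D u = \<Sum>D(X\<^sub>i) \<partial>\<^sub>i u(z)\<close>.
\<close>

lemma derivation_directional:
  assumes D: "D \<in> tangent_space M z" and c: "(U, \<phi>) \<in> matlas M" and z: "z \<in> U"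
    and r: "r > 0" "closed_box dm (\<phi> z) r \<subseteq> \<phi> ` U"
    and \<rho>: "\<And>Q k. eopen dm Q \<Longrightarrow> ck_on k dm Q \<rho>"
      "\<And>y. y \<in> open_box dm (\<phi> z) r \<Longrightarrow> y \<notin> closed_box dm (\<phi> z) (r/2) \<Longrightarrow> \<rho> y = 0" "\<rho> (\<phi> z) = 1"
  shows "\<exists>v. \<forall>u. smooth_fun M u \<longrightarrow>
     D (restrict u (points M)) = (\<Sum>i<dm. v i * partial_deriv i (\<lambda>y. u (inv_into U \<phi> y)) (\<phi> z))"
proof -
  define p where "p = \<phi> z"
  define Q where "Q = open_box dm p r"
  note rp = r(2)[folded p_def] and \<rho>p = \<rho>(2,3)[folded p_def, folded Q_def]
  have zM: "z \<in> points M" using z chart_facts(4)[OF c] by blast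
  have inv: "inv_into U \<phi> (\<phi> x) = x" if "x \<in> U" for x using chart_facts(3)[OF c] that by simp
  have "Q \<subseteq> closed_box dm p r" by (simp add: Q_def open_box_def closed_box_def subset_iff less_imp_le)
  then have Q: "eopen dm Q" "Q \<subseteq> \<phi> ` U" using rp eopen_open_box by (simp_all add: Q_def subset_trans)
  have pc: "p \<in> coord_space dm" using z eopen_subset[OF chart_facts(2)[OF c]] by (auto simp: p_def)
  have pQ: "p \<in> Q" unfolding Q_def by (rule open_box_center[OF pc r(1)])
  have KQ: "closed_box dm p (r/2) \<subseteq> Q" using r(1) by (force simp: closed_box_def open_box_def Q_def)
  define ext where "ext g m = (if m \<in> U \<and> \<phi> m \<in> Q then \<rho> (\<phi> m) * g (\<phi> m) else 0)" for g m
  have ext: "smooth_fun M (ext g)" if "smooth_in dm Q g" for g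
    unfolding ext_def[abs_def]
  proof (rule smooth_fun_extend_by_zero[OF c Q _ KQ, of "\<lambda>y. \<rho> y * g y"])
    show "smooth_in dm Q (\<lambda>y. \<rho> y * g y)"
      using that unfolding smooth_in_def by (intro allI ck_on_mult[OF Q(1) \<rho>(1)[OF Q(1)]]) simp
    show "\<rho> y * g y = 0" if "y \<in> Q" "y \<notin> closed_box dm p (r/2)" for y using \<rho>p(1)[OF that] by simp
  qed
  let ?R = "\<lambda>u. restrict u (points M)"
  have D_add: "D (?R (\<lambda>x. f x + g x)) = D (?R f) + D (?R g)" if "smooth_fun M f" "smooth_fun M g" for f g
  proof -
    have "D (?R f \<oplus>\<^bsub>C_inf M\<^esub> ?R g) = D (?R f) + D (?R g)"
      using D smooth_fun_restrict that unfolding tangent_space_def by blast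
    moreover have "?R f \<oplus>\<^bsub>C_inf M\<^esub> ?R g = ?R (\<lambda>x. f x + g x)" by (auto simp: C_inf_def function_ring_def)
    ultimately show ?thesis by simp
  qed
  have D_cmult: "D (?R (\<lambda>x. c * f x)) = c * D (?R f)" if "smooth_fun M f" for f c
  proof -
    have "D (?R (\<lambda>x. c * ?R f x)) = c * D (?R f)"
      using D smooth_fun_restrict[OF that] unfolding tangent_space_def by blast
    moreover have "?R (\<lambda>x. c * ?R f x) = ?R (\<lambda>x. c * f x)" by auto
    ultimately show ?thesis by simp
  qed
  have D_mult: "D (?R (\<lambda>x. f x * g x)) = f z * D (?R g) + g z * D (?R f)" if "smooth_fun M f" "smooth_fun M g" for f g
  proof -
    have "D (?R f \<otimes>\<^bsub>C_inf M\<^esub> ?R g) = ?R f z * D (?R g) + ?R g z * D (?R f)"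
      using D smooth_fun_restrict that unfolding tangent_space_def by blast
    moreover have "?R f \<otimes>\<^bsub>C_inf M\<^esub> ?R g = ?R (\<lambda>x. f x * g x)" by (auto simp: C_inf_def function_ring_def)
    ultimately show ?thesis using zM by simp
  qed
  have D_one: "D (?R (\<lambda>x. 1)) = 0" using D_mult[OF smooth_fun_const[of 1] smooth_fun_const[of 1]] by simp
  have D_const: "D (?R (\<lambda>x. b)) = 0" for b using D_cmult[OF smooth_fun_const[of 1], of b] D_one by simp
  have D_sum: "D (?R (\<lambda>x. \<Sum>i\<in>A. f i x)) = (\<Sum>i\<in>A. D (?R (f i)))" if "finite A" "\<And>i. i \<in> A \<Longrightarrow> smooth_fun M (f i)" for f and A :: "nat set"
    using that
  proof (induction A rule: finite_induct)
    case (insert a A)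
    have "D (?R (\<lambda>x. f a x + (\<Sum>i\<in>A. f i x))) = D (?R (f a)) + D (?R (\<lambda>x. \<Sum>i\<in>A. f i x))"
      by (rule D_add[OF _ smooth_fun_sum]) (use insert in auto)
    moreover have "D (?R (\<lambda>x. \<Sum>i\<in>A. f i x)) = (\<Sum>i\<in>A. D (?R (f i)))"
      by (rule insert.IH) (use insert.prems in auto)
    ultimately show ?case unfolding sum.insert[OF insert.hyps] by (simp only:)
  next
    case empty
    show ?case unfolding sum.empty by (rule D_const)
  qed
  define Xc where "Xc i = ext (\<lambda>y. y i - p i)" for i
  have Xc: "smooth_fun M (Xc i)" for i
    unfolding Xc_def by (rule ext) (unfold smooth_in_def, intro allI ck_on_diff ck_on_coord ck_on_const Q(1))
  have "D (?R u) = (\<Sum>i<dm. D (?R (Xc i)) * partial_deriv i (\<lambda>y. u (inv_into U \<phi> y)) p)" if u: "smooth_fun M u" for u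
  proof -
    let ?u = "\<lambda>y. u (inv_into U \<phi> y)"
    have hs: "smooth_in dm Q ?u"
      using ck_on_subset[OF chart_facts(2)[OF c] Q] smooth_fun_ck_on[OF u c] unfolding smooth_in_def by blast
    have "\<exists>g. (\<forall>i<dm. smooth_in dm Q (g i) \<and> g i p = partial_deriv i ?u p) \<and>
        (\<forall>x\<in>Q. ?u x = ?u p + (\<Sum>i<dm. (x i - p i) * g i x))"
      by (rule hadamard[OF pc r(1) hs[unfolded Q_def], folded Q_def]) blast
    then obtain g where g: "\<And>i. i < dm \<Longrightarrow> smooth_in dm Q (g i)" "\<And>i. i < dm \<Longrightarrow> g i p = partial_deriv i ?u p"
        "\<And>x. x \<in> Q \<Longrightarrow> ?u x = ?u p + (\<Sum>i<dm. (x i - p i) * g i x)" by blast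
    define b where "b = ext (\<lambda>y. 1)"
    have b: "smooth_fun M b" unfolding b_def by (rule ext) (simp add: smooth_in_def ck_on_const[OF Q(1)] del: ck_on.simps)
    have bz: "b z = 1" using z pQ \<rho>p(2) by (simp add: b_def ext_def p_def)
    have Gsm: "smooth_fun M (ext (g i))" if "i < dm" for i by (rule ext[OF g(1)[OF that]])
    have Gz: "ext (g i) z = partial_deriv i ?u p" if "i < dm" for i
      using z pQ \<rho>p(2) g(2)[OF that] by (simp add: ext_def p_def)
    have Xz: "Xc i z = 0" for i by (simp add: Xc_def ext_def p_def)
    define w where "w x = u x + (- u z)" for x
    have w: "smooth_fun M w" unfolding w_def[abs_def] by (rule smooth_fun_add[OF u smooth_fun_const])
    have Dw: "D (?R w) = D (?R u)"
      unfolding w_def[abs_def] D_add[OF u smooth_fun_const] D_const by simp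
    have up: "?u p = u z" using inv[OF z] by (simp add: p_def)
    have id: "b x * b x * w x = (\<Sum>i<dm. Xc i x * ext (g i) x)" for x
    proof (cases "x \<in> U \<and> \<phi> x \<in> Q")
      case True
      have "w x = (\<Sum>i<dm. (\<phi> x i - p i) * g i (\<phi> x))"
        using g(3)[of "\<phi> x"] True inv[of x] up by (simp add: w_def)
      then show ?thesis using True by (simp add: b_def Xc_def ext_def sum_distrib_left mult_ac)
    next
      case False
      then have "ext g x = 0" for g by (simp only: ext_def if_False)
      then show ?thesis by (simp add: b_def Xc_def)
    qed
    have "D (?R (\<lambda>x. b x * b x * w x)) = D (?R w)"
      using D_mult[OF smooth_fun_mult[OF b b] w] bz by (simp add: w_def)
    moreover have "D (?R (\<lambda>x. b x * b x * w x)) = (\<Sum>i<dm. D (?R (\<lambda>x. Xc i x * ext (g i) x)))"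
      unfolding id by (rule D_sum) (use smooth_fun_mult[OF Xc Gsm] in auto)
    moreover have "D (?R (\<lambda>x. Xc i x * ext (g i) x)) = D (?R (Xc i)) * partial_deriv i ?u p" if "i < dm" for i
      using D_mult[OF Xc Gsm[OF that]] Xz Gz[OF that] by simp
    ultimately show ?thesis using Dw by simp
  qed
  then show ?thesis unfolding p_def by (intro exI[of _ "\<lambda>i. D (?R (Xc i))"]) blast
qed

end

text \<open>
  Induction on the number of variables: sort the exponents by that of the last variable and use that a polynomial
  in one variable with infinitely many zeros vanishes.
\<close>

lemma polynomial_function_zero:
  fixes c :: "(nat \<Rightarrow> nat) \<Rightarrow> real"
  assumes "finite A" "\<And>\<alpha>. \<alpha> \<in> A \<Longrightarrow> \<forall>i\<ge>l. \<alpha> i = 0"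
    and "\<And>w. (\<Sum>\<alpha>\<in>A. c \<alpha> * (\<Prod>a<l. w a ^ \<alpha> a)) = 0"
  shows "\<forall>\<alpha>\<in>A. c \<alpha> = 0"
  using assms
proof (induction l arbitrary: A c)
  case 0
  then have "\<alpha> = (\<lambda>_. 0)" if "\<alpha> \<in> A" for \<alpha> using that by auto
  then have "A \<subseteq> {\<lambda>_. 0}" by auto
  then show ?case using 0(3)[of undefined] by (cases "A = {}") (auto simp: subset_singleton_iff)
next
  case (Suc l)
  obtain K where K: "\<And>\<alpha>. \<alpha> \<in> A \<Longrightarrow> \<alpha> l \<le> K"
    using finite_nat_set_iff_bounded_le[of "(\<lambda>\<alpha>. \<alpha> l) ` A"] Suc.prems(1) by auto
  define Ak where "Ak k = {\<alpha>\<in>A. \<alpha> l = k}" for k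
  define d where "d k w = (\<Sum>\<alpha>\<in>Ak k. c \<alpha> * (\<Prod>a<l. w a ^ \<alpha> a))" for k and w :: "nat \<Rightarrow> real"
  have d0: "d k w = 0" if k: "k \<le> K" for k w
  proof -
    have "(\<Sum>k\<le>K. d k w * t ^ k) = 0" for t
    proof -
      have "(\<Sum>k\<le>K. d k w * t ^ k) = (\<Sum>k\<le>K. \<Sum>\<alpha>\<in>Ak k. c \<alpha> * (\<Prod>a<Suc l. (w(l := t)) a ^ \<alpha> a))"
        unfolding d_def sum_distrib_right by (intro sum.cong refl) (auto simp: Ak_def)
      also have "\<dots> = (\<Sum>\<alpha>\<in>A. c \<alpha> * (\<Prod>a<Suc l. (w(l := t)) a ^ \<alpha> a))"
        unfolding Ak_def by (rule sum.group) (use Suc.prems(1) K in auto)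
      also have "\<dots> = 0" by (rule Suc.prems(3))
      finally show ?thesis .
    qed
    then show ?thesis using polyfun_eq_0[of "\<lambda>k. d k w" K] k by blast
  qed
  show ?case
  proof
    fix \<alpha> assume a: "\<alpha> \<in> A"
    let ?r = "\<lambda>\<alpha>::nat \<Rightarrow> nat. \<alpha>(l := 0)"
    define k where "k = \<alpha> l"
    have inj: "inj_on ?r (Ak k)"
      by (rule inj_onI) (auto simp: Ak_def fun_eq_iff split: if_splits, metis)
    have "\<forall>\<beta>\<in>?r ` Ak k. c (\<beta>(l := k)) = 0"
    proof (rule Suc.IH)
      show "finite (?r ` Ak k)" using Suc.prems(1) by (simp add: Ak_def)
      show "\<forall>i\<ge>l. \<beta> i = 0" if "\<beta> \<in> ?r ` Ak k" for \<beta>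
      proof (intro allI impI)
        fix i assume "l \<le> i"
        then show "\<beta> i = 0" using that Suc.prems(2) by (cases "i = l") (auto simp: Ak_def)
      qed
      fix w :: "nat \<Rightarrow> real"
      have "(\<Sum>\<beta>\<in>?r ` Ak k. c (\<beta>(l := k)) * (\<Prod>a<l. w a ^ \<beta> a)) = d k w"
        unfolding d_def sum.reindex[OF inj] by (intro sum.cong refl) (auto simp: Ak_def)
      then show "(\<Sum>\<beta>\<in>?r ` Ak k. c (\<beta>(l := k)) * (\<Prod>a<l. w a ^ \<beta> a)) = 0"
        using d0[of k w] K[OF a] by (simp add: k_def)
    qed
    then show "c \<alpha> = 0" using a by (force simp: Ak_def k_def)
  qed
qed

section \<open>Quasi-regularity at regular points\<close>

lemma points_euclidean [simp]: "points (euclidean_manifold l) = coord_space l"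
  by (simp add: euclidean_manifold_def)

lemma smooth_functions_euclidean:
  "g \<in> smooth_functions (euclidean_manifold l) \<longleftrightarrow> g \<in> extensional (coord_space l) \<and> smooth_in l (coord_space l) g"
proof -
  have inv: "inv_into (coord_space l) (\<lambda>x. x) y = y" if "y \<in> coord_space l" for y
    using inv_into_f_f[of "\<lambda>x. x" "coord_space l" y] that by simp
  have "ck_on k l (coord_space l) (\<lambda>y. g (inv_into (coord_space l) (\<lambda>x. x) y)) \<longleftrightarrow> ck_on k l (coord_space l) g" for k
    by (rule ck_on_cong[OF openin_topspace]) (simp add: inv)
  then show ?thesis
    by (simp add: smooth_functions_def euclidean_manifold_def smooth_in_def)
qed

lemma directional_derivative_tangent:
  assumes p: "p \<in> coord_space l"
  shows "(\<lambda>g\<in>smooth_functions (euclidean_manifold l). \<Sum>a<l. w a * partial_deriv a g p)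
     \<in> tangent_space (euclidean_manifold l) p" (is "?D \<in> _")
proof -
  let ?F = "smooth_functions (euclidean_manifold l)" and ?X = "coord_space l"
  note o = openin_topspace[of "Euclidean_space l"]
  have pd: "has_pd g a (partial_deriv a g p) p" if "g \<in> ?F" "a < l" for g a
    using that p ck_on_SucD(2)[of 0 l ?X g a p] unfolding smooth_functions_euclidean smooth_in_def by blast
  have sm: "ck_on k l ?X g" if "g \<in> ?F" for g k
    using that unfolding smooth_functions_euclidean smooth_in_def by blast
  have mem: "(\<lambda>x\<in>?X. h x) \<in> ?F" if "\<And>k. ck_on k l ?X h" for h
    unfolding smooth_functions_euclidean smooth_in_def
    using ck_on_cong[OF o, of "\<lambda>x\<in>?X. h x" h] that by auto
  have pdr: "partial_deriv a (\<lambda>x\<in>?X. h x) p = d" if "has_pd h a d p" "a < l" for h a d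
    by (rule has_pd_partial_deriv) (use has_pd_cong[OF o p that(2), of "\<lambda>x\<in>?X. h x" h] that(1) in simp)
  have add: "?D (f \<oplus>\<^bsub>C_inf (euclidean_manifold l)\<^esub> g) = ?D f + ?D g" if f: "f \<in> ?F" and g: "g \<in> ?F" for f g
  proof -
    have eq: "f \<oplus>\<^bsub>C_inf (euclidean_manifold l)\<^esub> g = (\<lambda>x\<in>?X. f x + g x)"
      by (simp add: C_inf_def function_ring_def)
    have "(\<lambda>x\<in>?X. f x + g x) \<in> ?F" by (rule mem) (rule ck_on_add[OF o sm[OF f] sm[OF g]])
    moreover have "partial_deriv a (\<lambda>x\<in>?X. f x + g x) p = partial_deriv a f p + partial_deriv a g p" if "a < l" for a
      by (rule pdr[OF has_pd_add[OF pd[OF f that] pd[OF g that]] that])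
    ultimately show ?thesis using f g unfolding eq by (simp add: distrib_left sum.distrib)
  qed
  have cmult: "?D (\<lambda>x\<in>points (euclidean_manifold l). c * f x) = c * ?D f" if f: "f \<in> ?F" for f c
  proof -
    have "(\<lambda>x\<in>?X. c * f x) \<in> ?F" by (rule mem) (rule ck_on_cmult[OF o sm[OF f]])
    moreover have "partial_deriv a (\<lambda>x\<in>?X. c * f x) p = c * partial_deriv a f p" if "a < l" for a
      using pdr[OF has_pd_mult[OF has_pd_const[of c] pd[OF f that]] that] by simp
    ultimately show ?thesis using f by (simp add: sum_distrib_left mult_ac)
  qed
  have mult: "?D (f \<otimes>\<^bsub>C_inf (euclidean_manifold l)\<^esub> g) = f p * ?D g + g p * ?D f" if f: "f \<in> ?F" and g: "g \<in> ?F" for f g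
  proof -
    have eq: "f \<otimes>\<^bsub>C_inf (euclidean_manifold l)\<^esub> g = (\<lambda>x\<in>?X. f x * g x)"
      by (simp add: C_inf_def function_ring_def)
    have "(\<lambda>x\<in>?X. f x * g x) \<in> ?F" by (rule mem) (rule ck_on_mult[OF o sm[OF f] sm[OF g]])
    moreover have "partial_deriv a (\<lambda>x\<in>?X. f x * g x) p = partial_deriv a f p * g p + f p * partial_deriv a g p" if "a < l" for a
      by (rule pdr[OF has_pd_mult[OF pd[OF f that] pd[OF g that]] that])
    ultimately show ?thesis using f g unfolding eq
      by (simp add: distrib_left sum.distrib sum_distrib_left mult_ac)
  qed
  show ?thesis unfolding tangent_space_def using add cmult mult by auto
qed

context analytic_manifold
begin

text \<open>
  The directional derivative along \<open>w\<close> at \<open>J z\<close> is a tangent vector; its preimage under the tangent map is tested on the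
  coordinate functions.
\<close>

lemma regular_directions:
  assumes JE: "\<And>x. x \<in> points M \<Longrightarrow> J x \<in> coord_space l" and z: "z \<in> regular_stratum M l J"
  shows "\<exists>D\<in>tangent_space M z. \<forall>a<l. D (component M J a) = w a"
proof -
  let ?E = "euclidean_manifold l" and ?X = "coord_space l"
  note o = openin_topspace[of "Euclidean_space l"]
  have zM: "z \<in> points M" using z by (auto simp: regular_stratum_def zero_fibre_def)
  define Dw where "Dw = (\<lambda>g\<in>smooth_functions ?E. \<Sum>a<l. w a * partial_deriv a g (J z))"
  have "Dw \<in> tangent_space ?E (J z)" unfolding Dw_def by (rule directional_derivative_tangent[OF JE[OF zM]])
  then have "Dw \<in> tangent_map M ?E J ` tangent_space M z" using z by (simp add: regular_stratum_def)
  then obtain D where D: "D \<in> tangent_space M z" "Dw = tangent_map M ?E J D" by blast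
  have "D (component M J a) = w a" if a: "a < l" for a
  proof -
    define g where "g = (\<lambda>x\<in>?X. x a)"
    have "ck_on k l ?X g" for k
      using ck_on_cong[OF o, of g "\<lambda>x. x a"] ck_on_coord[OF o] by (simp add: g_def del: ck_on.simps)
    then have g: "g \<in> smooth_functions ?E" by (simp add: smooth_functions_euclidean smooth_in_def g_def del: ck_on.simps)
    have pd: "partial_deriv b g (J z) = (if b = a then 1 else 0)" if "b < l" for b
      by (rule has_pd_partial_deriv)
        (use has_pd_cong[OF o JE[OF zM] that, of g "\<lambda>x. x a"] has_pd_coord[of a b] in \<open>simp add: g_def\<close>)
    have "Dw g = (\<Sum>b<l. w b * (if b = a then 1 else 0))" using g pd by (simp add: Dw_def)
    also have "\<dots> = w a" using a by (subst sum.remove[of _ a]) auto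
    finally have "Dw g = w a" .
    moreover have "Dw g = D (\<lambda>x\<in>points M. g (J x))" using g unfolding D(2) tangent_map_def by simp
    moreover have "(\<lambda>x\<in>points M. g (J x)) = component M J a"
      unfolding component_def by (rule restrict_ext) (simp add: g_def JE)
    ultimately show ?thesis by simp
  qed
  then show ?thesis using D(1) by blast
qed

text \<open>
  Choose a derivation with \<open>D J\<^sub>a = w\<^sub>a\<close> and the line through \<open>z\<close> in its direction in a chart. Along it
  \<open>J\<^sub>a / t \<rightarrow> w\<^sub>a\<close>, so dividing the relation by \<open>t\<^sup>k\<close> shows that the polynomial \<open>\<Sum>c\<^sub>\<alpha>(z) w\<^sup>\<alpha>\<close> vanishes for
  every \<open>w\<close>.
\<close>

lemma quasi_regular_at:
  assumes JE: "\<And>x. x \<in> points M \<Longrightarrow> J x \<in> coord_space l" and z: "z \<in> regular_stratum M l J"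
    and Jsm: "\<And>a. a < l \<Longrightarrow> smooth_fun M (\<lambda>x. J x a)"
    and A: "finite A" "\<And>\<alpha>. \<alpha> \<in> A \<Longrightarrow> \<forall>i\<ge>l. \<alpha> i = 0" "\<And>\<alpha>. \<alpha> \<in> A \<Longrightarrow> (\<Sum>a<l. \<alpha> a) = k"
    and c: "\<And>\<alpha>. \<alpha> \<in> A \<Longrightarrow> smooth_fun M (c \<alpha>)"
    and eq: "\<And>x. x \<in> points M \<Longrightarrow> (\<Sum>\<alpha>\<in>A. c \<alpha> x * (\<Prod>a<l. J x a ^ \<alpha> a)) = 0"
  shows "\<forall>\<alpha>\<in>A. c \<alpha> z = 0"
proof (rule polynomial_function_zero[OF A(1,2)])
  fix w :: "nat \<Rightarrow> real"
  have zM: "z \<in> points M" and Jz: "J z = (\<lambda>_. 0)" using z by (auto simp: regular_stratum_def zero_fibre_def)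
  obtain D where D: "D \<in> tangent_space M z" "\<And>a. a < l \<Longrightarrow> D (component M J a) = w a"
    using regular_directions[OF JE z, of w] by blast
  obtain U \<phi> r \<rho> where ch: "(U, \<phi>) \<in> matlas M" "z \<in> U" "r > 0" "closed_box dm (\<phi> z) r \<subseteq> \<phi> ` U"
    "\<And>Q k. eopen dm Q \<Longrightarrow> ck_on k dm Q \<rho>"
    "\<And>y. y \<in> open_box dm (\<phi> z) r \<Longrightarrow> y \<notin> closed_box dm (\<phi> z) (r/2) \<Longrightarrow> \<rho> y = 0"
    "\<exists>s>0. s < r \<and> (\<forall>y\<in>open_box dm (\<phi> z) s. \<rho> y = 1)" using bump_chart[OF zM] by blast
  note U = chart_facts(2)[OF ch(1)]
  have pU: "\<phi> z \<in> \<phi> ` U" using ch(2) by blast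
  have pc: "\<phi> z \<in> coord_space dm" using pU eopen_subset[OF U] by blast
  have \<rho>1: "\<rho> (\<phi> z) = 1" using ch(7) open_box_center[OF pc] by blast
  obtain v where v: "\<And>u. smooth_fun M u \<Longrightarrow>
      D (restrict u (points M)) = (\<Sum>i<dm. v i * partial_deriv i (\<lambda>y. u (inv_into U \<phi> y)) (\<phi> z))"
    using derivation_directional[OF D(1) ch(1-4) ch(5,6) \<rho>1] by blast
  have inv: "inv_into U \<phi> (\<phi> z) = z" using chart_facts(3)[OF ch(1)] ch(2) by simp
  define \<gamma> where "\<gamma> t = (\<lambda>j. if j < dm then \<phi> z j + t * v j else 0)" for t
  have \<gamma>c: "\<gamma> t \<in> coord_space dm" for t by (auto simp: \<gamma>_def topspace_Euclidean_space)
  have \<gamma>0: "\<gamma> 0 = \<phi> z" using pc by (auto simp: \<gamma>_def topspace_Euclidean_space)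
  define x where "x t = inv_into U \<phi> (\<gamma> t)" for t
  have x0: "x 0 = z" by (simp add: x_def \<gamma>0 inv)
  have deriv: "((\<lambda>t. u (x t)) has_real_derivative D (restrict u (points M))) (at 0)" if u: "smooth_fun M u" for u
  proof -
    have "((\<lambda>t. (\<lambda>y. u (inv_into U \<phi> y)) (\<gamma> t)) has_real_derivative
        (\<Sum>j<dm. partial_deriv j (\<lambda>y. u (inv_into U \<phi> y)) (\<gamma> 0) * v j)) (at 0)"
    proof (rule chain_rule[OF U smooth_fun_ck_on[OF u ch(1)] \<gamma>c])
      show "\<gamma> 0 \<in> \<phi> ` U" using pU \<gamma>0 by simp
      show "((\<lambda>t. \<gamma> t j) has_real_derivative v j) (at 0)" if "j < dm" for j
        using that by (auto simp: \<gamma>_def intro!: derivative_eq_intros)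
    qed
    then show ?thesis by (simp add: v[OF u] \<gamma>0 x_def mult.commute)
  qed
  have lim_c: "((\<lambda>t. c \<alpha> (x t)) \<longlongrightarrow> c \<alpha> z) (at 0)" if "\<alpha> \<in> A" for \<alpha>
    using DERIV_isCont[OF deriv[OF c[OF that]]] by (simp add: isCont_def x0)
  have lim_J: "((\<lambda>t. J (x t) a / t) \<longlongrightarrow> w a) (at 0)" if a: "a < l" for a
  proof -
    have "D (restrict (\<lambda>x. J x a) (points M)) = w a" using D(2)[OF a] by (simp add: component_def)
    then show ?thesis using deriv[OF Jsm[OF a]] Jz unfolding has_field_derivative_iff by (simp add: x0)
  qed
  have "((\<lambda>t. \<Sum>\<alpha>\<in>A. c \<alpha> (x t) * (\<Prod>a<l. (J (x t) a / t) ^ \<alpha> a)) \<longlongrightarrow>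
      (\<Sum>\<alpha>\<in>A. c \<alpha> z * (\<Prod>a<l. w a ^ \<alpha> a))) (at 0)"
    by (intro tendsto_sum tendsto_mult tendsto_prod tendsto_power lim_c lim_J) auto
  moreover have "\<forall>\<^sub>F t in at 0. (\<Sum>\<alpha>\<in>A. c \<alpha> (x t) * (\<Prod>a<l. (J (x t) a / t) ^ \<alpha> a)) = 0"
  proof -
    obtain s where s: "s > 0" "open_box dm (\<phi> z) s \<subseteq> \<phi> ` U" using eopen_contains_box[OF U pU] .
    have "\<forall>\<^sub>F t in at 0. \<bar>t * v i\<bar> < s" for i
    proof -
      have "((\<lambda>t. \<bar>t * v i\<bar>) \<longlongrightarrow> \<bar>0 * v i\<bar>) (at 0)" by (intro tendsto_intros)
      then show ?thesis by (rule order_tendstoD(2)) (use s in simp)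
    qed
    then have "\<forall>\<^sub>F t in at 0. \<forall>i\<in>{..<dm}. \<bar>t * v i\<bar> < s" by (intro eventually_ball_finite) auto
    moreover have "\<forall>\<^sub>F t in at (0::real). t \<noteq> 0" by (simp add: eventually_at_filter)
    ultimately show ?thesis
    proof eventually_elim
      case (elim t)
      have "\<gamma> t \<in> open_box dm (\<phi> z) s" using elim(1) \<gamma>c by (auto simp: open_box_def \<gamma>_def)
      then have "\<gamma> t \<in> \<phi> ` U" using s(2) by blast
      then have "x t \<in> U" unfolding x_def by (rule inv_into_into)
      then have xM: "x t \<in> points M" using chart_facts(4)[OF ch(1)] by blast
      have "(\<Prod>a<l. (J (x t) a / t) ^ \<alpha> a) = (\<Prod>a<l. J (x t) a ^ \<alpha> a) / t ^ k" if "\<alpha> \<in> A" for \<alpha>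
        by (simp add: power_divide prod_dividef power_sum[symmetric] A(3)[OF that])
      then have "(\<Sum>\<alpha>\<in>A. c \<alpha> (x t) * (\<Prod>a<l. (J (x t) a / t) ^ \<alpha> a))
          = (\<Sum>\<alpha>\<in>A. c \<alpha> (x t) * (\<Prod>a<l. J (x t) a ^ \<alpha> a)) / t ^ k"
        by (simp add: sum_divide_distrib)
      then show ?case using eq[OF xM] by simp
    qed
  qed
  ultimately have "((\<lambda>t. 0) \<longlongrightarrow> (\<Sum>\<alpha>\<in>A. c \<alpha> z * (\<Prod>a<l. w a ^ \<alpha> a))) (at (0::real))"
    by (rule Lim_transform_eventually)
  then show "(\<Sum>\<alpha>\<in>A. c \<alpha> z * (\<Prod>a<l. w a ^ \<alpha> a)) = 0"
    using tendsto_unique[OF _ tendsto_const] by (metis at_neq_bot)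
qed

lemma openin_smooth_nonzero:
  assumes h: "smooth_fun M h" shows "openin (mtop M) {x \<in> points M. h x \<noteq> 0}"
proof (subst openin_subopen, intro ballI)
  fix x assume "x \<in> {x \<in> points M. h x \<noteq> 0}"
  then have x: "x \<in> points M" "h x \<noteq> 0" by auto
  obtain U \<phi> where c: "(U, \<phi>) \<in> matlas M" "x \<in> U" using chart_at[OF x(1)] .
  note U = chart_facts(2)[OF c(1)]
  have inv: "inv_into U \<phi> (\<phi> y) = y" if "y \<in> U" for y using chart_facts(3)[OF c(1)] that by simp
  have cont: "continuous_on (\<phi> ` U) (\<lambda>y. h (inv_into U \<phi> y))"
    by (rule ck_on_continuous[OF U smooth_fun_ck_on[OF h c(1)]])
  have px: "\<phi> x \<in> \<phi> ` U" using c(2) by blast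
  have "\<bar>h (inv_into U \<phi> (\<phi> x))\<bar> > 0" using inv[OF c(2)] x(2) by simp
  from continuous_on_open_box[OF U cont px this] obtain r where r: "r > 0"
    "\<And>y. y \<in> open_box dm (\<phi> x) r \<Longrightarrow> \<bar>h (inv_into U \<phi> y) - h (inv_into U \<phi> (\<phi> x))\<bar> < \<bar>h (inv_into U \<phi> (\<phi> x))\<bar>"
    by metis
  let ?T = "{m \<in> U. \<phi> m \<in> open_box dm (\<phi> x) r}"
  have "openin (mtop M) ?T" by (rule openin_chart_preimage[OF c(1) eopen_open_box])
  moreover have "x \<in> ?T" using c(2) open_box_center r(1) px eopen_subset[OF U] by blast
  moreover have "h m \<noteq> 0" if "m \<in> ?T" for m
    using r(2)[of "\<phi> m"] that inv[of m] inv[OF c(2)] by auto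
  moreover have "?T \<subseteq> points M" using chart_facts(4)[OF c(1)] by blast
  ultimately show "\<exists>T. openin (mtop M) T \<and> x \<in> T \<and> T \<subseteq> {x \<in> points M. h x \<noteq> 0}" by blast
qed

lemma smooth_zero_on_closure:
  assumes h: "smooth_fun M h" and Z: "Z \<subseteq> points M" and R: "\<And>z. z \<in> R \<Longrightarrow> h z = 0"
    and z: "z \<in> (subtopology (mtop M) Z) closure_of R"
  shows "h z = 0"
proof (rule ccontr)
  assume nz: "h z \<noteq> 0"
  have zZ: "z \<in> Z" using z by (auto simp: in_closure_of)
  have "openin (subtopology (mtop M) Z) ({x \<in> points M. h x \<noteq> 0} \<inter> Z)"
    using openin_smooth_nonzero[OF h] by (auto simp: openin_subtopology)
  moreover have "z \<in> {x \<in> points M. h x \<noteq> 0} \<inter> Z" using nz zZ Z by auto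
  moreover have "\<forall>T. z \<in> T \<and> openin (subtopology (mtop M) Z) T \<longrightarrow> (\<exists>y. y \<in> R \<and> y \<in> T)"
    using z unfolding in_closure_of by (rule conjunct2)
  ultimately have "\<exists>y. y \<in> R \<and> y \<in> {x \<in> points M. h x \<noteq> 0} \<inter> Z" by (meson)
  then show False using R by auto
qed

end

section \<open>The formal primitive, and acyclicity\<close>

text \<open>
  The exponents of the monomials of degree \<open>j - 1\<close>. The shift makes \<open>j = 0\<close> the zero form, which is what the
  correction term of a form of degree \<open>0\<close> has to be.
\<close>

definition exponents :: "nat \<Rightarrow> nat \<Rightarrow> (nat \<Rightarrow> nat) set" where
  "exponents l j = {\<alpha>. (\<forall>i\<ge>l. \<alpha> i = 0) \<and> Suc (\<Sum>a<l. \<alpha> a) = j}"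

definition monomial :: "nat \<Rightarrow> (nat \<Rightarrow> real) \<Rightarrow> (nat \<Rightarrow> nat) \<Rightarrow> real" where
  "monomial l y \<alpha> = (\<Prod>a<l. y a ^ \<alpha> a)"

lemma finite_exponents: "finite (exponents l j)"
proof (rule finite_subset)
  show "exponents l j \<subseteq> {\<alpha>. \<forall>i. (i \<in> {..<l} \<longrightarrow> \<alpha> i \<in> {..j}) \<and> (i \<notin> {..<l} \<longrightarrow> \<alpha> i = 0)}"
  proof (intro subsetI CollectI allI conjI impI)
    fix \<alpha> i assume \<alpha>: "\<alpha> \<in> exponents l j"
    show "\<alpha> i \<in> {..j}" if "i \<in> {..<l}"
    proof -
      have "\<alpha> i \<le> (\<Sum>a<l. \<alpha> a)" using that by (intro member_le_sum) auto
      then show ?thesis using \<alpha> by (simp add: exponents_def)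
    qed
    show "\<alpha> i = 0" if "i \<notin> {..<l}" using that \<alpha> by (simp add: exponents_def)
  qed
  show "finite {\<alpha>. \<forall>i. (i \<in> {..<l} \<longrightarrow> \<alpha> i \<in> {..j}) \<and> (i \<notin> {..<l} \<longrightarrow> \<alpha> i = (0::nat))}"
    by (rule finite_set_of_finite_funs) auto
qed

lemma exponents_1: "exponents l (Suc 0) = {\<lambda>_. 0}"
proof -
  have "\<alpha> = (\<lambda>_. 0)" if "\<forall>i\<ge>l. \<alpha> i = 0" "\<forall>a<l. \<alpha> a = 0" for \<alpha> :: "nat \<Rightarrow> nat"
  proof
    fix i show "\<alpha> i = 0" using that by (cases "i < l") auto
  qed
  then show ?thesis by (auto simp: exponents_def)
qed

lemma exponents_raise:
  assumes "b < l" shows "\<alpha>(b := Suc (\<alpha> b)) \<in> exponents l (Suc j) \<longleftrightarrow> \<alpha> \<in> exponents l j"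
proof -
  have "(\<Sum>a<l. (\<alpha>(b := Suc (\<alpha> b))) a) = Suc (\<Sum>a<l. \<alpha> a)"
    using assms by (simp add: sum.remove[of "{..<l}" b])
  moreover have "(\<forall>i\<ge>l. (\<alpha>(b := Suc (\<alpha> b))) i = 0) \<longleftrightarrow> (\<forall>i\<ge>l. \<alpha> i = 0)" using assms by auto
  ultimately show ?thesis unfolding exponents_def by auto
qed

lemma monomial_raise:
  assumes "b < l" shows "monomial l y (\<alpha>(b := Suc (\<alpha> b))) = y b * monomial l y \<alpha>"
  unfolding monomial_def using assms by (simp add: prod.remove[of "{..<l}" b])

lemma form_times_variable:
  assumes b: "b < l"
  shows "y b * (\<Sum>\<alpha>\<in>exponents l j. c \<alpha> * monomial l y \<alpha>)
     = (\<Sum>\<beta>\<in>exponents l (Suc j). (if \<beta> b > 0 then c (\<beta>(b := \<beta> b - 1)) else 0) * monomial l y \<beta>)"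
proof -
  let ?up = "\<lambda>\<alpha>::nat \<Rightarrow> nat. \<alpha>(b := Suc (\<alpha> b))"
  let ?g = "\<lambda>\<beta>. (if \<beta> b > 0 then c (\<beta>(b := \<beta> b - 1)) else 0) * monomial l y \<beta>"
  have "y b * (\<Sum>\<alpha>\<in>exponents l j. c \<alpha> * monomial l y \<alpha>) = (\<Sum>\<alpha>\<in>exponents l j. ?g (?up \<alpha>))"
    unfolding sum_distrib_left by (intro sum.cong refl) (simp add: monomial_raise[OF b] mult_ac)
  also have "\<dots> = sum ?g {\<beta>\<in>exponents l (Suc j). \<beta> b > 0}"
  proof (rule sum.reindex_bij_witness[of _ "\<lambda>\<beta>. \<beta>(b := \<beta> b - 1)" ?up])
    fix \<beta> assume "\<beta> \<in> {\<beta>\<in>exponents l (Suc j). \<beta> b > 0}"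
    then have "\<beta> \<in> exponents l (Suc j)" "?up (\<beta>(b := \<beta> b - 1)) = \<beta>" by auto
    then show "\<beta>(b := \<beta> b - 1) \<in> exponents l j" "?up (\<beta>(b := \<beta> b - 1)) = \<beta>"
      using exponents_raise[OF b, of "\<beta>(b := \<beta> b - 1)" j] by simp_all
  qed (use exponents_raise[OF b] in auto)
  also have "\<dots> = sum ?g (exponents l (Suc j))"
    by (rule sum.mono_neutral_left) (auto simp: finite_exponents)
  finally show ?thesis .
qed

text \<open>
  The Koszul differential on the coefficients of a polynomial form, where multiplication by \<open>y\<^sub>a\<close> shifts exponents.
\<close>

definition coeff_d :: "nat \<Rightarrow> (nat set \<Rightarrow> (nat \<Rightarrow> nat) \<Rightarrow> real) \<Rightarrow> nat set \<Rightarrow> (nat \<Rightarrow> nat) \<Rightarrow> real" where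
  "coeff_d l c S \<alpha> = (\<Sum>a\<in>{..<l} - S. (-1) ^ inversions {a} S *
      (if \<alpha> a > 0 then c (insert a S) (\<alpha>(a := \<alpha> a - 1)) else 0))"

text \<open>
  The de Rham differential in the variables \<open>y\<close>, on coefficients.
\<close>

definition coeff_de_Rham :: "(nat set \<Rightarrow> (nat \<Rightarrow> nat) \<Rightarrow> real) \<Rightarrow> nat set \<Rightarrow> (nat \<Rightarrow> nat) \<Rightarrow> real" where
  "coeff_de_Rham c S \<alpha> = (\<Sum>b\<in>S. (-1) ^ inversions {b} (S - {b}) *
      (real (Suc (\<alpha> b)) * c (S - {b}) (\<alpha>(b := Suc (\<alpha> b)))))"

lemma koszul_d_form:
  "koszul_d l y (\<lambda>T. \<Sum>\<alpha>\<in>exponents l j. c T \<alpha> * monomial l y \<alpha>) S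
   = (\<Sum>\<beta>\<in>exponents l (Suc j). coeff_d l c S \<beta> * monomial l y \<beta>)"
proof -
  have "koszul_d l y (\<lambda>T. \<Sum>\<alpha>\<in>exponents l j. c T \<alpha> * monomial l y \<alpha>) S
     = (\<Sum>a\<in>{..<l} - S. \<Sum>\<beta>\<in>exponents l (Suc j). (-1) ^ inversions {a} S *
         ((if \<beta> a > 0 then c (insert a S) (\<beta>(a := \<beta> a - 1)) else 0) * monomial l y \<beta>))"
    unfolding koszul_d_def
  proof (rule sum.cong[OF refl])
    fix a assume "a \<in> {..<l} - S"
    then have al: "a < l" by simp
    show "(-1) ^ inversions {a} S * (y a * (\<Sum>\<alpha>\<in>exponents l j. c (insert a S) \<alpha> * monomial l y \<alpha>))
      = (\<Sum>\<beta>\<in>exponents l (Suc j). (-1) ^ inversions {a} S *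
         ((if \<beta> a > 0 then c (insert a S) (\<beta>(a := \<beta> a - 1)) else 0) * monomial l y \<beta>))"
      unfolding form_times_variable[OF al] by (rule sum_distrib_left)
  qed
  also have "\<dots> = (\<Sum>\<beta>\<in>exponents l (Suc j). coeff_d l c S \<beta> * monomial l y \<beta>)"
    by (subst sum.swap) (simp add: coeff_d_def sum_distrib_right mult.assoc)
  finally show ?thesis .
qed

text \<open>
  Here \<open>P\<close> and \<open>Q\<close> are the compositions \<open>y\<^sub>a \<partial>/\<partial>y\<^sub>b\<close> and \<open>\<partial>/\<partial>y\<^sub>b y\<^sub>a\<close> on coefficients; the diagonal terms \<open>\<alpha>\<^sub>a\<close> and
  \<open>\<alpha>\<^sub>b + 1\<close> add up to polynomial degree plus form degree.
\<close>

lemma euler_homotopy: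
  assumes S: "S \<subseteq> {..<l}"
  shows "coeff_d l (coeff_de_Rham c) S \<alpha> + coeff_de_Rham (coeff_d l c) S \<alpha>
       = (real (\<Sum>a<l. \<alpha> a) + real (card S)) * c S \<alpha>"
proof -
  have fS: "finite S" using S finite_subset by blast
  define P where "P a b T = (if \<alpha> a > 0 then real (Suc ((\<alpha>(a := \<alpha> a - 1)) b)) *
      c T ((\<alpha>(a := \<alpha> a - 1))(b := Suc ((\<alpha>(a := \<alpha> a - 1)) b))) else 0)" for a b T
  define Q where "Q a b T = real (Suc (\<alpha> b)) * (if (\<alpha>(b := Suc (\<alpha> b))) a > 0
      then c T ((\<alpha>(b := Suc (\<alpha> b)))(a := (\<alpha>(b := Suc (\<alpha> b))) a - 1)) else 0)" for a b T
  have PQ: "P a b T = Q a b T" if "a \<noteq> b" for a b T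
    using that by (simp add: P_def Q_def fun_upd_twist)
  have Paa: "P a a S = real (\<alpha> a) * c S \<alpha>" for a
  proof (cases "\<alpha> a > 0")
    case True
    then have "(\<alpha>(a := \<alpha> a - 1))(a := Suc ((\<alpha>(a := \<alpha> a - 1)) a)) = \<alpha>" by auto
    then show ?thesis using True by (simp add: P_def)
  qed (simp add: P_def)
  have Qbb: "Q b b S = real (Suc (\<alpha> b)) * c S \<alpha>" for b by (simp add: Q_def)
  have 1: "coeff_d l (coeff_de_Rham c) S \<alpha> = (\<Sum>a\<in>{..<l} - S. (-1) ^ inversions {a} S *
      (\<Sum>b\<in>insert a S. (-1) ^ inversions {b} (insert a S - {b}) * P a b (insert a S - {b})))"
    unfolding coeff_d_def
  proof (rule sum.cong[OF refl], rule arg_cong[where f = "\<lambda>t. _ * t"])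
    fix a
    show "(if \<alpha> a > 0 then coeff_de_Rham c (insert a S) (\<alpha>(a := \<alpha> a - 1)) else 0)
      = (\<Sum>b\<in>insert a S. (-1) ^ inversions {b} (insert a S - {b}) * P a b (insert a S - {b}))"
      by (cases "\<alpha> a > 0") (simp_all only: coeff_de_Rham_def P_def if_True if_False mult_zero_right sum.neutral_const simp_thms)
  qed
  have 2: "coeff_de_Rham (coeff_d l c) S \<alpha> = (\<Sum>b\<in>S. (-1) ^ inversions {b} (S - {b}) *
      (\<Sum>a\<in>{..<l} - (S - {b}). (-1) ^ inversions {a} (S - {b}) * Q a b (insert a (S - {b}))))"
    unfolding coeff_de_Rham_def coeff_d_def Q_def
    by (intro sum.cong refl arg_cong[where f = "\<lambda>t. _ * t"]) (simp only: sum_distrib_left mult.left_commute)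
  have "coeff_d l (coeff_de_Rham c) S \<alpha> + coeff_de_Rham (coeff_d l c) S \<alpha>
      = (\<Sum>a\<in>{..<l} - S. P a a S) + (\<Sum>b\<in>S. Q b b S)"
    unfolding 1 2 by (rule koszul_homotopy_sum[OF S PQ])
  also have "\<dots> = ((\<Sum>a\<in>{..<l} - S. real (\<alpha> a)) + (\<Sum>b\<in>S. real (\<alpha> b)) + real (card S)) * c S \<alpha>"
    unfolding Paa Qbb by (simp add: sum_distrib_right[symmetric] sum.distrib algebra_simps)
  also have "(\<Sum>a\<in>{..<l} - S. real (\<alpha> a)) + (\<Sum>b\<in>S. real (\<alpha> b)) = (\<Sum>a<l. real (\<alpha> a))"
    using S by (simp add: sum.subset_diff[of S "{..<l}"])
  finally show ?thesis by simp
qed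

text \<open>
  The two properties of \<open>J\<close> from which acyclicity follows: \<open>J\<close> generates the vanishing ideal of its zero set, and
  relations between monomials in \<open>J\<close> of one degree have coefficients in this ideal.
\<close>

locale quasi_regular_equations = analytic_manifold M for M :: "'m manifold" +
  fixes l :: nat and J :: "nat \<Rightarrow> 'm \<Rightarrow> real"
  assumes J_smooth: "\<And>a. a < l \<Longrightarrow> smooth_fun M (J a)"
    and division: "\<And>u. smooth_fun M u \<Longrightarrow> (\<And>x. x \<in> points M \<Longrightarrow> \<forall>a<l. J a x = 0 \<Longrightarrow> u x = 0) \<Longrightarrow>
       \<exists>g. (\<forall>b. smooth_fun M (g b)) \<and> (\<forall>x\<in>points M. u x = (\<Sum>b<l. g b x * J b x))"
    and quasi_regular: "\<And>j c. (\<And>\<alpha>. \<alpha> \<in> exponents l j \<Longrightarrow> smooth_fun M (c \<alpha>)) \<Longrightarrow>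
       (\<And>x. x \<in> points M \<Longrightarrow> (\<Sum>\<alpha>\<in>exponents l j. c \<alpha> x * monomial l (\<lambda>a. J a x) \<alpha>) = 0) \<Longrightarrow>
       \<alpha> \<in> exponents l j \<Longrightarrow> z \<in> points M \<Longrightarrow> \<forall>a<l. J a z = 0 \<Longrightarrow> c \<alpha> z = 0"
begin

abbreviation "dJ v S x \<equiv> koszul_d l (\<lambda>a. J a x) (\<lambda>T. v T x) S"

definition form :: "nat \<Rightarrow> (nat set \<Rightarrow> (nat \<Rightarrow> nat) \<Rightarrow> 'm \<Rightarrow> real) \<Rightarrow> nat set \<Rightarrow> 'm \<Rightarrow> real" where
  "form j c S x = (\<Sum>\<alpha>\<in>exponents l j. c S \<alpha> x * monomial l (\<lambda>a. J a x) \<alpha>)"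

lemma koszul_d_form': "dJ (form j c) S x =
    (\<Sum>\<beta>\<in>exponents l (Suc j). coeff_d l (\<lambda>T \<alpha>. c T \<alpha> x) S \<beta> * monomial l (\<lambda>a. J a x) \<beta>)"
  unfolding form_def by (rule koszul_d_form)

lemma smooth_coeff_d:
  assumes "\<And>T \<alpha>. smooth_fun M (c T \<alpha>)" shows "smooth_fun M (\<lambda>x. coeff_d l (\<lambda>T \<alpha>. c T \<alpha> x) S \<beta>)"
  unfolding coeff_d_def
proof (rule smooth_fun_sum, rule smooth_fun_cmult)
  show "smooth_fun M (\<lambda>x. if 0 < \<beta> a then c (insert a S) (\<beta>(a := \<beta> a - 1)) x else 0)" for a
    by (cases "\<beta> a > 0") (simp_all add: assms smooth_fun_const)
qed

lemma smooth_coeff_de_Rham: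
  assumes "\<And>T \<alpha>. smooth_fun M (c T \<alpha>)" shows "smooth_fun M (\<lambda>x. coeff_de_Rham (\<lambda>T \<alpha>. c T \<alpha> x) S \<beta>)"
  unfolding coeff_de_Rham_def by (rule smooth_fun_sum) (intro smooth_fun_cmult assms)

lemma smooth_form:
  assumes "\<And>T \<alpha>. smooth_fun M (c T \<alpha>)" shows "smooth_fun M (form j c S)"
  unfolding form_def[abs_def] monomial_def
  by (rule smooth_fun_sum, rule smooth_fun_mult[OF assms smooth_fun_prod]) (simp add: smooth_fun_power J_smooth)

text \<open>
  Let \<open>R = (k + i)\<^sup>-\<^sup>1 d\<partial>F\<close> on coefficients, so that \<open>F = \<partial>W + R\<close> by Euler's relation. Since the form is a cycle,
  quasi-regularity makes the coefficients of \<open>\<partial>F\<close>, hence those of \<open>R\<close>, vanish on the zero set. Dividing them by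
  \<open>J\<close> turns \<open>R\<close> into a form \<open>F'\<close> of one degree more.
\<close>

lemma correction_step:
  assumes i: "i \<ge> 1" and F: "\<And>S \<alpha>. smooth_fun M (F S \<alpha>)" and deg: "\<And>S \<alpha> x. card S \<noteq> i \<Longrightarrow> F S \<alpha> x = 0"
    and cycle: "\<And>S x. S \<subseteq> {..<l} \<Longrightarrow> x \<in> points M \<Longrightarrow> dJ (form (Suc k) F) S x = 0"
  shows "\<exists>W F'. (\<forall>S \<alpha>. smooth_fun M (W S \<alpha>)) \<and> (\<forall>S \<alpha>. smooth_fun M (F' S \<alpha>)) \<and>
     (\<forall>S \<alpha> x. card S \<noteq> i \<longrightarrow> F' S \<alpha> x = 0) \<and>
     (\<forall>S\<subseteq>{..<l}. \<forall>x\<in>points M. form (Suc k) F S x = dJ (form k W) S x + form (Suc (Suc k)) F' S x)"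
proof -
  define dF where "dF S \<beta> x = coeff_d l (\<lambda>T \<alpha>. F T \<alpha> x) S \<beta>" for S \<beta> x
  define W where "W S \<alpha> x = inverse (real (k + i)) * coeff_de_Rham (\<lambda>T \<alpha>. F T \<alpha> x) S \<alpha>" for S \<alpha> x
  define R where "R S \<alpha> x = inverse (real (k + i)) * coeff_de_Rham (\<lambda>T \<alpha>. dF T \<alpha> x) S \<alpha>" for S \<alpha> x
  have ki: "real (k + i) > 0" using i by simp
  have dF: "smooth_fun M (dF S \<beta>)" for S \<beta> unfolding dF_def[abs_def] by (rule smooth_coeff_d[OF F])
  have W: "smooth_fun M (W S \<alpha>)" for S \<alpha>
    unfolding W_def[abs_def] by (rule smooth_fun_cmult[OF smooth_coeff_de_Rham[OF F]])
  have R: "smooth_fun M (R S \<alpha>)" for S \<alpha>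
    unfolding R_def[abs_def] by (rule smooth_fun_cmult[OF smooth_coeff_de_Rham[OF dF]])
  have dF0: "dF S \<beta> z = 0" if "S \<subseteq> {..<l}" "\<beta> \<in> exponents l (Suc (Suc k))" "z \<in> points M" "\<forall>a<l. J a z = 0" for S \<beta> z
    by (rule quasi_regular[of "Suc (Suc k)" "dF S", OF dF _ that(2-4)])
      (use cycle[OF that(1)] in \<open>simp add: koszul_d_form' dF_def\<close>)
  have R0: "R S \<alpha> z = 0" if S: "S \<subseteq> {..<l}" and \<alpha>: "\<alpha> \<in> exponents l (Suc k)" and z: "z \<in> points M" "\<forall>a<l. J a z = 0" for S \<alpha> z
  proof -
    have "dF (S - {b}) (\<alpha>(b := Suc (\<alpha> b))) z = 0" if "b \<in> S" for b
      by (rule dF0) (use S \<alpha> z that exponents_raise[of b l \<alpha> "Suc k"] in auto)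
    then show ?thesis by (simp add: R_def coeff_de_Rham_def)
  qed
  have ex: "\<exists>g. (\<forall>b. smooth_fun M (g b)) \<and> (\<forall>x\<in>points M. R S \<alpha> x = (\<Sum>b<l. g b x * J b x))"
    if "S \<subseteq> {..<l}" "\<alpha> \<in> exponents l (Suc k)" for S \<alpha>
    by (rule division[OF R]) (use R0[OF that] in blast)
  define g where "g S \<alpha> = (SOME g. (\<forall>b. smooth_fun M (g b)) \<and>
      (\<forall>x\<in>points M. R S \<alpha> x = (\<Sum>b<l. g b x * J b x)))" for S \<alpha>
  have g: "smooth_fun M (g S \<alpha> b)" "x \<in> points M \<Longrightarrow> R S \<alpha> x = (\<Sum>b<l. g S \<alpha> b x * J b x)"
    if "S \<subseteq> {..<l}" "\<alpha> \<in> exponents l (Suc k)" for S \<alpha> b x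
    using someI_ex[OF ex[OF that]] unfolding g_def[symmetric] by simp_all
  define G where "G S \<alpha> b x = (if card S = i \<and> S \<subseteq> {..<l} \<and> \<alpha> \<in> exponents l (Suc k) then g S \<alpha> b x else 0)" for S \<alpha> b x
  have G: "smooth_fun M (G S \<alpha> b)" for S \<alpha> b
  proof (cases "card S = i \<and> S \<subseteq> {..<l} \<and> \<alpha> \<in> exponents l (Suc k)")
    case True
    then have "G S \<alpha> b = g S \<alpha> b" by (simp add: G_def fun_eq_iff)
    then show ?thesis using g(1) True by simp
  next
    case False
    then have "G S \<alpha> b = (\<lambda>x. 0)" unfolding G_def fun_eq_iff by (simp only: if_False simp_thms)
    then show ?thesis using smooth_fun_const[of 0] by simp
  qed
  define F' where "F' S \<beta> x = (\<Sum>b<l. if \<beta> b > 0 then G S (\<beta>(b := \<beta> b - 1)) b x else 0)" for S \<beta> x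
  have F': "smooth_fun M (F' S \<beta>)" for S \<beta>
    unfolding F'_def[abs_def]
  proof (rule smooth_fun_sum)
    show "smooth_fun M (\<lambda>x. if 0 < \<beta> b then G S (\<beta>(b := \<beta> b - 1)) b x else 0)" for b
      by (cases "\<beta> b > 0") (simp_all add: G smooth_fun_const)
  qed
  have G0: "G S \<alpha> b x = 0" if "card S \<noteq> i" for S \<alpha> b x
    using that by (simp add: G_def)
  have F'0: "F' S \<alpha> x = 0" if "card S \<noteq> i" for S \<alpha> x
    unfolding F'_def G0[OF that] by simp
  have euler: "coeff_d l (\<lambda>T \<alpha>. W T \<alpha> x) S \<alpha> + R S \<alpha> x = F S \<alpha> x"
    if S: "S \<subseteq> {..<l}" and \<alpha>: "\<alpha> \<in> exponents l (Suc k)" for S \<alpha> x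
  proof -
    have "coeff_d l (\<lambda>T \<alpha>. W T \<alpha> x) S \<alpha> = inverse (real (k + i)) * coeff_d l (coeff_de_Rham (\<lambda>T \<alpha>. F T \<alpha> x)) S \<alpha>"
      unfolding coeff_d_def W_def sum_distrib_left by (intro sum.cong refl) simp
    moreover have "R S \<alpha> x = inverse (real (k + i)) * coeff_de_Rham (coeff_d l (\<lambda>T \<alpha>. F T \<alpha> x)) S \<alpha>"
      unfolding R_def dF_def by simp
    ultimately have "coeff_d l (\<lambda>T \<alpha>. W T \<alpha> x) S \<alpha> + R S \<alpha> x
        = inverse (real (k + i)) * ((real (\<Sum>a<l. \<alpha> a) + real (card S)) * F S \<alpha> x)"
      using euler_homotopy[OF S, of "\<lambda>T \<alpha>. F T \<alpha> x" \<alpha>] by (simp only: distrib_left[symmetric])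
    moreover have "(\<Sum>a<l. \<alpha> a) = k" using \<alpha> by (simp add: exponents_def)
    moreover have "inverse (real (k + i)) * ((real k + real (card S)) * F S \<alpha> x) = F S \<alpha> x"
    proof (cases "card S = i")
      case True
      then have "inverse (real (k + i)) * (real k + real (card S)) = 1" using ki by simp
      then show ?thesis by (simp only: mult.assoc[symmetric] mult_1_left)
    qed (simp add: deg)
    ultimately show ?thesis by simp
  qed
  have RG: "R S \<alpha> x = (\<Sum>b<l. G S \<alpha> b x * J b x)" if S: "S \<subseteq> {..<l}" and \<alpha>: "\<alpha> \<in> exponents l (Suc k)" and x: "x \<in> points M" for S \<alpha> x
  proof (cases "card S = i")
    case True
    then show ?thesis using g(2)[OF S \<alpha> x] S \<alpha> by (simp add: G_def)
  next
    case False
    have "coeff_d l (\<lambda>T \<alpha>. W T \<alpha> x) S \<alpha> = 0"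
      unfolding coeff_d_def
    proof (intro sum.neutral ballI)
      fix a assume a: "a \<in> {..<l} - S"
      have "finite S" using S finite_subset by blast
      have "W (insert a S) \<beta> x = 0" for \<beta>
      proof -
        have "F (insert a S - {b}) \<gamma> x = 0" if "b \<in> insert a S" for b \<gamma>
          using deg[of "insert a S - {b}" \<gamma> x] that a \<open>finite S\<close> False by (simp add: card_insert_if del: insert_Diff_single)
        then show ?thesis by (simp add: W_def coeff_de_Rham_def del: insert_Diff_single)
      qed
      then show "(-1) ^ inversions {a} S * (if \<alpha> a > 0 then W (insert a S) (\<alpha>(a := \<alpha> a - 1)) x else 0) = 0" by simp
    qed
    then have "R S \<alpha> x = 0" using euler[OF S \<alpha>, of x] deg[OF False, of \<alpha> x] by simp
    then show ?thesis using False by (simp add: G_def)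
  qed
  have "form (Suc k) F S x = dJ (form k W) S x + form (Suc (Suc k)) F' S x"
    if S: "S \<subseteq> {..<l}" and x: "x \<in> points M" for S x
  proof -
    let ?m = "monomial l (\<lambda>a. J a x)"
    have "form (Suc k) F S x = (\<Sum>\<alpha>\<in>exponents l (Suc k). coeff_d l (\<lambda>T \<alpha>. W T \<alpha> x) S \<alpha> * ?m \<alpha>)
        + (\<Sum>\<alpha>\<in>exponents l (Suc k). R S \<alpha> x * ?m \<alpha>)"
      unfolding form_def sum.distrib[symmetric]
      by (intro sum.cong refl) (simp add: euler[OF S, symmetric] distrib_right)
    also have "(\<Sum>\<alpha>\<in>exponents l (Suc k). R S \<alpha> x * ?m \<alpha>)
        = (\<Sum>b<l. J b x * (\<Sum>\<alpha>\<in>exponents l (Suc k). G S \<alpha> b x * ?m \<alpha>))"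
      unfolding sum_distrib_left
      by (subst sum.swap) (intro sum.cong refl, simp add: RG[OF S _ x] sum_distrib_left sum_distrib_right mult_ac)
    also have "\<dots> = (\<Sum>b<l. \<Sum>\<beta>\<in>exponents l (Suc (Suc k)). (if \<beta> b > 0 then G S (\<beta>(b := \<beta> b - 1)) b x else 0) * ?m \<beta>)"
      by (intro sum.cong refl) (simp add: form_times_variable[where y = "\<lambda>a. J a x"])
    also have "\<dots> = form (Suc (Suc k)) F' S x"
      unfolding form_def F'_def sum_distrib_right by (rule sum.swap)
    finally show ?thesis by (simp add: koszul_d_form')
  qed
  then show ?thesis using W F' F'0 by blast
qed

lemma formal_primitive:
  assumes i: "i \<ge> 1" and f: "\<And>S. smooth_fun M (f S)" and deg: "\<And>S x. card S \<noteq> i \<Longrightarrow> f S x = 0"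
    and cycle: "\<And>S x. S \<subseteq> {..<l} \<Longrightarrow> x \<in> points M \<Longrightarrow> dJ f S x = 0"
  obtains F W where "\<And>k S \<alpha>. smooth_fun M (F k S \<alpha>)" "\<And>k S \<alpha>. smooth_fun M (W k S \<alpha>)"
    "\<And>k S x. S \<subseteq> {..<l} \<Longrightarrow> x \<in> points M \<Longrightarrow> dJ (form (Suc k) (F k)) S x = 0"
    "\<And>k S x. S \<subseteq> {..<l} \<Longrightarrow> x \<in> points M \<Longrightarrow>
       form (Suc k) (F k) S x = dJ (form k (W k)) S x + form (Suc (Suc k)) (F (Suc k)) S x"
    "\<And>S x. form (Suc 0) (F 0) S x = f S x"
proof -
  \<comment> \<open>Dependent choice: the next form is chosen after the previous one.\<close>
  define P where "P k F \<longleftrightarrow> (\<forall>S \<alpha>. smooth_fun M (F S \<alpha>)) \<and> (\<forall>S \<alpha> x. card S \<noteq> i \<longrightarrow> F S \<alpha> x = 0) \<and>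
    (\<forall>S\<subseteq>{..<l}. \<forall>x\<in>points M. dJ (form (Suc k) F) S x = 0) \<and>
    (k = 0 \<longrightarrow> F = (\<lambda>S \<alpha>. f S))" for k and F :: "nat set \<Rightarrow> (nat \<Rightarrow> nat) \<Rightarrow> 'm \<Rightarrow> real"
  define Q where "Q k F F' \<longleftrightarrow> (\<exists>W. (\<forall>S \<alpha>. smooth_fun M (W S \<alpha>)) \<and>
    (\<forall>S\<subseteq>{..<l}. \<forall>x\<in>points M. form (Suc k) F S x = dJ (form k W) S x + form (Suc (Suc k)) F' S x))"
    for k and F F' :: "nat set \<Rightarrow> (nat \<Rightarrow> nat) \<Rightarrow> 'm \<Rightarrow> real"
  have base: "form (Suc 0) (\<lambda>S \<alpha>. f S) S x = f S x" for S x
    by (simp add: form_def exponents_1 monomial_def)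
  have "P 0 (\<lambda>S \<alpha>. f S)" unfolding P_def base using f deg cycle by simp
  moreover have "\<exists>F'. P (Suc k) F' \<and> Q k F F'" if P: "P k F" for k F
  proof -
    have F: "\<And>S \<alpha>. smooth_fun M (F S \<alpha>)" "\<And>S \<alpha> x. card S \<noteq> i \<Longrightarrow> F S \<alpha> x = 0"
      "\<And>S x. S \<subseteq> {..<l} \<Longrightarrow> x \<in> points M \<Longrightarrow> dJ (form (Suc k) F) S x = 0"
      using P unfolding P_def by blast+
    obtain W F' where W: "\<forall>S \<alpha>. smooth_fun M (W S \<alpha>)" and F': "\<forall>S \<alpha>. smooth_fun M (F' S \<alpha>)"
      "\<forall>S \<alpha> x. card S \<noteq> i \<longrightarrow> F' S \<alpha> x = 0"
      and eq: "\<forall>S\<subseteq>{..<l}. \<forall>x\<in>points M. form (Suc k) F S x = dJ (form k W) S x + form (Suc (Suc k)) F' S x"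
      using correction_step[OF i F] by blast
    have "dJ (form (Suc (Suc k)) F') S x = 0" if S: "S \<subseteq> {..<l}" and x: "x \<in> points M" for S x
    proof -
      have "dJ (form (Suc (Suc k)) F') S x
          = koszul_d l (\<lambda>a. J a x) (\<lambda>T. form (Suc k) F T x - dJ (form k W) T x) S"
        by (rule koszul_d_cong[OF S]) (use eq x in simp)
      also have "\<dots> = 0" unfolding koszul_d_diff koszul_d_d[OF S] using F(3)[OF S x] by simp
      finally show ?thesis .
    qed
    then have "P (Suc k) F'" unfolding P_def using F' by simp
    moreover have "Q k F F'" unfolding Q_def using W eq by blast
    ultimately show ?thesis by blast
  qed
  ultimately obtain F where F: "\<forall>k. P k (F k)" "\<forall>k. Q k (F k) (F (Suc k))"
    using dependent_nat_choice[of P Q] by blast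
  from F(2) have "\<forall>k. \<exists>W. (\<forall>S \<alpha>. smooth_fun M (W S \<alpha>)) \<and>
    (\<forall>S\<subseteq>{..<l}. \<forall>x\<in>points M. form (Suc k) (F k) S x = dJ (form k W) S x + form (Suc (Suc k)) (F (Suc k)) S x)"
    unfolding Q_def .
  from choice[OF this] obtain W where W: "\<forall>k. (\<forall>S \<alpha>. smooth_fun M (W k S \<alpha>)) \<and>
    (\<forall>S\<subseteq>{..<l}. \<forall>x\<in>points M. form (Suc k) (F k) S x = dJ (form k (W k)) S x + form (Suc (Suc k)) (F (Suc k)) S x)" by blast
  note PF = F(1)[THEN spec, unfolded P_def]
  have "F 0 = (\<lambda>S \<alpha>. f S)" using PF[of 0] by simp
  then have 1: "form (Suc 0) (F 0) S x = f S x" for S x by (simp only: base)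
  have 2: "smooth_fun M (F k S \<alpha>)" for k S \<alpha> using conjunct1[OF PF[of k]] by simp
  have 3: "dJ (form (Suc k) (F k)) S x = 0" if "S \<subseteq> {..<l}" "x \<in> points M" for k S x
    using conjunct1[OF conjunct2[OF conjunct2[OF PF[of k]]]] that by simp
  show ?thesis
  proof (rule that[OF 2 _ 3 _ 1])
    show "smooth_fun M (W k S \<alpha>)" for k S \<alpha> using conjunct1[OF spec[OF W, of k]] by simp
    show "form (Suc k) (F k) S x = dJ (form k (W k)) S x + form (Suc (Suc k)) (F (Suc k)) S x"
      if "S \<subseteq> {..<l}" "x \<in> points M" for k S x
      using conjunct2[OF spec[OF W, of k]] that by simp
  qed
qed

text \<open>
  The formal primitive is summed in a chart around each point, multiplied by a bump function and extended by zero.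
\<close>

theorem koszul_acyclic:
  assumes i: "i \<ge> 1" and f: "\<And>S. smooth_fun M (f S)" and deg: "\<And>S x. card S \<noteq> i \<Longrightarrow> f S x = 0"
    and cycle: "\<And>S x. S \<subseteq> {..<l} \<Longrightarrow> x \<in> points M \<Longrightarrow> dJ f S x = 0"
  shows "\<exists>\<eta>. \<forall>S\<subseteq>{..<l}. smooth_fun M (\<eta> S) \<and> (\<forall>x\<in>points M. dJ \<eta> S x = f S x)"
proof (rule koszul_primitive_glue)
  obtain F W where F: "\<And>k S \<alpha>. smooth_fun M (F k S \<alpha>)" and W: "\<And>k S \<alpha>. smooth_fun M (W k S \<alpha>)"
    and cyc: "\<And>k S x. S \<subseteq> {..<l} \<Longrightarrow> x \<in> points M \<Longrightarrow> dJ (form (Suc k) (F k)) S x = 0"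
    and st: "\<And>k S x. S \<subseteq> {..<l} \<Longrightarrow> x \<in> points M \<Longrightarrow>
       form (Suc k) (F k) S x = dJ (form k (W k)) S x + form (Suc (Suc k)) (F (Suc k)) S x"
    and F0: "\<And>S x. form (Suc 0) (F 0) S x = f S x"
    using formal_primitive[OF i f deg cycle] by blast
  fix p assume p: "p \<in> points M"
  obtain U \<phi> r \<rho> where ch: "(U, \<phi>) \<in> matlas M" "p \<in> U" "r > 0" "closed_box dm (\<phi> p) r \<subseteq> \<phi> ` U"
    "\<And>Q k. eopen dm Q \<Longrightarrow> ck_on k dm Q \<rho>"
    "\<And>y. y \<in> open_box dm (\<phi> p) r \<Longrightarrow> y \<notin> closed_box dm (\<phi> p) (r/2) \<Longrightarrow> \<rho> y = 0"
    "\<exists>s>0. s < r \<and> (\<forall>y\<in>open_box dm (\<phi> p) s. \<rho> y = 1)" using bump_chart[OF p] by blast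
  note U = chart_facts(2)[OF ch(1)]
  define B where "B = open_box dm (\<phi> p) r"
  have BU: "B \<subseteq> \<phi> ` U"
    using ch(4) by (rule order_trans[rotated]) (simp add: B_def open_box_def closed_box_def subset_iff less_imp_le)
  have KB: "closed_box dm (\<phi> p) (r/2) \<subseteq> B" using ch(3) by (force simp: closed_box_def open_box_def B_def)
  define param where "param = inv_into U \<phi>"
  have inv: "param (\<phi> x) = x" if "x \<in> U" for x using chart_facts(3)[OF ch(1)] that by (simp add: param_def)
  have paramU: "param y \<in> U" "param y \<in> points M" if "y \<in> B" for y
    using inv_into_into[of y \<phi> U] BU that chart_facts(4)[OF ch(1)] by (auto simp: param_def)
  have sm: "smooth_in dm (\<phi> ` U) (\<lambda>y. u (param y))" if "smooth_fun M u" for u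
    unfolding param_def smooth_in_def using smooth_fun_ck_on[OF that ch(1)] by blast
  have bd: "weighted_domain.sym_order dm B (\<lambda>_. 1) N (\<lambda>y. u (param y))" if "smooth_fun M u" for u N
    unfolding B_def by (rule smooth_bounded_on_box[OF U ch(4) sm[OF that]])
  define Jh where "Jh a y = J a (param y)" for a y
  define fh where "fh k S y = form (Suc k) (F k) S (param y)" for k S y
  define Wh where "Wh k S y = form k (W k) S (param y)" for k S y
  interpret E: local_equations dm B l Jh
  proof
    show "eopen dm B" by (simp add: B_def eopen_open_box)
    show "weighted_domain.sym_order dm B (\<lambda>_. 1) 0 (Jh a)" if "a < l" for a
      unfolding Jh_def[abs_def] by (rule bd[OF J_smooth[OF that]])
  qed
  have zero: "form (Suc (Suc k)) c S (param y) = 0" if "E.q y = 0" for k c S y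
  proof -
    have J0: "J a (param y) = 0" if "a < l" for a
      using E.q_zero_iff[of y] \<open>E.q y = 0\<close> that by (simp add: Jh_def)
    have "monomial l (\<lambda>a. J a (param y)) \<alpha> = 0" if \<alpha>: "\<alpha> \<in> exponents l (Suc (Suc k))" for \<alpha>
    proof -
      have "(\<Sum>a<l. \<alpha> a) \<noteq> 0" using \<alpha> by (simp add: exponents_def)
      then obtain a where a: "a < l" "\<alpha> a \<noteq> 0" by (meson lessThan_iff sum.neutral)
      then have "J a (param y) ^ \<alpha> a = 0" using J0 by simp
      then show ?thesis unfolding monomial_def using a(1) by (intro prod_zero) auto
    qed
    then show ?thesis unfolding form_def by simp
  qed
  have formorder: "E.X.sym_order (real k / 2) (\<lambda>y. form (Suc k) c S (param y))"
    if c: "\<And>\<alpha>. smooth_fun M (c S \<alpha>)" for k c S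
    unfolding form_def monomial_def Jh_def[symmetric]
    by (rule E.order_form[where c = "\<lambda>\<alpha> y. c S \<alpha> (param y)"]) (use bd[OF c] in \<open>auto simp: exponents_def\<close>)
  interpret R: local_resolution dm B l Jh fh Wh
  proof
    fix k :: nat and S x assume S: "S \<subseteq> {..<l}"
    show "E.X.sym_order (real k / 2) (fh k S)"
      unfolding fh_def[abs_def] by (rule formorder) (rule F)
    show "E.X.sym_order ((real k - 1) / 2) (Wh k S)"
    proof (cases k)
      case 0
      have "Wh 0 S y = 0" for y by (simp add: Wh_def form_def exponents_def)
      then have "Wh 0 S = (\<lambda>y. 0)" by blast
      then show ?thesis using E.X.sym_order_zero 0 by simp
    next
      case (Suc k')
      have "E.X.sym_order (real k' / 2) (\<lambda>y. form (Suc k') (W (Suc k')) S (param y))"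
        by (rule formorder) (rule W)
      then show ?thesis unfolding Wh_def[abs_def] Suc by simp
    qed
    have "smooth_fun M (form k (W k) S)" by (rule smooth_form) (rule W)
    from sm[OF this] show "smooth_in dm B (Wh k S)"
      using ck_on_subset[OF U E.B BU] unfolding Wh_def[abs_def] smooth_in_def by blast
    assume x: "x \<in> B"
    note xM = paramU(2)[OF x]
    show "Wh k S x = 0" if q: "E.q x = 0" and k: "k \<noteq> 1"
    proof (cases k)
      case 0
      then show ?thesis by (simp add: Wh_def form_def exponents_def)
    next
      case (Suc k')
      then obtain k'' where "k = Suc (Suc k'')" using k by (cases k') auto
      then show ?thesis using zero[OF q] by (simp add: Wh_def)
    qed
    show "fh 0 S x = 0" if q: "E.q x = 0"
    proof -
      have "J a (param x) = 0" if "a < l" for a using E.q_zero_iff[of x] q that by (simp add: Jh_def)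
      then have "dJ (form 0 (W 0)) S (param x) = 0" by (simp add: koszul_d_def)
      then show ?thesis using st[OF S xM, of 0] zero[OF q] by (simp add: fh_def)
    qed
    show "koszul_d l (\<lambda>a. Jh a x) (\<lambda>T. fh k T x) S = 0"
      unfolding Jh_def fh_def by (rule cyc[OF S xM])
    show "fh k S x = koszul_d l (\<lambda>a. Jh a x) (\<lambda>T. Wh k T x) S + fh (Suc k) S x"
      unfolding Jh_def fh_def Wh_def by (rule st[OF S xM])
  qed
  obtain \<eta> where \<eta>: "\<And>S. S \<subseteq> {..<l} \<Longrightarrow> smooth_in dm B (\<eta> S)"
    "\<And>S y. S \<subseteq> {..<l} \<Longrightarrow> y \<in> B \<Longrightarrow> koszul_d l (\<lambda>a. Jh a y) (\<lambda>T. \<eta> T y) S = fh 0 S y"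
    using R.local_primitive by blast
  define ext where "ext g m = (if m \<in> U \<and> \<phi> m \<in> B then \<rho> (\<phi> m) * g (\<phi> m) else 0)" for g m
  have ext: "smooth_fun M (ext g)" if "smooth_in dm B g" for g
    unfolding ext_def[abs_def]
  proof (rule smooth_fun_extend_by_zero[OF ch(1) E.B BU _ KB, of "\<lambda>y. \<rho> y * g y"])
    show "smooth_in dm B (\<lambda>y. \<rho> y * g y)"
      using that unfolding smooth_in_def by (intro allI ck_on_mult[OF E.B ch(5)[OF E.B]]) simp
    show "\<rho> y * g y = 0" if "y \<in> B" "y \<notin> closed_box dm (\<phi> p) (r/2)" for y
      using ch(6)[folded B_def, OF that] by simp
  qed
  define \<sigma> where "\<sigma> = ext (\<lambda>y. 1)"
  obtain s where s: "s > 0" "s < r" "\<And>y. y \<in> open_box dm (\<phi> p) s \<Longrightarrow> \<rho> y = 1" using ch(7) by blast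
  define V where "V = {m \<in> U. \<phi> m \<in> open_box dm (\<phi> p) s}"
  have "smooth_fun M \<sigma>" unfolding \<sigma>_def
    by (rule ext) (simp add: smooth_in_def ck_on_const[OF E.B] del: ck_on.simps)
  moreover have "openin (mtop M) V" unfolding V_def by (rule openin_chart_preimage[OF ch(1) eopen_open_box])
  moreover have "p \<in> V"
    using ch(2) s(1) eopen_subset[OF U] open_box_center[of "\<phi> p" dm s] by (auto simp: V_def)
  moreover have "\<forall>x\<in>V. \<sigma> x = 1"
    using s(3) open_box_mono[of s r dm "\<phi> p"] s(2) by (auto simp: V_def \<sigma>_def ext_def B_def subset_iff)
  moreover have "dJ (\<lambda>S. ext (\<eta> S)) S x = \<sigma> x * f S x" if S: "S \<subseteq> {..<l}" and x: "x \<in> points M" for S x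
  proof (cases "x \<in> U \<and> \<phi> x \<in> B")
    case True
    have e: "ext g x = \<rho> (\<phi> x) * g (\<phi> x)" for g using True by (simp only: ext_def if_True simp_thms)
    have "dJ (\<lambda>S. ext (\<eta> S)) S x = \<rho> (\<phi> x) * koszul_d l (\<lambda>a. J a x) (\<lambda>T. \<eta> T (\<phi> x)) S"
      unfolding e by (rule koszul_d_cmult)
    also have "koszul_d l (\<lambda>a. J a x) (\<lambda>T. \<eta> T (\<phi> x)) S = f S x"
      using \<eta>(2)[OF S, of "\<phi> x"] True inv F0 by (simp add: fh_def Jh_def)
    finally show ?thesis by (simp add: \<sigma>_def e)
  next
    case False
    then have e: "ext g x = 0" for g by (simp only: ext_def if_False)
    show ?thesis by (simp add: \<sigma>_def e koszul_d_def)
  qed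
  ultimately show "\<exists>\<rho> V e. smooth_fun M \<rho> \<and> openin (mtop M) V \<and> p \<in> V \<and> (\<forall>x\<in>V. \<rho> x = 1) \<and>
      (\<forall>S\<subseteq>{..<l}. smooth_fun M (e S) \<and> (\<forall>x\<in>points M. dJ e S x = \<rho> x * f S x))"
    using ext[OF \<eta>(1)] by (intro exI[of _ \<sigma>] exI[of _ V] exI[of _ "\<lambda>S. ext (\<eta> S)"]) simp
qed

end

section \<open>The ring of smooth functions and its Koszul homology\<close>

context analytic_manifold
begin

lemma C_inf_simps [simp]:
  "carrier (C_inf M) = smooth_functions M"
  "f \<otimes>\<^bsub>C_inf M\<^esub> g = (\<lambda>x\<in>points M. f x * g x)"
  "f \<oplus>\<^bsub>C_inf M\<^esub> g = (\<lambda>x\<in>points M. f x + g x)"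
  "\<one>\<^bsub>C_inf M\<^esub> = (\<lambda>x\<in>points M. 1)"
  "\<zero>\<^bsub>C_inf M\<^esub> = (\<lambda>x\<in>points M. 0)"
  by (simp_all add: C_inf_def function_ring_def)

lemma smooth_functions_eqI:
  assumes "f \<in> smooth_functions M" "g \<in> smooth_functions M" "\<And>x. x \<in> points M \<Longrightarrow> f x = g x"
  shows "f = g"
  using assms by (intro extensionalityI[of f "points M" g]) (auto simp: smooth_functions_iff)

lemma cring_C_inf: "cring (C_inf M)"
proof (rule cringI)
  have add: "(\<lambda>x\<in>points M. f x + g x) \<in> smooth_functions M"
    and mult: "(\<lambda>x\<in>points M. f x * g x) \<in> smooth_functions M"
    if "f \<in> smooth_functions M" "g \<in> smooth_functions M" for f g
    using that smooth_fun_restrict[OF smooth_fun_add] smooth_fun_restrict[OF smooth_fun_mult]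
    by (auto simp: smooth_functions_iff)
  have const: "(\<lambda>x\<in>points M. c) \<in> smooth_functions M" for c
    by (rule smooth_fun_restrict[OF smooth_fun_const])
  show "abelian_group (C_inf M)"
  proof (rule abelian_groupI)
    fix f assume f: "f \<in> carrier (C_inf M)"
    have "(\<lambda>x\<in>points M. (-1) * f x) \<in> smooth_functions M"
      using f by (intro smooth_fun_restrict smooth_fun_cmult) (simp add: smooth_functions_iff)
    then show "\<exists>g\<in>carrier (C_inf M). g \<oplus>\<^bsub>C_inf M\<^esub> f = \<zero>\<^bsub>C_inf M\<^esub>"
      by (intro bexI[of _ "\<lambda>x\<in>points M. (-1) * f x"]) auto
    show "\<zero>\<^bsub>C_inf M\<^esub> \<oplus>\<^bsub>C_inf M\<^esub> f = f"
      using f add[OF const[of 0]] by (intro smooth_functions_eqI) auto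
  qed (auto intro: add const)
  show "comm_monoid (C_inf M)"
  proof (rule comm_monoidI)
    fix f assume f: "f \<in> carrier (C_inf M)"
    show "\<one>\<^bsub>C_inf M\<^esub> \<otimes>\<^bsub>C_inf M\<^esub> f = f"
      using f mult[OF const[of 1]] by (intro smooth_functions_eqI) auto
  qed (auto intro: mult const simp: mult_ac)
qed (auto simp: algebra_simps)

sublocale C: cring "C_inf M" by (rule cring_C_inf)

lemma C_inf_minus: 
  assumes f: "f \<in> smooth_functions M" shows "\<ominus>\<^bsub>C_inf M\<^esub> f = (\<lambda>x\<in>points M. - f x)"
proof (rule C.minus_equality)
  have "(\<lambda>x\<in>points M. (-1) * f x) \<in> smooth_functions M"
    using f by (intro smooth_fun_restrict smooth_fun_cmult) (simp add: smooth_functions_iff)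
  then show "(\<lambda>x\<in>points M. - f x) \<in> carrier (C_inf M)" by simp
qed (use f in auto)

lemma C_inf_finsum:
  assumes "finite A" "\<And>a. a \<in> A \<Longrightarrow> f a \<in> smooth_functions M"
  shows "finsum (C_inf M) f A = (\<lambda>x\<in>points M. \<Sum>a\<in>A. f a x)"
  using assms
proof (induction A rule: finite_induct)
  case (insert a A)
  then have "f \<in> A \<rightarrow> carrier (C_inf M)" "f a \<in> carrier (C_inf M)" by auto
  then show ?case using insert by (auto simp: C.finsum_insert)
qed simp

lemma C_inf_alt_sign: "alt_sign (C_inf M) k = (\<lambda>x\<in>points M. (-1) ^ k)"
proof -
  have "\<ominus>\<^bsub>C_inf M\<^esub> \<one>\<^bsub>C_inf M\<^esub> = (\<lambda>x\<in>points M. - 1)"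
    using C_inf_minus[of "\<one>\<^bsub>C_inf M\<^esub>"] C.one_closed by (auto simp: restrict_def)
  then show ?thesis by (simp add: C.alt_sign_even)
qed

text \<open>
  The linear combinations of the \<open>J\<^sub>a\<close> form an ideal.
\<close>

lemma ideal_generated_by_functions:
  fixes J :: "nat \<Rightarrow> 'm \<Rightarrow> real"
  assumes Js: "\<And>a. a < l \<Longrightarrow> J a \<in> smooth_functions M"
  shows "Idl\<^bsub>C_inf M\<^esub> (J ` {..<l}) \<subseteq>
    {u. \<exists>g. (\<forall>b. smooth_fun M (g b)) \<and> u = (\<lambda>x\<in>points M. \<Sum>b<l. g b x * J b x)}" (is "_ \<subseteq> ?I")
proof (rule C.genideal_minimal)
  have Jsm: "smooth_fun M (J b)" if "b < l" for b using Js[OF that] by (simp add: smooth_functions_iff)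
  have sub: "?I \<subseteq> smooth_functions M"
  proof clarify
    fix g :: "nat \<Rightarrow> 'm \<Rightarrow> real" assume "\<forall>b. smooth_fun M (g b)"
    then show "(\<lambda>x\<in>points M. \<Sum>b<l. g b x * J b x) \<in> smooth_functions M"
      by (intro smooth_fun_restrict smooth_fun_sum smooth_fun_mult Jsm) auto
  qed
  have mult: "u \<otimes>\<^bsub>C_inf M\<^esub> h \<in> ?I" "h \<otimes>\<^bsub>C_inf M\<^esub> u \<in> ?I" if u: "u \<in> ?I" and h: "h \<in> carrier (C_inf M)" for u h
  proof -
    obtain g where g: "\<forall>b. smooth_fun M (g b)" "u = (\<lambda>x\<in>points M. \<Sum>b<l. g b x * J b x)" using u by blast
    have "u \<otimes>\<^bsub>C_inf M\<^esub> h = (\<lambda>x\<in>points M. \<Sum>b<l. (h x * g b x) * J b x)"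
      unfolding g(2) by (auto simp: restrict_def sum_distrib_left sum_distrib_right mult_ac)
    moreover have "\<forall>b. smooth_fun M (\<lambda>x. h x * g b x)"
      using g(1) h smooth_fun_mult by (simp add: smooth_functions_iff)
    ultimately show 1: "u \<otimes>\<^bsub>C_inf M\<^esub> h \<in> ?I" by (intro CollectI exI[of _ "\<lambda>b x. h x * g b x"]) simp
    have "u \<in> carrier (C_inf M)" using u sub by auto
    then show "h \<otimes>\<^bsub>C_inf M\<^esub> u \<in> ?I" using 1 C.m_comm[of h u] h by simp
  qed
  show "ideal ?I (C_inf M)"
  proof (rule idealI[OF C.ring_axioms _ mult(2) mult(1)])
    show "subgroup ?I (add_monoid (C_inf M))"
    proof (rule C.add.subgroupI)
      show "?I \<subseteq> carrier (C_inf M)" using sub by simp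
      have "(\<lambda>x\<in>points M. \<Sum>b<l. 0 * J b x) \<in> ?I"
        by (intro CollectI exI[of _ "\<lambda>b x. 0"] conjI allI smooth_fun_const refl)
      then show "?I \<noteq> {}" by blast
      fix u assume u: "u \<in> ?I"
      then obtain g where g: "\<forall>b. smooth_fun M (g b)" "u = (\<lambda>x\<in>points M. \<Sum>b<l. g b x * J b x)" by blast
      have "\<ominus>\<^bsub>C_inf M\<^esub> u = (\<lambda>x\<in>points M. \<Sum>b<l. ((-1) * g b x) * J b x)"
        using C_inf_minus[OF subsetD[OF sub u]] unfolding g(2) by (auto simp: restrict_def sum_negf)
      then show "\<ominus>\<^bsub>C_inf M\<^esub> u \<in> ?I"
        using g(1) smooth_fun_cmult by (intro CollectI exI[of _ "\<lambda>b x. (-1) * g b x"] conjI allI) blast+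
      fix v assume v: "v \<in> ?I"
      obtain g h where g: "\<forall>b. smooth_fun M (g b)" "u = (\<lambda>x\<in>points M. \<Sum>b<l. g b x * J b x)"
        and h: "\<forall>b. smooth_fun M (h b)" "v = (\<lambda>x\<in>points M. \<Sum>b<l. h b x * J b x)" using u v by blast
      have "u \<oplus>\<^bsub>C_inf M\<^esub> v = (\<lambda>x\<in>points M. \<Sum>b<l. (g b x + h b x) * J b x)"
        unfolding g(2) h(2) by (auto simp: restrict_def sum.distrib distrib_right)
      then show "u \<oplus>\<^bsub>C_inf M\<^esub> v \<in> ?I"
        using g h smooth_fun_add by (intro CollectI exI[of _ "\<lambda>b x. g b x + h b x"]) simp
    qed
  qed
  show "J ` {..<l} \<subseteq> ?I"
  proof clarify
    fix a assume a: "a < l"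
    have "(\<Sum>b<l. (if b = a then 1 else 0) * J b x) = J a x" for x
      using a by (subst sum.remove[of _ a]) auto
    then have "J a = (\<lambda>x\<in>points M. \<Sum>b<l. (if b = a then 1 else 0) * J b x)"
      using Js[OF a] by (simp add: smooth_functions_iff extensional_restrict)
    then show "\<exists>g. (\<forall>b. smooth_fun M (g b)) \<and> J a = (\<lambda>x\<in>points M. \<Sum>b<l. g b x * J b x)"
      by (intro exI[of _ "\<lambda>b x. if b = a then 1 else 0"]) (auto intro: smooth_fun_const)
  qed
qed

end

locale koszul_of_manifold = quasi_regular_equations M l "\<lambda>a x. J x a"
  for M :: "'m manifold" and l :: nat and J :: "'m \<Rightarrow> nat \<Rightarrow> real" +
  fixes Z assumes Z: "Z = {x \<in> points M. \<forall>a<l. J x a = 0}"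
begin

abbreviation "RM \<equiv> C_inf M"
abbreviation "JM \<equiv> component M J"

sublocale K: koszul RM l JM
proof
  fix a assume "a < l"
  then show "JM a \<in> carrier RM"
    using smooth_fun_restrict[OF J_smooth] by (simp add: component_def)
qed

abbreviation "EM \<equiv> exterior_algebra RM l"

lemma component_app [simp]: "x \<in> points M \<Longrightarrow> JM a x = J x a" by (simp add: component_def)

lemma E_smooth: "x \<in> carrier EM \<Longrightarrow> S \<subseteq> {..<l} \<Longrightarrow> x S \<in> smooth_functions M"
  using K.E_app by simp

lemma E_eqI:
  assumes "x \<in> carrier EM" "y \<in> carrier EM" "\<And>S m. S \<subseteq> {..<l} \<Longrightarrow> m \<in> points M \<Longrightarrow> x S m = y S m"
  shows "x = y"
  using assms E_smooth by (intro K.E_ext smooth_functions_eqI) auto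

lemma koszul_diff_app:
  assumes x: "x \<in> carrier EM" and S: "S \<subseteq> {..<l}" and m: "m \<in> points M"
  shows "koszul_diff RM l JM x S m = dJ x S m"
proof -
  let ?t = "\<lambda>a. alt_sign RM (inversions {a} S) \<otimes>\<^bsub>RM\<^esub> (JM a \<otimes>\<^bsub>RM\<^esub> x (insert a S))"
  have t: "?t a \<in> smooth_functions M" if "a \<in> {..<l} - S" for a
  proof -
    have "x (insert a S) \<in> carrier RM" by (rule K.E_app[OF x]) (use that S in auto)
    then have "?t a \<in> carrier RM"
      using that by (intro C.m_closed K.J_closed C.alt_sign_closed) auto
    then show ?thesis by simp
  qed
  have "koszul_diff RM l JM x S = finsum RM ?t ({..<l} - S)"
    unfolding K.koszul_diff_formula by (rule K.dd_app[OF x S])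
  also have "\<dots> = (\<lambda>m\<in>points M. \<Sum>a\<in>{..<l} - S. ?t a m)" by (rule C_inf_finsum) (use t in auto)
  finally show ?thesis using m by (simp add: C_inf_alt_sign koszul_d_def)
qed

lemma koszul_diff_closed: "x \<in> carrier EM \<Longrightarrow> koszul_diff RM l JM x \<in> carrier EM"
  unfolding K.koszul_diff_formula by (rule K.dd_closed)

lemma exterior_zero_app: "S \<subseteq> {..<l} \<Longrightarrow> m \<in> points M \<Longrightarrow> \<zero>\<^bsub>EM\<^esub> S m = 0"
  by (simp add: K.E_simps(6))

lemma koszul_moduleI:
  assumes "\<And>S. S \<subseteq> {..<l} \<Longrightarrow> smooth_fun M (v S)"
    and "\<And>S m. S \<subseteq> {..<l} \<Longrightarrow> card S \<noteq> i \<Longrightarrow> m \<in> points M \<Longrightarrow> v S m = 0"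
  shows "(\<lambda>S\<in>Pow {..<l}. restrict (v S) (points M)) \<in> koszul_module RM l i"
proof -
  have "restrict (v S) (points M) = (\<lambda>x\<in>points M. 0)" if "S \<subseteq> {..<l}" "card S \<noteq> i" for S
    by (rule restrict_ext) (use assms(2) that in auto)
  then show ?thesis using assms(1) by (auto simp: koszul_module_def K.E_simps(1) smooth_fun_restrict)
qed

lemma koszul_module_app:
  "x \<in> koszul_module RM l i \<Longrightarrow> S \<subseteq> {..<l} \<Longrightarrow> card S \<noteq> i \<Longrightarrow> m \<in> points M \<Longrightarrow> x S m = 0"
  by (simp add: koszul_module_def)

lemma koszul_module_carrier: "x \<in> koszul_module RM l i \<Longrightarrow> x \<in> carrier EM"
  by (simp add: koszul_module_def)

lemma koszul_d_restrict:
  assumes "S \<subseteq> {..<l}" "m \<in> points M"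
  shows "dJ (\<lambda>S\<in>Pow {..<l}. restrict (v S) (points M)) S m = dJ v S m"
  by (rule koszul_d_cong) (use assms in auto)

lemma cycles_are_boundaries:
  assumes i: "i \<noteq> 0" shows "koszul_cycles RM l JM i \<subseteq> koszul_boundaries RM l JM i"
proof
  fix z assume z: "z \<in> koszul_cycles RM l JM i"
  then have zm: "z \<in> koszul_module RM l i" and dz: "koszul_diff RM l JM z = \<zero>\<^bsub>EM\<^esub>"
    by (auto simp: koszul_cycles_def)
  note zE = koszul_module_carrier[OF zm]
  define f where "f S m = (if S \<subseteq> {..<l} \<and> m \<in> points M then z S m else 0)" for S m
  have fz: "f S m = z S m" if "S \<subseteq> {..<l}" "m \<in> points M" for S m using that by (simp add: f_def)
  have fsm: "smooth_fun M (f S)" for S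
  proof (cases "S \<subseteq> {..<l}")
    case True
    then show ?thesis using E_smooth[OF zE True] smooth_fun_cong[of "z S" "f S"] fz by (simp add: smooth_functions_iff)
  next
    case False
    then show ?thesis using smooth_fun_cong[OF smooth_fun_const[of 0], of "f S"] by (simp add: f_def)
  qed
  have deg: "f S m = 0" if "card S \<noteq> i" for S m
    using koszul_module_app[OF zm _ that] by (simp add: f_def)
  have cyc: "dJ f S m = 0" if S: "S \<subseteq> {..<l}" and m: "m \<in> points M" for S m
  proof -
    have "dJ f S m = dJ z S m" by (rule koszul_d_cong[OF S]) (simp add: fz m)
    also have "\<dots> = 0"
      using koszul_diff_app[OF zE S m] dz exterior_zero_app[OF S m] by simp
    finally show ?thesis .
  qed
  have "i \<ge> 1" using i by simp
  from koszul_acyclic[OF this fsm deg cyc] obtain \<eta> where \<eta>: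
    "\<And>S. S \<subseteq> {..<l} \<Longrightarrow> smooth_fun M (\<eta> S)" "\<And>S m. S \<subseteq> {..<l} \<Longrightarrow> m \<in> points M \<Longrightarrow> dJ \<eta> S m = f S m"
    by blast
  define v where "v S = (if card S = Suc i then \<eta> S else (\<lambda>m. 0))" for S
  define y where "y = (\<lambda>S\<in>Pow {..<l}. restrict (v S) (points M))"
  have y: "y \<in> koszul_module RM l (Suc i)"
    unfolding y_def by (rule koszul_moduleI) (use \<eta>(1) smooth_fun_const[of 0] in \<open>auto simp: v_def\<close>)
  have "koszul_diff RM l JM y = z"
  proof (rule E_eqI[OF koszul_diff_closed[OF koszul_module_carrier[OF y]] zE])
    fix S m assume S: "S \<subseteq> {..<l}" and m: "m \<in> points M"
    have fS: "finite S" using S finite_subset by blast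
    have "koszul_diff RM l JM y S m = dJ v S m"
      using koszul_diff_app[OF koszul_module_carrier[OF y] S m] koszul_d_restrict[OF S m, of v] by (simp add: y_def)
    also have "\<dots> = z S m"
    proof (cases "card S = i")
      case True
      have "dJ v S m = dJ \<eta> S m"
        unfolding koszul_d_def by (intro sum.cong refl) (use fS True in \<open>simp add: v_def\<close>)
      then show ?thesis using \<eta>(2)[OF S m] fz[OF S m] by simp
    next
      case False
      have "dJ v S m = 0"
        unfolding koszul_d_def by (intro sum.neutral ballI) (use fS False in \<open>simp add: v_def\<close>)
      then show ?thesis using koszul_module_app[OF zm S False m] by simp
    qed
    finally show "koszul_diff RM l JM y S m = z S m" .
  qed
  then show "z \<in> koszul_boundaries RM l JM i" using y unfolding koszul_boundaries_def by blast
qed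

text \<open>
  The boundaries in degree \<open>0\<close> are the combinations \<open>\<Sum>g\<^sub>a J\<^sub>a\<close>, that is, the functions in the vanishing ideal.
\<close>

lemma boundaries_0:
  "koszul_boundaries RM l JM 0 = {x \<in> koszul_module RM l 0. \<forall>z\<in>Z. x {} z = 0}"
proof (intro equalityI subsetI)
  fix x assume "x \<in> koszul_boundaries RM l JM 0"
  then obtain y where y: "y \<in> koszul_module RM l (Suc 0)" "x = koszul_diff RM l JM y"
    by (auto simp: koszul_boundaries_def)
  have "x {} z = 0" if "z \<in> Z" for z
    using koszul_diff_app[OF koszul_module_carrier[OF y(1)], of "{}" z] that
    by (simp add: y(2) Z koszul_d_def)
  moreover have "x \<in> koszul_module RM l 0" unfolding y(2) by (rule K.koszul_diff_degree[OF y(1)])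
  ultimately show "x \<in> {x \<in> koszul_module RM l 0. \<forall>z\<in>Z. x {} z = 0}" by blast
next
  fix x assume "x \<in> {x \<in> koszul_module RM l 0. \<forall>z\<in>Z. x {} z = 0}"
  then have x: "x \<in> koszul_module RM l 0" and xZ: "\<And>z. z \<in> Z \<Longrightarrow> x {} z = 0" by auto
  note xE = koszul_module_carrier[OF x]
  have "smooth_fun M (x {})" using E_smooth[OF xE, of "{}"] by (simp add: smooth_functions_iff)
  from division[OF this] xZ obtain g where g: "\<And>b. smooth_fun M (g b)"
    "\<And>m. m \<in> points M \<Longrightarrow> x {} m = (\<Sum>b<l. g b m * J m b)" by (auto simp: Z)
  define v where "v S = (if card S = Suc 0 then g (the_elem S) else (\<lambda>m. 0))" for S
  define y where "y = (\<lambda>S\<in>Pow {..<l}. restrict (v S) (points M))"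
  have y: "y \<in> koszul_module RM l (Suc 0)"
    unfolding y_def by (rule koszul_moduleI) (use g(1) smooth_fun_const[of 0] in \<open>auto simp: v_def\<close>)
  have "koszul_diff RM l JM y = x"
  proof (rule E_eqI[OF koszul_diff_closed[OF koszul_module_carrier[OF y]] xE])
    fix S m assume S: "S \<subseteq> {..<l}" and m: "m \<in> points M"
    have fS: "finite S" using S finite_subset by blast
    have "koszul_diff RM l JM y S m = dJ v S m"
      using koszul_diff_app[OF koszul_module_carrier[OF y] S m] koszul_d_restrict[OF S m, of v] by (simp add: y_def)
    also have "\<dots> = x S m"
    proof (cases "S = {}")
      case True
      then show ?thesis using g(2)[OF m] by (simp add: koszul_d_def v_def mult.commute)
    next
      case False
      have c: "card S \<noteq> 0" using False fS by simp
      have "dJ v S m = 0"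
        unfolding koszul_d_def by (intro sum.neutral ballI) (use fS c in \<open>simp add: v_def\<close>)
      then show ?thesis using koszul_module_app[OF x S c m] by simp
    qed
    finally show "koszul_diff RM l JM y S m = x S m" .
  qed
  then show "x \<in> koszul_boundaries RM l JM 0" using y unfolding koszul_boundaries_def by blast
qed

lemma cycles_0: "koszul_cycles RM l JM 0 = koszul_module RM l 0"
proof -
  have "koszul_diff RM l JM x = \<zero>\<^bsub>EM\<^esub>" if x: "x \<in> koszul_module RM l 0" for x
  proof (rule E_eqI[OF koszul_diff_closed[OF koszul_module_carrier[OF x]]])
    show "\<zero>\<^bsub>EM\<^esub> \<in> carrier EM" using C.zero_closed by (auto simp: K.E_simps(1,6))
    fix S m assume S: "S \<subseteq> {..<l}" and m: "m \<in> points M"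
    have fS: "finite S" using S finite_subset by blast
    have "x (insert a S) m = 0" if "a \<in> {..<l} - S" for a
      using koszul_module_app[OF x, of "insert a S"] S m that fS by (simp add: card_insert_if)
    then show "koszul_diff RM l JM x S m = \<zero>\<^bsub>EM\<^esub> S m"
      unfolding koszul_diff_app[OF koszul_module_carrier[OF x] S m] exterior_zero_app[OF S m] koszul_d_def by simp
  qed
  then show ?thesis by (auto simp: koszul_cycles_def)
qed

text \<open>
  Since every cycle is a boundary, each coset is a translate of the subgroup of boundaries by one of its elements.
\<close>

lemma homology_carrier_positive:
  assumes i: "i \<noteq> 0"
  shows "carrier (koszul_homology RM l JM i) = {\<zero>\<^bsub>koszul_homology RM l JM i\<^esub>}"
proof -
  let ?C = "koszul_cycles RM l JM i" and ?B = "koszul_boundaries RM l JM i"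
  have diff_add: "koszul_diff RM l JM (x \<oplus>\<^bsub>EM\<^esub> y) = koszul_diff RM l JM x \<oplus>\<^bsub>EM\<^esub> koszul_diff RM l JM y"
    if "x \<in> carrier EM" "y \<in> carrier EM" for x y
    unfolding K.koszul_diff_formula using that by (rule K.dd_add)
  have BE: "b \<in> carrier EM" if "b \<in> ?B" for b
    using that koszul_diff_closed koszul_module_carrier by (auto simp: koszul_boundaries_def)
  have mod_add: "x \<oplus>\<^bsub>EM\<^esub> y \<in> koszul_module RM l j" if "x \<in> koszul_module RM l j" "y \<in> koszul_module RM l j" for x y j
    using that K.E_add_closed[of x y] by (auto simp: koszul_module_def K.E_simps(2))
  have add: "b \<oplus>\<^bsub>EM\<^esub> c \<in> ?B" if b: "b \<in> ?B" and c: "c \<in> ?B" for b c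
  proof -
    obtain x y where x: "x \<in> koszul_module RM l (Suc i)" "b = koszul_diff RM l JM x"
      and y: "y \<in> koszul_module RM l (Suc i)" "c = koszul_diff RM l JM y"
      using b c by (auto simp: koszul_boundaries_def)
    have "b \<oplus>\<^bsub>EM\<^esub> c = koszul_diff RM l JM (x \<oplus>\<^bsub>EM\<^esub> y)"
      using diff_add[of x y] x y koszul_module_carrier by simp
    then show ?thesis using mod_add[OF x(1) y(1)] unfolding koszul_boundaries_def by blast
  qed
  have neg: "\<exists>c'\<in>?B. \<forall>S m. S \<subseteq> {..<l} \<longrightarrow> m \<in> points M \<longrightarrow> c' S m = - c S m" if c: "c \<in> ?B" for c
  proof -
    obtain y where y: "y \<in> koszul_module RM l (Suc i)" "c = koszul_diff RM l JM y"
      using c by (auto simp: koszul_boundaries_def)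
    note yE = koszul_module_carrier[OF y(1)]
    define v where "v S m = (-1) * y S m" for S m
    define y' where "y' = (\<lambda>S\<in>Pow {..<l}. restrict (v S) (points M))"
    have y': "y' \<in> koszul_module RM l (Suc i)"
      unfolding y'_def
    proof (rule koszul_moduleI)
      show "smooth_fun M (v S)" if "S \<subseteq> {..<l}" for S
        unfolding v_def[abs_def] using E_smooth[OF yE that] by (intro smooth_fun_cmult) (simp add: smooth_functions_iff)
      show "v S m = 0" if "S \<subseteq> {..<l}" "card S \<noteq> Suc i" "m \<in> points M" for S m
        using koszul_module_app[OF y(1) that] by (simp add: v_def)
    qed
    have "koszul_diff RM l JM y' S m = - c S m" if S: "S \<subseteq> {..<l}" and m: "m \<in> points M" for S m
    proof -
      have "koszul_diff RM l JM y' S m = dJ v S m"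
        using koszul_diff_app[OF koszul_module_carrier[OF y'] S m] koszul_d_restrict[OF S m, of v] by (simp add: y'_def)
      also have "\<dots> = (-1) * dJ y S m" unfolding v_def by (rule koszul_d_cmult)
      also have "\<dots> = - c S m" using koszul_diff_app[OF yE S m] y(2) by simp
      finally show ?thesis .
    qed
    then show ?thesis using y' unfolding koszul_boundaries_def by blast
  qed
  have coset: "(\<Union>h\<in>?B. {h \<oplus>\<^bsub>EM\<^esub> c}) = ?B" if c: "c \<in> ?B" for c
  proof (intro equalityI subsetI)
    fix b assume "b \<in> ?B"
    obtain c' where c': "c' \<in> ?B" "\<forall>S m. S \<subseteq> {..<l} \<longrightarrow> m \<in> points M \<longrightarrow> c' S m = - c S m" using neg[OF c] by blast
    have "b = (b \<oplus>\<^bsub>EM\<^esub> c') \<oplus>\<^bsub>EM\<^esub> c"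
      by (rule E_eqI[OF BE[OF \<open>b \<in> ?B\<close>] K.E_add_closed[OF K.E_add_closed[OF BE[OF \<open>b \<in> ?B\<close>] BE[OF c'(1)]] BE[OF c]]])
        (simp add: K.E_simps(2) c'(2))
    then show "b \<in> (\<Union>h\<in>?B. {h \<oplus>\<^bsub>EM\<^esub> c})" using add[OF \<open>b \<in> ?B\<close> c'(1)] by blast
  qed (use add c in auto)
  have zero: "\<zero>\<^bsub>EM\<^esub> \<in> ?C"
  proof -
    have z: "\<zero>\<^bsub>EM\<^esub> \<in> carrier EM" using C.zero_closed by (auto simp: K.E_simps(1,6))
    have "koszul_diff RM l JM \<zero>\<^bsub>EM\<^esub> = \<zero>\<^bsub>EM\<^esub>"
    proof (rule E_eqI[OF koszul_diff_closed[OF z] z])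
      fix S m assume S: "S \<subseteq> {..<l}" and m: "m \<in> points M"
      have "\<zero>\<^bsub>EM\<^esub> (insert a S) m = 0" if "a \<in> {..<l} - S" for a
        by (rule exterior_zero_app) (use S m that in auto)
      then show "koszul_diff RM l JM \<zero>\<^bsub>EM\<^esub> S m = \<zero>\<^bsub>EM\<^esub> S m"
        unfolding koszul_diff_app[OF z S m] exterior_zero_app[OF S m] koszul_d_def by simp
    qed
    moreover have "\<zero>\<^bsub>EM\<^esub> \<in> koszul_module RM l i" using z by (simp add: koszul_module_def K.E_simps(6))
    ultimately show ?thesis by (simp add: koszul_cycles_def)
  qed
  have "carrier (koszul_homology RM l JM i) = (\<Union>a\<in>?C. {\<Union>h\<in>?B. {h \<oplus>\<^bsub>EM\<^esub> a}})"
    by (simp add: koszul_homology_def FactRing_def A_RCOSETS_def' a_r_coset_def')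
  also have "\<dots> = {?B}" using coset cycles_are_boundaries[OF i] zero by auto
  finally show ?thesis by (simp add: koszul_homology_def FactRing_def)
qed

end

context koszul_of_manifold
begin

text \<open>
  The coset of \<open>x\<close> modulo boundaries, described by values on \<open>Z\<close>.
\<close>

definition degree0_class :: "(nat set \<Rightarrow> 'm \<Rightarrow> real) \<Rightarrow> (nat set \<Rightarrow> 'm \<Rightarrow> real) set" where
  "degree0_class x = {w \<in> koszul_module RM l 0. \<forall>z\<in>Z. w {} z = x {} z}"

text \<open>
  The element of Koszul degree \<open>0\<close> with coefficient \<open>u\<close>.
\<close>

definition const_form :: "('m \<Rightarrow> real) \<Rightarrow> nat set \<Rightarrow> 'm \<Rightarrow> real" where
  "const_form u = (\<lambda>S\<in>Pow {..<l}. restrict (if S = {} then u else (\<lambda>_. 0)) (points M))"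

lemma Z_subset: "Z \<subseteq> points M" by (auto simp: Z)

lemma const_form_module: "smooth_fun M u \<Longrightarrow> const_form u \<in> koszul_module RM l 0"
  unfolding const_form_def
proof (rule koszul_moduleI)
  fix S m assume "S \<subseteq> {..<l}" "card S \<noteq> 0"
  then show "(if S = {} then u else (\<lambda>_. 0)) m = 0" by auto
qed (auto intro: smooth_fun_const)

lemma const_form_empty: "m \<in> points M \<Longrightarrow> const_form u {} m = u m"
  by (simp add: const_form_def)

lemma module_0_eqI:
  assumes "x \<in> koszul_module RM l 0" "y \<in> koszul_module RM l 0" "\<And>m. m \<in> points M \<Longrightarrow> x {} m = y {} m"
  shows "x = y"
proof (rule E_eqI[OF koszul_module_carrier[OF assms(1)] koszul_module_carrier[OF assms(2)]])
  fix S m assume S: "S \<subseteq> {..<l}" and m: "m \<in> points M"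
  have fS: "finite S" using S finite_subset by blast
  show "x S m = y S m"
  proof (cases "S = {}")
    case False
    then have "card S \<noteq> 0" using fS by simp
    then show ?thesis using koszul_module_app[OF assms(1) S _ m] koszul_module_app[OF assms(2) S _ m] by simp
  qed (use assms(3) m in simp)
qed

lemma module_0_smooth: "x \<in> koszul_module RM l 0 \<Longrightarrow> smooth_fun M (x {})"
  using E_smooth[OF koszul_module_carrier, of x 0 "{}"] by (simp add: smooth_functions_iff)

lemma add_empty: "x \<oplus>\<^bsub>EM\<^esub> y = (\<lambda>S\<in>Pow {..<l}. \<lambda>m\<in>points M. x S m + y S m)"
  by (simp add: K.E_simps(2))

lemma add_module_0:
  assumes "x \<in> koszul_module RM l 0" "y \<in> koszul_module RM l 0"
  shows "x \<oplus>\<^bsub>EM\<^esub> y \<in> koszul_module RM l 0"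
  using assms K.E_add_closed[of x y] by (auto simp: koszul_module_def K.E_simps(2))

lemma mult_empty:
  assumes "x \<in> koszul_module RM l 0" "y \<in> koszul_module RM l 0" "m \<in> points M"
  shows "(x \<otimes>\<^bsub>EM\<^esub> y) {} m = x {} m * y {} m"
proof -
  note xE = koszul_module_carrier[OF assms(1)] and yE = koszul_module_carrier[OF assms(2)]
  have c: "x {} \<in> carrier RM" "y {} \<in> carrier RM" using K.E_app[OF xE, of "{}"] K.E_app[OF yE, of "{}"] by auto
  define t where "t A = alt_sign RM (inversions A ({} - A)) \<otimes>\<^bsub>RM\<^esub> (x A \<otimes>\<^bsub>RM\<^esub> y ({} - A))" for A
  have "t {} \<in> carrier RM"
    unfolding t_def using c C.m_closed C.alt_sign_closed by (metis Diff_empty)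
  then have tc: "t {} \<in> smooth_functions M" by simp
  have "(x \<otimes>\<^bsub>EM\<^esub> y) {} = finsum RM t {{}}"
    unfolding K.E_simps(4) t_def[abs_def] restrict_apply'[OF Pow_bottom] Pow_empty by (rule refl)
  also have "\<dots> = (\<lambda>m\<in>points M. \<Sum>A\<in>{{}}. t A m)" by (rule C_inf_finsum) (use tc in auto)
  finally show ?thesis using assms(3) by (simp add: t_def C_inf_alt_sign)
qed

lemma mult_module_0:
  assumes x: "x \<in> koszul_module RM l 0" and y: "y \<in> koszul_module RM l 0"
  shows "x \<otimes>\<^bsub>EM\<^esub> y \<in> koszul_module RM l 0"
proof -
  note xE = koszul_module_carrier[OF x] and yE = koszul_module_carrier[OF y]
  have "(x \<otimes>\<^bsub>EM\<^esub> y) S = \<zero>\<^bsub>RM\<^esub>" if S: "S \<in> Pow {..<l}" "card S \<noteq> 0" for S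
  proof -
    have sub: "S \<subseteq> {..<l}" using S by simp
    have fS: "finite S" using sub finite_subset by blast
    have "(x \<otimes>\<^bsub>EM\<^esub> y) S = (\<Oplus>\<^bsub>RM\<^esub>A\<in>Pow S. alt_sign RM (inversions A (S - A)) \<otimes>\<^bsub>RM\<^esub> (x A \<otimes>\<^bsub>RM\<^esub> y (S - A)))"
      unfolding K.E_simps(4) using S(1) by (rule restrict_apply')
    also have "\<dots> = (\<Oplus>\<^bsub>RM\<^esub>A\<in>Pow S. \<zero>\<^bsub>RM\<^esub>)"
    proof (rule C.finsum_cong'[OF refl])
      fix A assume "A \<in> Pow S"
      then have A: "A \<subseteq> {..<l}" "S - A \<subseteq> {..<l}" "A \<subseteq> S" using sub by auto
      have xy: "x A \<in> carrier RM" "y (S - A) \<in> carrier RM" using K.E_app[OF xE A(1)] K.E_app[OF yE A(2)] .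
      have "x A = \<zero>\<^bsub>RM\<^esub> \<or> y (S - A) = \<zero>\<^bsub>RM\<^esub>"
      proof (cases "A = {}")
        case True
        then show ?thesis using y A(2) S(2) by (simp add: koszul_module_def)
      next
        case False
        then have "card A \<noteq> 0" using A(3) fS finite_subset by fastforce
        then show ?thesis using x A(1) by (simp add: koszul_module_def)
      qed
      then show "alt_sign RM (inversions A (S - A)) \<otimes>\<^bsub>RM\<^esub> (x A \<otimes>\<^bsub>RM\<^esub> y (S - A)) = \<zero>\<^bsub>RM\<^esub>"
        using xy C.alt_sign_closed C.l_null C.r_null by metis
    qed (use C.zero_closed in simp)
    also have "\<dots> = \<zero>\<^bsub>RM\<^esub>" by (rule C.finsum_zero)
    finally show ?thesis .
  qed
  then show ?thesis using K.E_mult_closed[OF xE yE] by (simp add: koszul_module_def)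
qed

lemma coset_0:
  assumes x: "x \<in> koszul_module RM l 0"
  shows "(\<Union>h\<in>koszul_boundaries RM l JM 0. {h \<oplus>\<^bsub>EM\<^esub> x}) = degree0_class x"
proof (intro equalityI subsetI)
  fix w assume "w \<in> (\<Union>h\<in>koszul_boundaries RM l JM 0. {h \<oplus>\<^bsub>EM\<^esub> x})"
  then obtain h where h: "h \<in> koszul_module RM l 0" "\<forall>z\<in>Z. h {} z = 0" "w = h \<oplus>\<^bsub>EM\<^esub> x"
    by (auto simp: boundaries_0)
  then show "w \<in> degree0_class x"
    using add_module_0[OF h(1) x] Z_subset by (auto simp: degree0_class_def add_empty)
next
  fix w assume w: "w \<in> degree0_class x"
  then have wm: "w \<in> koszul_module RM l 0" by (simp add: degree0_class_def)
  define h where "h = const_form (\<lambda>m. w {} m - x {} m)"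
  have hm: "h \<in> koszul_module RM l 0"
    unfolding h_def by (rule const_form_module[OF smooth_fun_diff[OF module_0_smooth[OF wm] module_0_smooth[OF x]]])
  have "h \<in> koszul_boundaries RM l JM 0"
    unfolding boundaries_0 using hm w Z_subset by (auto simp: h_def const_form_empty degree0_class_def)
  moreover have "w = h \<oplus>\<^bsub>EM\<^esub> x"
    by (rule module_0_eqI[OF wm add_module_0[OF hm x]]) (simp add: add_empty h_def const_form_empty)
  ultimately show "w \<in> (\<Union>h\<in>koszul_boundaries RM l JM 0. {h \<oplus>\<^bsub>EM\<^esub> x})" by blast
qed

lemma degree0_class_eq_iff:
  assumes "x \<in> koszul_module RM l 0" "y \<in> koszul_module RM l 0"
  shows "degree0_class x = degree0_class y \<longleftrightarrow> (\<forall>z\<in>Z. x {} z = y {} z)"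
  using assms by (auto simp: degree0_class_def)

lemma mem_degree0_class: "x \<in> koszul_module RM l 0 \<Longrightarrow> x \<in> degree0_class x"
  by (simp add: degree0_class_def)

lemma homology_0_simps:
  defines "H \<equiv> koszul_homology RM l JM 0"
  shows "carrier H = degree0_class ` koszul_module RM l 0"
    and "\<And>x y. x \<in> koszul_module RM l 0 \<Longrightarrow> y \<in> koszul_module RM l 0 \<Longrightarrow>
       degree0_class x \<otimes>\<^bsub>H\<^esub> degree0_class y = degree0_class (x \<otimes>\<^bsub>EM\<^esub> y)"
    and "\<And>x y. x \<in> koszul_module RM l 0 \<Longrightarrow> y \<in> koszul_module RM l 0 \<Longrightarrow>
       degree0_class x \<oplus>\<^bsub>H\<^esub> degree0_class y = degree0_class (x \<oplus>\<^bsub>EM\<^esub> y)"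
    and "\<one>\<^bsub>H\<^esub> = degree0_class \<one>\<^bsub>EM\<^esub>" and "\<one>\<^bsub>EM\<^esub> \<in> koszul_module RM l 0"
proof -
  let ?K = "koszul_module RM l 0" and ?B = "koszul_boundaries RM l JM 0"
  have "carrier H = (\<Union>a\<in>?K. {\<Union>h\<in>?B. {h \<oplus>\<^bsub>EM\<^esub> a}})"
    by (simp add: H_def koszul_homology_def FactRing_def A_RCOSETS_def' a_r_coset_def' cycles_0)
  also have "\<dots> = (\<Union>a\<in>?K. {degree0_class a})" by (rule SUP_cong) (simp_all only: coset_0)
  also have "\<dots> = degree0_class ` ?K" by (rule UNION_singleton_eq_range)
  finally show "carrier H = degree0_class ` ?K" .
  show one: "\<one>\<^bsub>EM\<^esub> \<in> ?K" using K.ext_basis_in_module[of "{}"] by (simp add: K.E_simps(5))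
  have "\<one>\<^bsub>H\<^esub> = (\<Union>h\<in>?B. {h \<oplus>\<^bsub>EM\<^esub> \<one>\<^bsub>EM\<^esub>})"
    by (simp add: H_def koszul_homology_def FactRing_def a_r_coset_def')
  then show "\<one>\<^bsub>H\<^esub> = degree0_class \<one>\<^bsub>EM\<^esub>" by (simp only: coset_0[OF one])
  fix x y assume x: "x \<in> ?K" and y: "y \<in> ?K"
  have "degree0_class x \<otimes>\<^bsub>H\<^esub> degree0_class y = (\<Union>a\<in>degree0_class x. \<Union>b\<in>degree0_class y. \<Union>h\<in>?B. {h \<oplus>\<^bsub>EM\<^esub> (a \<otimes>\<^bsub>EM\<^esub> b)})"
    by (simp add: H_def koszul_homology_def FactRing_def rcoset_mult_def a_r_coset_def')
  also have "\<dots> = (\<Union>a\<in>degree0_class x. \<Union>b\<in>degree0_class y. degree0_class (x \<otimes>\<^bsub>EM\<^esub> y))"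
  proof (intro SUP_cong refl)
    fix a b assume "a \<in> degree0_class x" "b \<in> degree0_class y"
    then have a: "a \<in> ?K" "\<forall>z\<in>Z. a {} z = x {} z" and b: "b \<in> ?K" "\<forall>z\<in>Z. b {} z = y {} z"
      by (auto simp: degree0_class_def)
    have "\<forall>z\<in>Z. (a \<otimes>\<^bsub>EM\<^esub> b) {} z = (x \<otimes>\<^bsub>EM\<^esub> y) {} z"
      using a b x y mult_empty Z_subset by (auto simp: subset_iff)
    then show "(\<Union>h\<in>?B. {h \<oplus>\<^bsub>EM\<^esub> (a \<otimes>\<^bsub>EM\<^esub> b)}) = degree0_class (x \<otimes>\<^bsub>EM\<^esub> y)"
      unfolding coset_0[OF mult_module_0[OF a(1) b(1)]]
      by (simp only: degree0_class_eq_iff[OF mult_module_0[OF a(1) b(1)] mult_module_0[OF x y]])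
  qed
  also have "\<dots> = degree0_class (x \<otimes>\<^bsub>EM\<^esub> y)" using mem_degree0_class[OF x] mem_degree0_class[OF y] by blast
  finally show "degree0_class x \<otimes>\<^bsub>H\<^esub> degree0_class y = degree0_class (x \<otimes>\<^bsub>EM\<^esub> y)" .
  have "degree0_class x \<oplus>\<^bsub>H\<^esub> degree0_class y = (\<Union>a\<in>degree0_class x. \<Union>b\<in>degree0_class y. {a \<oplus>\<^bsub>EM\<^esub> b})"
    by (simp add: H_def koszul_homology_def FactRing_def set_add_def')
  also have "\<dots> = degree0_class (x \<oplus>\<^bsub>EM\<^esub> y)"
  proof (intro equalityI subsetI)
    fix w assume "w \<in> (\<Union>a\<in>degree0_class x. \<Union>b\<in>degree0_class y. {a \<oplus>\<^bsub>EM\<^esub> b})"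
    then obtain a b where "a \<in> degree0_class x" "b \<in> degree0_class y" "w = a \<oplus>\<^bsub>EM\<^esub> b" by blast
    then show "w \<in> degree0_class (x \<oplus>\<^bsub>EM\<^esub> y)"
      using add_module_0[of a b] Z_subset by (auto simp: degree0_class_def add_empty)
  next
    fix w assume w: "w \<in> degree0_class (x \<oplus>\<^bsub>EM\<^esub> y)"
    then have wm: "w \<in> ?K" by (simp add: degree0_class_def)
    define a where "a = const_form (\<lambda>m. w {} m - y {} m)"
    have am: "a \<in> ?K"
      unfolding a_def by (rule const_form_module[OF smooth_fun_diff[OF module_0_smooth[OF wm] module_0_smooth[OF y]]])
    have "a \<in> degree0_class x"
      using am w Z_subset by (auto simp: degree0_class_def a_def const_form_empty add_empty subset_iff)
    moreover have "w = a \<oplus>\<^bsub>EM\<^esub> y"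
      by (rule module_0_eqI[OF wm add_module_0[OF am y]]) (simp add: add_empty a_def const_form_empty)
    ultimately show "w \<in> (\<Union>a\<in>degree0_class x. \<Union>b\<in>degree0_class y. {a \<oplus>\<^bsub>EM\<^esub> b})" using mem_degree0_class[OF y] by blast
  qed
  finally show "degree0_class x \<oplus>\<^bsub>H\<^esub> degree0_class y = degree0_class (x \<oplus>\<^bsub>EM\<^esub> y)" .
qed

text \<open>
  Two elements of degree \<open>0\<close> define the same class if and only if their coefficients agree on \<open>Z\<close>, so a class is the same
  as a restriction to \<open>Z\<close>.
\<close>

lemma homology_0_iso:
  "(\<lambda>X. the_elem ((\<lambda>\<omega>. restrict (\<omega> {}) Z) ` X)) \<in> ring_iso (koszul_homology RM l JM 0) (C_inf_restricted M Z)"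
proof -
  let ?K = "koszul_module RM l 0" and ?\<Phi> = "\<lambda>X. the_elem ((\<lambda>\<omega>. restrict (\<omega> {}) Z) ` X)"
  note H = homology_0_simps
  have \<Phi>: "?\<Phi> (degree0_class x) = restrict (x {}) Z" if x: "x \<in> ?K" for x
  proof -
    have "restrict (w {}) Z = restrict (x {}) Z" if "w \<in> degree0_class x" for w
      by (rule restrict_ext) (use that in \<open>auto simp: degree0_class_def\<close>)
    then have "(\<lambda>\<omega>. restrict (\<omega> {}) Z) ` degree0_class x = (\<lambda>\<omega>. restrict (x {}) Z) ` degree0_class x"
      by (rule image_cong[OF refl])
    also have "\<dots> = {restrict (x {}) Z}" by (rule image_constant[OF mem_degree0_class[OF x]])
    finally show ?thesis by (simp only: the_elem_eq)
  qed
  have carr: "carrier (C_inf_restricted M Z) = (\<lambda>f. restrict f Z) ` smooth_functions M"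
    by (simp add: C_inf_restricted_def function_ring_def)
  have img: "(\<lambda>x. restrict (x {}) Z) ` ?K = (\<lambda>f. restrict f Z) ` smooth_functions M"
  proof (intro equalityI subsetI)
    fix h assume "h \<in> (\<lambda>x. restrict (x {}) Z) ` ?K"
    then obtain x where "x \<in> ?K" "h = restrict (x {}) Z" by blast
    then show "h \<in> (\<lambda>f. restrict f Z) ` smooth_functions M"
      using E_smooth[OF koszul_module_carrier, of x 0 "{}"] by auto
  next
    fix h assume "h \<in> (\<lambda>f. restrict f Z) ` smooth_functions M"
    then obtain f where f: "f \<in> smooth_functions M" "h = restrict f Z" by blast
    have "const_form f \<in> ?K" using const_form_module f(1) by (simp add: smooth_functions_iff)
    moreover have "h = restrict (const_form f {}) Z"
      unfolding f(2) by (rule restrict_ext) (use Z_subset in \<open>auto simp: const_form_empty\<close>)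
    ultimately show "h \<in> (\<lambda>x. restrict (x {}) Z) ` ?K" by blast
  qed
  have "?\<Phi> \<in> ring_hom (koszul_homology RM l JM 0) (C_inf_restricted M Z)"
  proof (rule ring_hom_memI)
    fix X assume "X \<in> carrier (koszul_homology RM l JM 0)"
    then obtain x where x: "x \<in> ?K" "X = degree0_class x" using H(1) by blast
    show "?\<Phi> X \<in> carrier (C_inf_restricted M Z)"
      unfolding carr img[symmetric] x(2) \<Phi>[OF x(1)] using x(1) by blast
    fix Y assume "Y \<in> carrier (koszul_homology RM l JM 0)"
    then obtain y where y: "y \<in> ?K" "Y = degree0_class y" using H(1) by blast
    show "?\<Phi> (X \<otimes>\<^bsub>koszul_homology RM l JM 0\<^esub> Y) = ?\<Phi> X \<otimes>\<^bsub>C_inf_restricted M Z\<^esub> ?\<Phi> Y"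
      unfolding x(2) y(2) H(2)[OF x(1) y(1)] \<Phi>[OF x(1)] \<Phi>[OF y(1)] \<Phi>[OF mult_module_0[OF x(1) y(1)]]
      using mult_empty[OF x(1) y(1)] Z_subset
      by (auto simp: C_inf_restricted_def function_ring_def intro!: restrict_ext)
    show "?\<Phi> (X \<oplus>\<^bsub>koszul_homology RM l JM 0\<^esub> Y) = ?\<Phi> X \<oplus>\<^bsub>C_inf_restricted M Z\<^esub> ?\<Phi> Y"
      unfolding x(2) y(2) H(3)[OF x(1) y(1)] \<Phi>[OF x(1)] \<Phi>[OF y(1)] \<Phi>[OF add_module_0[OF x(1) y(1)]]
    proof -
      have "restrict ((x \<oplus>\<^bsub>EM\<^esub> y) {}) Z = (\<lambda>z\<in>Z. restrict (x {}) Z z + restrict (y {}) Z z)"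
        by (rule restrict_ext) (use Z_subset in \<open>auto simp: add_empty\<close>)
      then show "restrict ((x \<oplus>\<^bsub>EM\<^esub> y) {}) Z = restrict (x {}) Z \<oplus>\<^bsub>C_inf_restricted M Z\<^esub> restrict (y {}) Z"
        by (simp add: C_inf_restricted_def function_ring_def)
    qed
  next
    show "?\<Phi> \<one>\<^bsub>koszul_homology RM l JM 0\<^esub> = \<one>\<^bsub>C_inf_restricted M Z\<^esub>"
      unfolding H(4) \<Phi>[OF H(5)]
    proof -
      have "restrict (\<one>\<^bsub>EM\<^esub> {}) Z = (\<lambda>z\<in>Z. 1)"
        by (rule restrict_ext) (use Z_subset in \<open>auto simp: K.E_simps(5) ext_basis_def\<close>)
      then show "restrict (\<one>\<^bsub>EM\<^esub> {}) Z = \<one>\<^bsub>C_inf_restricted M Z\<^esub>"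
        by (simp add: C_inf_restricted_def function_ring_def)
    qed
  qed
  moreover have "bij_betw ?\<Phi> (carrier (koszul_homology RM l JM 0)) (carrier (C_inf_restricted M Z))"
    unfolding bij_betw_def
  proof
    show "inj_on ?\<Phi> (carrier (koszul_homology RM l JM 0))"
    proof (rule inj_onI)
      fix X Y assume "X \<in> carrier (koszul_homology RM l JM 0)" "Y \<in> carrier (koszul_homology RM l JM 0)"
        and eq: "?\<Phi> X = ?\<Phi> Y"
      from this(1,2) obtain x y where x: "x \<in> ?K" "X = degree0_class x" and y: "y \<in> ?K" "Y = degree0_class y"
        unfolding H(1) by (elim imageE) auto
      have "restrict (x {}) Z = restrict (y {}) Z"
        using eq unfolding x(2) y(2) \<Phi>[OF x(1)] \<Phi>[OF y(1)] .
      then have "x {} z = y {} z" if "z \<in> Z" for z using that by (metis restrict_apply')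
      then show "X = Y" using degree0_class_eq_iff x y by simp
    qed
    have "?\<Phi> ` carrier (koszul_homology RM l JM 0) = (\<lambda>x. restrict (x {}) Z) ` ?K"
      unfolding H(1) image_image by (rule image_cong[OF refl \<Phi>])
    then show "?\<Phi> ` carrier (koszul_homology RM l JM 0) = carrier (C_inf_restricted M Z)"
      unfolding carr img .
  qed
  ultimately show ?thesis by (simp add: ring_iso_def)
qed

end

theorem theorem3p5p1:
  fixes M :: "'m manifold" and l :: nat and J :: "'m \<Rightarrow> nat \<Rightarrow> real"
  assumes "real_analytic_manifold M"
    and "analytic_map M (euclidean_manifold l) J"
    and "Idl\<^bsub>C_inf M\<^esub> (component M J ` {..<l}) = vanishing_ideal M (zero_fibre M J)"
    and "subtopology (mtop M) (zero_fibre M J) closure_of regular_stratum M l J = zero_fibre M J"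
  shows "(\<forall>i. i \<noteq> 0 \<longrightarrow>
             carrier (koszul_homology (C_inf M) l (component M J) i)
               = {\<zero>\<^bsub>koszul_homology (C_inf M) l (component M J) i\<^esub>}) \<and>
         (\<lambda>X. the_elem ((\<lambda>\<omega>. restrict (\<omega> {}) (zero_fibre M J)) ` X))
           \<in> ring_iso (koszul_homology (C_inf M) l (component M J) 0)
                      (C_inf_restricted M (zero_fibre M J))"
proof -
  interpret A: analytic_manifold M by unfold_locales (rule assms(1))
  let ?Z = "zero_fibre M J"
  have JE: "J x \<in> coord_space l" if x: "x \<in> points M" for x
  proof -
    have "continuous_map (mtop M) (Euclidean_space l) J"
      using assms(2) by (simp add: analytic_map_def euclidean_manifold_def)
    then show ?thesis using x continuous_map_image_subset_topspace by blast
  qed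
  have Z: "?Z = {x \<in> points M. \<forall>a<l. J x a = 0}"
  proof -
    have "J x = (\<lambda>_. 0)" if "x \<in> points M" "\<forall>a<l. J x a = 0" for x
    proof
      fix a show "J x a = 0"
        using that JE[OF that(1)] by (cases "a < l") (auto simp: topspace_Euclidean_space)
    qed
    then have "J x = (\<lambda>_. 0) \<longleftrightarrow> (\<forall>a<l. J x a = 0)" if "x \<in> points M" for x using that by metis
    then show ?thesis unfolding zero_fibre_def by (intro Collect_cong conj_cong refl)
  qed
  \<comment> \<open>The generators of an ideal inside the smooth functions are smooth themselves.\<close>
  have "component M J ` {..<l} \<subseteq> Idl\<^bsub>C_inf M\<^esub> (component M J ` {..<l})"
    unfolding genideal_def by blast
  then have comp: "component M J a \<in> smooth_functions M" if "a < l" for a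
    using that unfolding assms(3) vanishing_ideal_def by blast
  have Jsm: "smooth_fun M (\<lambda>x. J x a)" if a: "a < l" for a
    by (rule A.smooth_fun_cong[of "component M J a"])
      (use comp[OF a] in \<open>simp_all add: smooth_functions_iff component_def\<close>)
  interpret Q: quasi_regular_equations M l "\<lambda>a x. J x a"
  proof
    show "smooth_fun M (\<lambda>x. J x a)" if "a < l" for a by (rule Jsm[OF that])
  next
    fix u assume u: "smooth_fun M u" "\<And>x. x \<in> points M \<Longrightarrow> \<forall>a<l. J x a = 0 \<Longrightarrow> u x = 0"
    have "restrict u (points M) \<in> vanishing_ideal M ?Z"
      unfolding vanishing_ideal_def using A.smooth_fun_restrict[OF u(1)] u(2) by (auto simp: Z)
    then have "restrict u (points M) \<in> Idl\<^bsub>C_inf M\<^esub> (component M J ` {..<l})" by (simp only: assms(3))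
    with A.ideal_generated_by_functions[of l "component M J", OF comp] obtain g where
      g: "\<forall>b. smooth_fun M (g b)" "restrict u (points M) = (\<lambda>x\<in>points M. \<Sum>b<l. g b x * component M J b x)"
      by blast
    have "u x = (\<Sum>b<l. g b x * J x b)" if "x \<in> points M" for x
      using fun_cong[OF g(2), of x] that by (simp add: component_def)
    then show "\<exists>g. (\<forall>b. smooth_fun M (g b)) \<and> (\<forall>x\<in>points M. u x = (\<Sum>b<l. g b x * J x b))"
      using g(1) by blast
  next
    fix j c \<alpha> z
    assume c: "\<And>\<alpha>. \<alpha> \<in> exponents l j \<Longrightarrow> smooth_fun M (c \<alpha>)"
      and eq: "\<And>x. x \<in> points M \<Longrightarrow> (\<Sum>\<alpha>\<in>exponents l j. c \<alpha> x * monomial l (\<lambda>a. J x a) \<alpha>) = 0"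
      and \<alpha>: "\<alpha> \<in> exponents l j" and z: "z \<in> points M" "\<forall>a<l. J z a = 0"
    have reg: "c \<alpha> y = 0" if y: "y \<in> regular_stratum M l J" for y
    proof -
      have "\<forall>\<alpha>\<in>exponents l j. c \<alpha> y = 0"
        by (rule A.quasi_regular_at[OF JE y Jsm finite_exponents, where k = "j - 1"])
          (use c eq in \<open>auto simp: exponents_def monomial_def\<close>)
      then show ?thesis using \<alpha> by blast
    qed
    have "z \<in> ?Z" using z by (simp add: Z)
    then have cl: "z \<in> (subtopology (mtop M) ?Z) closure_of regular_stratum M l J" using assms(4) by simp
    have "?Z \<subseteq> points M" by (auto simp: Z)
    then show "c \<alpha> z = 0" by (rule A.smooth_zero_on_closure[OF c[OF \<alpha>] _ reg cl])
  qed
  interpret K: koszul_of_manifold M l J ?Z by unfold_locales (rule Z)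
  show ?thesis using K.homology_carrier_positive K.homology_0_iso by blast
qed

end
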